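(* Fix a line $L_\infty\subset\mathbb{P}^2_{\mathbb{R}}$ defined over $\mathbb{R}$. Let $Q\subset\mathbb{P}^2_{\mathbb{R}}$ be a smooth plane quartic curve defined over $\mathbb{R}$ that does not meet $L_\infty$ over $\mathbb{R}$, i.e. $Q(\mathbb{R})\cap L_\infty(\mathbb{R})=\varnothing$. Then \[\#\{\text{real bitangents } L \text{ of } Q \text{ with } \operatorname{Qtype}_{L_\infty}(L)=\langle 1\rangle\}-\#\{\text{real bitangents } L \text{ of } Q \text{ with } \operatorname{Qtype}_{L_\infty}(L)=\langle -1\rangle\}=4.\] Therefore \[\sum_{\text{lines } L \text{ bitangent to } Q}\operatorname{Tr}_{k(L)/\mathbb{R}}\operatorname{Qtype}_{L_\infty}(L)=16\langle 1\rangle+12\langle -1\rangle\in \mathrm{GW}(\mathbb{R}).\]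
   Context: Let $k$ be a field of characteristic different from $2$ (here $k=\mathbb{R}$). $\mathrm{GW}(K)$ is the Grothendieck-Witt ring of a field $K$, and for $a\in K^*$, $\langle a\rangle\in\mathrm{GW}(K)$ is the class of the rank one form $(x,y)\mapsto axy$. For a finite separable extension $K/k$, $\operatorname{Tr}_{K/k}:\mathrm{GW}(K)\to\mathrm{GW}(k)$ is the transfer obtained by composing a form with the field trace $K\to k$. A line in $\mathbb{P}^2_k$ means a closed point $[L]$ of the dual plane $(\mathbb{P}^2_k)^\vee$, with residue field $k(L)$. When $k(L)=K$, one regards $L$ as a line in $\mathbb{P}^2_K$ defined over $K$, by choosing one line in the Galois orbit. A line $L$ over $K$ is bitangent to a smooth quartic $Q=V(f)$ if $Q_K\cap L=2Z$ for a degree $2$ divisor $Z=z_1+z_2$ on $L$ (the case $z_1=z_2$, a hyperflex, is allowed). Over $\bar k$ there are exactly $28$ bitangents. Sums over bitangent lines are over closed points of $(\mathbb{P}^2_k)^\vee$. A real bitangent is a bitangent line defined over $\mathbb{R}$. Type of a bitangent: fix a line $L_\infty$ over $k$, and suppose $L$ (with residue field $K$) is bitangent to $Q=V(f)$ with $2Z=V(f)\cap L$ and $Z\cap L_\infty=\varnothing$. Choose linear forms $\ell$ over $K$ defining $L$ and $\ell_\infty$ over $k$ defining $L_\infty$. On $\mathbb{A}^2_K=\mathbb{P}^2_K\smallsetminus L_\infty$ consider the functions $\tilde f=f/\ell_\infty^4$ and $\tilde\ell=\ell/\ell_\infty$. Since $\tilde f|_L$ vanishes to order at least $2$ at $z_i$,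 there is a unique scalar $\partial_Lf(z_i)$ in the field of definition of $z_i$ with $d\tilde f=\partial_Lf(z_i)\,d\tilde\ell$ at $z_i$. Set \[\operatorname{Qtype}_{L_\infty}(L)=\langle\partial_Lf(z_1)\cdot\partial_Lf(z_2)\rangle\in\mathrm{GW}(K);\] the product is a nonzero element of $K$ well-defined up to $(K^* )^2$. Conventions when $Z\cap L_\infty\neq\varnothing$: if $L_\infty$ is itself a real bitangent (its two tangency points are then complex conjugate, since $Q$ has no real points on $L_\infty$), it is counted with type $\langle 1\rangle$; a bitangent with residue field $\mathbb{C}$ is always given the type $\langle 1\rangle$, the only rank one class in $\mathrm{GW}(\mathbb{C})$. *)

theory Defs
  imports
    "HOL-Analysis.Analysis"
    "Jordan_Normal_Form.Matrix"
    "Jordan_Normal_Form.Determinant"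
begin

no_notation Matrix.vec_index (infixl "$" 100)
no_notation Matrix.scalar_prod (infix "\<bullet>" 70)
hide_const (open) Matrix.vec

section \<open>Grothendieck-Witt rings\<close>

text \<open>A nondegenerate symmetric bilinear form on a finite-dimensional vector space is given by
  its Gram matrix; isometry of forms is congruence of Gram matrices.\<close>

definition nondeg_form :: "nat \<Rightarrow> 'a::field mat \<Rightarrow> bool" where
  "nondeg_form n A \<longleftrightarrow> A \<in> carrier_mat n n \<and> transpose_mat A = A \<and> invertible_mat A"

definition isometric :: "'a::field mat \<Rightarrow> 'a mat \<Rightarrow> bool" where
  "isometric A B \<longleftrightarrow> (\<exists>n. nondeg_form n A \<and> nondeg_form n B \<and>
     (\<exists>P \<in> carrier_mat n n. invertible_mat P \<and> B = transpose_mat P * A * P))"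

definition osum :: "'a::field mat \<Rightarrow> 'a mat \<Rightarrow> 'a mat" where
  "osum A B = four_block_mat A (0\<^sub>m (dim_row A) (dim_col B)) (0\<^sub>m (dim_row B) (dim_col A)) B"

definition kronecker :: "'a::field mat \<Rightarrow> 'a mat \<Rightarrow> 'a mat" where
  "kronecker A B = mat (dim_row A * dim_row B) (dim_col A * dim_col B)
     (\<lambda>(i, j). A $$ (i div dim_row B, j div dim_col B) * B $$ (i mod dim_row B, j mod dim_col B))"

subsection \<open>Invariance under isometry\<close>

lemma invertible_mat_iff:
  assumes "A \<in> carrier_mat n n"
  shows "invertible_mat A \<longleftrightarrow> (\<exists>B \<in> carrier_mat n n. A * B = 1\<^sub>m n \<and> B * A = 1\<^sub>m n)"
proof
  assume "invertible_mat A"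
  then obtain B where B: "A * B = 1\<^sub>m n" "B * A = 1\<^sub>m (dim_row B)"
    using assms by (auto simp: invertible_mat_def inverts_mat_def)
  have "dim_col B = n" using arg_cong[OF B(1), of dim_col] by simp
  moreover have "dim_row B = n" using arg_cong[OF B(2), of dim_col] assms by simp
  ultimately show "\<exists>B \<in> carrier_mat n n. A * B = 1\<^sub>m n \<and> B * A = 1\<^sub>m n"
    using B by (intro bexI[of _ B]) auto
qed (use assms in \<open>auto simp: invertible_mat_def inverts_mat_def\<close>)

lemma invertible_mat_1: "invertible_mat (1\<^sub>m n :: 'a::field mat)"
  by (subst invertible_mat_iff[of _ n]) (auto intro!: bexI[of _ "1\<^sub>m n"])

lemma invertible_mat_mult:
  assumes "A \<in> carrier_mat n n" "B \<in> carrier_mat n n" "invertible_mat A" "invertible_mat B"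
  shows "invertible_mat (A * B :: 'a::field mat)"
proof -
  from assms obtain A' B' where
    A': "A' \<in> carrier_mat n n" "A * A' = 1\<^sub>m n" "A' * A = 1\<^sub>m n" and
    B': "B' \<in> carrier_mat n n" "B * B' = 1\<^sub>m n" "B' * B = 1\<^sub>m n"
    by (auto simp: invertible_mat_iff)
  have "A * B * (B' * A') = A * (B * B') * A'"
    using assms A'(1) B'(1) by (simp add: assoc_mult_mat[of _ n n _ n _ n])
  moreover have "B' * A' * (A * B) = B' * (A' * A) * B"
    using assms A'(1) B'(1) by (simp add: assoc_mult_mat[of _ n n _ n _ n])
  ultimately have "A * B * (B' * A') = 1\<^sub>m n" "B' * A' * (A * B) = 1\<^sub>m n"
    using assms A' B' by simp_all
  then show ?thesis
    using assms A'(1) B'(1) unfolding invertible_mat_iff[OF mult_carrier_mat[OF assms(1,2)]]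
    by (metis mult_carrier_mat)
qed

lemma invertible_mat_transpose:
  assumes "A \<in> carrier_mat n n" "invertible_mat A"
  shows "invertible_mat (transpose_mat A :: 'a::field mat)"
proof -
  from assms obtain A' where
    A': "A' \<in> carrier_mat n n" "A * A' = 1\<^sub>m n" "A' * A = 1\<^sub>m n"
    by (auto simp: invertible_mat_iff)
  have "transpose_mat A * transpose_mat A' = 1\<^sub>m n" "transpose_mat A' * transpose_mat A = 1\<^sub>m n"
    by (metis A' assms(1) transpose_mult transpose_one)+
  then show ?thesis
    using assms A' by (subst invertible_mat_iff[of _ n]) (auto intro!: bexI[of _ "transpose_mat A'"])
qed

lemma nondeg_form_congruent:
  assumes "nondeg_form n A" "P \<in> carrier_mat n n" "invertible_mat P"
  shows "nondeg_form n (transpose_mat P * A * P)"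
  unfolding nondeg_form_def
proof (intro conjI)
  show "transpose_mat (transpose_mat P * A * P) = transpose_mat P * A * P"
    using assms
    by (auto simp: nondeg_form_def transpose_mult[of _ n n _ n] assoc_mult_mat[of _ n n _ n _ n])
  show "invertible_mat (transpose_mat P * A * P)"
    using assms
    by (auto simp: nondeg_form_def intro!: invertible_mat_mult[of _ n] invertible_mat_transpose)
qed (use assms in \<open>auto simp: nondeg_form_def\<close>)

lemma isometricI:
  assumes "nondeg_form n A" "P \<in> carrier_mat n n" "invertible_mat P" "B = transpose_mat P * A * P"
  shows "isometric A B"
  using assms nondeg_form_congruent[OF assms(1-3)] by (auto simp: isometric_def)

lemma isometric_refl: "nondeg_form n A \<Longrightarrow> isometric A A"
  by (rule isometricI[of n _ "1\<^sub>m n"]) (auto simp: invertible_mat_1 nondeg_form_def)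

lemma isometric_sym: "isometric A B \<Longrightarrow> isometric B A"
proof -
  assume "isometric A B"
  then obtain n P where *: "nondeg_form n A" "nondeg_form n B" "P \<in> carrier_mat n n"
    "invertible_mat P" "B = transpose_mat P * A * P"
    by (auto simp: isometric_def)
  then obtain Q where Q: "Q \<in> carrier_mat n n" "P * Q = 1\<^sub>m n" "Q * P = 1\<^sub>m n"
    by (auto simp: invertible_mat_iff)
  have A: "A \<in> carrier_mat n n" using * by (auto simp: nondeg_form_def)
  have "transpose_mat Q * B * Q = (transpose_mat Q * transpose_mat P) * A * (P * Q)"
    using * Q A by (simp add: assoc_mult_mat[of _ n n _ n _ n])
  also have "transpose_mat Q * transpose_mat P = 1\<^sub>m n"
    using transpose_mult[of P n n Q n] * Q by simp
  finally have "A = transpose_mat Q * B * Q"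
    using A Q by simp
  moreover have "invertible_mat Q" using Q *(3) by (auto simp: invertible_mat_iff)
  ultimately show ?thesis using * Q by (intro isometricI[of n _ Q]) auto
qed

lemma isometric_trans: "isometric A B \<Longrightarrow> isometric B C \<Longrightarrow> isometric A C"
proof -
  assume "isometric A B" "isometric B C"
  then obtain n m P Q where *: "nondeg_form n A" "nondeg_form n B" "P \<in> carrier_mat n n"
    "invertible_mat P" "B = transpose_mat P * A * P"
    "nondeg_form m B" "Q \<in> carrier_mat m m" "invertible_mat Q" "C = transpose_mat Q * B * Q"
    by (auto simp: isometric_def)
  have [simp]: "m = n" using *(2,6) by (auto simp: nondeg_form_def)
  have A: "A \<in> carrier_mat n n" using * by (auto simp: nondeg_form_def)
  have "C = transpose_mat (P * Q) * A * (P * Q)"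
    using * A by (simp add: transpose_mult[of _ n n _ n] assoc_mult_mat[of _ n n _ n _ n])
  then show ?thesis
    using * by (intro isometricI[of n _ "P * Q"]) (auto intro: invertible_mat_mult)
qed

lemma isometric_permute:
  assumes A: "nondeg_form n A" and \<sigma>: "bij_betw \<sigma> {..<n} {..<n}"
    and B: "B \<in> carrier_mat n n" "\<And>i j. i < n \<Longrightarrow> j < n \<Longrightarrow> B $$ (i, j) = A $$ (\<sigma> i, \<sigma> j)"
  shows "isometric A B"
proof -
  define P :: "'a mat" where "P = mat n n (\<lambda>(i, j). if i = \<sigma> j then 1 else 0)"
  have P: "P \<in> carrier_mat n n" by (simp add: P_def)
  have Ac: "A \<in> carrier_mat n n" using A by (simp add: nondeg_form_def)
  have \<sigma>_less: "\<sigma> i < n" if "i < n" for i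
    using \<sigma> that by (auto simp: bij_betw_def)
  have AP: "(A * P) $$ (i, j) = A $$ (i, \<sigma> j)" if "i < n" "j < n" for i j
  proof -
    have "(A * P) $$ (i, j) = (\<Sum>k\<in>{0..<n}. A $$ (i, k) * (if k = \<sigma> j then 1 else 0))"
      using that Ac by (simp add: P_def scalar_prod_def)
    also have "\<dots> = A $$ (i, \<sigma> j)" using \<sigma>_less[OF that(2)] by (simp add: if_distrib cong: if_cong)
    finally show ?thesis .
  qed
  have PX: "(transpose_mat P * X) $$ (i, j) = X $$ (\<sigma> i, j)"
    if "i < n" "j < n" "X \<in> carrier_mat n n" for i j X
  proof -
    have "(transpose_mat P * X) $$ (i, j) = (\<Sum>k\<in>{0..<n}. (if k = \<sigma> i then 1 else 0) * X $$ (k, j))"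
      using that by (simp add: P_def scalar_prod_def)
    also have "\<dots> = X $$ (\<sigma> i, j)" using \<sigma>_less[OF that(1)] by (simp add: if_distrib if_distribR cong: if_cong)
    finally show ?thesis .
  qed
  have "B = transpose_mat P * (A * P)"
    using B Ac P
    by (intro eq_matI) (auto simp: PX[of _ _ "A * P"] AP \<sigma>_less simp del: index_mult_mat(1))
  then have "B = transpose_mat P * A * P" using Ac P by simp
  moreover have PP: "transpose_mat P * P = 1\<^sub>m n"
  proof (intro eq_matI)
    fix i j assume "i < dim_row (1\<^sub>m n :: 'a mat)" "j < dim_col (1\<^sub>m n :: 'a mat)"
    then have ij: "i < n" "j < n" by auto
    have "(transpose_mat P * P) $$ (i, j) = P $$ (\<sigma> i, j)" using ij P by (intro PX)
    also have "\<dots> = (if \<sigma> i = \<sigma> j then 1 else 0)" using ij \<sigma>_less by (simp add: P_def)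
    also have "\<sigma> i = \<sigma> j \<longleftrightarrow> i = j"
      using bij_betw_imp_inj_on[OF \<sigma>] ij by (auto dest: inj_onD)
    finally show "(transpose_mat P * P) $$ (i, j) = 1\<^sub>m n $$ (i, j)" using ij by simp
  qed (use P in auto)
  have "P * transpose_mat P = 1\<^sub>m n"
    using mat_mult_left_right_inverse[OF _ P PP] P by auto
  then have "invertible_mat P"
    using P PP by (subst invertible_mat_iff[of _ n]) (auto intro!: bexI[of _ "transpose_mat P"])
  ultimately show ?thesis using A P by (intro isometricI)
qed

lemma osum_carrier [simp]:
  "A \<in> carrier_mat n m \<Longrightarrow> B \<in> carrier_mat k l \<Longrightarrow> osum A B \<in> carrier_mat (n + k) (m + l)"
  by (auto simp: osum_def)

lemma dim_osum [simp]:
  "dim_row (osum A B) = dim_row A + dim_row B" "dim_col (osum A B) = dim_col A + dim_col B"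
  by (auto simp: osum_def)

lemma osum_mult:
  assumes "A \<in> carrier_mat n n" "A' \<in> carrier_mat n n" "B \<in> carrier_mat m m" "B' \<in> carrier_mat m m"
  shows "osum A B * osum A' B' = osum (A * A') (B * B')"
  using assms unfolding osum_def
  by (subst mult_four_block_mat[of _ n n _ m _ m _ _ n _ m]) auto

lemma osum_transpose:
  assumes "A \<in> carrier_mat n n" "B \<in> carrier_mat m m"
  shows "transpose_mat (osum A B) = osum (transpose_mat A) (transpose_mat B)"
  using assms unfolding osum_def
  by (subst transpose_four_block_mat[of _ n n _ m _ m]) auto

lemma osum_invertible:
  assumes "A \<in> carrier_mat n n" "B \<in> carrier_mat m m" "invertible_mat A" "invertible_mat B"
  shows "invertible_mat (osum A B)"
proof -
  from assms obtain A' B' where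
    A': "A' \<in> carrier_mat n n" "A * A' = 1\<^sub>m n" "A' * A = 1\<^sub>m n" and
    B': "B' \<in> carrier_mat m m" "B * B' = 1\<^sub>m m" "B' * B = 1\<^sub>m m"
    by (auto simp: invertible_mat_iff)
  moreover have "osum (1\<^sub>m n) (1\<^sub>m m) = (1\<^sub>m (n + m) :: 'a mat)"
    by (auto simp: osum_def)
  ultimately show ?thesis
    using assms
    by (subst invertible_mat_iff[of _ "n + m"]) (auto simp: osum_mult intro!: bexI[of _ "osum A' B'"])
qed

lemma osum_nondeg: "nondeg_form n A \<Longrightarrow> nondeg_form m B \<Longrightarrow> nondeg_form (n + m) (osum A B)"
  by (auto simp: nondeg_form_def osum_transpose intro: osum_invertible)

lemma osum_isometric:
  assumes "isometric A A'" "isometric B B'"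
  shows "isometric (osum A B) (osum A' B')"
proof -
  from assms obtain n m P Q where *: "nondeg_form n A" "P \<in> carrier_mat n n"
    "invertible_mat P" "A' = transpose_mat P * A * P"
    "nondeg_form m B" "Q \<in> carrier_mat m m" "invertible_mat Q" "B' = transpose_mat Q * B * Q"
    by (auto simp: isometric_def)
  have "A \<in> carrier_mat n n" "B \<in> carrier_mat m m" using * by (auto simp: nondeg_form_def)
  with * show ?thesis
    by (intro isometricI[of "n + m" _ "osum P Q"])
       (auto simp: osum_nondeg osum_transpose osum_mult[of _ n _ _ m] intro: osum_invertible)
qed

lemma osum_assoc: "osum (osum A B) C = osum A (osum B C)"
  using assoc_four_block_mat[of A B C] by (simp add: osum_def)

lemma osum_commute:
  assumes "nondeg_form n A" "nondeg_form m B"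
  shows "isometric (osum A B) (osum B A)"
proof (rule isometric_permute[OF osum_nondeg[OF assms]])
  let ?\<sigma> = "\<lambda>i. if i < m then n + i else i - m"
  show "bij_betw ?\<sigma> {..<n + m} {..<n + m}"
    by (rule bij_betwI[where g = "\<lambda>i. if i < n then m + i else i - n"]) auto
  have c: "A \<in> carrier_mat n n" "B \<in> carrier_mat m m" using assms by (auto simp: nondeg_form_def)
  then show "osum B A \<in> carrier_mat (n + m) (n + m)" by (auto simp: add.commute)
  show "osum B A $$ (i, j) = osum A B $$ (?\<sigma> i, ?\<sigma> j)" if "i < n + m" "j < n + m" for i j
    using that c by (auto simp: osum_def)
qed

lemma osum_0_left: "A \<in> carrier_mat n n \<Longrightarrow> osum (0\<^sub>m 0 0) A = A"
  by (intro eq_matI) (auto simp: osum_def)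

lemma nondeg_form_0: "nondeg_form 0 (0\<^sub>m 0 0)"
  by (auto simp: nondeg_form_def invertible_mat_iff[of _ 0] intro!: bexI[of _ "0\<^sub>m 0 0"])

lemma mult_add_less: "a * q + b < p * q" if "a < p" "b < q" for a b p q :: nat
proof -
  have "a * q + b < Suc a * q" using that(2) by simp
  also have "\<dots> \<le> p * q" using that(1) by (intro mult_right_mono) auto
  finally show ?thesis .
qed

lemma sum_div_mod:
  fixes f :: "nat \<Rightarrow> nat \<Rightarrow> 'a::comm_monoid_add"
  shows "(\<Sum>k\<in>{0..<n * m}. f (k div m) (k mod m)) = (\<Sum>i\<in>{0..<n}. \<Sum>j\<in>{0..<m}. f i j)"
proof (cases "m = 0")
  case False
  have "(\<Sum>k\<in>{0..<n * m}. f (k div m) (k mod m)) = (\<Sum>(i, j)\<in>{0..<n} \<times> {0..<m}. f i j)"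
    using False
    by (intro sum.reindex_bij_witness[of _ "\<lambda>(i, j). i * m + j" "\<lambda>k. (k div m, k mod m)"])
       (auto simp: less_mult_imp_div_less mult_add_less)
  then show ?thesis by (simp add: sum.cartesian_product)
qed auto

lemma div_mod_less:
  assumes "(i::nat) < n * m" shows "i div m < n" "i mod m < m"
  using assms by (auto simp: less_mult_imp_div_less intro!: mod_less_divisor) (metis mult_0_right gr0I not_less0)

lemma dim_kronecker [simp]:
  "dim_row (kronecker A B) = dim_row A * dim_row B" "dim_col (kronecker A B) = dim_col A * dim_col B"
  by (auto simp: kronecker_def)

lemma kronecker_carrier [simp]:
  "A \<in> carrier_mat n m \<Longrightarrow> B \<in> carrier_mat k l \<Longrightarrow> kronecker A B \<in> carrier_mat (n * k) (m * l)"
  by auto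

lemma kronecker_index:
  "i < dim_row A * dim_row B \<Longrightarrow> j < dim_col A * dim_col B \<Longrightarrow> kronecker A B $$ (i, j) =
     A $$ (i div dim_row B, j div dim_col B) * B $$ (i mod dim_row B, j mod dim_col B)"
  by (simp add: kronecker_def)

lemma kronecker_mult:
  assumes "A \<in> carrier_mat n n" "A' \<in> carrier_mat n n" "B \<in> carrier_mat m m" "B' \<in> carrier_mat m m"
  shows "kronecker A B * kronecker A' B' = kronecker (A * A') (B * B')"
proof (intro eq_matI)
  fix i j assume "i < dim_row (kronecker (A * A') (B * B'))" "j < dim_col (kronecker (A * A') (B * B'))"
  then have ij: "i < n * m" "j < n * m" using assms by auto
  note dm = div_mod_less[OF ij(1)] div_mod_less[OF ij(2)]
  have "(kronecker A B * kronecker A' B') $$ (i, j) = (\<Sum>k\<in>{0..<n * m}.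
      (A $$ (i div m, k div m) * B $$ (i mod m, k mod m)) *
      (A' $$ (k div m, j div m) * B' $$ (k mod m, j mod m)))"
    using assms ij by (auto simp: scalar_prod_def kronecker_index)
  also have "\<dots> = (\<Sum>a\<in>{0..<n}. \<Sum>b\<in>{0..<m}.
      (A $$ (i div m, a) * B $$ (i mod m, b)) * (A' $$ (a, j div m) * B' $$ (b, j mod m)))"
    by (rule sum_div_mod)
  also have "\<dots> = (\<Sum>a\<in>{0..<n}. A $$ (i div m, a) * A' $$ (a, j div m)) *
      (\<Sum>b\<in>{0..<m}. B $$ (i mod m, b) * B' $$ (b, j mod m))"
    by (simp add: sum_product mult_ac)
  also have "\<dots> = kronecker (A * A') (B * B') $$ (i, j)"
    using assms ij dm by (auto simp: kronecker_index scalar_prod_def)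
  finally show "(kronecker A B * kronecker A' B') $$ (i, j) = kronecker (A * A') (B * B') $$ (i, j)" .
qed (use assms in auto)

lemma kronecker_transpose:
  assumes "A \<in> carrier_mat n n" "B \<in> carrier_mat m m"
  shows "transpose_mat (kronecker A B) = kronecker (transpose_mat A) (transpose_mat B)"
  using assms by (intro eq_matI) (auto simp: kronecker_index div_mod_less)

lemma kronecker_one: "kronecker (1\<^sub>m n) (1\<^sub>m m) = (1\<^sub>m (n * m) :: 'a::field mat)"
proof (intro eq_matI)
  fix i j assume "i < dim_row (1\<^sub>m (n * m) :: 'a mat)" "j < dim_col (1\<^sub>m (n * m) :: 'a mat)"
  then have ij: "i < n * m" "j < n * m" by auto
  then have "i = j \<longleftrightarrow> i div m = j div m \<and> i mod m = j mod m" by (metis div_mult_mod_eq)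
  then show "kronecker (1\<^sub>m n) (1\<^sub>m m) $$ (i, j) = (1\<^sub>m (n * m) :: 'a mat) $$ (i, j)"
    using ij div_mod_less[OF ij(1)] div_mod_less[OF ij(2)] by (auto simp: kronecker_index)
qed auto

lemma kronecker_invertible:
  assumes "A \<in> carrier_mat n n" "B \<in> carrier_mat m m" "invertible_mat A" "invertible_mat B"
  shows "invertible_mat (kronecker A B)"
proof -
  from assms obtain A' B' where
    A': "A' \<in> carrier_mat n n" "A * A' = 1\<^sub>m n" "A' * A = 1\<^sub>m n" and
    B': "B' \<in> carrier_mat m m" "B * B' = 1\<^sub>m m" "B' * B = 1\<^sub>m m"
    by (auto simp: invertible_mat_iff)
  then show ?thesis
    using assms
    by (subst invertible_mat_iff[of _ "n * m"])
       (auto simp: kronecker_mult kronecker_one intro!: bexI[of _ "kronecker A' B'"])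
qed

lemma kronecker_nondeg: "nondeg_form n A \<Longrightarrow> nondeg_form m B \<Longrightarrow> nondeg_form (n * m) (kronecker A B)"
  by (auto simp: nondeg_form_def kronecker_transpose intro: kronecker_invertible)

lemma kronecker_isometric:
  assumes "isometric A A'" "isometric B B'"
  shows "isometric (kronecker A B) (kronecker A' B')"
proof -
  from assms obtain n m P Q where *: "nondeg_form n A" "P \<in> carrier_mat n n"
    "invertible_mat P" "A' = transpose_mat P * A * P"
    "nondeg_form m B" "Q \<in> carrier_mat m m" "invertible_mat Q" "B' = transpose_mat Q * B * Q"
    by (auto simp: isometric_def)
  have "A \<in> carrier_mat n n" "B \<in> carrier_mat m m" using * by (auto simp: nondeg_form_def)
  with * show ?thesis
    by (intro isometricI[of "n * m" _ "kronecker P Q"])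
       (auto simp: kronecker_nondeg kronecker_transpose kronecker_mult[of _ n _ _ m]
             intro: kronecker_invertible)
qed

lemma kronecker_assoc: "kronecker (kronecker A B) C = kronecker A (kronecker B C)"
proof (intro eq_matI)
  have div: "i div (b * c) = i div c div b" for i b c :: nat
    by (metis div_mult2_eq mult.commute)
  have mod_div: "i mod (b * c) div c = i div c mod b" for i b c :: nat
    by (cases "c = 0") (auto simp: mod_mult2_eq mult.commute[of b c])
  have mod_mod: "i mod (b * c) mod c = i mod c" for i b c :: nat
    by (simp add: mod_mod_cancel)
  fix i j assume "i < dim_row (kronecker A (kronecker B C))" "j < dim_col (kronecker A (kronecker B C))"
  then have i: "i < dim_row A * dim_row B * dim_row C" and j: "j < dim_col A * dim_col B * dim_col C"
    by (auto simp: mult.assoc)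
  have "i mod (dim_row B * dim_row C) < dim_row B * dim_row C"
    "j mod (dim_col B * dim_col C) < dim_col B * dim_col C"
    using i j by (auto intro!: mod_less_divisor gr0I)
  then show "kronecker (kronecker A B) C $$ (i, j) = kronecker A (kronecker B C) $$ (i, j)"
    using i j div_mod_less[OF i] div_mod_less[OF j]
    by (simp add: kronecker_index mult.assoc[symmetric])
       (simp add: kronecker_index div mod_div mod_mod)
qed (auto simp: mult.assoc)

lemma kronecker_commute:
  assumes "nondeg_form n A" "nondeg_form m B"
  shows "isometric (kronecker A B) (kronecker B A)"
proof (rule isometric_permute[OF kronecker_nondeg[OF assms]])
  let ?\<sigma> = "\<lambda>i. (i mod n) * m + i div n"
  have lt: "i mod n < n" "i div n < m" "i mod m < m" "i div m < n" if "i < n * m" for i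
    using div_mod_less[of i n m] div_mod_less[of i m n] that by (auto simp: mult.commute)
  have div_eq: "(a * q + b) div q = a" if "b < q" for a b q :: nat
    using that by simp
  show "bij_betw ?\<sigma> {..<n * m} {..<n * m}"
    by (rule bij_betwI[where g = "\<lambda>i. (i mod m) * n + i div m"])
       (auto simp: lt mult_add_less div_eq intro!: mult_add_less[of _ m _ n, unfolded mult.commute[of m n]])
  have c: "A \<in> carrier_mat n n" "B \<in> carrier_mat m m" using assms by (auto simp: nondeg_form_def)
  then show "kronecker B A \<in> carrier_mat (n * m) (n * m)" by (auto simp: mult.commute)
  show "kronecker B A $$ (i, j) = kronecker A B $$ (?\<sigma> i, ?\<sigma> j)" if "i < n * m" "j < n * m" for i j
    using that c lt[OF that(1)] lt[OF that(2)]
    by (auto simp: kronecker_index mult_add_less mult.commute[of m n])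
qed

lemma kronecker_osum_left: "kronecker (osum A B) C = osum (kronecker A C) (kronecker B C)"
proof (intro eq_matI)
  fix i j assume "i < dim_row (osum (kronecker A C) (kronecker B C))"
    "j < dim_col (osum (kronecker A C) (kronecker B C))"
  then have i: "i < (dim_row A + dim_row B) * dim_row C" and j: "j < (dim_col A + dim_col B) * dim_col C"
    by (auto simp: algebra_simps)
  have lt: "k div c < a \<longleftrightarrow> k < a * c" if "c > 0" for k c a :: nat
    using that by (simp add: div_less_iff_less_mult)
  have sub: "(k - a * c) div c = k div c - a" "(k - a * c) mod c = k mod c" if "\<not> k < a * c" "c > 0" for k c a :: nat
  proof -
    obtain l where "k = l + a * c" using \<open>\<not> k < a * c\<close> by (metis le_add_diff_inverse2 not_less)
    then show "(k - a * c) div c = k div c - a" "(k - a * c) mod c = k mod c"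
      using \<open>c > 0\<close> by auto
  qed
  have pos: "dim_row C > 0" "dim_col C > 0" using i j by (auto intro: gr0I)
  have "i - dim_row A * dim_row C < dim_row B * dim_row C" if "\<not> i < dim_row A * dim_row C"
    using i that by (auto simp: algebra_simps)
  moreover have "j - dim_col A * dim_col C < dim_col B * dim_col C" if "\<not> j < dim_col A * dim_col C"
    using j that by (auto simp: algebra_simps)
  moreover have "i div dim_row C - dim_row A < dim_row B" if "\<not> i < dim_row A * dim_row C"
    using div_mod_less(1)[OF i] that lt[of "dim_row C" i "dim_row A"] pos by linarith
  moreover have "j div dim_col C - dim_col A < dim_col B" if "\<not> j < dim_col A * dim_col C"
    using div_mod_less(1)[OF j] that lt[of "dim_col C" j "dim_col A"] pos by linarith
  ultimately show "kronecker (osum A B) C $$ (i, j) = osum (kronecker A C) (kronecker B C) $$ (i, j)"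
    using i j div_mod_less[OF i] div_mod_less[OF j] pos
    by (auto simp: kronecker_index osum_def lt sub algebra_simps)
qed (auto simp: algebra_simps)

lemma kronecker_1_left: "A \<in> carrier_mat n n \<Longrightarrow> kronecker (1\<^sub>m 1) A = A"
  by (intro eq_matI) (auto simp: kronecker_index)

lemma kronecker_0_left: "A \<in> carrier_mat n n \<Longrightarrow> kronecker (0\<^sub>m 0 0) A = 0\<^sub>m 0 0"
  by (intro eq_matI) auto


subsection \<open>The Grothendieck-Witt ring\<close>

text \<open>The semiring of isometry classes, with orthogonal sum and tensor product.\<close>

quotient_type (overloaded) 'a isom_class = "'a::field mat" / partial: isometric
proof (rule part_equivpI)
  show "\<exists>A :: 'a mat. isometric A A" using isometric_refl[OF nondeg_form_0] by blast
  show "symp (isometric :: 'a mat \<Rightarrow> _)" by (intro sympI, rule isometric_sym)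
  show "transp (isometric :: 'a mat \<Rightarrow> _)" by (intro transpI, rule isometric_trans)
qed

instantiation isom_class :: (field) comm_semiring_1
begin

lift_definition zero_isom_class :: "'a isom_class" is "0\<^sub>m 0 0"
  by (rule isometric_refl[OF nondeg_form_0])

lift_definition one_isom_class :: "'a isom_class" is "1\<^sub>m 1"
  by (rule isometric_refl[of 1]) (auto simp: nondeg_form_def invertible_mat_1)

lift_definition plus_isom_class :: "'a isom_class \<Rightarrow> 'a isom_class \<Rightarrow> 'a isom_class" is osum
  by (rule osum_isometric)

lift_definition times_isom_class :: "'a isom_class \<Rightarrow> 'a isom_class \<Rightarrow> 'a isom_class" is kronecker
  by (rule kronecker_isometric)

instance
proof
  fix a b c :: "'a isom_class"
  have nd: "\<exists>n. nondeg_form n A" if "isometric A A" for A :: "'a mat"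
    using that by (auto simp: isometric_def)
  show "a + b + c = a + (b + c)"
    by transfer (auto simp: osum_assoc intro!: osum_isometric)
  show "a + b = b + a"
    by transfer (use nd osum_commute in blast)
  show "0 + a = a"
  proof transfer
    fix A :: "'a mat" assume "isometric A A"
    moreover from nd[OF this] obtain n where "A \<in> carrier_mat n n" by (auto simp: nondeg_form_def)
    ultimately show "isometric (osum (0\<^sub>m 0 0) A) A" by (simp add: osum_0_left)
  qed
  show "a * b * c = a * (b * c)"
    by transfer (auto simp: kronecker_assoc intro!: kronecker_isometric)
  show comm: "a * b = b * a" for a b :: "'a isom_class"
    by transfer (use nd kronecker_commute in blast)
  show "1 * a = a"
  proof transfer
    fix A :: "'a mat" assume "isometric A A"
    moreover from nd[OF this] obtain n where "A \<in> carrier_mat n n" by (auto simp: nondeg_form_def)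
    ultimately show "isometric (kronecker (1\<^sub>m 1) A) A" by (subst kronecker_1_left)
  qed
  show "0 * a = 0"
  proof transfer
    fix A :: "'a mat" assume "isometric A A"
    from nd[OF this] obtain n where "A \<in> carrier_mat n n" by (auto simp: nondeg_form_def)
    then show "isometric (kronecker (0\<^sub>m 0 0) A) (0\<^sub>m 0 0)"
      by (simp add: kronecker_0_left isometric_refl[OF nondeg_form_0])
  qed
  then show "a * 0 = 0"
    using comm[of a 0] by simp
  show "(a + b) * c = a * c + b * c"
  proof transfer
    fix A B C :: "'a mat" assume "isometric A A" "isometric B B" "isometric C C"
    then show "isometric (kronecker (osum A B) C) (osum (kronecker A C) (kronecker B C))"
      unfolding kronecker_osum_left by (intro osum_isometric kronecker_isometric)
  qed
  show "(0 :: 'a isom_class) \<noteq> 1"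
  proof transfer
    show "\<not> isometric (0\<^sub>m 0 0) (1\<^sub>m 1 :: 'a mat)"
    proof
      assume "isometric (0\<^sub>m 0 0) (1\<^sub>m 1 :: 'a mat)"
      then obtain n where "(0\<^sub>m 0 0 :: 'a mat) \<in> carrier_mat n n" "(1\<^sub>m 1 :: 'a mat) \<in> carrier_mat n n"
        unfolding isometric_def nondeg_form_def by blast
      then show False by (auto dest!: carrier_matD)
    qed
  qed
qed

end

lift_definition form_rank :: "'a::field isom_class \<Rightarrow> nat" is dim_row
  by (auto simp: isometric_def nondeg_form_def)

lemma form_rank_0: "form_rank (0 :: 'a::field isom_class) = 0"
  by (simp add: zero_isom_class_def form_rank.abs_eq isometric_refl[OF nondeg_form_0])

lemma nondeg_form_1: "nondeg_form n (1\<^sub>m n)"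
  by (auto simp: nondeg_form_def invertible_mat_1)

lemma form_rank_1: "form_rank (1 :: 'a::field isom_class) = 1"
  by (simp add: one_isom_class_def form_rank.abs_eq isometric_refl[OF nondeg_form_1])

lemma form_rank_add: "form_rank (a + b) = form_rank a + form_rank b"
  by transfer simp

definition groth_rel :: "'a::comm_semiring_1 \<times> 'a \<Rightarrow> 'a \<times> 'a \<Rightarrow> bool" where
  "groth_rel = (\<lambda>(a, b) (c, d). \<exists>e. a + d + e = c + b + e)"

lemma groth_rel_refl: "groth_rel x x"
  by (auto simp: groth_rel_def split: prod.splits)

lemma groth_rel_trans: "groth_rel x y \<Longrightarrow> groth_rel y z \<Longrightarrow> groth_rel x z"
proof -
  assume xy: "groth_rel x y" and yz: "groth_rel y z"
  obtain a b c d p q where [simp]: "x = (a, b)" "y = (c, d)" "z = (p, q)"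
    by (cases x, cases y, cases z)
  from xy yz obtain e e' where e: "a + d + e = c + b + e" and e': "c + q + e' = p + d + e'"
    by (auto simp: groth_rel_def)
  have "a + q + (c + d + e + e') = (a + d + e) + (c + q + e')" by (simp add: add_ac)
  also have "\<dots> = (c + b + e) + (p + d + e')" by (simp only: e e')
  also have "\<dots> = p + b + (c + d + e + e')" by (simp add: add_ac)
  finally show ?thesis by (auto simp: groth_rel_def)
qed

quotient_type (overloaded) 'a GW = "'a::field isom_class \<times> 'a isom_class" / groth_rel
proof (rule equivpI)
  show "reflp groth_rel" by (intro reflpI groth_rel_refl)
  show "symp groth_rel"
    by (intro sympI) (simp add: groth_rel_def split_def, metis)
  show "transp groth_rel" by (intro transpI, rule groth_rel_trans)
qed

lemma groth_rel_times:
  assumes "groth_rel x x'"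
  shows "groth_rel (fst x * c + snd x * d, fst x * d + snd x * c)
    (fst x' * c + snd x' * d, fst x' * d + snd x' * c)"
proof -
  obtain a b a' b' where [simp]: "x = (a, b)" "x' = (a', b')" by (cases x, cases x')
  from assms obtain e where e: "a + b' + e = a' + b + e" by (auto simp: groth_rel_def)
  have "a * c + b * d + (a' * d + b' * c) + (e * c + e * d) = (a + b' + e) * c + (a' + b + e) * d"
    by (simp add: algebra_simps)
  also have "\<dots> = (a' + b + e) * c + (a + b' + e) * d" by (simp only: e)
  also have "\<dots> = a' * c + b' * d + (a * d + b * c) + (e * c + e * d)"
    by (simp add: algebra_simps)
  finally show ?thesis by (auto simp: groth_rel_def)
qed

instantiation GW :: (field) comm_ring_1
begin

lift_definition zero_GW :: "'a GW" is "(0, 0)" .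

lift_definition one_GW :: "'a GW" is "(1, 0)" .

lift_definition plus_GW :: "'a GW \<Rightarrow> 'a GW \<Rightarrow> 'a GW"
  is "\<lambda>(a, b) (c, d). (a + c, b + d)"
proof (clarsimp simp: groth_rel_def)
  fix a b a' b' c d c' d' e e' :: "'a isom_class"
  assume "a + b' + e = a' + b + e" "c + d' + e' = c' + d + e'"
  then have "(a + b' + e) + (c + d' + e') = (a' + b + e) + (c' + d + e')" by simp
  then have "a + c + (b' + d') + (e + e') = a' + c' + (b + d) + (e + e')" by (simp add: add_ac)
  then show "\<exists>e. a + c + (b' + d') + e = a' + c' + (b + d) + e" by blast
qed

lift_definition uminus_GW :: "'a GW \<Rightarrow> 'a GW" is "\<lambda>(a, b). (b, a)"
proof (clarsimp simp: groth_rel_def)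
  fix a b c d e :: "'a isom_class"
  assume "a + d + e = c + b + e"
  then have "b + c + e = d + a + e" by (simp add: add.commute)
  then show "\<exists>e. b + c + e = d + a + e" by blast
qed

definition minus_GW :: "'a GW \<Rightarrow> 'a GW \<Rightarrow> 'a GW" where "minus_GW x y = x + - y"

lift_definition times_GW :: "'a GW \<Rightarrow> 'a GW \<Rightarrow> 'a GW"
  is "\<lambda>x y. (fst x * fst y + snd x * snd y, fst x * snd y + snd x * fst y)"
proof -
  fix x x' y y' :: "'a isom_class \<times> 'a isom_class"
  assume "groth_rel x x'" "groth_rel y y'"
  note 1 = groth_rel_times[OF \<open>groth_rel x x'\<close>, of "fst y" "snd y"]
  have comm: "(fst v * fst u + snd v * snd u, fst v * snd u + snd v * fst u)
      = (fst u * fst v + snd u * snd v, fst u * snd v + snd u * fst v)"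
    for u v :: "'a isom_class \<times> 'a isom_class"
    by (simp add: mult.commute add.commute)
  note 2 = groth_rel_times[OF \<open>groth_rel y y'\<close>, of "fst x'" "snd x'"]
  show "groth_rel (fst x * fst y + snd x * snd y, fst x * snd y + snd x * fst y)
      (fst x' * fst y' + snd x' * snd y', fst x' * snd y' + snd x' * fst y')"
    using groth_rel_trans[OF 1 2[unfolded comm[of y x'] comm[of y' x']]] .
qed

instance
proof
  fix a b c :: "'a GW"
  have eqI: "groth_rel p q" if "p = q" for p q :: "'a isom_class \<times> 'a isom_class"
    using that groth_rel_refl by simp
  show "a + b + c = a + (b + c)" by transfer (auto simp: ac_simps intro!: eqI)
  show "a + b = b + a" by transfer (auto simp: ac_simps intro!: eqI)
  show "0 + a = a" by transfer (auto intro!: eqI)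
  show "- a + a = 0" by transfer (auto simp: groth_rel_def ac_simps)
  show "a - b = a + - b" by (simp add: minus_GW_def)
  show "a * b * c = a * (b * c)" by transfer (auto simp: algebra_simps intro!: eqI)
  show "a * b = b * a" by transfer (auto simp: algebra_simps intro!: eqI)
  show "1 * a = a" by transfer (auto intro!: eqI)
  show "(a + b) * c = a * c + b * c" by transfer (auto simp: algebra_simps intro!: eqI)
  have "\<not> groth_rel (0, 0) (1 :: 'a isom_class, 0)"
  proof
    assume "groth_rel (0, 0) (1 :: 'a isom_class, 0)"
    then obtain e :: "'a isom_class" where "0 + 0 + e = 1 + 0 + e"
      by (auto simp: groth_rel_def)
    then have "form_rank (0 + 0 + e) = form_rank (1 + 0 + e)" by (rule arg_cong)
    then show False unfolding form_rank_add form_rank_0 form_rank_1 by simp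
  qed
  then show "(0 :: 'a GW) \<noteq> 1" by transfer
qed

end

text \<open>The class of the form \<open>(x, y) \<mapsto> a x y\<close>; the degenerate case \<open>a = 0\<close> is sent to the class
  of the zero-dimensional form.\<close>

lift_definition rank_one_isom :: "'a::field \<Rightarrow> 'a isom_class"
  is "\<lambda>a. if a = 0 then 0\<^sub>m 0 0 else mat 1 1 (\<lambda>_. a)"
proof (split if_split, safe)
  fix a :: 'a assume "a \<noteq> 0"
  then have "nondeg_form 1 (mat 1 1 (\<lambda>_. a))"
    by (auto simp: nondeg_form_def invertible_mat_iff[of _ 1] scalar_prod_def
        intro!: bexI[of _ "mat 1 1 (\<lambda>_. inverse a)"] eq_matI)
  then show "isometric (mat 1 1 (\<lambda>_. a)) (mat 1 1 (\<lambda>_. a))" by (rule isometric_refl)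
qed (rule isometric_refl[OF nondeg_form_0])

lift_definition rank_one :: "'a::field \<Rightarrow> 'a GW" (\<open>\<langle>_\<rangle>\<close>) is "\<lambda>a. (rank_one_isom a, 0)" .

subsection \<open>Transfer from the complex to the real numbers\<close>

text \<open>In the real basis \<open>1, \<i>\<close> of the complex numbers, the trace of multiplication by \<open>z\<close> is
  the sum of the first coordinate of \<open>z * 1\<close> and the second coordinate of \<open>z * \<i>\<close>.\<close>

definition field_trace :: "complex \<Rightarrow> real" where
  "field_trace z = Re (z * 1) + Im (z * \<i>)"

definition cbasis :: "nat \<Rightarrow> complex" where
  "cbasis a = (if a = 0 then 1 else \<i>)"

text \<open>The Gram matrix of the trace of the form with Gram matrix \<open>A\<close>, with respect to the real
  basis \<open>e\<^sub>0, \<i> e\<^sub>0, e\<^sub>1, \<i> e\<^sub>1, \<dots>\<close>.\<close>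

definition trace_mat :: "complex mat \<Rightarrow> real mat" where
  "trace_mat A = mat (dim_row A * 2) (dim_col A * 2)
     (\<lambda>(i, j). field_trace (cbasis (i mod 2) * cbasis (j mod 2) * A $$ (i div 2, j div 2)))"

definition real_mat :: "complex mat \<Rightarrow> real mat" where
  "real_mat P = mat (dim_row P * 2) (dim_col P * 2)
     (\<lambda>(i, j). (if i mod 2 = 0 then Re else Im) (cbasis (j mod 2) * P $$ (i div 2, j div 2)))"

lemma trace_mat_carrier [simp]: "A \<in> carrier_mat n m \<Longrightarrow> trace_mat A \<in> carrier_mat (n * 2) (m * 2)"
  by (auto simp: trace_mat_def)

lemma real_mat_carrier [simp]: "A \<in> carrier_mat n m \<Longrightarrow> real_mat A \<in> carrier_mat (n * 2) (m * 2)"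
  by (auto simp: real_mat_def)

lemma sum_02: "(\<Sum>j\<in>{0..<2::nat}. f j) = f 0 + f 1" for f :: "nat \<Rightarrow> 'a::comm_monoid_add"
  by (simp add: numeral_2_eq_2)

lemma trace_mat_mult:
  assumes A: "A \<in> carrier_mat n n" and B: "B \<in> carrier_mat n n"
  shows "trace_mat (A * B) = trace_mat A * real_mat B"
proof (intro eq_matI)
  fix i j assume "i < dim_row (trace_mat A * real_mat B)" "j < dim_col (trace_mat A * real_mat B)"
  then have ij: "i < n * 2" "j < n * 2" using A B by (auto simp: trace_mat_def real_mat_def)
  note dm = div_mod_less[OF ij(1)] div_mod_less[OF ij(2)]
  have "(trace_mat A * real_mat B) $$ (i, j) = (\<Sum>k\<in>{0..<n * 2}.
      field_trace (cbasis (i mod 2) * cbasis (k mod 2) * A $$ (i div 2, k div 2)) *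
      (if k mod 2 = 0 then Re else Im) (cbasis (j mod 2) * B $$ (k div 2, j div 2)))"
    using A B ij by (auto simp: scalar_prod_def trace_mat_def real_mat_def)
  also have "\<dots> = (\<Sum>k\<in>{0..<n}. \<Sum>c\<in>{0..<2}.
      field_trace (cbasis (i mod 2) * cbasis c * A $$ (i div 2, k)) *
      (if c = 0 then Re else Im) (cbasis (j mod 2) * B $$ (k, j div 2)))"
    by (rule sum_div_mod)
  also have "\<dots> = (\<Sum>k\<in>{0..<n}. field_trace (cbasis (i mod 2) * cbasis (j mod 2) *
      (A $$ (i div 2, k) * B $$ (k, j div 2))))"
    by (intro sum.cong refl) (auto simp: sum_02 field_trace_def cbasis_def algebra_simps)
  also have "\<dots> = field_trace (cbasis (i mod 2) * cbasis (j mod 2) *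
      (\<Sum>k\<in>{0..<n}. A $$ (i div 2, k) * B $$ (k, j div 2)))"
    by (simp add: field_trace_def sum.distrib sum_distrib_left sum_distrib_right)
  also have "\<dots> = trace_mat (A * B) $$ (i, j)"
    using A B ij dm by (auto simp: trace_mat_def scalar_prod_def)
  finally show "trace_mat (A * B) $$ (i, j) = (trace_mat A * real_mat B) $$ (i, j)" ..
qed (use A B in \<open>auto simp: trace_mat_def real_mat_def\<close>)

lemma real_mat_mult:
  assumes A: "A \<in> carrier_mat n n" and B: "B \<in> carrier_mat n n"
  shows "real_mat (A * B) = real_mat A * real_mat B"
proof (intro eq_matI)
  fix i j assume "i < dim_row (real_mat A * real_mat B)" "j < dim_col (real_mat A * real_mat B)"
  then have ij: "i < n * 2" "j < n * 2" using A B by (auto simp: real_mat_def)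
  note dm = div_mod_less[OF ij(1)] div_mod_less[OF ij(2)]
  let ?c = "\<lambda>i. if i mod 2 = (0::nat) then Re else Im"
  have "(real_mat A * real_mat B) $$ (i, j) = (\<Sum>k\<in>{0..<n * 2}.
      ?c i (cbasis (k mod 2) * A $$ (i div 2, k div 2)) *
      (if k mod 2 = 0 then Re else Im) (cbasis (j mod 2) * B $$ (k div 2, j div 2)))"
    using A B ij by (auto simp: scalar_prod_def real_mat_def)
  also have "\<dots> = (\<Sum>k\<in>{0..<n}. \<Sum>c\<in>{0..<2}.
      ?c i (cbasis c * A $$ (i div 2, k)) *
      (if c = 0 then Re else Im) (cbasis (j mod 2) * B $$ (k, j div 2)))"
    by (rule sum_div_mod)
  also have "\<dots> = (\<Sum>k\<in>{0..<n}. ?c i (cbasis (j mod 2) *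
      (A $$ (i div 2, k) * B $$ (k, j div 2))))"
    by (intro sum.cong refl) (auto simp: sum_02 cbasis_def algebra_simps)
  also have "\<dots> = ?c i (cbasis (j mod 2) *
      (\<Sum>k\<in>{0..<n}. A $$ (i div 2, k) * B $$ (k, j div 2)))"
    by (auto simp: sum_subtractf sum.distrib sum_distrib_left sum_distrib_right)
  also have "\<dots> = real_mat (A * B) $$ (i, j)"
    using A B ij dm by (auto simp: real_mat_def scalar_prod_def)
  finally show "real_mat (A * B) $$ (i, j) = (real_mat A * real_mat B) $$ (i, j)" ..
qed (use A B in \<open>auto simp: real_mat_def\<close>)

lemma real_mat_one: "real_mat (1\<^sub>m n) = 1\<^sub>m (n * 2)"
proof (intro eq_matI)
  fix i j assume "i < dim_row (1\<^sub>m (n * 2) :: real mat)" "j < dim_col (1\<^sub>m (n * 2) :: real mat)"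
  then have ij: "i < n * 2" "j < n * 2" by auto
  have "i = j \<longleftrightarrow> i div 2 = j div 2 \<and> i mod 2 = j mod 2" by (metis div_mult_mod_eq)
  then show "real_mat (1\<^sub>m n) $$ (i, j) = 1\<^sub>m (n * 2) $$ (i, j)"
    using ij div_mod_less[OF ij(1)] div_mod_less[OF ij(2)] by (auto simp: real_mat_def cbasis_def)
qed (auto simp: real_mat_def)

lemma real_mat_invertible:
  assumes "A \<in> carrier_mat n n" "invertible_mat A"
  shows "invertible_mat (real_mat A)"
proof -
  from assms obtain B where B: "B \<in> carrier_mat n n" "A * B = 1\<^sub>m n" "B * A = 1\<^sub>m n"
    by (auto simp: invertible_mat_iff)
  then have "real_mat A * real_mat B = 1\<^sub>m (n * 2)" "real_mat B * real_mat A = 1\<^sub>m (n * 2)"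
    using assms by (simp_all add: real_mat_mult[symmetric] real_mat_one)
  then show ?thesis
    using assms B by (subst invertible_mat_iff[of _ "n * 2"]) (auto intro!: bexI[of _ "real_mat B"])
qed

lemma trace_mat_transpose:
  "A \<in> carrier_mat n n \<Longrightarrow> trace_mat (transpose_mat A) = transpose_mat (trace_mat A)"
  by (intro eq_matI) (auto simp: trace_mat_def div_mod_less mult_ac)

lemma trace_mat_one_invertible: "invertible_mat (trace_mat (1\<^sub>m n))"
proof -
  define D :: "real mat" where
    "D = mat_diag (n * 2) (\<lambda>i. if i mod 2 = 0 then 2 else - 2)"
  have T: "trace_mat (1\<^sub>m n) = D"
  proof (intro eq_matI)
    fix i j assume "i < dim_row D" "j < dim_col D"
    then have ij: "i < n * 2" "j < n * 2" by (auto simp: D_def mat_diag_def)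
    have lt: "i div 2 < n" "j div 2 < n" using div_mod_less ij by auto
    have entry: "trace_mat (1\<^sub>m n) $$ (i, j) =
        field_trace (cbasis (i mod 2) * cbasis (j mod 2) * (if i div 2 = j div 2 then 1 else 0))"
      using ij lt by (simp add: trace_mat_def)
    show "trace_mat (1\<^sub>m n) $$ (i, j) = D $$ (i, j)"
    proof (cases "i = j")
      case True
      then show ?thesis unfolding entry using ij by (simp add: D_def mat_diag_def cbasis_def field_trace_def)
    next
      case False
      then have "i div 2 \<noteq> j div 2 \<or> i mod 2 \<noteq> j mod 2" by (metis div_mult_mod_eq)
      moreover have "i mod 2 = 0 \<or> i mod 2 = 1" "j mod 2 = 0 \<or> j mod 2 = 1" by auto
      ultimately have "field_trace (cbasis (i mod 2) * cbasis (j mod 2) *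
          (if i div 2 = j div 2 then 1 else 0)) = 0"
        by (elim disjE) (simp_all add: cbasis_def field_trace_def)
      then show ?thesis unfolding entry using ij False by (simp add: D_def mat_diag_def)
    qed
  qed (auto simp: trace_mat_def D_def mat_diag_def)
  define E :: "real mat" where
    "E = mat_diag (n * 2) (\<lambda>i. if i mod 2 = 0 then 1 / 2 else - 1 / 2)"
  have half: "(if i mod 2 = 0 then 2 else - 2) * (if i mod 2 = 0 then 1 / 2 else - 1 / 2) = (1::real)"
    for i :: nat
    by simp
  have "D * E = 1\<^sub>m (n * 2)" "E * D = 1\<^sub>m (n * 2)"
    unfolding D_def E_def mat_diag_diag half mult.commute[of "if _ then 1 / 2 else _"]
    by (rule mat_diag_one)+
  then show ?thesis
    unfolding T by (subst invertible_mat_iff[of _ "n * 2"]) (auto simp: D_def E_def intro!: bexI[of _ E])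
qed

lemma trace_mat_nondeg:
  assumes "nondeg_form n A"
  shows "nondeg_form (n * 2) (trace_mat A)"
proof -
  have A: "A \<in> carrier_mat n n" "transpose_mat A = A" "invertible_mat A"
    using assms by (auto simp: nondeg_form_def)
  have "trace_mat A = trace_mat (1\<^sub>m n) * real_mat A"
    using trace_mat_mult[of "1\<^sub>m n" n A] A by simp
  then have "invertible_mat (trace_mat A)"
    using A by (auto intro!: invertible_mat_mult[of _ "n * 2"] trace_mat_one_invertible real_mat_invertible)
  then show ?thesis
    using A trace_mat_transpose[OF A(1)] by (auto simp: nondeg_form_def)
qed

lemma trace_mat_isometric:
  assumes "isometric A B"
  shows "isometric (trace_mat A) (trace_mat B)"
proof -
  from assms obtain n P where *: "nondeg_form n A" "P \<in> carrier_mat n n"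
    "invertible_mat P" "B = transpose_mat P * A * P"
    by (auto simp: isometric_def)
  have A: "A \<in> carrier_mat n n" "transpose_mat A = A" using * by (auto simp: nondeg_form_def)
  have "trace_mat (transpose_mat P * A) = trace_mat (transpose_mat (A * P))"
    using A * by (simp add: transpose_mult[of _ n n _ n])
  also have "\<dots> = transpose_mat (trace_mat A * real_mat P)"
    using A * by (simp add: trace_mat_transpose[of _ n] trace_mat_mult[of _ n])
  also have "\<dots> = transpose_mat (real_mat P) * transpose_mat (trace_mat A)"
    using A * by (intro transpose_mult[of _ "n * 2" "n * 2" _ "n * 2"]) auto
  also have "transpose_mat (trace_mat A) = trace_mat A"
    using A trace_mat_transpose[OF A(1)] by simp
  finally have eq: "trace_mat (transpose_mat P * A) = transpose_mat (real_mat P) * trace_mat A" .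
  have "trace_mat B = trace_mat (transpose_mat P * A) * real_mat P"
    unfolding *(4) using A * by (intro trace_mat_mult[of _ n]) auto
  then have "trace_mat B = transpose_mat (real_mat P) * trace_mat A * real_mat P"
    unfolding eq .
  then show ?thesis
    using * by (intro isometricI[of "n * 2" _ "real_mat P"])
      (auto intro: trace_mat_nondeg real_mat_invertible)
qed

lemma trace_mat_osum:
  assumes "A \<in> carrier_mat n n" "B \<in> carrier_mat m m"
  shows "trace_mat (osum A B) = osum (trace_mat A) (trace_mat B)"
proof (intro eq_matI)
  fix i j assume "i < dim_row (osum (trace_mat A) (trace_mat B))" "j < dim_col (osum (trace_mat A) (trace_mat B))"
  then have ij: "i < (n + m) * 2" "j < (n + m) * 2" using assms by (auto simp: trace_mat_def)
  have lt: "k div 2 < a \<longleftrightarrow> k < a * 2" for k a :: nat by linarith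
  have sub: "(k - a * 2) div 2 = k div 2 - a \<and> (k - a * 2) mod 2 = k mod 2" if "\<not> k < a * 2" for k a :: nat
  proof -
    define l where "l = k - a * 2"
    then have k: "k = l + a * 2" using that by simp
    show ?thesis unfolding k by simp
  qed
  show "trace_mat (osum A B) $$ (i, j) = osum (trace_mat A) (trace_mat B) $$ (i, j)"
  proof -
    have dims: "dim_row A = n" "dim_col A = n" "dim_row B = m" "dim_col B = m" using assms by auto
    let ?e = "\<lambda>x. field_trace (cbasis (i mod 2) * cbasis (j mod 2) * x)"
    have ltn: "i div 2 < n + m" "j div 2 < n + m" using div_mod_less ij by auto
    have e0: "?e 0 = 0" by (simp add: field_trace_def)
    have "trace_mat (osum A B) $$ (i, j) = ?e (if i < n * 2 then if j < n * 2 then A $$ (i div 2, j div 2) else 0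
         else if j < n * 2 then 0 else B $$ (i div 2 - n, j div 2 - n))"
      using ij ltn by (simp add: trace_mat_def osum_def dims lt)
    also have "\<dots> = (if i < n * 2 then if j < n * 2 then trace_mat A $$ (i, j) else 0
         else if j < n * 2 then 0 else trace_mat B $$ (i - n * 2, j - n * 2))"
    proof -
      have "trace_mat A $$ (i, j) = ?e (A $$ (i div 2, j div 2))" if "i < n * 2" "j < n * 2"
        using that by (simp add: trace_mat_def dims)
      moreover have "trace_mat B $$ (i - n * 2, j - n * 2) = ?e (B $$ (i div 2 - n, j div 2 - n))"
        if "\<not> i < n * 2" "\<not> j < n * 2"
      proof -
        have "i - n * 2 < m * 2" "j - n * 2 < m * 2" using ij that by auto
        then have "trace_mat B $$ (i - n * 2, j - n * 2) =
            field_trace (cbasis ((i - n * 2) mod 2) * cbasis ((j - n * 2) mod 2) *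
              B $$ ((i - n * 2) div 2, (j - n * 2) div 2))"
          by (simp add: trace_mat_def dims)
        then show ?thesis unfolding sub[OF that(1), THEN conjunct1] sub[OF that(1), THEN conjunct2]
            sub[OF that(2), THEN conjunct1] sub[OF that(2), THEN conjunct2] .
      qed
      ultimately show ?thesis by (simp only: e0 split: if_split) auto
    qed
    also have "\<dots> = osum (trace_mat A) (trace_mat B) $$ (i, j)"
    proof -
      have d: "dim_row (trace_mat A) = n * 2" "dim_col (trace_mat A) = n * 2"
        "dim_row (trace_mat B) = m * 2" "dim_col (trace_mat B) = m * 2"
        by (simp_all add: trace_mat_def dims)
      have "i < n * 2 + m * 2" "j < n * 2 + m * 2"
        "i - n * 2 < m * 2 \<or> i < n * 2" "j - n * 2 < m * 2 \<or> j < n * 2"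
        using ij by auto
      then show ?thesis by (auto simp: osum_def d)
    qed
    finally show ?thesis .
  qed
qed (use assms in \<open>auto simp: trace_mat_def\<close>)

lift_definition transfer_isom :: "complex isom_class \<Rightarrow> real isom_class" is trace_mat
  by (rule trace_mat_isometric)

lemma transfer_isom_add: "transfer_isom (a + b) = transfer_isom a + transfer_isom b"
proof transfer
  fix A B :: "complex mat" assume "isometric A A" "isometric B B"
  then obtain n m where *: "nondeg_form n A" "nondeg_form m B" by (auto simp: isometric_def)
  then have "trace_mat (osum A B) = osum (trace_mat A) (trace_mat B)"
    by (intro trace_mat_osum) (auto simp: nondeg_form_def)
  then show "isometric (trace_mat (osum A B)) (osum (trace_mat A) (trace_mat B))"
    using * by (auto intro!: isometric_refl osum_nondeg trace_mat_nondeg)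
qed

lift_definition GW_transfer :: "complex GW \<Rightarrow> real GW"
  is "\<lambda>(a, b). (transfer_isom a, transfer_isom b)"
proof (clarsimp simp: groth_rel_def)
  fix a b c d e :: "complex isom_class"
  assume "a + d + e = c + b + e"
  then have "transfer_isom (a + d + e) = transfer_isom (c + b + e)" by (rule arg_cong)
  then show "\<exists>e. transfer_isom a + transfer_isom d + e = transfer_isom c + transfer_isom b + e"
    unfolding transfer_isom_add by blast
qed

section \<open>Plane quartics and their bitangents\<close>

definition proj_rel :: "'a::field ^ 3 \<Rightarrow> 'a ^ 3 \<Rightarrow> bool" where
  "proj_rel v w \<longleftrightarrow> v \<noteq> 0 \<and> w \<noteq> 0 \<and> (\<exists>c. w = c *s v)"

text \<open>Both points and lines are elements of this type: an element of the dual plane is a linear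
  form up to scaling, and \<open>rep_proj_plane\<close> chooses a (nonzero) vector of homogeneous coordinates.\<close>

quotient_type (overloaded) 'a proj_plane = "'a::field ^ 3" / partial: proj_rel
proof (rule part_equivpI)
  have "(\<chi> i. (1 :: 'a)) \<noteq> (0 :: 'a ^ 3)" by (simp add: Finite_Cartesian_Product.vec_eq_iff)
  then show "\<exists>v :: 'a ^ 3. proj_rel v v"
    by (auto simp: proj_rel_def intro!: exI[of _ "\<chi> i. (1 :: 'a)"] exI[of _ "1 :: 'a"])
  show "symp (proj_rel :: 'a ^ 3 \<Rightarrow> _)"
  proof (rule sympI)
    fix v w :: "'a ^ 3" assume "proj_rel v w"
    then obtain c where *: "v \<noteq> 0" "w \<noteq> 0" "w = c *s v" by (auto simp: proj_rel_def)
    then have "c \<noteq> 0" by auto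
    then have "v = inverse c *s w" using * by (simp add: vector_smult_assoc)
    then show "proj_rel w v" using *(1,2) unfolding proj_rel_def by blast
  qed
  show "transp (proj_rel :: 'a ^ 3 \<Rightarrow> _)"
    by (rule transpI) (auto simp: proj_rel_def vector_smult_assoc)
qed

definition incident :: "'a::field proj_plane \<Rightarrow> 'a proj_plane \<Rightarrow> bool" where
  "incident p L \<longleftrightarrow> scalar_product (rep_proj_plane L) (rep_proj_plane p) = 0"

definition map_coords :: "('a \<Rightarrow> 'b) \<Rightarrow> 'a ^ 3 \<Rightarrow> 'b ^ 3" where
  "map_coords h v = (\<chi> i. h (v $ i))"

text \<open>To be used with field homomorphisms only, for which it does not depend on representatives.\<close>

definition base_change :: "('a::field \<Rightarrow> 'b::field) \<Rightarrow> 'a proj_plane \<Rightarrow> 'b proj_plane" where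
  "base_change h p = abs_proj_plane (map_coords h (rep_proj_plane p))"

text \<open>A ternary quartic form is given by its coefficients: \<open>f (i, j, k)\<close> is the coefficient of
  \<open>x\<^sup>i y\<^sup>j z\<^sup>k\<close>, and only the values with \<open>i + j + k = 4\<close> matter.\<close>

type_synonym 'a quartic = "nat \<times> nat \<times> nat \<Rightarrow> 'a"

definition quartic_eval :: "'a::comm_semiring_1 quartic \<Rightarrow> 'a ^ 3 \<Rightarrow> 'a" where
  "quartic_eval f v =
     (\<Sum>(i, j, k) \<in> {(i, j, k). i + j + k = 4}. f (i, j, k) * v $ 1 ^ i * v $ 2 ^ j * v $ 3 ^ k)"

definition on_quartic :: "'a::field quartic \<Rightarrow> 'a proj_plane \<Rightarrow> bool" where
  "on_quartic f p \<longleftrightarrow> quartic_eval f (rep_proj_plane p) = 0"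

definition cquartic :: "real quartic \<Rightarrow> complex quartic" where
  "cquartic f = (\<lambda>e. complex_of_real (f e))"

definition smooth_quartic :: "complex quartic \<Rightarrow> bool" where
  "smooth_quartic f \<longleftrightarrow> (\<forall>v. v \<noteq> 0 \<and> quartic_eval f v = 0 \<longrightarrow>
     (\<exists>w. frechet_derivative (quartic_eval f) (at v) w \<noteq> 0))"

text \<open>The univariate polynomial \<open>f (v + t w)\<close> in \<open>t\<close>.\<close>

definition quartic_on_line :: "complex quartic \<Rightarrow> complex ^ 3 \<Rightarrow> complex ^ 3 \<Rightarrow> complex poly" where
  "quartic_on_line f v w = quartic_eval (\<lambda>e. [:f e:]) (\<chi> i. [:v $ i, w $ i:])"

text \<open>For a point \<open>p\<close> of \<open>L\<close>, the multiplicity of \<open>p\<close> in the divisor on \<open>L\<close> cut out by \<open>f\<close>: the order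
  of vanishing at \<open>t = 0\<close> of \<open>f\<close> in the coordinate \<open>t \<mapsto> v + t w\<close> of \<open>L\<close> around \<open>p\<close>, where \<open>v\<close>
  represents \<open>p\<close> and \<open>w\<close> represents another point of \<open>L\<close>.\<close>

definition intersection_mult ::
  "complex quartic \<Rightarrow> complex proj_plane \<Rightarrow> complex proj_plane \<Rightarrow> nat" where
  "intersection_mult f L p =
     (let v = rep_proj_plane p;
          w = (SOME w. scalar_product (rep_proj_plane L) w = 0 \<and> (\<forall>c. w \<noteq> c *s v))
      in order 0 (quartic_on_line f v w))"

text \<open>The intersection divisor of the quartic and \<open>L\<close> is \<open>2Z\<close>, where the effective divisor \<open>Z\<close> of
  degree 2 on \<open>L\<close> is represented by a multiset of two points of \<open>L\<close>.  The divisor is defined only if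
  the quartic does not contain \<open>L\<close>.\<close>

definition tangency_divisor ::
  "complex quartic \<Rightarrow> complex proj_plane \<Rightarrow> complex proj_plane multiset \<Rightarrow> bool" where
  "tangency_divisor f L Z \<longleftrightarrow>
     (\<exists>p. incident p L \<and> \<not> on_quartic f p) \<and>
     size Z = 2 \<and> (\<forall>p \<in># Z. incident p L) \<and>
     (\<forall>p. incident p L \<longrightarrow> intersection_mult f L p = 2 * count Z p)"

definition bitangent :: "complex quartic \<Rightarrow> complex proj_plane \<Rightarrow> bool" where
  "bitangent f L \<longleftrightarrow> (\<exists>Z. tangency_divisor f L Z)"

text \<open>The functions \<open>f / l\<^sub>\<infinity>\<^sup>4\<close> and \<open>l / l\<^sub>\<infinity>\<close> on the affine plane \<open>l\<^sub>\<infinity> \<noteq> 0\<close> are treated as homogeneous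
  functions of degree 0 on the cone over it.  An identity between differentials on the affine plane
  holds iff it holds after pulling back along the submersion from the cone to the plane, and the
  scalar does not depend on the representative of \<open>z\<close>.\<close>

definition partial_line ::
  "complex quartic \<Rightarrow> complex ^ 3 \<Rightarrow> complex ^ 3 \<Rightarrow> complex proj_plane \<Rightarrow> complex" where
  "partial_line f linf l z = (THE c. \<forall>w.
     frechet_derivative (\<lambda>v. quartic_eval f v / scalar_product linf v ^ 4) (at (rep_proj_plane z)) w =
     c * frechet_derivative (\<lambda>v. scalar_product l v / scalar_product linf v) (at (rep_proj_plane z)) w)"

text \<open>The type of a bitangent \<open>L\<close> over a field \<open>K\<close> that is embedded into the complex numbers by \<open>\<iota>\<close>.
  The first branch is the convention for tangency points on the line at infinity: a real \<open>L\<close> reaches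
  it only if it equals \<open>Linf\<close>, when the quartic has no real point on \<open>Linf\<close>; for \<open>K\<close> the complex
  numbers, the second branch yields \<open>\<langle>1\<rangle>\<close> as well.\<close>

definition Qtype ::
  "('a::field \<Rightarrow> complex) \<Rightarrow> real quartic \<Rightarrow> real proj_plane \<Rightarrow> 'a proj_plane \<Rightarrow> 'a GW" where
  "Qtype \<iota> f Linf L =
     (let Z = (THE Z. tangency_divisor (cquartic f) (base_change \<iota> L) Z);
          linf = map_coords of_real (rep_proj_plane Linf);
          l = map_coords \<iota> (rep_proj_plane L)
      in if \<exists>z \<in># Z. incident z (base_change of_real Linf) then \<langle>1\<rangle>
         else \<langle>THE a. \<iota> a = (\<Prod>z \<in># Z. partial_line (cquartic f) linf l z)\<rangle>)"

text \<open>Closed points of the dual real projective plane, as Galois orbits of complex points.  The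
  residue field is \<open>\<real>\<close> if the orbit consists of a single point, which is then defined over \<open>\<real>\<close>, and
  the field of complex numbers otherwise.\<close>

definition closed_points :: "complex proj_plane set set" where
  "closed_points = {{L, base_change cnj L} |L. True}"

definition Tr_Qtype :: "real quartic \<Rightarrow> real proj_plane \<Rightarrow> complex proj_plane set \<Rightarrow> real GW" where
  "Tr_Qtype f Linf X =
     (if \<exists>L. X = {base_change of_real L}
      then Qtype of_real f Linf (THE L. X = {base_change of_real L})
      else GW_transfer (Qtype id f Linf (SOME L. L \<in> X)))"

end

theory Submission
  imports Defs "HOL-Computational_Algebra.Fundamental_Theorem_Algebra"
begin

text \<open>
  The number of real bitangents with signs comes from a winding number, the number of all
  bitangents from the classical description of a quartic by four of its bitangents; the sum in the
  Grothendieck-Witt ring follows from the two numbers.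

  \<^bold>\<open>Signed count.\<close>  The quartic has no real point on the line at infinity, so its restriction to that
  line is a definite binary quartic.  In suitable real coordinates it is, up to sign,
  \<open>(x\<^sup>2 + y\<^sup>2)\<^sup>2 + \<epsilon> Re ((x + i y)\<^sup>4)\<close> with \<open>\<bar>\<epsilon>\<bar> < 1\<close> (\<open>positive_quartic_normal_form\<close>,
  \<open>exists_real_frame\<close>).  A real line other than the line at infinity has a direction \<open>\<theta>\<close> and a
  signed distance \<open>b\<close> from the origin, unique up to \<open>(b, \<theta>) \<mapsto> (- b, \<theta> + \<pi>)\<close>.  The quartic restricts to
  it as a polynomial of degree 4 in one variable, which up to sign is a square iff two
  polynomials \<open>H0\<close> and \<open>H1\<close> in its coefficients vanish.  Thus the real bitangents in the affine
  plane are, two to one, the zeros of \<open>h = H0 + i H1\<close> on the cylinder with coordinate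
  \<open>b + i \<theta>\<close>.  The point of this choice is that the real Jacobian of \<open>h\<close> at a zero is a positive multiple
  of the product of the normal derivatives of the quartic at the two points of tangency
  (\<open>hfun_derivative\<close>, \<open>normal_cubic_product\<close>).  Smoothness says that the product is not zero, and its
  sign is the type of the bitangent (\<open>Qtype_real\<close>).  Hence twice the signed count is the
  difference of the degrees of \<open>h\<close> on the circles \<open>b = B\<close> and \<open>b = - B\<close> for large \<open>B\<close>
  (\<open>signed_zero_count\<close>), which the leading term of \<open>h\<close> at the line at infinity determines.  For
  \<open>\<epsilon> \<noteq> 0\<close> the degrees are \<open>4\<close> and \<open>- 4\<close>, and the signed count is 4 (\<open>degree_at_infinity_generic\<close>).
  For \<open>\<epsilon> = 0\<close> the degrees are \<open>3\<close> and \<open>- 3\<close> (\<open>degree_at_infinity_bitangent\<close>), and the line at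
  infinity is a bitangent itself, which adds 1 (\<open>signed_count\<close>).

  \<^bold>\<open>All bitangents.\<close>  By the signed count there are two different bitangents, with linear forms
  \<open>l1\<close> and \<open>l2\<close>, and these give conics \<open>Q\<close> and \<open>B\<close> with \<open>f = Q\<^sup>2 - l1 l2 B\<close>
  (\<open>decomposition_of_two_bitangents\<close>).  Such a decomposition survives the replacement of \<open>Q\<close> by
  \<open>Q - c l1 l2\<close> and of \<open>B\<close> by \<open>c\<^sup>2 l1 l2 - 2 c Q + B\<close>.  The discriminant of the latter conic is a polynomial
  in \<open>c\<close> of degree 5 with simple roots, since a multiple root would be a singular point of the
  quartic (\<open>pencil_roots\<close>).  At a root the conic splits, and \<open>f = Q\<^sup>2 - l1 l2 l3 l4\<close> for another \<open>Q\<close>.  On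
  any further bitangent \<open>f\<close> is a square \<open>q\<^sup>2\<close>, so \<open>(Q - q) (Q + q)\<close> is the product of the four linear
  forms, two of which make up each factor; the line is therefore a component of a singular conic
  in the family of one of the three pairings (\<open>bitangent_in_splitting\<close>).  Each pairing has four
  roots besides \<open>c = 0\<close>, each root two lines, and \<open>4 + 3 \<cdot> 4 \<cdot> 2 = 28\<close>
  (\<open>card_bitangents_of_tetrad\<close>).

  \<^bold>\<open>The sum.\<close>  The bitangents that are not real come in \<open>m\<close> pairs of complex conjugates, and
  the transfer of \<open>\<langle>1\<rangle>\<close> is \<open>\<langle>1\<rangle> + \<langle>- 1\<rangle>\<close>.  With \<open>p\<close> real bitangents of type \<open>\<langle>1\<rangle>\<close> and \<open>n\<close> of type
  \<open>\<langle>- 1\<rangle>\<close>, the equations \<open>p - n = 4\<close> and \<open>p + n + 2 m = 28\<close> give \<open>p + m = 16\<close> and \<open>n + m = 12\<close>.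
\<close>

section \<open>Rank one classes over the real and the complex numbers\<close>

lemma rank_one_cong: "rank_one_isom a = rank_one_isom b \<Longrightarrow> \<langle>a\<rangle> = \<langle>b\<rangle>"
  by (simp add: rank_one_def)

lemma rank_one_mult_square:
  fixes a c :: "'a::field"
  assumes "c \<noteq> 0"
  shows "\<langle>a * c\<^sup>2\<rangle> = \<langle>a\<rangle>"
proof (cases "a = 0")
  case False
  have nd: "nondeg_form 1 (mat 1 1 (\<lambda>_. a))"
    using False by (auto simp: nondeg_form_def invertible_mat_iff[of _ 1] scalar_prod_def
        intro!: bexI[of _ "mat 1 1 (\<lambda>_. inverse a)"] eq_matI)
  have "invertible_mat (mat 1 1 (\<lambda>_. c))"
    using assms by (auto simp: invertible_mat_iff[of _ 1] scalar_prod_def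
        intro!: bexI[of _ "mat 1 1 (\<lambda>_. inverse c)"] eq_matI)
  then have "isometric (mat 1 1 (\<lambda>_. a)) (mat 1 1 (\<lambda>_. a * c\<^sup>2))"
    by (intro isometricI[OF nd, of "mat 1 1 (\<lambda>_. c)"])
       (auto simp: scalar_prod_def power2_eq_square intro!: eq_matI)
  then have "rank_one_isom a = rank_one_isom (a * c\<^sup>2)"
    using False assms by transfer simp
  then show ?thesis by (intro rank_one_cong) simp
qed simp

lemma rank_one_real:
  fixes a :: real
  shows "a > 0 \<Longrightarrow> \<langle>a\<rangle> = \<langle>1\<rangle>" "a < 0 \<Longrightarrow> \<langle>a\<rangle> = \<langle>- 1\<rangle>"
  using rank_one_mult_square[of "sqrt \<bar>a\<bar>" 1] rank_one_mult_square[of "sqrt \<bar>a\<bar>" "- 1"] by auto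

lemma rank_one_complex: "(a :: complex) \<noteq> 0 \<Longrightarrow> \<langle>a\<rangle> = \<langle>1\<rangle>"
  using rank_one_mult_square[of "csqrt a" 1] by auto

text \<open>The determinant of a Gram matrix changes by a square under an isometry, so over the reals
  its sign separates the two classes, also after adding a common form to both.\<close>

lemma rank_one_real_neq: "\<langle>1 :: real\<rangle> \<noteq> \<langle>- 1\<rangle>"
proof
  assume "\<langle>1 :: real\<rangle> = \<langle>- 1\<rangle>"
  then have "groth_rel (rank_one_isom (1::real), 0) (rank_one_isom (- 1), 0)"
    by transfer
  then obtain e where "rank_one_isom (1::real) + e = rank_one_isom (- 1) + e"
    by (auto simp: groth_rel_def)
  then have "\<exists>E :: real mat. isometric E E \<and> isometric (osum (mat 1 1 (\<lambda>_. 1)) E) (osum (mat 1 1 (\<lambda>_. - 1)) E)"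
    by transfer auto
  then obtain E :: "real mat" where "isometric E E"
    and iso: "isometric (osum (mat 1 1 (\<lambda>_. 1)) E) (osum (mat 1 1 (\<lambda>_. - 1)) E)" by blast
  then obtain n where "nondeg_form n E" by (auto simp: isometric_def)
  then have E: "E \<in> carrier_mat n n" "invertible_mat E" by (auto simp: nondeg_form_def)
  obtain E' where E': "E' \<in> carrier_mat n n" "E * E' = 1\<^sub>m n"
    using E by (auto simp: invertible_mat_iff)
  have dE: "Determinant.det E \<noteq> 0"
    using Determinant.det_mult[OF E(1) E'(1)] E'(2) by auto
  have dsum: "Determinant.det (osum (mat 1 1 (\<lambda>_. x)) E) = x * Determinant.det E" for x :: real
    using E(1) unfolding osum_def
    by (subst det_four_block_mat_upper_right_zero[of _ 1 _ n]) (auto simp: det_single)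
  obtain k P where P: "P \<in> carrier_mat k k" "nondeg_form k (osum (mat 1 1 (\<lambda>_. 1)) E)"
    "osum (mat 1 1 (\<lambda>_. - 1)) E = transpose_mat P * osum (mat 1 1 (\<lambda>_. 1)) E * P"
    using iso by (auto simp: isometric_def)
  then have "osum (mat 1 1 (\<lambda>_. 1)) E \<in> carrier_mat k k" by (simp add: nondeg_form_def)
  then have "Determinant.det (osum (mat 1 1 (\<lambda>_. - 1)) E) =
      Determinant.det P * Determinant.det (osum (mat 1 1 (\<lambda>_. 1)) E) * Determinant.det P"
    unfolding P(3) using P(1)
    by (simp add: Determinant.det_mult[of _ k] det_transpose[of _ k])
  then have "- Determinant.det E = (Determinant.det P)\<^sup>2 * Determinant.det E"
    unfolding dsum by (simp add: power2_eq_square)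
  then have "(Determinant.det P)\<^sup>2 = - 1" using dE by (metis mult_cancel_right mult_minus1)
  then show False by (metis zero_le_power2 neg_0_le_iff_le not_one_le_zero)
qed

text \<open>In the basis \<open>1, i\<close> the trace form \<open>(x, y) \<mapsto> Tr (x y)\<close> is diagonal with entries 2 and \<open>- 2\<close>.\<close>

lemma GW_transfer_1: "GW_transfer \<langle>1\<rangle> = \<langle>1\<rangle> + \<langle>- 1\<rangle>"
proof -
  have nd: "nondeg_form 1 (mat 1 1 (\<lambda>_. a))" if "a \<noteq> 0" for a :: "'a::field"
    using that by (auto simp: nondeg_form_def invertible_mat_iff[of _ 1] scalar_prod_def
        intro!: bexI[of _ "mat 1 1 (\<lambda>_. inverse a)"] eq_matI)
  have "trace_mat (mat 1 1 (\<lambda>_. 1)) = osum (mat 1 1 (\<lambda>_. 2)) (mat 1 1 (\<lambda>_. - 2))"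
  proof (intro eq_matI)
    fix i j assume "i < dim_row (osum (mat 1 1 (\<lambda>_. 2 :: real)) (mat 1 1 (\<lambda>_. - 2)))"
      "j < dim_col (osum (mat 1 1 (\<lambda>_. 2 :: real)) (mat 1 1 (\<lambda>_. - 2)))"
    then have "i = 0 \<or> i = 1" "j = 0 \<or> j = 1" by auto
    then show "trace_mat (mat 1 1 (\<lambda>_. 1)) $$ (i, j) =
        osum (mat 1 1 (\<lambda>_. 2)) (mat 1 1 (\<lambda>_. - 2)) $$ (i, j)"
      by (auto simp: trace_mat_def osum_def cbasis_def field_trace_def)
  qed (auto simp: trace_mat_def osum_def)
  moreover have "isometric (osum (mat 1 1 (\<lambda>_. 2 :: real)) (mat 1 1 (\<lambda>_. - 2)))
      (osum (mat 1 1 (\<lambda>_. 2)) (mat 1 1 (\<lambda>_. - 2)))"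
    by (rule isometric_refl[OF osum_nondeg[OF nd nd]]) auto
  ultimately have "transfer_isom (rank_one_isom 1) = rank_one_isom 2 + rank_one_isom (- 2)"
    by transfer simp
  moreover have "transfer_isom 0 = 0"
  proof transfer
    have "trace_mat (0\<^sub>m 0 0) = 0\<^sub>m 0 0" by (intro eq_matI) (auto simp: trace_mat_def)
    then show "isometric (trace_mat (0\<^sub>m 0 0)) (0\<^sub>m 0 0)"
      by (simp add: isometric_refl[OF nondeg_form_0])
  qed
  ultimately have "GW_transfer \<langle>1\<rangle> = \<langle>2\<rangle> + \<langle>- 2\<rangle>"
    by (simp add: rank_one_def GW_transfer.abs_eq plus_GW.abs_eq)
  then show ?thesis using rank_one_real(1)[of 2] rank_one_real(2)[of "- 2"] by simp
qed

section \<open>Coordinates in the projective plane\<close>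

abbreviation dot :: "'a::semiring_1 ^ 3 \<Rightarrow> 'a ^ 3 \<Rightarrow> 'a" where "dot \<equiv> scalar_product"

text \<open>The cross product over any commutative ring serves for real and complex coordinates alike: it
  gives the line through two points, and \<open>crossp u v \<noteq> 0\<close> expresses independence.\<close>

definition crossp :: "'a::comm_ring_1 ^ 3 \<Rightarrow> 'a ^ 3 \<Rightarrow> 'a ^ 3" where
  "crossp u v = vector [u $ 2 * v $ 3 - u $ 3 * v $ 2, u $ 3 * v $ 1 - u $ 1 * v $ 3,
     u $ 1 * v $ 2 - u $ 2 * v $ 1]"

lemma crossp_nth [simp]:
  "crossp u v $ 1 = u $ 2 * v $ 3 - u $ 3 * v $ 2"
  "crossp u v $ 2 = u $ 3 * v $ 1 - u $ 1 * v $ 3"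
  "crossp u v $ 3 = u $ 1 * v $ 2 - u $ 2 * v $ 1"
  by (simp_all add: crossp_def)

lemma dot_3: "dot u v = u $ 1 * v $ 1 + u $ 2 * v $ 2 + u $ 3 * v $ 3"
  by (simp add: scalar_product_def sum_3)

lemma vec3_eq_iff: "(u :: 'a ^ 3) = v \<longleftrightarrow> u $ 1 = v $ 1 \<and> u $ 2 = v $ 2 \<and> u $ 3 = v $ 3"
  by (simp add: Finite_Cartesian_Product.vec_eq_iff forall_3)

lemma dot_add_right: "dot l (u + v) = dot l u + dot l (v :: 'a::comm_ring_1 ^ 3)"
  and dot_add_left: "dot (u + v) l = dot u l + dot v (l :: 'a::comm_ring_1 ^ 3)"
  and dot_smult_right: "dot l (c *s u) = c * dot l (u :: 'a::comm_ring_1 ^ 3)"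
  and dot_smult_left: "dot (c *s u) l = c * dot u (l :: 'a::comm_ring_1 ^ 3)"
  by (simp_all add: dot_3 algebra_simps)

lemmas dot_linear = dot_add_right dot_add_left dot_smult_right dot_smult_left

lemma dot_zero [simp]: "dot l (0 :: 'a::comm_ring_1 ^ 3) = 0" "dot 0 (l :: 'a::comm_ring_1 ^ 3) = 0"
  by (simp_all add: dot_3)

lemma dot_commute: "dot u v = dot v (u :: 'a::comm_ring_1 ^ 3)"
  by (simp add: dot_3 mult.commute)

lemma dot_crossp [simp]: "dot (crossp u v) u = 0" "dot (crossp u v) v = (0 :: 'a::comm_ring_1)"
  by (simp_all add: dot_3 algebra_simps)

text \<open>Cramer's rule.\<close>

lemma frame_expand:
  fixes u v n w :: "'a::field ^ 3"
  assumes "dot (crossp u v) n \<noteq> 0"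
  defines "\<Delta> \<equiv> dot (crossp u v) n"
  shows "w = (dot (crossp v n) w / \<Delta>) *s u + (dot (crossp n u) w / \<Delta>) *s v + (dot (crossp u v) w / \<Delta>) *s n"
proof -
  have "\<Delta> *s w = dot (crossp v n) w *s u + dot (crossp n u) w *s v + dot (crossp u v) w *s n"
    unfolding \<Delta>_def by (simp add: vec3_eq_iff dot_3 algebra_simps)
  then have "inverse \<Delta> *s (\<Delta> *s w) =
      inverse \<Delta> *s (dot (crossp v n) w *s u + dot (crossp n u) w *s v + dot (crossp u v) w *s n)" by simp
  moreover have "inverse \<Delta> * \<Delta> = 1" using assms by simp
  ultimately show ?thesis
    by (simp add: vector_smult_assoc vector_add_ldistrib divide_inverse mult.commute)
qed

lemma exists_dot_neq_0: "l \<noteq> (0 :: 'a::field ^ 3) \<Longrightarrow> \<exists>n. dot l n = 1"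
proof -
  assume "l \<noteq> 0"
  then consider "l $ 1 \<noteq> 0" | "l $ 2 \<noteq> 0" | "l $ 3 \<noteq> 0" by (auto simp: vec3_eq_iff)
  then show ?thesis
  proof cases
    case 1 then show ?thesis by (intro exI[of _ "vector [1 / l $ 1, 0, 0]"]) (simp add: dot_3)
  next
    case 2 then show ?thesis by (intro exI[of _ "vector [0, 1 / l $ 2, 0]"]) (simp add: dot_3)
  next
    case 3 then show ?thesis by (intro exI[of _ "vector [0, 0, 1 / l $ 3]"]) (simp add: dot_3)
  qed
qed

lemma exists_kernel_basis: "l \<noteq> (0 :: 'a::field ^ 3) \<Longrightarrow> \<exists>u v. crossp u v = l"
proof -
  assume "l \<noteq> 0"
  then consider "l $ 1 \<noteq> 0" | "l $ 2 \<noteq> 0" | "l $ 3 \<noteq> 0" by (auto simp: vec3_eq_iff)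
  then show ?thesis
  proof cases
    case 1 then show ?thesis
      by (intro exI[of _ "vector [- l $ 2 / l $ 1, 1, 0]"] exI[of _ "vector [- l $ 3, 0, l $ 1]"])
         (simp add: vec3_eq_iff)
  next
    case 2 then show ?thesis
      by (intro exI[of _ "vector [0, - l $ 3 / l $ 2, 1]"] exI[of _ "vector [l $ 2, - l $ 1, 0]"])
         (simp add: vec3_eq_iff)
  next
    case 3 then show ?thesis
      by (intro exI[of _ "vector [1, 0, - l $ 1 / l $ 3]"] exI[of _ "vector [0, l $ 3, - l $ 2]"])
         (simp add: vec3_eq_iff)
  qed
qed

lemma kernel_span:
  fixes u v w l :: "'a::field ^ 3"
  assumes "l \<noteq> 0" "dot l u = 0" "dot l v = 0" "crossp u v \<noteq> 0" "dot l w = 0"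
  shows "\<exists>s t. w = s *s u + t *s v"
proof -
  obtain n where n: "dot (crossp u v) n = 1" using exists_dot_neq_0[OF assms(4)] by blast
  have w: "w = (dot (crossp v n) w) *s u + (dot (crossp n u) w) *s v + (dot (crossp u v) w) *s n"
    using frame_expand[of u v n w] n by simp
  have "dot l w = dot (crossp u v) w * dot l n"
    by (subst w) (simp add: dot_linear assms)
  moreover have "dot l n \<noteq> 0"
  proof
    assume n0: "dot l n = 0"
    have "dot l x = 0" for x
      using arg_cong[OF frame_expand[of u v n x], of "dot l"] n
      by (simp add: dot_linear assms(2,3) n0)
    then show False using exists_dot_neq_0[OF assms(1)] by auto
  qed
  ultimately have "dot (crossp u v) w = 0" using assms(5) by auto
  then show ?thesis using w by (metis add.right_neutral vector_smult_lzero)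
qed

lemma crossp_crossp: "crossp l (crossp u v) = dot l v *s u - dot l u *s v"
  by (simp add: vec3_eq_iff dot_3 algebra_simps)

lemma crossp_eq_0_iff:
  fixes u v :: "'a::field ^ 3"
  assumes "u \<noteq> 0"
  shows "crossp u v = 0 \<longleftrightarrow> (\<exists>c. v = c *s u)"
proof
  assume z: "crossp u v = 0"
  obtain n where n: "dot u n = 1" using exists_dot_neq_0[OF assms] by blast
  have "crossp n (crossp u v) = 0" unfolding z by (simp add: vec3_eq_iff)
  then have "v = dot v n *s u"
    unfolding crossp_crossp using n by (simp add: dot_commute[of n])
  then show "\<exists>c. v = c *s u" ..
next
  assume "\<exists>c. v = c *s u"
  then show "crossp u v = 0" by (auto simp: vec3_eq_iff)
qed

lemma crossp_parallel:
  fixes l u v :: "'a::field ^ 3"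
  assumes "l \<noteq> 0" "dot l u = 0" "dot l v = 0"
  shows "\<exists>c. crossp u v = c *s l"
proof -
  have "crossp l (crossp u v) = 0" unfolding crossp_crossp by (simp add: assms)
  then show ?thesis using crossp_eq_0_iff[OF assms(1)] by blast
qed

subsection \<open>Points and their representatives\<close>

lemma rep_nonzero [simp]: "rep_proj_plane p \<noteq> 0"
  using Quotient_rep_reflp[OF Quotient_proj_plane, of p] by (auto simp: proj_rel_def)

lemma abs_rep [simp]: "abs_proj_plane (rep_proj_plane p) = p"
  by (rule Quotient_abs_rep[OF Quotient_proj_plane])

lemma abs_eq_iff:
  "v \<noteq> 0 \<Longrightarrow> w \<noteq> 0 \<Longrightarrow> abs_proj_plane v = abs_proj_plane w \<longleftrightarrow> (\<exists>c. w = c *s v)"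
proof -
  assume vw: "v \<noteq> 0" "w \<noteq> 0"
  have self: "proj_rel x x" if "x \<noteq> 0" for x :: "'a ^ 3"
    using that unfolding proj_rel_def by (auto intro: exI[of _ 1])
  have "abs_proj_plane v = abs_proj_plane w \<longleftrightarrow> proj_rel v w"
    using Quotient_rel[OF Quotient_proj_plane, of v w] self vw by simp
  then show ?thesis using vw by (simp add: proj_rel_def)
qed

lemma rep_abs: "v \<noteq> 0 \<Longrightarrow> \<exists>c. c \<noteq> 0 \<and> rep_proj_plane (abs_proj_plane v) = c *s v"
proof -
  assume v: "v \<noteq> 0"
  obtain c where c: "rep_proj_plane (abs_proj_plane v) = c *s v"
    using abs_eq_iff[OF v rep_nonzero, of "abs_proj_plane v"] by auto
  moreover have "c \<noteq> 0" using c rep_nonzero[of "abs_proj_plane v"] by auto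
  ultimately show ?thesis by blast
qed

lemma abs_smult: "c \<noteq> 0 \<Longrightarrow> v \<noteq> 0 \<Longrightarrow> abs_proj_plane (c *s v) = abs_proj_plane v"
  by (subst eq_commute, subst abs_eq_iff) (auto simp: vec3_eq_iff)

lemma incident_abs: "v \<noteq> 0 \<Longrightarrow> incident (abs_proj_plane v) L \<longleftrightarrow> dot (rep_proj_plane L) v = 0"
  using rep_abs[of v] by (auto simp: incident_def dot_linear)

lemma map_coords_nth [simp]: "map_coords h v $ i = h (v $ i)"
  by (simp add: map_coords_def)

lemma map_of_real_eq_0 [simp]: "map_coords complex_of_real v = 0 \<longleftrightarrow> v = 0"
  by (simp add: vec3_eq_iff)

lemma map_of_real_dot: "dot (map_coords complex_of_real u) (map_coords of_real v) = of_real (dot u v)"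
  by (simp add: dot_3)

lemma map_of_real_crossp: "crossp (map_coords complex_of_real u) (map_coords of_real v) = map_coords of_real (crossp u v)"
  by (simp add: vec3_eq_iff)

lemma map_of_real_linear:
  "map_coords complex_of_real (u + v) = map_coords of_real u + map_coords of_real v"
  "map_coords complex_of_real (c *s v) = of_real c *s map_coords of_real v"
  by (simp_all add: vec3_eq_iff)

lemma base_change_of_real_abs:
  assumes "v \<noteq> 0"
  shows "base_change complex_of_real (abs_proj_plane v) = abs_proj_plane (map_coords of_real v)"
proof -
  obtain c where c: "c \<noteq> 0" "rep_proj_plane (abs_proj_plane v) = c *s v" using rep_abs[OF assms] by blast
  then show ?thesis using assms by (simp add: base_change_def map_of_real_linear abs_smult)
qed

lemma base_change_of_real_inj: "base_change complex_of_real L = base_change of_real L' \<longleftrightarrow> L = L'"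
proof
  assume "base_change complex_of_real L = base_change of_real L'"
  then obtain c where c: "map_coords complex_of_real (rep_proj_plane L') = c *s map_coords of_real (rep_proj_plane L)"
    unfolding base_change_def by (subst (asm) abs_eq_iff) auto
  obtain n where n: "dot (rep_proj_plane L) n = 1" using exists_dot_neq_0[OF rep_nonzero] by blast
  have "c = of_real (dot (rep_proj_plane L') n)"
    using arg_cong[OF c, of "\<lambda>x. dot x (map_coords of_real n)"] n
    by (simp add: dot_linear map_of_real_dot)
  then have "rep_proj_plane L' = dot (rep_proj_plane L') n *s rep_proj_plane L"
    using c by (simp add: vec3_eq_iff flip: of_real_mult)
  then have "abs_proj_plane (rep_proj_plane L) = abs_proj_plane (rep_proj_plane L')"
    by (subst abs_eq_iff) auto
  then show "L = L'" by simp
qed simp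

section \<open>Homogeneous forms\<close>

text \<open>The subring keeps track of real coefficients inside complex forms.\<close>

definition subring :: "'a::comm_ring_1 set \<Rightarrow> bool" where
  "subring S \<longleftrightarrow> 0 \<in> S \<and> 1 \<in> S \<and> (\<forall>a\<in>S. \<forall>b\<in>S. a + b \<in> S \<and> a * b \<in> S)"

text \<open>Substitution into a form is treated at the level of functions, where closure under products and
  sums is a simple induction; the coefficients of the result are only asserted to exist.\<close>

definition hform :: "'a::comm_ring_1 set \<Rightarrow> nat \<Rightarrow> ('a \<Rightarrow> 'a \<Rightarrow> 'a \<Rightarrow> 'a) \<Rightarrow> bool" where
  "hform S d F \<longleftrightarrow> (\<exists>g. (\<forall>e. g e \<in> S) \<and> (\<forall>x y z. F x y z =
     (\<Sum>(i, j, k) \<in> {(i, j, k). i + j + k = d}. g (i, j, k) * x ^ i * y ^ j * z ^ k)))"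

lemma finite_degree: "finite {(i :: nat, j :: nat, k :: nat). i + j + k = d}"
  by (rule finite_subset[of _ "{..d} \<times> {..d} \<times> {..d}"]) auto

lemma hform_add: "subring S \<Longrightarrow> hform S d F \<Longrightarrow> hform S d G \<Longrightarrow> hform S d (\<lambda>x y z. F x y z + G x y z)"
  unfolding hform_def
proof (elim exE conjE)
  fix g h assume S: "subring S" and
    gh: "\<forall>e. g e \<in> S" "\<forall>e. h e \<in> S"
    "\<forall>x y z. F x y z = (\<Sum>(i, j, k) \<in> {(i, j, k). i + j + k = d}. g (i, j, k) * x ^ i * y ^ j * z ^ k)"
    "\<forall>x y z. G x y z = (\<Sum>(i, j, k) \<in> {(i, j, k). i + j + k = d}. h (i, j, k) * x ^ i * y ^ j * z ^ k)"
  show "\<exists>g. (\<forall>e. g e \<in> S) \<and> (\<forall>x y z. F x y z + G x y z =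
     (\<Sum>(i, j, k) \<in> {(i, j, k). i + j + k = d}. g (i, j, k) * x ^ i * y ^ j * z ^ k))"
    using S gh by (intro exI[of _ "\<lambda>e. g e + h e"])
      (auto simp: subring_def algebra_simps sum.distrib[symmetric] intro!: sum.cong)
qed

lemma hform_smult: "subring S \<Longrightarrow> c \<in> S \<Longrightarrow> hform S d F \<Longrightarrow> hform S d (\<lambda>x y z. c * F x y z)"
  unfolding hform_def
proof (elim exE conjE)
  fix g assume S: "subring S" "c \<in> S" and g: "\<forall>e. g e \<in> S"
    "\<forall>x y z. F x y z = (\<Sum>(i, j, k) \<in> {(i, j, k). i + j + k = d}. g (i, j, k) * x ^ i * y ^ j * z ^ k)"
  show "\<exists>g. (\<forall>e. g e \<in> S) \<and> (\<forall>x y z. c * F x y z =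
     (\<Sum>(i, j, k) \<in> {(i, j, k). i + j + k = d}. g (i, j, k) * x ^ i * y ^ j * z ^ k))"
    using S g by (intro exI[of _ "\<lambda>e. c * g e"])
      (auto simp: subring_def sum_distrib_left mult.assoc intro!: sum.cong)
qed

lemma hform_mult_var:
  assumes S: "subring S" and F: "hform S d F"
  shows "hform S (Suc d) (\<lambda>x y z. x * F x y z)" "hform S (Suc d) (\<lambda>x y z. y * F x y z)"
    "hform S (Suc d) (\<lambda>x y z. z * F x y z)"
proof -
  obtain g where g: "\<forall>e. g e \<in> S"
    "\<forall>x y z. F x y z = (\<Sum>(i, j, k) \<in> {(i, j, k). i + j + k = d}. g (i, j, k) * x ^ i * y ^ j * z ^ k)"
    using F unfolding hform_def by blast
  have 0: "0 \<in> S" using S by (simp add: subring_def)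
  show "hform S (Suc d) (\<lambda>x y z. x * F x y z)"
    unfolding hform_def using g 0
    by (intro exI[of _ "\<lambda>(i, j, k). case i of 0 \<Rightarrow> 0 | Suc i \<Rightarrow> g (i, j, k)"] conjI allI)
      (auto split: nat.splits simp: sum_distrib_left
       intro!: sum.reindex_bij_witness_not_neutral[where S' = "{}" and T' = "{(i, j, k). i = 0 \<and> j + k = Suc d}"
        and i = "\<lambda>(i, j, k). (i - 1, j, k)" and j = "\<lambda>(i, j, k). (Suc i, j, k)"]
        finite_subset[OF _ finite_degree[of "Suc d"]])
  show "hform S (Suc d) (\<lambda>x y z. y * F x y z)"
    unfolding hform_def using g 0
    by (intro exI[of _ "\<lambda>(i, j, k). case j of 0 \<Rightarrow> 0 | Suc j \<Rightarrow> g (i, j, k)"] conjI allI)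
      (auto split: nat.splits simp: sum_distrib_left
       intro!: sum.reindex_bij_witness_not_neutral[where S' = "{}" and T' = "{(i, j, k). j = 0 \<and> i + k = Suc d}"
        and i = "\<lambda>(i, j, k). (i, j - 1, k)" and j = "\<lambda>(i, j, k). (i, Suc j, k)"]
        finite_subset[OF _ finite_degree[of "Suc d"]])
  show "hform S (Suc d) (\<lambda>x y z. z * F x y z)"
    unfolding hform_def using g 0
    by (intro exI[of _ "\<lambda>(i, j, k). case k of 0 \<Rightarrow> 0 | Suc k \<Rightarrow> g (i, j, k)"] conjI allI)
      (auto split: nat.splits simp: sum_distrib_left
       intro!: sum.reindex_bij_witness_not_neutral[where S' = "{}" and T' = "{(i, j, k). k = 0 \<and> i + j = Suc d}"
        and i = "\<lambda>(i, j, k). (i, j, k - 1)" and j = "\<lambda>(i, j, k). (i, j, Suc k)"]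
        finite_subset[OF _ finite_degree[of "Suc d"]])
qed

lemma hform_mult_linear:
  assumes S: "subring S" and F: "hform S d F" and "a \<in> S" "b \<in> S" "c \<in> S"
  shows "hform S (Suc d) (\<lambda>x y z. (x * a + y * b + z * c) * F x y z)"
proof -
  have "hform S (Suc d) (\<lambda>x y z. a * (x * F x y z) + b * (y * F x y z) + c * (z * F x y z))"
    using assms by (intro hform_add hform_smult hform_mult_var)
  then show ?thesis by (simp add: algebra_simps)
qed

lemma hform_mult_linear_power:
  assumes S: "subring S" and F: "hform S d F" and "a \<in> S" "b \<in> S" "c \<in> S"
  shows "hform S (n + d) (\<lambda>x y z. (x * a + y * b + z * c) ^ n * F x y z)"
proof (induction n)
  case (Suc n)
  then show ?case using hform_mult_linear[OF S Suc assms(3-5)] by (simp add: mult.assoc)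
qed (use F in simp)

lemma hform_const: "c \<in> S \<Longrightarrow> hform S 0 (\<lambda>x y z. c)"
proof -
  assume "c \<in> S"
  moreover have "{(i :: nat, j :: nat, k :: nat). i = 0 \<and> j = 0 \<and> k = 0} = {(0, 0, 0)}" by auto
  ultimately show ?thesis unfolding hform_def by (intro exI[of _ "\<lambda>_. c"]) simp
qed

lemma hform_sum:
  "finite I \<Longrightarrow> subring S \<Longrightarrow> (\<And>i. i \<in> I \<Longrightarrow> hform S d (F i)) \<Longrightarrow> hform S d (\<lambda>x y z. \<Sum>i\<in>I. F i x y z)"
proof (induction I rule: finite_induct)
  case empty
  then show ?case unfolding hform_def by (intro exI[of _ "\<lambda>_. 0"]) (auto simp: subring_def)
next
  case (insert i I)
  then show ?case by (simp add: hform_add)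
qed

definition tern :: "'a::comm_ring_1 quartic \<Rightarrow> 'a \<Rightarrow> 'a \<Rightarrow> 'a \<Rightarrow> 'a" where
  "tern g x y z = quartic_eval g (vector [x, y, z])"

lemma quartic_linear_subst:
  fixes f :: "'a::comm_ring_1 quartic" and e1 e2 e3 :: "'a ^ 3"
  assumes S: "subring S" and f: "\<And>e. f e \<in> S" and e: "\<And>i. e1 $ i \<in> S" "\<And>i. e2 $ i \<in> S" "\<And>i. e3 $ i \<in> S"
  shows "\<exists>g. (\<forall>e. g e \<in> S) \<and> (\<forall>x y z. quartic_eval f (x *s e1 + y *s e2 + z *s e3) = tern g x y z)"
proof -
  let ?L = "\<lambda>i x y z. x * e1 $ i + y * e2 $ i + z * e3 $ i"
  have "hform S 4 (\<lambda>x y z. ?L 3 x y z ^ k * (?L 2 x y z ^ j * (?L 1 x y z ^ i * f (i, j, k))))"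
    if "i + j + k = 4" for i j k
  proof -
    have "hform S (k + (j + (i + 0))) (\<lambda>x y z. ?L 3 x y z ^ k * (?L 2 x y z ^ j * (?L 1 x y z ^ i * f (i, j, k))))"
      by (intro hform_mult_linear_power hform_const S f e)
    moreover have "k + (j + (i + 0)) = 4" using that by simp
    ultimately show ?thesis by simp
  qed
  then have "hform S 4 (\<lambda>x y z. \<Sum>e\<in>{(i, j, k). i + j + k = 4}.
      (case e of (i, j, k) \<Rightarrow> ?L 3 x y z ^ k * (?L 2 x y z ^ j * (?L 1 x y z ^ i * f (i, j, k)))))"
    by (intro hform_sum finite_degree S) auto
  then show ?thesis
    unfolding hform_def tern_def quartic_eval_def by (simp add: case_prod_unfold mult_ac)
qed

lemma sum_atMost_explicit:
  fixes G :: "nat \<Rightarrow> 'a::comm_monoid_add"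
  shows "(\<Sum>i\<le>0. G i) = G 0" "(\<Sum>i\<le>1. G i) = G 0 + G 1" "(\<Sum>i\<le>2. G i) = G 0 + G 1 + G 2"
    "(\<Sum>i\<le>3. G i) = G 0 + G 1 + G 2 + G 3" "(\<Sum>i\<le>4. G i) = G 0 + G 1 + G 2 + G 3 + G 4"
  by (simp_all add: eval_nat_numeral)

lemma sum_degree_4:
  fixes F :: "nat \<times> nat \<times> nat \<Rightarrow> 'a::comm_monoid_add"
  shows "(\<Sum>e \<in> {(i, j, k). i + j + k = 4}. F e) =
    F (4,0,0) + F (3,1,0) + F (3,0,1) + F (2,2,0) + F (2,1,1) + F (2,0,2)
      + F (1,3,0) + F (1,2,1) + F (1,1,2) + F (1,0,3) + F (0,4,0) + F (0,3,1) + F (0,2,2)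
      + F (0,1,3) + F (0,0,4)"
proof -
  have "(\<Sum>e \<in> {(i, j, k). i + j + k = 4}. F e) =
      (\<Sum>e \<in> (SIGMA i:{..4}. {..4 - i}). F (fst e, snd e, 4 - fst e - snd e))"
  proof (rule sum.reindex_bij_witness[of _ "\<lambda>(i, j). (i, j, 4 - i - j)" "\<lambda>(i, j, k). (i, j)"], goal_cases)
    case (1 e) then show ?case by clarsimp arith
  next
    case (2 e) then show ?case by clarsimp arith
  next
    case (5 e)
    then obtain i j k where e: "e = (i, j, k)" "i + j + k = 4" by auto
    then have "4 - i - j = k" by simp
    then show ?case unfolding e(1) by simp
  qed auto
  also have "\<dots> = (\<Sum>i\<le>4. \<Sum>j\<le>4 - i. F (i, j, 4 - i - j))"
    by (subst sum.Sigma) (auto simp: case_prod_unfold)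
  also have "\<dots> = (\<Sum>j\<le>4. F (0, j, 4 - j)) + (\<Sum>j\<le>3. F (1, j, 3 - j)) +
      (\<Sum>j\<le>2. F (2, j, 2 - j)) + (\<Sum>j\<le>1. F (3, j, 1 - j)) + (\<Sum>j\<le>0. F (4, j, 0 - j))"
    unfolding sum_atMost_explicit(5)[of "\<lambda>i. \<Sum>j\<le>4 - i. F (i, j, 4 - i - j)"] by simp
  finally show ?thesis unfolding sum_atMost_explicit by (simp add: add_ac)
qed

lemma tern_expand: "tern g x y z =
   g (4,0,0) * x^4 + g (3,1,0) * x^3 * y + g (3,0,1) * x^3 * z + g (2,2,0) * x^2 * y^2
   + g (2,1,1) * x^2 * y * z + g (2,0,2) * x^2 * z^2 + g (1,3,0) * x * y^3 + g (1,2,1) * x * y^2 * z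
   + g (1,1,2) * x * y * z^2 + g (1,0,3) * x * z^3 + g (0,4,0) * y^4 + g (0,3,1) * y^3 * z
   + g (0,2,2) * y^2 * z^2 + g (0,1,3) * y * z^3 + g (0,0,4) * z^4"
  unfolding tern_def quartic_eval_def sum_degree_4 by simp

lemma cquartic_eval: "quartic_eval (cquartic f) (map_coords of_real v) = of_real (quartic_eval f v)"
  by (simp add: quartic_eval_def cquartic_def case_prod_unfold)

lemma tern_of_real: "tern (cquartic g) (of_real x) (of_real y) (of_real z) = of_real (tern g x y z)"
  by (simp add: tern_expand cquartic_def)

lemma quartic_real_subst:
  fixes f :: "real quartic" and e1 e2 e3 :: "real ^ 3"
  shows "\<exists>g :: real quartic.
    (\<forall>x y z. quartic_eval (cquartic f) (x *s map_coords of_real e1 + y *s map_coords of_real e2 +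
       z *s map_coords of_real e3) = tern (cquartic g) x y z) \<and>
    (\<forall>x y z. quartic_eval f (x *s e1 + y *s e2 + z *s e3) = tern g x y z)"
proof -
  have "subring (\<real> :: complex set)" unfolding subring_def by (simp add: Reals_add Reals_mult)
  then obtain g' where g': "\<forall>e. g' e \<in> (\<real> :: complex set)"
    "\<forall>x y z. quartic_eval (cquartic f) (x *s map_coords of_real e1 + y *s map_coords of_real e2 +
       z *s map_coords of_real e3) = tern g' x y z"
    using quartic_linear_subst[of "\<real>" "cquartic f" "map_coords of_real e1" "map_coords of_real e2"
        "map_coords of_real e3"] by (auto simp: cquartic_def)
  define g where "g e = Re (g' e)" for e
  have g: "g' = cquartic g" using g'(1) by (auto simp: cquartic_def g_def)
  have "quartic_eval f (x *s e1 + y *s e2 + z *s e3) = tern g x y z" for x y z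
  proof -
    have "complex_of_real (quartic_eval f (x *s e1 + y *s e2 + z *s e3)) = of_real (tern g x y z)"
      unfolding cquartic_eval[symmetric] tern_of_real[symmetric] map_of_real_linear
      using g'(2) g by simp
    then show ?thesis by simp
  qed
  then show ?thesis using g'(2) unfolding g by (intro exI[of _ g]) simp
qed

section \<open>Bitangents\<close>

subsection \<open>Binary forms over the complex numbers\<close>

definition lf :: "complex \<times> complex \<Rightarrow> complex \<Rightarrow> complex \<Rightarrow> complex" where
  "lf a s t = fst a * s + snd a * t"

lemma binary_quadratic_factor:
  assumes "(\<alpha>, \<beta>, \<gamma>) \<noteq> (0, 0, 0)"
  shows "\<exists>a b. a \<noteq> 0 \<and> b \<noteq> 0 \<and> (\<forall>s t. \<alpha> * s\<^sup>2 + \<beta> * s * t + \<gamma> * t\<^sup>2 = lf a s t * lf b s t)"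
proof (cases "\<alpha> = 0")
  case True
  then show ?thesis
    using assms by (intro exI[of _ "(0, 1)"] exI[of _ "(\<beta>, \<gamma>)"])
      (auto simp: lf_def zero_prod_def power2_eq_square algebra_simps)
next
  case False
  define \<delta> where "\<delta> = csqrt (\<beta>\<^sup>2 - 4 * \<alpha> * \<gamma>)"
  have \<delta>: "\<delta>\<^sup>2 = \<beta>\<^sup>2 - 4 * \<alpha> * \<gamma>" by (simp add: \<delta>_def)
  have "\<alpha> * s\<^sup>2 + \<beta> * s * t + \<gamma> * t\<^sup>2 =
      lf (\<alpha>, (\<beta> + \<delta>) / 2) s t * lf (1, (\<beta> - \<delta>) / (2 * \<alpha>)) s t" for s t
  proof -
    have "4 * \<alpha> * (lf (\<alpha>, (\<beta> + \<delta>) / 2) s t * lf (1, (\<beta> - \<delta>) / (2 * \<alpha>)) s t) =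
        (2 * \<alpha> * s + (\<beta> + \<delta>) * t) * (2 * \<alpha> * s + (\<beta> - \<delta>) * t)"
      using False by (simp add: lf_def field_simps)
    also have "\<dots> = (2 * \<alpha> * s + \<beta> * t)\<^sup>2 - \<delta>\<^sup>2 * t\<^sup>2"
      by (simp add: power2_eq_square algebra_simps)
    also have "\<dots> = 4 * \<alpha> * (\<alpha> * s\<^sup>2 + \<beta> * s * t + \<gamma> * t\<^sup>2)"
      unfolding \<delta> by (simp add: power2_eq_square algebra_simps)
    finally show ?thesis using False by simp
  qed
  then show ?thesis using False
    by (intro exI[of _ "(\<alpha>, (\<beta> + \<delta>) / 2)"] exI[of _ "(1, (\<beta> - \<delta>) / (2 * \<alpha>))"])
       (auto simp: zero_prod_def)
qed

lemma binary_quartic_factor: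
  assumes "(c0, c1, c2, c3, c4) \<noteq> (0, 0, 0, 0, 0)"
  shows "\<exists>a b c d. a \<noteq> 0 \<and> b \<noteq> 0 \<and> c \<noteq> 0 \<and> d \<noteq> 0 \<and>
    (\<forall>s t. c0 * t^4 + c1 * s * t^3 + c2 * s^2 * t^2 + c3 * s^3 * t + c4 * s^4 =
       lf a s t * lf b s t * lf c s t * lf d s t)"
proof -
  define P where "P = [:c4, c3, c2, c1, c0:]"
  define H where "H s t = c0 * t^4 + c1 * s * t^3 + c2 * s^2 * t^2 + c3 * s^3 * t + c4 * s^4" for s t
  have "P \<noteq> 0" using assms by (auto simp: P_def)
  define \<kappa> where "\<kappa> = lead_coeff P"
  have \<kappa>: "\<kappa> \<noteq> 0" using \<open>P \<noteq> 0\<close> by (simp add: \<kappa>_def)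
  obtain xs where xs: "mset xs = proots P" using ex_mset by blast
  define m where "m = length xs"
  have m: "m = degree P" unfolding m_def using arg_cong[OF xs, of size] by (simp add: size_proots_complex)
  have "m \<le> 4" unfolding m by (simp add: P_def)
  have P_eq: "poly P x = \<kappa> * prod_list (map (\<lambda>a. x - a) xs)" for x
  proof -
    have "poly P x = poly (Polynomial.smult \<kappa> (\<Prod>a\<in>#mset xs. [:- a, 1:])) x"
      unfolding xs \<kappa>_def complex_poly_decompose_multiset ..
    moreover have "poly (\<Prod>a\<in>#mset xs. [:- a, 1:]) x = prod_list (map (\<lambda>a. x - a) xs)"
      by (induction xs) (auto simp: left_diff_distrib)
    ultimately show ?thesis by simp
  qed
  have H_eq: "H s t = \<kappa> * (s ^ (4 - m) * prod_list (map (\<lambda>a. t - a * s) xs))" for s t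
  proof (cases "s = 0")
    case False
    have "H s t = s ^ 4 * poly P (t / s)"
      using False by (simp add: H_def P_def field_simps power4_eq_xxxx power3_eq_cube power2_eq_square)
    also have "\<dots> = \<kappa> * (s ^ (4 - m) * (s ^ m * prod_list (map (\<lambda>a. t / s - a) xs)))"
      unfolding P_eq using \<open>m \<le> 4\<close> by (simp add: power_add[symmetric] mult_ac)
    also have "s ^ m * prod_list (map (\<lambda>a. t / s - a) xs) = prod_list (map (\<lambda>a. t - a * s) xs)"
      unfolding m_def using False by (induction xs) (auto simp: field_simps)
    finally show ?thesis .
  next
    case True
    have "prod_list (map (\<lambda>a. t) xs) = t ^ m" unfolding m_def by (induction xs) auto
    moreover have "c0 = (if m = 4 then \<kappa> else 0)"
    proof -
      have "c0 = coeff P 4" by (simp add: P_def eval_nat_numeral)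
      then show ?thesis using m \<open>m \<le> 4\<close> by (auto simp: \<kappa>_def coeff_eq_0)
    qed
    ultimately show ?thesis using True \<open>m \<le> 4\<close> by (auto simp: H_def)
  qed
  define zs where "zs = map (\<lambda>a. (- a, 1 :: complex)) xs @ replicate (4 - m) (1, 0)"
  have "length zs = 4" using \<open>m \<le> 4\<close> by (simp add: zs_def m_def)
  then obtain a b c d where zs: "zs = [a, b, c, d]"
    by (auto simp: eval_nat_numeral length_Suc_conv)
  have nz: "\<forall>z\<in>set zs. z \<noteq> 0" by (auto simp: zs_def zero_prod_def)
  have "prod_list (map (\<lambda>a. lf a s t) zs) = prod_list (map (\<lambda>a. t - a * s) xs) * s ^ (4 - m)" for s t
    unfolding zs_def by (simp add: lf_def o_def prod_list_replicate)
  then have prod: "lf a s t * (lf b s t * (lf c s t * lf d s t)) =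
      prod_list (map (\<lambda>a. t - a * s) xs) * s ^ (4 - m)" for s t
    unfolding zs by simp
  have "lf (\<kappa> * fst a, \<kappa> * snd a) s t = \<kappa> * lf a s t" for s t by (simp add: lf_def algebra_simps)
  then have "H s t = lf (\<kappa> * fst a, \<kappa> * snd a) s t * lf b s t * lf c s t * lf d s t" for s t
    using prod[of s t] unfolding H_eq by (simp add: mult_ac)
  moreover have "(\<kappa> * fst a, \<kappa> * snd a) \<noteq> 0" using nz \<kappa> unfolding zs by (auto simp: zero_prod_def prod_eq_iff)
  ultimately show ?thesis using nz unfolding zs H_def
    by (intro exI[of _ "(\<kappa> * fst a, \<kappa> * snd a)"] exI[of _ b] exI[of _ c] exI[of _ d]) auto
qed

lemma order_linear:
  assumes "(\<alpha>, \<beta>) \<noteq> (0, 0)"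
  shows "order 0 [:\<alpha>, \<beta> :: complex:] = (if \<alpha> = 0 then 1 else 0)"
proof (cases "\<alpha> = 0")
  case True
  then have "[:\<alpha>, \<beta>:] \<noteq> 0" using assms by auto
  moreover have "poly [:\<alpha>, \<beta>:] 0 = 0" using True by simp
  ultimately have "order 0 [:\<alpha>, \<beta>:] \<noteq> 0" using order_root by blast
  moreover have "order 0 [:\<alpha>, \<beta>:] \<le> degree [:\<alpha>, \<beta>:]"
    using \<open>[:\<alpha>, \<beta>:] \<noteq> 0\<close> by (rule order_degree)
  ultimately show ?thesis using True by (auto split: if_splits)
next
  case False
  then show ?thesis by (simp add: order_0I)
qed

lemma poly_quartic_on_line: "poly (quartic_on_line f v w) t = quartic_eval f (v + t *s w)"
proof -
  have "poly (quartic_eval (\<lambda>e. [:f e:]) V) t = quartic_eval f (\<chi> i. poly (V $ i) t)" for V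
    by (simp add: quartic_eval_def poly_sum case_prod_unfold mult.assoc)
  moreover have "(\<chi> i. poly [:v $ i, w $ i:] t) = v + t *s w"
    by (simp add: vec3_eq_iff)
  ultimately show ?thesis unfolding quartic_on_line_def by simp
qed

subsection \<open>The intersection divisor in coordinates\<close>

text \<open>A basis of the points of the line turns forms in the plane into binary forms, so that divisors
  on the line become factorizations.\<close>

locale line_basis =
  fixes L :: "complex proj_plane" and u v :: "complex ^ 3"
  assumes u: "dot (rep_proj_plane L) u = 0" and v: "dot (rep_proj_plane L) v = 0"
    and indep: "crossp u v \<noteq> 0"
begin

lemma on_line: "dot (rep_proj_plane L) (s *s u + t *s v) = 0"
  by (simp add: dot_linear u v)

lemma crossp_comb: "crossp (x *s u + y *s v) (x' *s u + y' *s v) = (x * y' - x' * y) *s crossp u v"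
  by (simp add: vec3_eq_iff algebra_simps)

lemma comb_eq_0: "s *s u + t *s v = 0 \<longleftrightarrow> s = 0 \<and> t = 0"
proof
  assume 0: "s *s u + t *s v = 0"
  have "crossp (s *s u + t *s v) v = s *s crossp u v" "crossp u (s *s u + t *s v) = t *s crossp u v"
    by (simp_all add: vec3_eq_iff algebra_simps)
  moreover have "crossp 0 v = 0" "crossp u 0 = 0" by (simp_all add: vec3_eq_iff)
  ultimately have "s *s crossp u v = 0" "t *s crossp u v = 0" unfolding 0 by auto
  then show "s = 0 \<and> t = 0" using indep by (simp add: vec3_eq_iff) blast
qed simp

definition root_point :: "complex \<times> complex \<Rightarrow> complex proj_plane" where
  "root_point a = abs_proj_plane (snd a *s u + (- fst a) *s v)"

lemma root_point_rep:
  assumes "a \<noteq> 0"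
  shows "\<exists>c. c \<noteq> 0 \<and> rep_proj_plane (root_point a) = (c * snd a) *s u + (- c * fst a) *s v"
proof -
  have "snd a *s u + (- fst a) *s v \<noteq> 0" using assms comb_eq_0[of "snd a" "- fst a"] by (auto simp: prod_eq_iff)
  from rep_abs[OF this] obtain c where c: "c \<noteq> 0"
    "rep_proj_plane (root_point a) = c *s (snd a *s u + (- fst a) *s v)" unfolding root_point_def by blast
  then show ?thesis by (intro exI[of _ c]) (simp add: vector_add_ldistrib vector_smult_assoc)
qed

lemma incident_root_point: "a \<noteq> 0 \<Longrightarrow> incident (root_point a) L"
proof -
  assume "a \<noteq> 0"
  then obtain c where "rep_proj_plane (root_point a) = (c * snd a) *s u + (- c * fst a) *s v"
    using root_point_rep by blast
  then show "incident (root_point a) L" unfolding incident_def by (simp only: on_line)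
qed

lemma rep_coords: "incident p L \<Longrightarrow> \<exists>x y. rep_proj_plane p = x *s u + y *s v \<and> (x, y) \<noteq> (0, 0)"
proof -
  assume "incident p L"
  then obtain x y where xy: "rep_proj_plane p = x *s u + y *s v"
    using kernel_span[OF rep_nonzero u v indep] unfolding incident_def by blast
  moreover have "(x, y) \<noteq> (0, 0)" using rep_nonzero[of p] xy by auto
  ultimately show ?thesis by blast
qed

lemma lf_eq_0_iff:
  assumes a: "a \<noteq> 0" and p: "rep_proj_plane p = x *s u + y *s v"
  shows "lf a x y = 0 \<longleftrightarrow> p = root_point a"
proof -
  have nz: "snd a *s u + (- fst a) *s v \<noteq> 0" using a comb_eq_0[of "snd a" "- fst a"] by (auto simp: prod_eq_iff)
  have "p = root_point a \<longleftrightarrow> abs_proj_plane (rep_proj_plane p) = root_point a" by simp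
  also have "\<dots> \<longleftrightarrow> (\<exists>c. snd a *s u + (- fst a) *s v = c *s rep_proj_plane p)"
    unfolding root_point_def using nz by (subst abs_eq_iff) auto
  also have "\<dots> \<longleftrightarrow> crossp (x *s u + y *s v) (snd a *s u + (- fst a) *s v) = 0"
    using crossp_eq_0_iff[OF rep_nonzero[of p]] unfolding p by blast
  also have "\<dots> \<longleftrightarrow> lf a x y = 0"
    proof -
    have "x * - fst a - snd a * y = - lf a x y" by (simp add: lf_def algebra_simps)
    then show ?thesis unfolding crossp_comb vector_mul_eq_0 using indep by simp
  qed
  finally show ?thesis ..
qed

text \<open>The chosen second point of the line is another basis vector, so the polynomial whose order is
  taken is a product of linear polynomials, one for each linear factor of the binary form.\<close>

lemma intersection_mult_eq:
  assumes F: "\<And>s t. quartic_eval f (s *s u + t *s v) = lf a s t * lf b s t * lf c s t * lf d s t"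
    and nz: "a \<noteq> 0" "b \<noteq> 0" "c \<noteq> 0" "d \<noteq> 0" and p: "incident p L"
  shows "intersection_mult f L p = of_bool (p = root_point a) + of_bool (p = root_point b)
    + of_bool (p = root_point c) + of_bool (p = root_point d)"
proof -
  obtain x y where xy: "rep_proj_plane p = x *s u + y *s v" "(x, y) \<noteq> (0, 0)"
    using rep_coords[OF p] by blast
  let ?W = "\<lambda>w. dot (rep_proj_plane L) w = 0 \<and> (\<forall>c. w \<noteq> c *s rep_proj_plane p)"
  define w where "w = (SOME w. ?W w)"
  have "crossp (x *s u + y *s v) (- y *s u + x *s v) \<noteq> 0 \<or> crossp (x *s u + y *s v) (1 *s u + 0 *s v) \<noteq> 0
      \<or> crossp (x *s u + y *s v) (0 *s u + 1 *s v) \<noteq> 0"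
    unfolding crossp_comb using indep xy(2) by (auto simp: vec3_eq_iff)
  then have "\<exists>w. ?W w"
    using crossp_eq_0_iff[OF rep_nonzero[of p]] on_line unfolding xy(1) by metis
  then have w: "?W w" unfolding w_def by (rule someI_ex)
  then obtain x' y' where w_eq: "w = x' *s u + y' *s v"
    using kernel_span[OF rep_nonzero u v indep] by blast
  have "crossp (x *s u + y *s v) (x' *s u + y' *s v) \<noteq> 0"
    using w crossp_eq_0_iff[OF rep_nonzero[of p], of w] unfolding xy(1) w_eq by blast
  then have det: "x * y' - x' * y \<noteq> 0" unfolding crossp_comb by auto
  let ?q = "\<lambda>a. [:lf a x y, lf a x' y':]"
  have q: "(lf a x y, lf a x' y') \<noteq> (0, 0)" if "a \<noteq> 0" for a
  proof
    assume "(lf a x y, lf a x' y') = (0, 0)"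
    then have 0: "lf a x y = 0" "lf a x' y' = 0" by auto
    have "fst a * (x * y' - x' * y) = lf a x y * y' - lf a x' y' * y"
      "snd a * (x * y' - x' * y) = lf a x' y' * x - lf a x y * x'"
      by (simp_all add: lf_def algebra_simps)
    then show False using 0 det that by (auto simp: prod_eq_iff)
  qed
  then have q0: "?q a \<noteq> 0" if "a \<noteq> 0" for a using that by auto
  have ord: "order 0 (?q a) = of_bool (p = root_point a)" if "a \<noteq> 0" for a
    using order_linear[OF q[OF that]] lf_eq_0_iff[OF that xy(1)] by simp
  have "quartic_on_line f (rep_proj_plane p) w = ?q a * ?q b * ?q c * ?q d"
  proof -
    have "poly (quartic_on_line f (rep_proj_plane p) w) z = poly (?q a * ?q b * ?q c * ?q d) z" for z
    proof -
      have e1: "rep_proj_plane p + z *s w = (x + z * x') *s u + (y + z * y') *s v"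
        unfolding xy(1) w_eq by (simp add: vec3_eq_iff algebra_simps)
      have e2: "lf e (x + z * x') (y + z * y') = lf e x y + z * lf e x' y'" for e
        by (simp add: lf_def algebra_simps)
      show ?thesis unfolding poly_quartic_on_line e1 F e2
        by (simp del: mult_pCons_left mult_pCons_right)
    qed
    then show ?thesis by (simp add: poly_eq_poly_eq_iff[symmetric] fun_eq_iff)
  qed
  then have "intersection_mult f L p = order 0 (?q a * ?q b * ?q c * ?q d)"
    unfolding intersection_mult_def Let_def w_def[symmetric] by simp
  also have "\<dots> = order 0 (?q a) + order 0 (?q b) + order 0 (?q c) + order 0 (?q d)"
    using q0 nz by (simp add: order_mult del: mult_pCons_left mult_pCons_right)
  finally show ?thesis using ord nz by simp
qed

lemma tangency_divisorI:
  assumes F: "\<And>s t. quartic_eval f (s *s u + t *s v) = (lf a s t * lf b s t)\<^sup>2"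
    and nz: "a \<noteq> 0" "b \<noteq> 0"
  shows "tangency_divisor f L {#root_point a, root_point b#}"
proof -
  have F': "quartic_eval f (s *s u + t *s v) = lf a s t * lf b s t * lf a s t * lf b s t" for s t
    unfolding F by (simp add: power2_eq_square)
  have "\<exists>x y. lf a x y \<noteq> 0 \<and> lf b x y \<noteq> 0"
  proof -
    have "\<exists>x. x \<noteq> 0 \<and> fst a + snd a * x \<noteq> 0 \<and> fst b + snd b * x \<noteq> 0"
    proof -
      have "finite {x. fst a + snd a * x = 0}" if "a \<noteq> 0" for a :: "complex \<times> complex"
        using poly_roots_finite[of "[:fst a, snd a:]"] that by (auto simp: prod_eq_iff mult.commute)
      then have "finite ({0} \<union> {x. fst a + snd a * x = 0} \<union> {x. fst b + snd b * x = 0})"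
        using nz by blast
      from ex_new_if_finite[OF infinite_UNIV_char_0 this] show ?thesis by blast
    qed
    then obtain x where "fst a + snd a * x \<noteq> 0" "fst b + snd b * x \<noteq> 0" by blast
    then show ?thesis by (intro exI[of _ 1] exI[of _ x]) (simp add: lf_def)
  qed
  then obtain x y where xy: "lf a x y \<noteq> 0" "lf b x y \<noteq> 0" by blast
  let ?w = "x *s u + y *s v"
  have w0: "?w \<noteq> 0" using xy by (auto simp: comb_eq_0 lf_def)
  obtain k where k: "k \<noteq> 0" "rep_proj_plane (abs_proj_plane ?w) = k *s ?w" using rep_abs[OF w0] by blast
  have "rep_proj_plane (abs_proj_plane ?w) = (k * x) *s u + (k * y) *s v"
    unfolding k(2) by (simp add: vector_add_ldistrib vector_smult_assoc)
  moreover have "lf a (k * x) (k * y) = k * lf a x y" for a by (simp add: lf_def algebra_simps)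
  ultimately have "\<not> on_quartic f (abs_proj_plane ?w)"
    unfolding on_quartic_def using F k xy by simp
  moreover have "incident (abs_proj_plane ?w) L" using incident_abs[OF w0] on_line by simp
  moreover have "intersection_mult f L p = 2 * count {#root_point a, root_point b#} p" if "incident p L" for p
    using intersection_mult_eq[OF F' nz nz that] by auto
  ultimately show ?thesis
    unfolding tangency_divisor_def using incident_root_point nz by auto
qed

lemma tangency_divisor_unique:
  "tangency_divisor f L Z \<Longrightarrow> tangency_divisor f L Z' \<Longrightarrow> Z = Z'"
proof (rule multiset_eqI)
  fix p assume Z: "tangency_divisor f L Z" "tangency_divisor f L Z'"
  show "count Z p = count Z' p"
  proof (cases "incident p L")
    case True then show ?thesis using Z unfolding tangency_divisor_def by fastforce
  next
    case False
    then have "p \<notin># Z" "p \<notin># Z'" using Z unfolding tangency_divisor_def by blast+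
    then show ?thesis by (simp add: not_in_iff)
  qed
qed

lemma root_point_eq_iff:
  assumes "a \<noteq> 0" "b \<noteq> 0"
  shows "root_point a = root_point b \<longleftrightarrow> fst a * snd b = fst b * snd a"
proof -
  obtain c where c: "c \<noteq> 0" "rep_proj_plane (root_point a) = (c * snd a) *s u + (- c * fst a) *s v"
    using root_point_rep[OF assms(1)] by blast
  have "root_point a = root_point b \<longleftrightarrow> lf b (c * snd a) (- c * fst a) = 0"
    using lf_eq_0_iff[OF assms(2) c(2)] by simp
  also have "\<dots> \<longleftrightarrow> c * (fst b * snd a - snd b * fst a) = 0" by (simp add: lf_def algebra_simps)
  finally show ?thesis using c(1) by (auto simp: algebra_simps)
qed

lemma root_point_eqD:
  assumes "a \<noteq> 0" "b \<noteq> 0" "root_point a = root_point b"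
  shows "\<exists>k. \<forall>s t. lf b s t = k * lf a s t"
proof -
  have e: "fst a * snd b = fst b * snd a" using assms root_point_eq_iff by blast
  show ?thesis
  proof (cases "fst a = 0")
    case True
    then have "snd a \<noteq> 0" using assms(1) by (auto simp: prod_eq_iff)
    then show ?thesis using e True by (intro exI[of _ "snd b / snd a"]) (auto simp: lf_def)
  next
    case False
    then have "snd b = fst b / fst a * snd a" using e by (simp add: field_simps)
    then show ?thesis using False by (intro exI[of _ "fst b / fst a"]) (auto simp: lf_def algebra_simps)
  qed
qed

lemma binary_quartic:
  fixes f :: "complex quartic"
  shows "\<exists>c0 c1 c2 c3 c4. \<forall>s t. quartic_eval f (s *s u + t *s v) =
    c0 * t^4 + c1 * s * t^3 + c2 * s^2 * t^2 + c3 * s^3 * t + c4 * s^4"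
proof -
  have "subring (UNIV :: complex set)" by (simp add: subring_def)
  then obtain g where g: "\<And>x y z. quartic_eval f (x *s u + y *s v + z *s 0) = tern g x y z"
    using quartic_linear_subst[of UNIV f u v 0] by auto
  have "quartic_eval f (s *s u + t *s v) = g (0,4,0) * t^4 + g (1,3,0) * s * t^3 + g (2,2,0) * s^2 * t^2
      + g (3,1,0) * s^3 * t + g (4,0,0) * s^4" for s t
    using g[of s t 0] by (simp add: tern_expand)
  then show ?thesis by blast
qed

text \<open>If all points of the intersection divisor have even multiplicity, then its four linear
  factors can be grouped into proportional pairs.\<close>

lemma bitangent_iff:
  "bitangent f L \<longleftrightarrow> (\<exists>\<alpha> \<beta> \<gamma>. (\<alpha>, \<beta>, \<gamma>) \<noteq> (0, 0, 0) \<and>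
     (\<forall>s t. quartic_eval f (s *s u + t *s v) = (\<alpha> * s\<^sup>2 + \<beta> * s * t + \<gamma> * t\<^sup>2)\<^sup>2))"
proof
  assume "\<exists>\<alpha> \<beta> \<gamma>. (\<alpha>, \<beta>, \<gamma>) \<noteq> (0, 0, 0) \<and>
     (\<forall>s t. quartic_eval f (s *s u + t *s v) = (\<alpha> * s\<^sup>2 + \<beta> * s * t + \<gamma> * t\<^sup>2)\<^sup>2)"
  then obtain a b where "a \<noteq> 0" "b \<noteq> 0" "\<And>s t. quartic_eval f (s *s u + t *s v) = (lf a s t * lf b s t)\<^sup>2"
    using binary_quadratic_factor by metis
  then show "bitangent f L" unfolding bitangent_def using tangency_divisorI by blast
next
  assume "bitangent f L"
  then obtain Z where Z: "tangency_divisor f L Z" unfolding bitangent_def by blast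
  then obtain p where p: "incident p L" "\<not> on_quartic f p" unfolding tangency_divisor_def by blast
  obtain x y where xy: "rep_proj_plane p = x *s u + y *s v" using rep_coords[OF p(1)] by blast
  obtain c0 c1 c2 c3 c4 where c: "\<And>s t. quartic_eval f (s *s u + t *s v) =
      c0 * t^4 + c1 * s * t^3 + c2 * s^2 * t^2 + c3 * s^3 * t + c4 * s^4"
    using binary_quartic[of f] by blast
  have nz0: "quartic_eval f (x *s u + y *s v) \<noteq> 0" using p(2) xy by (simp add: on_quartic_def)
  have "(c0, c1, c2, c3, c4) \<noteq> (0, 0, 0, 0, 0)"
    using nz0 unfolding c by auto
  then obtain a b c d where nz: "a \<noteq> 0" "b \<noteq> 0" "c \<noteq> 0" "d \<noteq> 0"
    and F: "\<And>s t. quartic_eval f (s *s u + t *s v) = lf a s t * lf b s t * lf c s t * lf d s t"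
    using binary_quartic_factor c by metis
  have even: "even (of_bool (p = root_point a) + of_bool (p = root_point b)
      + of_bool (p = root_point c) + of_bool (p = root_point d) :: nat)" if "incident p L" for p
    using intersection_mult_eq[OF F nz that] Z that unfolding tangency_divisor_def
    by (metis dvd_triv_left)
  have pairs: "(root_point a = root_point b \<and> root_point c = root_point d) \<or>
      (root_point a = root_point c \<and> root_point b = root_point d) \<or>
      (root_point a = root_point d \<and> root_point b = root_point c)"
    using even[OF incident_root_point[OF nz(1)]] even[OF incident_root_point[OF nz(2)]]
      even[OF incident_root_point[OF nz(3)]] even[OF incident_root_point[OF nz(4)]]
    by (auto simp: of_bool_def split: if_splits)
  have sq: "\<exists>k. \<forall>s t. lf a s t * lf b s t * (lf c s t * lf d s t) = (k * (lf a s t * lf c s t))\<^sup>2"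
    if h: "a \<noteq> 0" "b \<noteq> 0" "c \<noteq> 0" "d \<noteq> 0" "root_point a = root_point b" "root_point c = root_point d" for a b c d
  proof -
    obtain k where "\<forall>s t. lf b s t = k * lf a s t" using root_point_eqD h(1,2,5) by blast
    moreover obtain k' where "\<forall>s t. lf d s t = k' * lf c s t" using root_point_eqD h(3,4,6) by blast
    ultimately show ?thesis
      by (intro exI[of _ "csqrt (k * k')"]) (simp add: power_mult_distrib, simp add: power2_eq_square)
  qed
  have "\<exists>k a' c'. \<forall>s t. quartic_eval f (s *s u + t *s v) = (k * (lf a' s t * lf c' s t))\<^sup>2"
    using pairs
  proof (elim disjE conjE)
    assume "root_point a = root_point b" "root_point c = root_point d"
    from sq[OF nz this] obtain k where k: "\<forall>s t. lf a s t * lf b s t * (lf c s t * lf d s t) = (k * (lf a s t * lf c s t))\<^sup>2"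
      by blast
    show ?thesis
    proof (intro exI allI)
      show "quartic_eval f (s *s u + t *s v) = (k * (lf a s t * lf c s t))\<^sup>2" for s t
        using k[rule_format, of s t] unfolding F by (simp only: mult_ac)
    qed
  next
    assume "root_point a = root_point c" "root_point b = root_point d"
    from sq[OF nz(1,3,2,4) this] obtain k where k: "\<forall>s t. lf a s t * lf c s t * (lf b s t * lf d s t) = (k * (lf a s t * lf b s t))\<^sup>2"
      by blast
    show ?thesis
    proof (intro exI allI)
      show "quartic_eval f (s *s u + t *s v) = (k * (lf a s t * lf b s t))\<^sup>2" for s t
        using k[rule_format, of s t] unfolding F by (simp only: mult_ac)
    qed
  next
    assume "root_point a = root_point d" "root_point b = root_point c"
    from sq[OF nz(1,4,2,3) this] obtain k where k: "\<forall>s t. lf a s t * lf d s t * (lf b s t * lf c s t) = (k * (lf a s t * lf b s t))\<^sup>2"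
      by blast
    show ?thesis
    proof (intro exI allI)
      show "quartic_eval f (s *s u + t *s v) = (k * (lf a s t * lf b s t))\<^sup>2" for s t
        using k[rule_format, of s t] unfolding F by (simp only: mult_ac)
    qed
  qed
  then obtain k a' c' where k: "\<And>s t. quartic_eval f (s *s u + t *s v) = (k * (lf a' s t * lf c' s t))\<^sup>2"
    by blast
  let ?\<alpha> = "k * (fst a' * fst c')" and ?\<beta> = "k * (fst a' * snd c' + snd a' * fst c')" and ?\<gamma> = "k * (snd a' * snd c')"
  have eq: "k * (lf a' s t * lf c' s t) = ?\<alpha> * s\<^sup>2 + ?\<beta> * s * t + ?\<gamma> * t\<^sup>2" for s t
    by (simp add: lf_def power2_eq_square algebra_simps)
  have "(?\<alpha>, ?\<beta>, ?\<gamma>) \<noteq> (0, 0, 0)"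
  proof
    assume "(?\<alpha>, ?\<beta>, ?\<gamma>) = (0, 0, 0)"
    then have 0: "?\<alpha> = 0" "?\<beta> = 0" "?\<gamma> = 0" by (simp_all only: prod.inject)
    have "k * (lf a' x y * lf c' x y) = 0" unfolding eq 0 by simp
    then show False using nz0 unfolding k by simp
  qed
  then show "\<exists>\<alpha> \<beta> \<gamma>. (\<alpha>, \<beta>, \<gamma>) \<noteq> (0, 0, 0) \<and>
     (\<forall>s t. quartic_eval f (s *s u + t *s v) = (\<alpha> * s\<^sup>2 + \<beta> * s * t + \<gamma> * t\<^sup>2)\<^sup>2)"
    using k unfolding eq by blast
qed

end

subsection \<open>Derivatives at tangency points\<close>

lemma has_derivative_dot: "((\<lambda>w. dot p (w :: complex ^ 3)) has_derivative (\<lambda>w. dot p w)) (at x)"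
  unfolding dot_3
  by (intro bounded_linear_imp_has_derivative bounded_linear_add
      bounded_linear_compose[OF bounded_linear_mult_right bounded_linear_vec_nth])

lemma dot_differentiable [simp]: "(\<lambda>w. dot p (w :: complex ^ 3)) differentiable (at x)"
  using has_derivative_dot differentiable_def by blast

text \<open>Only the middle term is of first order, because \<open>\<phi>\<close> and \<open>\<psi>\<close> vanish at \<open>p\<close>.\<close>

lemma has_derivative_near_double_zero:
  fixes \<phi> \<psi> \<kappa> \<rho> :: "'a::real_normed_vector \<Rightarrow> complex"
  assumes "\<phi> differentiable (at p)" "\<kappa> differentiable (at p)" "\<rho> differentiable (at p)"
    and \<psi>: "(\<psi> has_derivative \<psi>') (at p)" and 0: "\<phi> p = 0" "\<psi> p = 0"
  shows "((\<lambda>w. (\<phi> w)\<^sup>2 + \<psi> w * \<kappa> w + (\<psi> w)\<^sup>2 * \<rho> w) has_derivative (\<lambda>w. \<kappa> p * \<psi>' w)) (at p)"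
proof -
  obtain \<phi>' \<kappa>' \<rho>' where d: "(\<phi> has_derivative \<phi>') (at p)" "(\<kappa> has_derivative \<kappa>') (at p)"
    "(\<rho> has_derivative \<rho>') (at p)" using assms(1-3) unfolding differentiable_def by blast
  show ?thesis
    unfolding power2_eq_square
    by (rule derivative_eq_intros d \<psi> refl)+ (simp add: 0 mult.commute)
qed

text \<open>A quartic in the coordinates \<open>x, y, z\<close> of a frame \<open>u, n, v\<close>, where \<open>u\<close> and \<open>v\<close> span the line
  \<open>l = 0\<close>: the normal derivative along the line is the cubic in the coefficients of \<open>y\<close>.\<close>

definition normal_cubic :: "'a::comm_ring_1 quartic \<Rightarrow> 'a \<Rightarrow> 'a \<Rightarrow> 'a" where
  "normal_cubic g x z = g (3,1,0) * x^3 + g (2,1,1) * x^2 * z + g (1,1,2) * x * z^2 + g (0,1,3) * z^3"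

text \<open>The line \<open>l = 0\<close> is spanned by \<open>u\<close> and \<open>v\<close>, the vector \<open>n\<close> points away from it, and the quartic
  restricts to the square of the product of the linear forms \<open>a\<close> and \<open>b\<close>, whose zeros are the
  points of tangency.\<close>

locale line_frame =
  fixes F g :: "complex quartic" and l u n v :: "complex ^ 3" and a b :: "complex \<times> complex"
  assumes lu: "dot l u = 0" and lv: "dot l v = 0" and ln: "dot l n \<noteq> 0"
    and uv: "crossp u v \<noteq> 0"
    and smooth: "smooth_quartic F"
    and g: "\<And>x y z. quartic_eval F (x *s u + y *s n + z *s v) = tern g x y z"
    and sq: "\<And>s t. quartic_eval F (s *s u + t *s v) = (lf a s t * lf b s t)\<^sup>2"
    and ab: "a \<noteq> 0" "b \<noteq> 0"
begin

lemma l_nz: "l \<noteq> 0" using ln by auto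

lemma det_frame: "dot (crossp u v) n \<noteq> 0"
proof -
  obtain c where "crossp u v = c *s l" using crossp_parallel[OF l_nz lu lv] by blast
  then show ?thesis using uv ln by (auto simp: dot_linear)
qed

lemma coords: "\<exists>p q. \<forall>w. w = dot p w *s u + (dot l w / dot l n) *s n + dot q w *s v"
proof -
  let ?\<Delta> = "dot (crossp u v) n"
  obtain c where c: "crossp u v = c *s l" using crossp_parallel[OF l_nz lu lv] by blast
  then have "c \<noteq> 0" using uv by auto
  then have y: "dot (crossp u v) w / ?\<Delta> = dot l w / dot l n" for w
    unfolding c by (simp add: dot_linear)
  have "w = dot (inverse ?\<Delta> *s crossp v n) w *s u + (dot l w / dot l n) *s n
      + dot (inverse ?\<Delta> *s crossp n u) w *s v" for w
    using frame_expand[OF det_frame, of w] unfolding y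
    by (simp add: dot_linear divide_inverse mult.commute add_ac)
  then show ?thesis by blast
qed

text \<open>In the frame the quartic is \<open>(a b)\<^sup>2 + y C + y\<^sup>2 D\<close> with the normal cubic \<open>C\<close>, and both \<open>a b\<close> and \<open>y\<close>
  vanish at a point of tangency.\<close>

lemma derivative:
  assumes 0: "lf a x z * lf b x z = 0"
  shows "(quartic_eval F has_derivative (\<lambda>w. normal_cubic g x z * (dot l w / dot l n))) (at (x *s u + z *s v))"
proof -
  let ?p = "x *s u + z *s v"
  obtain p q where pq: "\<And>w. w = dot p w *s u + (dot l w / dot l n) *s n + dot q w *s v"
    using coords by blast
  define X Y Z where "X w = dot p w" and "Y w = dot l w / dot l n" and "Z w = dot q w" for w
  have "dot l ?p = 0" using lu lv by (simp add: dot_linear)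
  then have Y0: "Y ?p = 0" by (simp add: Y_def)
  have XZ: "X ?p = x" "Z ?p = z"
  proof -
    have "?p = X ?p *s u + Z ?p *s v" using pq[of ?p] Y0 unfolding X_def Y_def Z_def by simp
    then have e: "(X ?p - x) *s u + (Z ?p - z) *s v = 0" by (simp add: algebra_simps vector_sub_rdistrib)
    have "crossp ((X ?p - x) *s u + (Z ?p - z) *s v) v = (X ?p - x) *s crossp u v"
      "crossp u ((X ?p - x) *s u + (Z ?p - z) *s v) = (Z ?p - z) *s crossp u v"
      by (simp_all add: vec3_eq_iff algebra_simps)
    moreover have "crossp 0 v = 0" "crossp u 0 = 0" by (simp_all add: vec3_eq_iff)
    ultimately have "(X ?p - x) *s crossp u v = 0" "(Z ?p - z) *s crossp u v = 0" unfolding e by auto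
    then show "X ?p = x" "Z ?p = z" using uv unfolding vector_mul_eq_0 by auto
  qed
  define D where "D w = g (2,2,0) * X w^2 + g (1,2,1) * X w * Z w + g (0,2,2) * Z w^2
      + Y w * (g (1,3,0) * X w + g (0,3,1) * Z w) + Y w^2 * g (0,4,0)" for w
  have F_eq: "quartic_eval F = (\<lambda>w. (lf a (X w) (Z w) * lf b (X w) (Z w))\<^sup>2 + Y w * normal_cubic g (X w) (Z w)
      + (Y w)\<^sup>2 * D w)"
  proof
    fix w
    have "quartic_eval F w = tern g (X w) (Y w) (Z w)"
      using g[of "X w" "Y w" "Z w"] pq[of w] unfolding X_def Y_def Z_def by simp
    moreover have "tern g (X w) 0 (Z w) = (lf a (X w) (Z w) * lf b (X w) (Z w))\<^sup>2"
      using g[of "X w" 0 "Z w"] sq by simp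
    moreover have "tern g (X w) (Y w) (Z w) =
        tern g (X w) 0 (Z w) + Y w * normal_cubic g (X w) (Z w) + (Y w)\<^sup>2 * D w"
      unfolding tern_expand normal_cubic_def D_def
      by (simp add: algebra_simps power2_eq_square power3_eq_cube power4_eq_xxxx)
    ultimately show "quartic_eval F w = (lf a (X w) (Z w) * lf b (X w) (Z w))\<^sup>2 + Y w * normal_cubic g (X w) (Z w)
      + (Y w)\<^sup>2 * D w" by simp
  qed
  have dX: "X differentiable (at w)" "Z differentiable (at w)" for w
    unfolding X_def Z_def by simp_all
  have dY: "(Y has_derivative (\<lambda>w. dot l w / dot l n)) (at w)" for w
    unfolding Y_def using ln by (auto intro!: derivative_eq_intros has_derivative_dot)
  then have dY': "Y differentiable (at w)" for w using differentiable_def by blast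
  have "((\<lambda>w. (lf a (X w) (Z w) * lf b (X w) (Z w))\<^sup>2 + Y w * normal_cubic g (X w) (Z w)
      + (Y w)\<^sup>2 * D w) has_derivative (\<lambda>w. normal_cubic g (X ?p) (Z ?p) * (dot l w / dot l n))) (at ?p)"
  proof (rule has_derivative_near_double_zero[OF _ _ _ dY])
    show "(\<lambda>w. lf a (X w) (Z w) * lf b (X w) (Z w)) differentiable (at ?p)"
      unfolding lf_def using dX by (intro derivative_intros) auto
    show "(\<lambda>w. normal_cubic g (X w) (Z w)) differentiable (at ?p)"
      unfolding normal_cubic_def using dX by (intro derivative_intros) auto
    show "D differentiable (at ?p)"
      unfolding D_def using dX dY' by (intro derivative_intros) auto
  qed (use 0 XZ Y0 in auto)
  then show ?thesis unfolding F_eq XZ .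
qed

text \<open>The derivative at a point of tangency is the value of the normal cubic times a linear form, so
  this value vanishes only at a singular point.\<close>

lemma normal_cubic_nz:
  assumes 0: "lf a x z * lf b x z = 0" and "(x, z) \<noteq> (0, 0)"
  shows "normal_cubic g x z \<noteq> 0"
proof
  let ?p = "x *s u + z *s v"
  assume z: "normal_cubic g x z = 0"
  have "crossp ?p v = x *s crossp u v" "crossp u ?p = z *s crossp u v"
    by (simp_all add: vec3_eq_iff algebra_simps)
  moreover have "crossp 0 v = 0" "crossp u 0 = 0" by (simp_all add: vec3_eq_iff)
  ultimately have p0: "?p \<noteq> 0" using uv assms(2) vector_mul_eq_0[of _ "crossp u v"] by (metis (full_types))
  have F0: "quartic_eval F ?p = 0" using sq[of x z] 0 by simp
  obtain w where w: "frechet_derivative (quartic_eval F) (at ?p) w \<noteq> 0"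
    using smooth p0 F0 unfolding smooth_quartic_def by blast
  have "frechet_derivative (quartic_eval F) (at ?p) = (\<lambda>w. normal_cubic g x z * (dot l w / dot l n))"
    using frechet_derivative_at[OF derivative[OF 0]] by simp
  then show False using w z by simp
qed

lemma partial_line_eq:
  assumes 0: "lf a x z * lf b x z = 0" and p: "rep_proj_plane \<pi> = x *s u + z *s v"
    and linf: "dot linf (x *s u + z *s v) \<noteq> 0"
  shows "partial_line F linf l \<pi> = normal_cubic g x z / (dot l n * dot linf (x *s u + z *s v) ^ 3)"
proof -
  let ?p = "x *s u + z *s v" and ?C = "normal_cubic g x z"
  have F0: "quartic_eval F ?p = 0" using sq[of x z] 0 by simp
  have l0: "dot l ?p = 0" using lu lv by (simp add: dot_linear)
  have d1: "((\<lambda>v. quartic_eval F v / dot linf v ^ 4) has_derivative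
      (\<lambda>w. ?C * (dot l w / dot l n) / dot linf ?p ^ 4)) (at ?p)"
    by (rule derivative_eq_intros derivative[OF 0] has_derivative_dot refl)+
       (use linf F0 in \<open>auto simp: field_simps\<close>)
  have d2: "((\<lambda>v. dot l v / dot linf v) has_derivative (\<lambda>w. dot l w / dot linf ?p)) (at ?p)"
    by (rule derivative_eq_intros has_derivative_dot refl)+
       (use linf l0 in \<open>auto simp: field_simps\<close>)
  have "partial_line F linf l \<pi> = (THE c. \<forall>w. ?C * (dot l w / dot l n) / dot linf ?p ^ 4 =
      c * (dot l w / dot linf ?p))"
    unfolding partial_line_def p frechet_derivative_at[OF d1, symmetric] frechet_derivative_at[OF d2, symmetric] ..
  also have "\<dots> = ?C / (dot l n * dot linf ?p ^ 3)"
  proof (rule the_equality)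
    show "\<forall>w. ?C * (dot l w / dot l n) / dot linf ?p ^ 4 = ?C / (dot l n * dot linf ?p ^ 3) * (dot l w / dot linf ?p)"
      using linf ln by (simp add: field_simps eval_nat_numeral)
    fix c assume "\<forall>w. ?C * (dot l w / dot l n) / dot linf ?p ^ 4 = c * (dot l w / dot linf ?p)"
    then have "?C * (dot l n / dot l n) / dot linf ?p ^ 4 = c * (dot l n / dot linf ?p)" by blast
    then show "c = ?C / (dot l n * dot linf ?p ^ 3)"
      using linf ln by (simp add: field_simps eval_nat_numeral)
  qed
  finally show ?thesis .
qed

end

subsection \<open>Types of bitangents\<close>

lemma base_change_id [simp]: "base_change id L = L"
proof -
  have "map_coords id v = v" for v :: "'a ^ 3" by (simp add: vec3_eq_iff)
  then show ?thesis by (simp add: base_change_def)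
qed

lemma incident_base_change:
  "incident z (base_change complex_of_real L) \<longleftrightarrow> dot (map_coords of_real (rep_proj_plane L)) (rep_proj_plane z) = 0"
proof -
  obtain c where "c \<noteq> 0" "rep_proj_plane (base_change complex_of_real L) = c *s map_coords of_real (rep_proj_plane L)"
    using rep_abs[of "map_coords complex_of_real (rep_proj_plane L)"] unfolding base_change_def by auto
  then show ?thesis unfolding incident_def by (simp add: dot_linear)
qed

lemma Qtype_complex:
  assumes smooth: "smooth_quartic (cquartic f)" and bit: "bitangent (cquartic f) L"
  shows "Qtype id f Linf L = \<langle>1\<rangle>"
proof -
  let ?F = "cquartic f" and ?l = "rep_proj_plane L" and ?linf = "map_coords complex_of_real (rep_proj_plane Linf)"
  obtain u v where uv: "crossp u v = ?l" using exists_kernel_basis[OF rep_nonzero] by blast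
  interpret line_basis L u v by unfold_locales (insert dot_crossp[of u v] uv, simp_all)
  obtain n where n: "dot ?l n = 1" using exists_dot_neq_0[OF rep_nonzero] by blast
  obtain a b where ab: "a \<noteq> 0" "b \<noteq> 0"
    and sq: "\<And>s t. quartic_eval ?F (s *s u + t *s v) = (lf a s t * lf b s t)\<^sup>2"
    using bit unfolding bitangent_iff using binary_quadratic_factor by metis
  have "subring (UNIV :: complex set)" by (simp add: subring_def)
  then obtain g where g: "\<And>x y z. quartic_eval ?F (x *s u + y *s n + z *s v) = tern g x y z"
    using quartic_linear_subst[of UNIV ?F u n v] by auto
  interpret line_frame ?F g ?l u n v a b
    by unfold_locales (use u v n indep smooth g sq ab in auto)
  let ?Z = "{#root_point a, root_point b#}"
  have Z: "(THE Z. tangency_divisor ?F L Z) = ?Z"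
    using tangency_divisorI[OF sq ab] tangency_divisor_unique by (intro the_equality)
  show ?thesis
  proof (cases "\<exists>z\<in>#?Z. incident z (base_change of_real Linf)")
    case True
    then show ?thesis unfolding Qtype_def Let_def base_change_id Z by (simp only: if_True)
  next
    case False
    have map_id: "map_coords id ?l = ?l" by (simp add: vec3_eq_iff)
    have nz: "partial_line ?F ?linf ?l (root_point e) \<noteq> 0" if e: "e = a \<or> e = b" for e
    proof -
      have "e \<noteq> 0" using ab that by auto
      then obtain c where c: "c \<noteq> 0" "rep_proj_plane (root_point e) = (c * snd e) *s u + (- c * fst e) *s v"
        using root_point_rep by blast
      have "dot ?linf (rep_proj_plane (root_point e)) \<noteq> 0"
        using False that unfolding incident_base_change by auto
      then have linf: "dot ?linf ((c * snd e) *s u + (- c * fst e) *s v) \<noteq> 0" unfolding c(2) .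
      have 0: "lf a (c * snd e) (- c * fst e) * lf b (c * snd e) (- c * fst e) = 0"
        using that by (auto simp: lf_def algebra_simps)
      have "(c * snd e, - c * fst e) \<noteq> (0, 0)" using c(1) \<open>e \<noteq> 0\<close> by (auto simp: prod_eq_iff)
      from normal_cubic_nz[OF 0 this] show ?thesis
        unfolding partial_line_eq[OF 0 c(2) linf] using linf ln by simp
    qed
    then have "(\<Prod>z\<in>#?Z. partial_line ?F ?linf ?l z) \<noteq> 0" by simp
    from rank_one_complex[OF this]
    have "\<langle>THE a. id a = (\<Prod>z\<in>#?Z. partial_line ?F ?linf ?l z)\<rangle> = \<langle>1\<rangle>" by (simp only: id_apply the_eq_trivial)
    moreover have "Qtype id f Linf L = \<langle>THE a. id a = (\<Prod>z\<in>#?Z. partial_line ?F ?linf ?l z)\<rangle>"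
      using False unfolding Qtype_def Let_def base_change_id Z map_id by (simp only: if_False)
    ultimately show ?thesis by (simp only:)
  qed
qed

lemma Qtype_at_infinity:
  assumes "bitangent (cquartic f) (base_change of_real Linf)"
  shows "Qtype of_real f Linf Linf = \<langle>1\<rangle>"
proof -
  let ?L = "base_change complex_of_real Linf"
  obtain Z where Z: "tangency_divisor (cquartic f) ?L Z" using assms unfolding bitangent_def by blast
  obtain u v where uv: "crossp u v = rep_proj_plane ?L" using exists_kernel_basis[OF rep_nonzero] by blast
  interpret line_basis ?L u v by unfold_locales (insert dot_crossp[of u v] uv, simp_all)
  have the: "(THE Z. tangency_divisor (cquartic f) ?L Z) = Z"
    using Z tangency_divisor_unique by (intro the_equality)
  have "size Z = 2" "\<forall>p\<in>#Z. incident p ?L" using Z unfolding tangency_divisor_def by auto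
  then have "\<exists>z\<in>#Z. incident z ?L" by (metis size_eq_0_iff_empty zero_neq_numeral multiset_nonemptyE)
  then show ?thesis unfolding Qtype_def Let_def the by (simp only: if_True)
qed

lemma real_symmetric_pair:
  assumes "s1 + s2 \<in> \<real>" "s1 * s2 \<in> \<real>"
  shows "(s1 \<in> \<real> \<and> s2 \<in> \<real>) \<or> s2 = cnj s1"
proof -
  have 1: "Im s2 = - Im s1" using assms(1) by (simp add: complex_is_Real_iff)
  then have "Im s1 * (Re s2 - Re s1) = 0" using assms(2) by (simp add: complex_is_Real_iff algebra_simps)
  then show ?thesis using 1 by (auto simp: complex_is_Real_iff complex_eq_iff)
qed

text \<open>The derivatives that define the type are the values of the normal cubic at the representatives
  \<open>s u + v\<close> of the points of tangency, divided by a real number that is the same for both points.  So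
  the products agree up to a square.\<close>

lemma Qtype_real:
  fixes f g :: "real quartic" and L :: "real proj_plane" and u n v :: "real ^ 3"
  assumes smooth: "smooth_quartic (cquartic f)"
    and l: "dot (rep_proj_plane L) u = 0" "dot (rep_proj_plane L) v = 0" "dot (rep_proj_plane L) n \<noteq> 0"
    and uv: "crossp u v \<noteq> 0"
    and linf: "dot (rep_proj_plane Linf) u = 0" "dot (rep_proj_plane Linf) v \<noteq> 0"
    and g: "\<And>x y z. quartic_eval (cquartic f) (x *s map_coords of_real u + y *s map_coords of_real n
       + z *s map_coords of_real v) = tern (cquartic g) x y z"
    and sq: "\<And>s t. tern (cquartic g) s 0 t = (\<alpha> * (s - s1 * t) * (s - s2 * t))\<^sup>2" and "\<alpha> \<noteq> 0"
    and sym: "s1 + s2 \<in> \<real>" "s1 * s2 \<in> \<real>"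
  defines "R \<equiv> normal_cubic (cquartic g) s1 1 * normal_cubic (cquartic g) s2 1"
  shows "bitangent (cquartic f) (base_change of_real L)" "R \<in> \<real>" "Re R \<noteq> 0"
    "Qtype of_real f Linf L = (if Re R > 0 then \<langle>1\<rangle> else \<langle>- 1\<rangle>)"
proof -
  let ?F = "cquartic f" and ?L = "base_change complex_of_real L"
  let ?c = "map_coords complex_of_real"
  let ?l = "?c (rep_proj_plane L)" and ?linf = "?c (rep_proj_plane Linf)"
  define a b where "a = (\<alpha>, - \<alpha> * s1)" and "b = (1 :: complex, - s2)"
  have ab: "a \<noteq> 0" "b \<noteq> 0" using \<open>\<alpha> \<noteq> 0\<close> by (auto simp: a_def b_def prod_eq_iff)
  obtain k where k: "k \<noteq> 0" "rep_proj_plane ?L = k *s ?l"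
    using rep_abs[of ?l] unfolding base_change_def by auto
  have indep: "crossp (?c u) (?c v) \<noteq> 0" using uv by (simp add: map_of_real_crossp)
  have lu: "dot ?l (?c u) = 0" "dot ?l (?c v) = 0" "dot ?l (?c n) \<noteq> 0"
    using l by (simp_all add: map_of_real_dot)
  interpret line_basis ?L "?c u" "?c v"
    by unfold_locales (use k lu indep in \<open>auto simp: dot_linear\<close>)
  have sq': "quartic_eval ?F (s *s ?c u + t *s ?c v) = (lf a s t * lf b s t)\<^sup>2" for s t
    using g[of s 0 t] sq[of s t] by (simp add: lf_def a_def b_def algebra_simps)
  interpret line_frame ?F "cquartic g" ?l "?c u" "?c n" "?c v" a b
    by unfold_locales (use lu indep smooth g sq' ab in auto)
  let ?Z = "{#root_point a, root_point b#}"
  have div: "tangency_divisor ?F ?L ?Z" using tangency_divisorI[OF sq' ab] .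
  then show "bitangent ?F ?L" unfolding bitangent_def by blast
  have Z: "(THE Z. tangency_divisor ?F ?L Z) = ?Z"
    using div tangency_divisor_unique by (intro the_equality)
  have rep: "\<exists>c. c \<noteq> 0 \<and> rep_proj_plane (root_point e) = (c * s) *s ?c u + c *s ?c v"
    if e: "(e, s) = (a, s1) \<or> (e, s) = (b, s2)" for e s
  proof -
    have "e \<noteq> 0" using that ab by auto
    then obtain c where c: "c \<noteq> 0" "rep_proj_plane (root_point e) = (c * snd e) *s ?c u + (- c * fst e) *s ?c v"
      using root_point_rep by blast
    then show ?thesis using that \<open>\<alpha> \<noteq> 0\<close>
      by (intro exI[of _ "- c * fst e"]) (auto simp: a_def b_def)
  qed
  have linf': "dot ?linf (x *s ?c u + z *s ?c v) = z * of_real (dot (rep_proj_plane Linf) v)" for x z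
    using linf(1) by (simp add: dot_linear map_of_real_dot)
  let ?m = "dot (rep_proj_plane L) n * dot (rep_proj_plane Linf) v ^ 3"
  have zero: "lf a (c * s) c * lf b (c * s) c = 0" if "s = s1 \<or> s = s2" for c s
    using that by (auto simp: a_def b_def lf_def algebra_simps)
  have part: "partial_line ?F ?linf ?l (root_point e) = normal_cubic (cquartic g) s 1 / of_real ?m"
    if e: "(e, s) = (a, s1) \<or> (e, s) = (b, s2)" for e s
  proof -
    obtain c where c: "c \<noteq> 0" "rep_proj_plane (root_point e) = (c * s) *s ?c u + c *s ?c v" using rep[OF e] by blast
    have nz: "dot ?linf ((c * s) *s ?c u + c *s ?c v) \<noteq> 0" unfolding linf' using c(1) linf(2) by simp
    have "s = s1 \<or> s = s2" using e by auto
    from partial_line_eq[OF zero[OF this] c(2) nz]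
    have "partial_line ?F ?linf ?l (root_point e) = normal_cubic (cquartic g) (c * s) c /
        (of_real (dot (rep_proj_plane L) n) * (c * of_real (dot (rep_proj_plane Linf) v)) ^ 3)"
      unfolding linf' map_of_real_dot .
    also have "normal_cubic (cquartic g) (c * s) c = c ^ 3 * normal_cubic (cquartic g) s 1"
      unfolding normal_cubic_def by (simp add: power_mult_distrib power2_eq_square power3_eq_cube algebra_simps)
    finally show ?thesis using c(1) by (simp add: power_mult_distrib)
  qed
  have inc: "\<not> incident (root_point e) (base_change of_real Linf)" if e: "e = a \<or> e = b" for e
  proof -
    obtain c s where "c \<noteq> 0" "rep_proj_plane (root_point e) = (c * s) *s ?c u + c *s ?c v" using rep e by metis
    then show ?thesis unfolding incident_base_change using linf' linf(2) by simp
  qed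
  have R_cubic: "normal_cubic (cquartic g) s1 1 \<noteq> 0" "normal_cubic (cquartic g) s2 1 \<noteq> 0"
    using normal_cubic_nz[OF zero[of s1 1]] normal_cubic_nz[OF zero[of s2 1]] by auto
  then have R0: "R \<noteq> 0" by (simp add: R_def)
  have C_real: "normal_cubic (cquartic g) (cnj s) 1 = cnj (normal_cubic (cquartic g) s 1)" for s
    by (simp add: normal_cubic_def cquartic_def)
  show R: "R \<in> \<real>"
    using real_symmetric_pair[OF sym]
  proof (elim disjE conjE)
    assume "s1 \<in> \<real>" "s2 \<in> \<real>"
    then show ?thesis unfolding R_def normal_cubic_def cquartic_def
      by (intro Reals_mult Reals_add Reals_power Reals_of_real) auto
  next
    assume "s2 = cnj s1"
    then have "R = normal_cubic (cquartic g) s1 1 * cnj (normal_cubic (cquartic g) s1 1)"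
      unfolding R_def by (simp add: C_real)
    then show ?thesis by (simp add: complex_is_Real_iff)
  qed
  then have Re: "R = of_real (Re R)" by simp
  then show Re0: "Re R \<noteq> 0" using R0 by auto
  have m: "?m \<noteq> 0" using l linf by simp
  have prod: "(\<Prod>z\<in>#?Z. partial_line ?F ?linf ?l z) = of_real (Re R / ?m\<^sup>2)"
  proof -
    have "(\<Prod>z\<in>#?Z. partial_line ?F ?linf ?l z) = R / (of_real ?m)\<^sup>2"
      using part[of a s1] part[of b s2] by (simp add: R_def power2_eq_square)
    then show ?thesis by (subst (asm) Re) simp
  qed
  have "Qtype of_real f Linf L = \<langle>THE r. complex_of_real r = (\<Prod>z\<in>#?Z. partial_line ?F ?linf ?l z)\<rangle>"
    unfolding Qtype_def Let_def Z using inc by auto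
  also have "(THE r. complex_of_real r = (\<Prod>z\<in>#?Z. partial_line ?F ?linf ?l z)) = Re R / ?m\<^sup>2"
    unfolding prod by (rule the_equality) (simp_all only: of_real_eq_iff)
  finally have Q: "Qtype of_real f Linf L = \<langle>Re R / ?m\<^sup>2\<rangle>" .
  have m2: "?m\<^sup>2 > 0" using m by (simp only: zero_less_power2) simp
  show "Qtype of_real f Linf L = (if Re R > 0 then \<langle>1\<rangle> else \<langle>- 1\<rangle>)"
  proof (cases "Re R > 0")
    case True
    then have "Re R / ?m\<^sup>2 > 0" using m2 by (rule divide_pos_pos)
    then show ?thesis unfolding Q if_P[OF True] by (rule rank_one_real(1))
  next
    case False
    then have "Re R / ?m\<^sup>2 < 0" using m2 Re0 by (intro divide_neg_pos) auto
    then show ?thesis unfolding Q if_not_P[OF False] by (rule rank_one_real(2))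
  qed
qed

section \<open>The twenty-eight bitangents\<close>

lemma crossp_self [simp]: "crossp u u = (0 :: 'a::comm_ring_1 ^ 3)"
  by (simp add: vec3_eq_iff algebra_simps)

subsection \<open>Conics\<close>

text \<open>A conic is given by its symmetric matrix: entries 0, 1, 2 are the diagonal, and 3, 4, 5 are the
  entries in the positions (2,3), (1,3) and (1,2).\<close>

type_synonym conic = "nat \<Rightarrow> complex"

definition qf :: "conic \<Rightarrow> complex ^ 3 \<Rightarrow> complex" where
  "qf M v = M 0 * v $ 1 ^ 2 + M 1 * v $ 2 ^ 2 + M 2 * v $ 3 ^ 2
     + 2 * (M 3 * (v $ 2 * v $ 3) + M 4 * (v $ 1 * v $ 3) + M 5 * (v $ 1 * v $ 2))"

text \<open>The symmetric matrix applied to \<open>v\<close>, which is half the gradient.\<close>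

definition grad :: "conic \<Rightarrow> complex ^ 3 \<Rightarrow> complex ^ 3" where
  "grad M v = vector [M 0 * v $ 1 + M 5 * v $ 2 + M 4 * v $ 3, M 5 * v $ 1 + M 1 * v $ 2 + M 3 * v $ 3,
     M 4 * v $ 1 + M 3 * v $ 2 + M 2 * v $ 3]"

text \<open>The determinant of the symmetric matrix; the ring is general because the entries are also taken
  to be polynomials in a parameter.\<close>

definition disc :: "(nat \<Rightarrow> 'a) \<Rightarrow> 'a::comm_ring_1" where
  "disc M = M 0 * M 1 * M 2 + 2 * M 3 * M 4 * M 5 - M 0 * M 3 ^ 2 - M 1 * M 4 ^ 2 - M 2 * M 5 ^ 2"

text \<open>The product of two linear forms.\<close>

definition symm :: "complex ^ 3 \<Rightarrow> complex ^ 3 \<Rightarrow> conic" where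
  "symm l m = (\<lambda>i. if i = 0 then l $ 1 * m $ 1 else if i = 1 then l $ 2 * m $ 2 else if i = 2 then l $ 3 * m $ 3
     else if i = 3 then (l $ 2 * m $ 3 + l $ 3 * m $ 2) / 2 else if i = 4 then (l $ 1 * m $ 3 + l $ 3 * m $ 1) / 2
     else (l $ 1 * m $ 2 + l $ 2 * m $ 1) / 2)"

lemma grad_nth [simp]:
  "grad M v $ 1 = M 0 * v $ 1 + M 5 * v $ 2 + M 4 * v $ 3"
  "grad M v $ 2 = M 5 * v $ 1 + M 1 * v $ 2 + M 3 * v $ 3"
  "grad M v $ 3 = M 4 * v $ 1 + M 3 * v $ 2 + M 2 * v $ 3"
  by (simp_all add: grad_def)

lemma qf_symm: "qf (symm l m) v = dot l v * dot m v"
  by (simp add: qf_def symm_def dot_3 power2_eq_square field_simps)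

lemma qf_lincomb: "qf (\<lambda>i. a * M i + b * N i) v = a * qf M v + b * qf N v"
  by (simp add: qf_def algebra_simps)

lemma qf_comb: "qf M (s *s u + t *s v) = qf M u * s\<^sup>2 + 2 * dot (grad M u) v * s * t + qf M v * t\<^sup>2"
  by (simp add: qf_def dot_3 power2_eq_square algebra_simps)

lemma dot_grad: "dot (grad M v) v = qf M v" "dot (grad M u) v = dot (grad M v) u"
  by (simp_all add: qf_def dot_3 power2_eq_square algebra_simps)

lemma grad_comb: "grad M (s *s u + t *s v) = s *s grad M u + t *s grad M v"
  by (simp add: vec3_eq_iff algebra_simps)

lemma exists_kernel_vector: "\<exists>w :: complex ^ 3. w \<noteq> 0 \<and> dot l w = 0"
proof (cases "l = 0")
  case True
  then show ?thesis by (intro exI[of _ "vector [1, 0, 0]"]) (simp add: vec3_eq_iff dot_3)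
next
  case False
  then obtain u v where uv: "crossp u v = l" using exists_kernel_basis by blast
  then have "u \<noteq> 0" using False by (auto simp: vec3_eq_iff)
  then show ?thesis using uv by (intro exI[of _ u]) auto
qed

lemma disc_eq_0_iff: "disc M = 0 \<longleftrightarrow> (\<exists>v. v \<noteq> 0 \<and> grad M v = 0)"
proof -
  define r1 r2 r3 :: "complex ^ 3" where "r1 = vector [M 0, M 5, M 4]" and "r2 = vector [M 5, M 1, M 3]"
    and "r3 = vector [M 4, M 3, M 2]"
  have g: "grad M v = 0 \<longleftrightarrow> dot r1 v = 0 \<and> dot r2 v = 0 \<and> dot r3 v = 0" for v
    by (simp add: vec3_eq_iff dot_3 r1_def r2_def r3_def)
  have d: "disc M = dot (crossp r1 r2) r3" "disc M = dot (crossp r2 r3) r1" "disc M = dot (crossp r3 r1) r2"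
    by (simp_all add: disc_def dot_3 r1_def r2_def r3_def power2_eq_square algebra_simps)
  show ?thesis
  proof
    assume 0: "disc M = 0"
    have w: "\<exists>v. v \<noteq> 0 \<and> grad M v = 0" if "w \<noteq> 0" "dot r1 w = 0" "dot r2 w = 0" "dot r3 w = 0" for w
      using that g by blast
    show "\<exists>v. v \<noteq> 0 \<and> grad M v = 0"
    proof (cases "crossp r1 r2 = 0 \<and> crossp r2 r3 = 0 \<and> crossp r3 r1 = 0")
      case False
      then consider "crossp r1 r2 \<noteq> 0" | "crossp r2 r3 \<noteq> 0" | "crossp r3 r1 \<noteq> 0" by blast
      then show ?thesis
        by cases (use 0 d w[of "crossp r1 r2"] w[of "crossp r2 r3"] w[of "crossp r3 r1"] in
          \<open>simp_all add: dot_commute[of r1] dot_commute[of r2] dot_commute[of r3]\<close>)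
    next
      case True
      have par: "\<exists>c. b = c *s a" if "crossp a b = 0 \<or> crossp b a = 0" "a \<noteq> 0" for a b :: "complex ^ 3"
      proof -
        have "crossp a b = - crossp b a" by (simp add: vec3_eq_iff)
        then have "crossp a b = 0" using that(1) by auto
        then show ?thesis using crossp_eq_0_iff[OF that(2)] by blast
      qed
      obtain r :: "complex ^ 3" where r: "\<exists>c. r1 = c *s r" "\<exists>c. r2 = c *s r" "\<exists>c. r3 = c *s r"
      proof -
        consider "r1 \<noteq> 0" | "r2 \<noteq> 0" | "r3 \<noteq> 0" | "r1 = 0 \<and> r2 = 0 \<and> r3 = 0" by blast
        then show thesis
        proof cases
          case 1
          show thesis by (rule that[of r1]; rule par) (use True 1 in auto)
        next
          case 2
          show thesis by (rule that[of r2]; rule par) (use True 2 in auto)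
        next
          case 3
          show thesis by (rule that[of r3]; rule par) (use True 3 in auto)
        next
          case 4 then show thesis using that[of 0] by simp
        qed
      qed
      obtain w where "w \<noteq> 0" "dot r w = 0" using exists_kernel_vector by blast
      then show ?thesis unfolding g using r by (intro exI[of _ w]) (auto simp: dot_linear)
    qed
  next
    assume "\<exists>v. v \<noteq> 0 \<and> grad M v = 0"
    then obtain v where v: "v \<noteq> 0" "dot r1 v = 0" "dot r2 v = 0" "dot r3 v = 0" unfolding g by blast
    then obtain c where "crossp r1 r2 = c *s v"
      using crossp_parallel[of v r1 r2] by (auto simp: dot_commute)
    then show "disc M = 0" unfolding d(1) using v(4) by (simp add: dot_linear dot_commute)
  qed
qed

text \<open>A singular conic is a pair of lines: it is a binary quadratic form in coordinates of the plane
  modulo its vertex.\<close>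

lemma singular_conic_splits:
  assumes "disc M = 0"
  shows "\<exists>m1 m2. \<forall>w. qf M w = dot m1 w * dot m2 w"
proof -
  obtain v where v: "v \<noteq> 0" "grad M v = 0" using assms disc_eq_0_iff by blast
  obtain \<eta> where \<eta>: "dot v \<eta> = 1" using exists_dot_neq_0[OF v(1)] by blast
  then have "\<eta> \<noteq> 0" by auto
  then obtain p q where pq: "crossp p q = \<eta>" using exists_kernel_basis by blast
  have det: "dot (crossp p q) v = 1" using \<eta> pq by (simp add: dot_commute)
  have M: "qf M w = qf M p * (dot (crossp q v) w)\<^sup>2 + 2 * dot (grad M p) q * dot (crossp q v) w * dot (crossp v p) w
      + qf M q * (dot (crossp v p) w)\<^sup>2" for w
  proof -
    define w' where "w' = dot (crossp q v) w *s p + dot (crossp v p) w *s q"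
    have "w = 1 *s w' + dot (crossp p q) w *s v" using frame_expand[of p q v w] det by (simp add: w'_def)
    then have "qf M w = qf M (1 *s w' + dot (crossp p q) w *s v)" by simp
    also have "\<dots> = qf M w'"
      unfolding qf_comb dot_grad(2)[of M w' v] dot_grad(1)[of M v, symmetric] v(2) by simp
    finally show ?thesis unfolding w'_def qf_comb .
  qed
  show ?thesis
  proof (cases "(qf M p, 2 * dot (grad M p) q, qf M q) = (0, 0, 0)")
    case True
    then have "qf M w = 0" for w using M[of w] by simp
    then show ?thesis by (intro exI[of _ 0]) simp
  next
    case False
    from binary_quadratic_factor[OF this] obtain a b where ab: "\<And>s t. qf M p * s\<^sup>2 + 2 * dot (grad M p) q * s * t
        + qf M q * t\<^sup>2 = lf a s t * lf b s t" by metis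
    show ?thesis
    proof (intro exI allI)
      fix w
      show "qf M w = dot (fst a *s crossp q v + snd a *s crossp v p) w * dot (fst b *s crossp q v + snd b *s crossp v p) w"
        unfolding M[of w] ab by (simp add: dot_add_left dot_smult_left lf_def)
    qed
  qed
qed

lemma conic_zero_on_line:
  assumes "l \<noteq> 0"
  shows "\<exists>w. w \<noteq> 0 \<and> dot l w = 0 \<and> qf M w = 0"
proof -
  obtain u v where uv: "crossp u v = l" using exists_kernel_basis[OF assms] by blast
  have l: "dot l (s *s u + t *s v) = 0" for s t using uv by (auto simp: dot_linear)
  have nz: "s *s u + t *s v \<noteq> 0" if "(s, t) \<noteq> (0, 0)" for s t
  proof
    assume 0: "s *s u + t *s v = 0"
    have "crossp (s *s u + t *s v) v = s *s l" "crossp u (s *s u + t *s v) = t *s l"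
      using uv by (simp_all add: vec3_eq_iff flip: uv) (simp_all add: algebra_simps)
    then have "s *s l = 0" "t *s l = 0" unfolding 0 by (auto simp: vec3_eq_iff)
    then show False using that assms by (auto simp: vector_mul_eq_0)
  qed
  show ?thesis
  proof (cases "(qf M u, 2 * dot (grad M u) v, qf M v) = (0, 0, 0)")
    case True
    then have "qf M (1 *s u + 0 *s v) = 0" by simp
    then show ?thesis using l[of 1 0] nz[of 1 0] by (intro exI[of _ "1 *s u + 0 *s v"]) simp
  next
    case False
    from binary_quadratic_factor[OF this] obtain a b where ab: "a \<noteq> 0" "\<And>s t. qf M u * s\<^sup>2 + 2 * dot (grad M u) v * s * t
        + qf M v * t\<^sup>2 = lf a s t * lf b s t" by metis
    have "qf M (snd a *s u + (- fst a) *s v) = 0" unfolding qf_comb ab by (simp add: lf_def)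
    moreover have "(snd a, - fst a) \<noteq> (0, 0)" using ab(1) by (auto simp: prod_eq_iff)
    ultimately show ?thesis using l nz by blast
  qed
qed

lemma qf_product_coeffs:
  assumes "\<And>w. qf M w = dot m1 w * dot m2 w" "i \<le> 5"
  shows "M i = symm m1 m2 i"
proof -
  have e: "qf M (vector [x, y, z]) = qf (symm m1 m2) (vector [x, y, z])" for x y z
    using assms(1) by (simp add: qf_symm)
  note e' = e[unfolded qf_def, simplified]
  have 0: "M 0 = symm m1 m2 0" "M 1 = symm m1 m2 1" "M 2 = symm m1 m2 2"
    using e'[of 1 0 0] e'[of 0 1 0] e'[of 0 0 1] by simp_all
  have "M 3 = symm m1 m2 3" "M 4 = symm m1 m2 4" "M 5 = symm m1 m2 5"
    using e'[of 0 1 1] e'[of 1 0 1] e'[of 1 1 0] 0 by simp_all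
  moreover have "i = 0 \<or> i = 1 \<or> i = 2 \<or> i = 3 \<or> i = 4 \<or> i = 5" using assms(2) by arith
  ultimately show ?thesis using 0 by auto
qed

subsection \<open>The discriminant of a quadratic family of conics\<close>

definition pencil :: "conic \<Rightarrow> conic \<Rightarrow> conic \<Rightarrow> complex \<Rightarrow> conic" where
  "pencil A Q B c = (\<lambda>i. c\<^sup>2 * A i - 2 * c * Q i + B i)"

lemma qf_pencil: "qf (pencil A Q B c) w = c\<^sup>2 * qf A w - 2 * c * qf Q w + qf B w"
  by (simp add: qf_def pencil_def algebra_simps)

definition disc_poly :: "conic \<Rightarrow> conic \<Rightarrow> conic \<Rightarrow> complex poly" where
  "disc_poly A Q B = disc (\<lambda>i. [:B i, - 2 * Q i, A i:])"

lemma poly_disc_poly: "poly (disc_poly A Q B) c = disc (pencil A Q B c)"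
proof -
  have "poly (disc P) c = disc (\<lambda>i. poly (P i) c)" for P :: "nat \<Rightarrow> complex poly"
    by (simp add: disc_def)
  moreover have "(\<lambda>i. poly [:B i, - 2 * Q i, A i:] c) = pencil A Q B c"
    by (simp add: fun_eq_iff pencil_def power2_eq_square algebra_simps)
  ultimately show ?thesis unfolding disc_poly_def by simp
qed

text \<open>The derivative of the determinant at \<open>M\<close> in the direction \<open>N\<close>.\<close>

definition disc_deriv :: "(nat \<Rightarrow> 'a) \<Rightarrow> (nat \<Rightarrow> 'a) \<Rightarrow> 'a::comm_ring_1" where
  "disc_deriv M N = N 0 * (M 1 * M 2 - M 3 ^ 2) + N 1 * (M 0 * M 2 - M 4 ^ 2) + N 2 * (M 0 * M 1 - M 5 ^ 2)
     + 2 * (N 3 * (M 4 * M 5 - M 0 * M 3) + N 4 * (M 3 * M 5 - M 1 * M 4) + N 5 * (M 3 * M 4 - M 2 * M 5))"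

text \<open>The adjugate of a matrix of rank 2 is a multiple of the square of its kernel vector, which here
  is the intersection of the two lines.\<close>

lemma disc_deriv_symm: "disc_deriv (symm m1 m2) N = - qf N (crossp m1 m2) / 4"
  by (simp add: disc_deriv_def symm_def qf_def power2_eq_square field_simps)

lemma poly_pderiv_disc_poly:
  "poly (pderiv (disc_poly A Q B)) c = disc_deriv (pencil A Q B c) (\<lambda>i. 2 * (c * A i - Q i))"
proof -
  have "pderiv (disc P) = disc_deriv P (\<lambda>i. pderiv (P i))" for P :: "nat \<Rightarrow> complex poly"
    by (simp add: disc_def disc_deriv_def pderiv_add pderiv_diff pderiv_mult pderiv_smult smult_add_right power2_eq_square
        algebra_simps numeral_poly flip: mult_2)
  moreover have "poly (disc_deriv P R) c = disc_deriv (\<lambda>i. poly (P i) c) (\<lambda>i. poly (R i) c)"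
    for P R :: "nat \<Rightarrow> complex poly"
    by (simp add: disc_deriv_def)
  moreover have "(\<lambda>i. poly [:B i, - 2 * Q i, A i:] c) = pencil A Q B c"
    by (simp add: fun_eq_iff pencil_def power2_eq_square algebra_simps)
  moreover have "(\<lambda>i. poly (pderiv [:B i, - 2 * Q i, A i:]) c) = (\<lambda>i. 2 * (c * A i - Q i))"
    by (simp add: fun_eq_iff pderiv_pCons algebra_simps)
  ultimately show ?thesis unfolding disc_poly_def by simp
qed

lemma disc_expand:
  fixes A N B :: "nat \<Rightarrow> complex"
  shows "disc (\<lambda>i. c\<^sup>2 * A i + c * N i + B i) = disc B + c * disc_deriv B N + c^2 * (disc_deriv B A + disc_deriv N B)
    + c^3 * (disc N + (disc_deriv (\<lambda>i. A i + B i) N - disc_deriv A N - disc_deriv B N))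
    + c^4 * (disc_deriv A B + disc_deriv N A) + c^5 * disc_deriv A N + c^6 * disc A"
  by (simp add: disc_def disc_deriv_def eval_nat_numeral algebra_simps)

lemma disc_poly_coeffs:
  "\<exists>k2 k3 k4. disc_poly A Q B = [:disc B, disc_deriv B (\<lambda>i. - 2 * Q i), k2, k3, k4, disc_deriv A (\<lambda>i. - 2 * Q i), disc A:]"
proof -
  define N where "N = (\<lambda>i. - 2 * Q i)"
  have "pencil A Q B c = (\<lambda>i. c\<^sup>2 * A i + c * N i + B i)" for c
    by (simp add: pencil_def N_def mult_ac)
  then have "poly (disc_poly A Q B) c = poly [:disc B, disc_deriv B N, disc_deriv B A + disc_deriv N B,
      disc N + (disc_deriv (\<lambda>i. A i + B i) N - disc_deriv A N - disc_deriv B N),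
      disc_deriv A B + disc_deriv N A, disc_deriv A N, disc A:] c" for c
    unfolding poly_disc_poly by (simp only: disc_expand) (simp add: eval_nat_numeral algebra_simps)
  then have "disc_poly A Q B = [:disc B, disc_deriv B N, disc_deriv B A + disc_deriv N B,
      disc N + (disc_deriv (\<lambda>i. A i + B i) N - disc_deriv A N - disc_deriv B N),
      disc_deriv A B + disc_deriv N A, disc_deriv A N, disc A:]"
    by (simp only: poly_eq_poly_eq_iff[symmetric] fun_eq_iff) simp
  then show ?thesis unfolding N_def by blast
qed

subsection \<open>Binary forms\<close>

lemma exists_nonroot:
  assumes "finite A" "0 \<notin> A"
  shows "\<exists>s t. \<forall>a\<in>A. lf a s t \<noteq> 0"
proof -
  have "finite {x. fst a + snd a * x = 0}" if "a \<in> A" for a :: "complex \<times> complex"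
  proof -
    have "a \<noteq> 0" using that assms(2) by auto
    then show ?thesis using poly_roots_finite[of "[:fst a, snd a:]"] by (auto simp: prod_eq_iff mult.commute)
  qed
  then have "finite (\<Union>a\<in>A. {x. fst a + snd a * x = 0})" using assms(1) by blast
  from ex_new_if_finite[OF infinite_UNIV_char_0 this] obtain x where "\<forall>a\<in>A. fst a + snd a * x \<noteq> 0" by blast
  then show ?thesis by (intro exI[of _ 1] exI[of _ x]) (simp add: lf_def)
qed

lemma lf_parallel:
  assumes "a \<noteq> 0" "(s, t) \<noteq> (0, 0)" "lf a s t = 0" "lf b s t = 0"
  shows "\<exists>k. \<forall>x y. lf b x y = k * lf a x y"
proof -
  have 1: "fst a * s = - snd a * t" "fst b * s = - snd b * t"
    using assms(3,4) by (simp_all add: lf_def eq_neg_iff_add_eq_0)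
  have "fst a * snd b * s = snd a * fst b * s" "fst a * snd b * t = snd a * fst b * t"
  proof -
    have "fst a * snd b * s = snd b * (fst a * s)" by simp
    also have "\<dots> = snd a * (- snd b * t)" unfolding 1(1) by simp
    finally show "fst a * snd b * s = snd a * fst b * s" unfolding 1(2)[symmetric] by simp
    have "snd a * fst b * t = - fst b * (- snd a * t)" by simp
    also have "\<dots> = - fst a * (fst b * s)" unfolding 1(1)[symmetric] by simp
    finally show "fst a * snd b * t = snd a * fst b * t" unfolding 1(2) by auto
  qed
  then have e: "fst a * snd b = snd a * fst b" using assms(2) by auto
  show ?thesis
  proof (cases "fst a = 0")
    case True
    then have "snd a \<noteq> 0" using assms(1) by (auto simp: prod_eq_iff)
    then show ?thesis using e True by (intro exI[of _ "snd b / snd a"]) (auto simp: lf_def)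
  next
    case False
    then have "snd b = fst b / fst a * snd a" using e by (simp add: field_simps)
    then show ?thesis using False by (intro exI[of _ "fst b / fst a"]) (auto simp: lf_def algebra_simps)
  qed
qed

lemma isCont_lf: "isCont (\<lambda>e :: complex. lf a (s + e * x) (t + e * y)) 0"
  unfolding lf_def by (intro continuous_intros)

text \<open>Cancellation: a continuous function on the plane that vanishes off a line vanishes.\<close>

lemma lf_cancel:
  assumes a: "a \<noteq> 0" and eq: "\<And>s t. lf a s t * G s t = lf a s t * H s t"
    and cont: "\<And>s t x y. isCont (\<lambda>e :: complex. G (s + e * x) (t + e * y)) 0"
      "\<And>s t x y. isCont (\<lambda>e :: complex. H (s + e * x) (t + e * y)) 0"
  shows "G s t = (H s t :: complex)"
proof (cases "lf a s t = 0")
  case False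
  then show ?thesis using eq[of s t] by simp
next
  case True
  obtain x y where xy: "lf a x y \<noteq> 0" using exists_nonroot[of "{a}"] a by auto
  have "lf a (s + e * x) (t + e * y) = e * lf a x y" for e
    using True by (simp add: lf_def algebra_simps)
  then have "G (s + e * x) (t + e * y) = H (s + e * x) (t + e * y)" if "e \<noteq> 0" for e
    using eq[of "s + e * x" "t + e * y"] that xy by simp
  then have ev: "eventually (\<lambda>e. H (s + e * x) (t + e * y) = G (s + e * x) (t + e * y)) (at 0)"
    by (intro eventually_mono[OF eventually_neq_at_within[of 0]]) auto
  have lim: "((\<lambda>e. G (s + e * x) (t + e * y)) \<longlongrightarrow> G s t) (at 0)"
    "((\<lambda>e. H (s + e * x) (t + e * y)) \<longlongrightarrow> H s t) (at 0)"
    using cont[where s = s and t = t and x = x and y = y] by (simp_all add: isCont_def)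
  have "((\<lambda>e. G (s + e * x) (t + e * y)) \<longlongrightarrow> H s t) (at 0)"
    using lim(2) tendsto_cong[OF ev] by blast
  with lim(1) show ?thesis by (rule LIM_unique)
qed

text \<open>Unique factorization for products of four binary linear forms: once \<open>a\<close> is matched with \<open>l1\<close>, the
  factor \<open>b\<close> is matched with one of the others, and the remaining pairs have equal products.\<close>

lemma product_pairs:
  assumes nz: "a \<noteq> 0" "b \<noteq> 0" "c \<noteq> 0" "d \<noteq> 0" and l: "l1 \<noteq> 0" "l2 \<noteq> 0" "l3 \<noteq> 0" "l4 \<noteq> 0"
    and eq: "\<And>s t. lf a s t * lf b s t * (lf c s t * lf d s t) = lf l1 s t * lf l2 s t * lf l3 s t * lf l4 s t"
    and a: "\<And>s t. lf a s t = k * lf l1 s t"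
  shows "\<exists>K m n p. K \<noteq> 0 \<and> (m, n, p) \<in> {(l2, l3, l4), (l3, l2, l4), (l4, l2, l3)} \<and>
    (\<forall>s t. lf a s t * lf b s t = K * (lf l1 s t * lf m s t) \<and> K * (lf c s t * lf d s t) = lf n s t * lf p s t)"
proof -
  note conts = isCont_lf continuous_intros
  have "k \<noteq> 0"
  proof
    assume "k = 0"
    then have "lf a s t = 0" for s t using a by simp
    then show False using exists_nonroot[of "{a}"] nz by auto
  qed
  have 1: "k * (lf b s t * (lf c s t * lf d s t)) = lf l2 s t * lf l3 s t * lf l4 s t" for s t
  proof (rule lf_cancel[OF l(1), where G = "\<lambda>s t. k * (lf b s t * (lf c s t * lf d s t))"
        and H = "\<lambda>s t. lf l2 s t * lf l3 s t * lf l4 s t"])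
    show "lf l1 s t * (k * (lf b s t * (lf c s t * lf d s t))) = lf l1 s t * (lf l2 s t * lf l3 s t * lf l4 s t)" for s t
      using eq[of s t] a[of s t] by (simp add: mult_ac)
  qed (intro conts)+
  have "lf b (snd b) (- fst b) = 0" by (simp add: lf_def)
  then have "lf l2 (snd b) (- fst b) * lf l3 (snd b) (- fst b) * lf l4 (snd b) (- fst b) = 0"
    using 1[of "snd b" "- fst b"] by simp
  then consider "lf l2 (snd b) (- fst b) = 0" | "lf l3 (snd b) (- fst b) = 0" | "lf l4 (snd b) (- fst b) = 0" by auto
  then obtain m n p where mnp: "(m, n, p) \<in> {(l2, l3, l4), (l3, l2, l4), (l4, l2, l3)}"
    and m0: "lf m (snd b) (- fst b) = 0"
    by cases (rule that[of l2 l3 l4] that[of l3 l2 l4] that[of l4 l2 l3]; simp; fail)+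
  have mz: "m \<noteq> 0" using mnp l by auto
  have "(snd b, - fst b) \<noteq> (0, 0)" using nz(2) by (auto simp: prod_eq_iff)
  then obtain k' where k': "\<And>x y. lf b x y = k' * lf m x y"
    using lf_parallel[OF mz _ m0 \<open>lf b (snd b) (- fst b) = 0\<close>] by blast
  have "k' \<noteq> 0"
  proof
    assume "k' = 0"
    then have "lf b s t = 0" for s t using k' by simp
    then show False using exists_nonroot[of "{b}"] nz by auto
  qed
  have 2: "k * k' * (lf c s t * lf d s t) = lf n s t * lf p s t" for s t
  proof (rule lf_cancel[OF mz, where G = "\<lambda>s t. k * k' * (lf c s t * lf d s t)" and H = "\<lambda>s t. lf n s t * lf p s t"])
    show "lf m s t * (k * k' * (lf c s t * lf d s t)) = lf m s t * (lf n s t * lf p s t)" for s t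
      using 1[of s t] k'[of s t] mnp by (auto simp: mult_ac)
  qed (intro conts)+
  show ?thesis
    using \<open>k \<noteq> 0\<close> \<open>k' \<noteq> 0\<close> mnp 2 a k'
    by (intro exI[of _ "k * k'"] exI[of _ m] exI[of _ n] exI[of _ p]) simp
qed

subsection \<open>Decompositions of a smooth quartic\<close>

lemma has_derivative_qf: "qf M differentiable (at (v :: complex ^ 3))"
proof -
  have nth: "(\<lambda>v :: complex ^ 3. v $ i) differentiable (at w)" for i w
    using bounded_linear_imp_has_derivative[OF bounded_linear_vec_nth] differentiable_def by blast
  show ?thesis unfolding qf_def[abs_def] by (intro derivative_intros nth)
qed

lemma smooth_no_critical_zero:
  assumes "smooth_quartic F" "v \<noteq> 0" "quartic_eval F v = 0"
    "(quartic_eval F has_derivative (\<lambda>w. 0)) (at v)"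
  shows False
  using assms frechet_derivative_at[OF assms(4)] unfolding smooth_quartic_def by metis

locale smooth_plane_quartic =
  fixes F :: "complex quartic"
  assumes smooth: "smooth_quartic F"
begin

text \<open>Every term of the derivative at \<open>w\<close> has a vanishing factor.\<close>

lemma no_triple_point:
  assumes F: "\<And>w. quartic_eval F w = (qf P w)\<^sup>2 - qf A w * (dot m1 w * dot m2 w)"
    and w: "w \<noteq> 0" "qf P w = 0" "dot m1 w = 0" "dot m2 w = 0"
  shows False
proof (rule smooth_no_critical_zero[OF smooth w(1)])
  have "quartic_eval F = (\<lambda>w. (qf P w)\<^sup>2 + dot m1 w * (- qf A w * dot m2 w) + (dot m1 w)\<^sup>2 * 0)"
    using F by (simp add: fun_eq_iff)
  moreover have "((\<lambda>w. (qf P w)\<^sup>2 + dot m1 w * (- qf A w * dot m2 w) + (dot m1 w)\<^sup>2 * 0) has_derivative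
      (\<lambda>x. (- qf A w * dot m2 w) * dot m1 x)) (at w)"
    using w by (intro has_derivative_near_double_zero has_derivative_dot has_derivative_qf derivative_intros) auto
  ultimately show "(quartic_eval F has_derivative (\<lambda>w. 0)) (at w)" using w by simp
  show "quartic_eval F w = 0" using F w by simp
qed

lemma no_common_zero:
  assumes F: "\<And>w. quartic_eval F w = (qf P w)\<^sup>2 - qf A w * qf B w"
    and w: "w \<noteq> 0" "qf P w = 0" "qf A w = 0" "qf B w = 0"
  shows False
proof (rule smooth_no_critical_zero[OF smooth w(1)])
  have F': "quartic_eval F = (\<lambda>w. qf P w * qf P w - qf A w * qf B w)"
    using F by (simp add: fun_eq_iff power2_eq_square)
  obtain p a b where "(qf P has_derivative p) (at w)" "(qf A has_derivative a) (at w)" "(qf B has_derivative b) (at w)"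
    using has_derivative_qf unfolding differentiable_def by metis
  then have "((\<lambda>w. qf P w * qf P w - qf A w * qf B w) has_derivative
      (\<lambda>x. (qf P w * p x + p x * qf P w) - (qf A w * b x + a x * qf B w))) (at w)"
    by (intro has_derivative_diff has_derivative_mult)
  then show "(quartic_eval F has_derivative (\<lambda>w. 0)) (at w)" unfolding F' using w by simp
  show "quartic_eval F w = 0" using F w by simp
qed

text \<open>If both forms are multiples of one form, then \<open>P\<close> vanishes at some point of its line, which is a
  singular point of the quartic.\<close>

lemma factors_independent:
  assumes F: "\<And>w. quartic_eval F w = (qf P w)\<^sup>2 - qf A w * (dot m1 w * dot m2 w)"
  shows "crossp m1 m2 \<noteq> 0"
proof
  assume 0: "crossp m1 m2 = 0"
  obtain l where l: "l \<noteq> 0" "\<exists>c. m1 = c *s l" "\<exists>c. m2 = c *s l"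
  proof (cases "m1 = 0")
    case False
    then show thesis using that[of m1] crossp_eq_0_iff[OF False] 0 by (metis vector_smult_lid)
  next
    case True
    show thesis
    proof (cases "m2 = 0")
      case False
      then show thesis using that[of m2] True by (metis vector_smult_lid vector_smult_lzero)
    next
      case m2: True
      have "(vector [1, 0, 0] :: complex ^ 3) \<noteq> 0" by (simp add: vec3_eq_iff)
      then show thesis using that[of "vector [1, 0, 0]"] True m2 by (metis vector_smult_lzero)
    qed
  qed
  obtain w where "w \<noteq> 0" "dot l w = 0" "qf P w = 0" using conic_zero_on_line[OF l(1)] by blast
  then show False using no_triple_point[OF F, of w] l by (auto simp: dot_linear)
qed

text \<open>On the line \<open>m1 = 0\<close> the quartic is the square of \<open>P\<close>, and \<open>P\<close> does not vanish on the whole line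
  because it does not vanish at the point of intersection with \<open>m2 = 0\<close>.\<close>

lemma bitangent_of_decomposition:
  assumes F: "\<And>w. quartic_eval F w = (qf P w)\<^sup>2 - qf A w * (dot m1 w * dot m2 w)"
  shows "bitangent F (abs_proj_plane m1)"
proof -
  let ?L = "abs_proj_plane m1"
  have ind: "crossp m1 m2 \<noteq> 0" using factors_independent[OF F] .
  then have "m1 \<noteq> 0" by (auto simp: vec3_eq_iff)
  then obtain c where c: "c \<noteq> 0" "rep_proj_plane ?L = c *s m1" using rep_abs by blast
  obtain u v where uv: "crossp u v = m1" using exists_kernel_basis[OF \<open>m1 \<noteq> 0\<close>] by blast
  have m: "dot m1 u = 0" "dot m1 v = 0" using uv by auto
  interpret line_basis ?L u v
    by unfold_locales (use uv \<open>m1 \<noteq> 0\<close> m in \<open>simp_all add: c dot_smult_left\<close>)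
  have F': "quartic_eval F (s *s u + t *s v) = (qf P u * s\<^sup>2 + 2 * dot (grad P u) v * s * t + qf P v * t\<^sup>2)\<^sup>2" for s t
    unfolding F qf_comb[of P] by (simp add: dot_linear m)
  have "(qf P u, 2 * dot (grad P u) v, qf P v) \<noteq> (0, 0, 0)"
  proof
    assume 0: "(qf P u, 2 * dot (grad P u) v, qf P v) = (0, 0, 0)"
    let ?w = "crossp m1 m2"
    have "dot (rep_proj_plane ?L) ?w = 0" unfolding c by (simp add: dot_linear dot_commute[of m1])
    then obtain s t where w: "?w = s *s u + t *s v" using kernel_span[OF rep_nonzero u v indep] by blast
    have "qf P ?w = 0" unfolding w qf_comb using 0 by simp
    then show False using no_triple_point[OF F ind] by (simp add: dot_commute[of m1] dot_commute[of m2])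
  qed
  then show ?thesis unfolding bitangent_iff using F' by blast
qed

definition conic_lines :: "conic \<Rightarrow> complex proj_plane set" where
  "conic_lines M = {L. \<forall>w. dot (rep_proj_plane L) w = 0 \<longrightarrow> qf M w = 0}"

lemma conic_lines_product:
  assumes M: "\<And>w. qf M w = dot m1 w * dot m2 w" and ind: "crossp m1 m2 \<noteq> 0"
  shows "conic_lines M = {abs_proj_plane m1, abs_proj_plane m2}" "card (conic_lines M) = 2"
proof -
  have nz: "m1 \<noteq> 0" "m2 \<noteq> 0" using ind by (auto simp: vec3_eq_iff)
  show eq: "conic_lines M = {abs_proj_plane m1, abs_proj_plane m2}"
  proof (intro equalityI subsetI)
    fix L assume L: "L \<in> conic_lines M"
    obtain u v where uv: "crossp u v = rep_proj_plane L" using exists_kernel_basis[OF rep_nonzero] by blast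
    have Luv: "dot (rep_proj_plane L) u = 0" "dot (rep_proj_plane L) v = 0" using uv by (metis dot_crossp)+
    have par: "L = abs_proj_plane m" if h: "dot m u = 0" "dot m v = 0" "m \<noteq> 0" for m
    proof -
      obtain c where c: "crossp u v = c *s m" using crossp_parallel[OF h(3,1,2)] by blast
      then have "c \<noteq> 0" using uv by (metis rep_nonzero vector_smult_lzero)
      have "abs_proj_plane (rep_proj_plane L) = abs_proj_plane m"
        unfolding uv[symmetric] c using \<open>c \<noteq> 0\<close> h(3) by (rule abs_smult)
      then show ?thesis by simp
    qed
    have z: "lf (dot m1 u, dot m1 v) s t * lf (dot m2 u, dot m2 v) s t = 0" for s t
    proof -
      have "dot (rep_proj_plane L) (s *s u + t *s v) = 0" using Luv by (simp add: dot_linear)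
      then have "qf M (s *s u + t *s v) = 0" using L by (simp add: conic_lines_def)
      then show ?thesis unfolding M by (simp add: lf_def dot_linear mult.commute)
    qed
    have "(dot m1 u, dot m1 v) = 0 \<or> (dot m2 u, dot m2 v) = 0"
      using exists_nonroot[of "{(dot m1 u, dot m1 v), (dot m2 u, dot m2 v)}"] z by fastforce
    then show "L \<in> {abs_proj_plane m1, abs_proj_plane m2}"
      using par nz by (auto simp: zero_prod_def)
  next
    fix L assume "L \<in> {abs_proj_plane m1, abs_proj_plane m2}"
    then consider "L = abs_proj_plane m1" | "L = abs_proj_plane m2" by blast
    then show "L \<in> conic_lines M"
      by cases (use rep_abs[OF nz(1)] rep_abs[OF nz(2)] in \<open>auto simp: conic_lines_def M dot_linear\<close>)
  qed
  have "abs_proj_plane m1 \<noteq> abs_proj_plane m2"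
    using ind crossp_eq_0_iff[OF nz(1)] nz by (simp add: abs_eq_iff)
  then show "card (conic_lines M) = 2" unfolding eq by simp
qed

text \<open>The gradient maps the two-dimensional space of a line contained in the conic into the
  one-dimensional space of multiples of its equation, so the matrix has a kernel.\<close>

lemma conic_lines_disc:
  assumes "L \<in> conic_lines M"
  shows "disc M = 0"
proof -
  let ?l = "rep_proj_plane L"
  obtain u v where uv: "crossp u v = ?l" using exists_kernel_basis[OF rep_nonzero] by blast
  have Luv: "dot ?l u = 0" "dot ?l v = 0" using uv by (metis dot_crossp)+
  have z: "qf M u * s\<^sup>2 + 2 * dot (grad M u) v * s * t + qf M v * t\<^sup>2 = 0" for s t
  proof -
    have "dot ?l (s *s u + t *s v) = 0" using Luv by (simp add: dot_linear)
    then show ?thesis using assms unfolding conic_lines_def qf_comb[symmetric] by blast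
  qed
  have q: "qf M u = 0" "qf M v = 0" "dot (grad M u) v = 0"
    using z[of 1 0] z[of 0 1] z[of 1 1] by simp_all
  have uvz: "u \<noteq> 0" using uv rep_nonzero[of L] by (auto simp: vec3_eq_iff)
  have "crossp u v \<noteq> 0" using uv by simp
  have g: "\<exists>c. grad M x = c *s ?l" if h: "dot (grad M x) u = 0" "dot (grad M x) v = 0" for x
  proof (cases "grad M x = 0")
    case True then show ?thesis by (intro exI[of _ 0]) simp
  next
    case False
    obtain c where c: "crossp u v = c *s grad M x" using crossp_parallel[OF False h] by blast
    then have "c \<noteq> 0" using \<open>crossp u v \<noteq> 0\<close> by auto
    then have "grad M x = inverse c *s ?l" using c uv by (simp add: vector_smult_assoc)
    then show ?thesis ..
  qed
  obtain c c' where c: "grad M u = c *s ?l" "grad M v = c' *s ?l"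
    using g[of u] g[of v] q dot_grad[of M] by metis
  show ?thesis
  proof (cases "c = 0 \<and> c' = 0")
    case True
    then show ?thesis unfolding disc_eq_0_iff using c uvz by (intro exI[of _ u]) simp
  next
    case False
    have "grad M (c' *s u + (- c) *s v) = 0" unfolding grad_comb c by (simp add: vec3_eq_iff)
    moreover have "c' *s u + (- c) *s v \<noteq> 0"
    proof
      assume 0: "c' *s u + (- c) *s v = 0"
      have "crossp (c' *s u + (- c) *s v) v = c' *s crossp u v" "crossp u (c' *s u + (- c) *s v) = (- c) *s crossp u v"
        by (simp_all add: vec3_eq_iff algebra_simps)
      then have "c' *s crossp u v = 0" "(- c) *s crossp u v = 0" unfolding 0 by (auto simp: vec3_eq_iff)
      then show False using \<open>crossp u v \<noteq> 0\<close> False unfolding vector_mul_eq_0 by auto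
    qed
    ultimately show ?thesis unfolding disc_eq_0_iff by blast
  qed
qed

lemma pencil_decomposition:
  assumes F: "\<And>w. quartic_eval F w = (qf Q w)\<^sup>2 - qf A w * qf B w"
  shows "quartic_eval F w = (qf (\<lambda>i. 1 * Q i + (- c) * A i) w)\<^sup>2 - qf A w * qf (pencil A Q B c) w"
  unfolding F qf_lincomb qf_pencil by (simp add: power2_eq_square algebra_simps)

text \<open>At a root the conic is a product \<open>m1 m2\<close>, and up to a factor the derivative of the discriminant is
  the value of \<open>Q - c A\<close> at the intersection of the two lines, which would be a singular point of
  the quartic if the value were zero.\<close>

lemma pencil_singular_member:
  assumes F: "\<And>w. quartic_eval F w = (qf Q w)\<^sup>2 - qf A w * qf B w"
    and c: "poly (disc_poly A Q B) c = 0"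
  shows "\<exists>m1 m2. crossp m1 m2 \<noteq> 0 \<and> (\<forall>w. qf (pencil A Q B c) w = dot m1 w * dot m2 w)"
    and "poly (pderiv (disc_poly A Q B)) c \<noteq> 0"
proof -
  let ?P = "\<lambda>i. 1 * Q i + (- c) * A i"
  obtain m1 m2 where m: "\<And>w. qf (pencil A Q B c) w = dot m1 w * dot m2 w"
    using singular_conic_splits c unfolding poly_disc_poly by blast
  have dec: "quartic_eval F w = (qf ?P w)\<^sup>2 - qf A w * (dot m1 w * dot m2 w)" for w
    using pencil_decomposition[OF F, of w c] unfolding m .
  have ind: "crossp m1 m2 \<noteq> 0" using factors_independent[OF dec] .
  then show "\<exists>m1 m2. crossp m1 m2 \<noteq> 0 \<and> (\<forall>w. qf (pencil A Q B c) w = dot m1 w * dot m2 w)" using m by blast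
  have "disc_deriv (pencil A Q B c) N = disc_deriv (symm m1 m2) N" for N
    using qf_product_coeffs[OF m] by (simp add: disc_deriv_def)
  then have "poly (pderiv (disc_poly A Q B)) c = - qf (\<lambda>i. 2 * (c * A i - Q i)) (crossp m1 m2) / 4"
    unfolding poly_pderiv_disc_poly by (simp add: disc_deriv_symm)
  also have "\<dots> = qf ?P (crossp m1 m2) / 2"
    by (simp add: qf_def field_simps)
  finally have eq: "poly (pderiv (disc_poly A Q B)) c = qf ?P (crossp m1 m2) / 2" .
  have ne: "qf ?P (crossp m1 m2) \<noteq> 0"
    using no_triple_point[OF dec ind] by (auto simp: dot_commute[of m1] dot_commute[of m2])
  show "poly (pderiv (disc_poly A Q B)) c \<noteq> 0" unfolding eq using ne by simp
qed

text \<open>The coefficient of \<open>c\<^sup>6\<close> is the discriminant of \<open>l1 l2\<close>, which is zero, and the coefficient of \<open>c\<^sup>5\<close> is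
  its derivative in the direction \<open>- 2 Q\<close>, which is not.\<close>

lemma pencil_roots:
  assumes F: "\<And>w. quartic_eval F w = (qf Q w)\<^sup>2 - qf (symm l1 l2) w * qf B w"
  shows "card {c. poly (disc_poly (symm l1 l2) Q B) c = 0} = 5"
proof -
  let ?p = "disc_poly (symm l1 l2) Q B"
  have dec: "quartic_eval F w = (qf Q w)\<^sup>2 - qf B w * (dot l1 w * dot l2 w)" for w
    unfolding F qf_symm by (simp add: mult.commute)
  have ind: "crossp l1 l2 \<noteq> 0" using factors_independent[OF dec] .
  have "grad (symm l1 l2) (crossp l1 l2) = 0"
    by (simp add: vec3_eq_iff symm_def field_simps)
  then have "disc (symm l1 l2) = 0" unfolding disc_eq_0_iff using ind by blast
  moreover have "disc_deriv (symm l1 l2) (\<lambda>i. - 2 * Q i) \<noteq> 0"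
  proof -
    have "qf Q (crossp l1 l2) \<noteq> 0"
      using no_triple_point[OF dec ind] by (auto simp: dot_commute[of l1] dot_commute[of l2])
    moreover have "qf (\<lambda>i. - 2 * Q i) v = - 2 * qf Q v" for v by (simp add: qf_def algebra_simps)
    ultimately show ?thesis unfolding disc_deriv_symm by simp
  qed
  ultimately have deg: "degree ?p = 5" using disc_poly_coeffs[of "symm l1 l2" Q B] by auto
  then have "?p \<noteq> 0" by auto
  have "rsquarefree ?p" unfolding rsquarefree_roots using pencil_singular_member(2)[OF F] by blast
  then have ord: "order c ?p = 1" if "poly ?p c = 0" for c
    using rsquarefree_root_order[OF _ that \<open>?p \<noteq> 0\<close>] by blast
  have "5 = size (proots ?p)" using deg by (simp add: size_proots_complex)
  also have "\<dots> = (\<Sum>c\<in>{c. poly ?p c = 0}. order c ?p)"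
    using \<open>?p \<noteq> 0\<close> by (simp add: size_multiset_overloaded_eq)
  also have "\<dots> = card {c. poly ?p c = 0}" using ord by simp
  finally show ?thesis by simp
qed

end

lemma dot_diff_left: "dot (u - v) w = dot u w - dot v (w :: 'a::comm_ring_1 ^ 3)"
  by (simp add: dot_3 algebra_simps)

lemma crossp_zero [simp]: "crossp 0 v = 0" "crossp v 0 = (0 :: 'a::comm_ring_1 ^ 3)"
  by (simp_all add: vec3_eq_iff)

context smooth_plane_quartic
begin

text \<open>The parameter \<open>\<kappa> = 0\<close> is excluded because it yields the lines \<open>c\<close> and \<open>d\<close> themselves.\<close>

definition splitting :: "conic \<Rightarrow> complex ^ 3 \<Rightarrow> complex ^ 3 \<Rightarrow> complex ^ 3 \<Rightarrow> complex ^ 3 \<Rightarrow> complex proj_plane set" where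
  "splitting Q a b c d = {L. \<exists>\<kappa>. \<kappa> \<noteq> 0 \<and> L \<in> conic_lines (pencil (symm a b) Q (symm c d) \<kappa>)}"

lemma in_splitting_iff:
  "L \<in> splitting Q a b c d \<longleftrightarrow> (\<exists>\<kappa>. \<kappa> \<noteq> 0 \<and> (\<forall>w. dot (rep_proj_plane L) w = 0 \<longrightarrow>
     \<kappa>\<^sup>2 * (dot a w * dot b w) - 2 * \<kappa> * qf Q w + dot c w * dot d w = 0))"
  by (simp add: splitting_def conic_lines_def qf_pencil qf_symm)

text \<open>Four of the five roots are nonzero.  Two members of the family with a common line would
  force \<open>Q\<close>, \<open>a b\<close> and \<open>c d\<close> to have a common zero on it, so the pairs of lines are disjoint.\<close>

lemma splitting_card:
  assumes F: "\<And>w. quartic_eval F w = (qf Q w)\<^sup>2 - (dot a w * dot b w) * (dot c w * dot d w)"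
  shows "card (splitting Q a b c d) = 8" "\<And>L. L \<in> splitting Q a b c d \<Longrightarrow> bitangent F L"
proof -
  let ?A = "symm a b" and ?B = "symm c d"
  let ?p = "disc_poly ?A Q ?B" and ?M = "pencil ?A Q ?B"
  have FAB: "quartic_eval F w = (qf Q w)\<^sup>2 - qf ?A w * qf ?B w" for w
    unfolding F qf_symm ..
  have FA: "quartic_eval F w = (qf Q w)\<^sup>2 - qf ?A w * (dot c w * dot d w)" for w
    unfolding F qf_symm ..
  define R where "R = {\<kappa>. poly ?p \<kappa> = 0} - {0}"
  have "crossp c d \<noteq> 0" using factors_independent[OF FA] .
  moreover have "grad (?M 0) (crossp c d) = 0"
    by (simp add: vec3_eq_iff symm_def pencil_def field_simps)
  ultimately have "poly ?p 0 = 0" unfolding poly_disc_poly disc_eq_0_iff by blast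
  moreover have c5: "card {\<kappa>. poly ?p \<kappa> = 0} = 5" using pencil_roots[OF FAB] .
  moreover have fin0: "finite {\<kappa>. poly ?p \<kappa> = 0}" using c5 card.infinite by fastforce
  ultimately have R: "card R = 4" "finite R" unfolding R_def by simp_all
  have split: "splitting Q a b c d = (\<Union>\<kappa>\<in>R. conic_lines (?M \<kappa>))"
    unfolding splitting_def R_def poly_disc_poly using conic_lines_disc by blast
  have two: "card (conic_lines (?M \<kappa>)) = 2 \<and> (\<forall>L \<in> conic_lines (?M \<kappa>). bitangent F L)" if "\<kappa> \<in> R" for \<kappa>
  proof -
    have "poly ?p \<kappa> = 0" using that by (simp add: R_def)
    then obtain m1 m2 where m: "crossp m1 m2 \<noteq> 0" "\<And>w. qf (?M \<kappa>) w = dot m1 w * dot m2 w"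
      using pencil_singular_member(1)[OF FAB] by blast
    have 1: "quartic_eval F w = (qf (\<lambda>i. 1 * Q i + (- \<kappa>) * ?A i) w)\<^sup>2 - qf ?A w * (dot m1 w * dot m2 w)" for w
      using pencil_decomposition[OF FAB, of w \<kappa>] unfolding m .
    have 2: "quartic_eval F w = (qf (\<lambda>i. 1 * Q i + (- \<kappa>) * ?A i) w)\<^sup>2 - qf ?A w * (dot m2 w * dot m1 w)" for w
      using 1[of w] by (simp add: mult.commute)
    show ?thesis
      using conic_lines_product[OF m(2,1)] bitangent_of_decomposition[OF 1] bitangent_of_decomposition[OF 2] by auto
  qed
  then show "bitangent F L" if "L \<in> splitting Q a b c d" for L using that unfolding split by blast
  have disj: "conic_lines (?M \<kappa>) \<inter> conic_lines (?M \<kappa>') = {}" if "\<kappa> \<noteq> \<kappa>'" for \<kappa> \<kappa>'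
  proof (rule ccontr)
    assume "conic_lines (?M \<kappa>) \<inter> conic_lines (?M \<kappa>') \<noteq> {}"
    then obtain L where L: "L \<in> conic_lines (?M \<kappa>)" "L \<in> conic_lines (?M \<kappa>')" by blast
    obtain w where w: "w \<noteq> 0" "dot (rep_proj_plane L) w = 0" "qf ?A w = 0"
      using conic_zero_on_line[OF rep_nonzero] by blast
    then have "qf ?B w = 2 * \<kappa> * qf Q w" "qf ?B w = 2 * \<kappa>' * qf Q w"
      using L unfolding conic_lines_def by (auto simp: qf_pencil)
    then have "qf Q w = 0" "qf ?B w = 0" using that by auto
    then show False using no_common_zero[OF FAB w(1) _ w(3)] by blast
  qed
  have "card (splitting Q a b c d) = (\<Sum>\<kappa>\<in>R. card (conic_lines (?M \<kappa>)))"
    unfolding split using disj R(2) two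
    by (intro card_UN_disjoint) (auto intro: card_ge_0_finite)
  also have "\<dots> = 8" using two R(1) by simp
  finally show "card (splitting Q a b c d) = 8" .
qed

text \<open>If one of the four forms vanishes on the line, then on it the equation of the family is a relation
  between \<open>Q\<close> and the other product, which produces a common zero of \<open>Q\<close>, \<open>a b\<close> and \<open>c d\<close>.\<close>

lemma splitting_no_factor:
  assumes F: "\<And>w. quartic_eval F w = (qf Q w)\<^sup>2 - (dot a w * dot b w) * (dot c w * dot d w)"
    and L: "L \<in> splitting Q a b c d" and m: "m \<in> {a, b, c, d}"
  shows "\<exists>w. dot (rep_proj_plane L) w = 0 \<and> dot m w \<noteq> 0"
proof (rule ccontr)
  assume "\<not> ?thesis"
  then have m0: "dot m w = 0" if "dot (rep_proj_plane L) w = 0" for w using that by blast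
  have FAB: "quartic_eval F w = (qf Q w)\<^sup>2 - qf (symm a b) w * qf (symm c d) w" for w
    unfolding F qf_symm ..
  obtain \<kappa> where \<kappa>: "\<kappa> \<noteq> 0" "\<And>w. dot (rep_proj_plane L) w = 0 \<Longrightarrow>
     \<kappa>\<^sup>2 * qf (symm a b) w - 2 * \<kappa> * qf Q w + qf (symm c d) w = 0"
    using L unfolding in_splitting_iff qf_symm by blast
  obtain w where w: "w \<noteq> 0" "dot (rep_proj_plane L) w = 0" "qf (symm a b) w = 0" "qf (symm c d) w = 0"
  proof (cases "m \<in> {a, b}")
    case True
    obtain w where "w \<noteq> 0" "dot (rep_proj_plane L) w = 0" "qf (symm c d) w = 0"
      using conic_zero_on_line[OF rep_nonzero] by blast
    then show thesis using that m0 True by (auto simp: qf_symm)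
  next
    case False
    obtain w where "w \<noteq> 0" "dot (rep_proj_plane L) w = 0" "qf (symm a b) w = 0"
      using conic_zero_on_line[OF rep_nonzero] by blast
    then show thesis using that m0 m False by (auto simp: qf_symm)
  qed
  then have "qf Q w = 0" using \<kappa>(2)[OF w(2)] \<kappa>(1) by simp
  then show False using no_common_zero[OF FAB] w by blast
qed

text \<open>If a line belonged to the families of two pairings, then two of the four lines would meet on
  it, in a zero of \<open>Q\<close>.\<close>

lemma splitting_disjoint:
  assumes F: "\<And>w. quartic_eval F w = (qf Q w)\<^sup>2 - (dot a w * dot b w) * (dot c w * dot d w)"
  shows "splitting Q a b c d \<inter> splitting Q a c b d = {}"
proof (rule ccontr)
  assume "splitting Q a b c d \<inter> splitting Q a c b d \<noteq> {}"
  then obtain L where L: "L \<in> splitting Q a b c d" "L \<in> splitting Q a c b d" by blast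
  let ?l = "rep_proj_plane L"
  obtain \<kappa> where \<kappa>: "\<kappa> \<noteq> 0" "\<And>w. dot ?l w = 0 \<Longrightarrow>
     \<kappa>\<^sup>2 * (dot a w * dot b w) - 2 * \<kappa> * qf Q w + dot c w * dot d w = 0"
    using L(1) unfolding in_splitting_iff by blast
  obtain \<mu> where \<mu>: "\<mu> \<noteq> 0" "\<And>w. dot ?l w = 0 \<Longrightarrow>
     \<mu>\<^sup>2 * (dot a w * dot c w) - 2 * \<mu> * qf Q w + dot b w * dot d w = 0"
    using L(2) unfolding in_splitting_iff by blast
  obtain u v where uv: "crossp u v = ?l" using exists_kernel_basis[OF rep_nonzero] by blast
  have Luv: "dot ?l (s *s u + t *s v) = 0" for s t using uv by (metis dot_crossp dot_linear(1,3) mult_zero_right add_0)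
  define res where "res m = (dot m u, dot m v)" for m
  have res: "dot m (s *s u + t *s v) = lf (res m) s t" for m s t
    by (simp add: res_def lf_def dot_linear mult.commute)
  have onL: "\<exists>s t. w = s *s u + t *s v" if "dot ?l w = 0" for w
    using kernel_span[OF rep_nonzero _ _ _ that, of u v] uv dot_crossp[of u v] by simp
  define m m' where "m = \<kappa> *s b + (- \<mu>) *s c" and "m' = (\<kappa> * \<mu>) *s a + (- 1) *s d"
  have mm: "dot m w * dot m' w = 0" if "dot ?l w = 0" for w
  proof -
    have "dot m w * dot m' w = \<mu> * (\<kappa>\<^sup>2 * (dot a w * dot b w) - 2 * \<kappa> * qf Q w + dot c w * dot d w)
        - \<kappa> * (\<mu>\<^sup>2 * (dot a w * dot c w) - 2 * \<mu> * qf Q w + dot b w * dot d w)"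
      unfolding m_def m'_def by (simp add: dot_linear dot_diff_left power2_eq_square algebra_simps)
    then show ?thesis using \<kappa>(2)[OF that] \<mu>(2)[OF that] by simp
  qed
  have "res m = 0 \<or> res m' = 0"
  proof (rule ccontr)
    assume "\<not> ?thesis"
    then obtain s t where "lf (res m) s t \<noteq> 0" "lf (res m') s t \<noteq> 0"
      using exists_nonroot[of "{res m, res m'}"] by auto
    then show False using mm[OF Luv[of s t]] unfolding res by simp
  qed
  then have "(\<forall>w. dot ?l w = 0 \<longrightarrow> dot m w = 0) \<or> (\<forall>w. dot ?l w = 0 \<longrightarrow> dot m' w = 0)"
    using onL res by (metis lf_def add_0 fst_zero mult_zero_left snd_zero)
  then show False
  proof
    assume m: "\<forall>w. dot ?l w = 0 \<longrightarrow> dot m w = 0"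
    obtain w where w: "w \<noteq> 0" "dot ?l w = 0" "qf (symm b b) w = 0"
      using conic_zero_on_line[OF rep_nonzero] by blast
    then have b: "dot b w = 0" by (simp add: qf_symm)
    moreover have c: "dot c w = 0" using m w(2) b \<mu>(1) by (auto simp: m_def dot_linear dot_diff_left)
    moreover have "qf Q w = 0" using \<kappa>(2)[OF w(2)] \<kappa>(1) b c by simp
    moreover have "quartic_eval F w = (qf Q w)\<^sup>2 - qf (symm a d) w * (dot b w * dot c w)" for w
      unfolding F qf_symm by (simp add: mult_ac)
    ultimately show False using no_triple_point[of Q "symm a d" b c w] w(1) by blast
  next
    assume m: "\<forall>w. dot ?l w = 0 \<longrightarrow> dot m' w = 0"
    obtain w where w: "w \<noteq> 0" "dot ?l w = 0" "qf (symm a a) w = 0"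
      using conic_zero_on_line[OF rep_nonzero] by blast
    then have a: "dot a w = 0" by (simp add: qf_symm)
    moreover have d: "dot d w = 0" using m w(2) a by (auto simp: m'_def dot_linear dot_diff_left)
    moreover have "qf Q w = 0" using \<kappa>(2)[OF w(2)] \<kappa>(1) a d by simp
    moreover have "quartic_eval F w = (qf Q w)\<^sup>2 - qf (symm b c) w * (dot a w * dot d w)" for w
      unfolding F qf_symm by (simp add: mult_ac)
    ultimately show False using no_triple_point[of Q "symm b c" a d w] w(1) by blast
  qed
qed

text \<open>On the line the quartic is a square \<open>q\<^sup>2\<close>, so \<open>U = Q - q\<close> and \<open>V = Q + q\<close> have the product of the four
  forms as their product and \<open>2 Q\<close> as their sum.  By unique factorization \<open>{U, V}\<close> is
  \<open>{K l1 m, n p / K}\<close> for one of the pairings, and the sum, multiplied by \<open>K\<close>, is the equation of the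
  family at \<open>\<kappa> = K\<close>.\<close>

lemma bitangent_in_splitting:
  assumes F: "\<And>w. quartic_eval F w = (qf Q w)\<^sup>2 - (dot l1 w * dot l2 w) * (dot l3 w * dot l4 w)"
    and nz: "l1 \<noteq> 0" "l2 \<noteq> 0" "l3 \<noteq> 0" "l4 \<noteq> 0"
    and bit: "bitangent F L"
    and L: "L \<notin> {abs_proj_plane l1, abs_proj_plane l2, abs_proj_plane l3, abs_proj_plane l4}"
  shows "L \<in> splitting Q l1 l2 l3 l4 \<union> splitting Q l1 l3 l2 l4 \<union> splitting Q l1 l4 l2 l3"
proof -
  let ?l = "rep_proj_plane L"
  obtain u v where uv: "crossp u v = ?l" using exists_kernel_basis[OF rep_nonzero] by blast
  interpret line_basis L u v by unfold_locales (insert dot_crossp[of u v] uv, simp_all)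
  define res where "res m = (dot m u, dot m v)" for m
  have res: "dot m (s *s u + t *s v) = lf (res m) s t" for m s t
    by (simp add: res_def lf_def dot_linear mult.commute)
  have res_nz: "res m \<noteq> 0" if m: "m \<noteq> 0" "L \<noteq> abs_proj_plane m" for m
  proof
    assume "res m = 0"
    then have "dot m u = 0" "dot m v = 0" by (simp_all add: res_def zero_prod_def)
    then obtain c where c: "crossp u v = c *s m" using crossp_parallel[OF m(1)] by blast
    then have "c \<noteq> 0" using indep by auto
    then have "abs_proj_plane ?l = abs_proj_plane m" unfolding uv[symmetric] c using m(1) by (rule abs_smult)
    then show False using m(2) by simp
  qed
  define r1 r2 r3 r4 where r: "r1 = res l1" "r2 = res l2" "r3 = res l3" "r4 = res l4"
  have rnz: "r1 \<noteq> 0" "r2 \<noteq> 0" "r3 \<noteq> 0" "r4 \<noteq> 0" using res_nz nz L unfolding r by auto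
  obtain \<alpha> \<beta> \<gamma> where h: "\<And>s t. quartic_eval F (s *s u + t *s v) = (\<alpha> * s\<^sup>2 + \<beta> * s * t + \<gamma> * t\<^sup>2)\<^sup>2"
    using bit unfolding bitangent_iff by blast
  define q0 q1 q2 where q: "q0 = qf Q u" "q1 = 2 * dot (grad Q u) v" "q2 = qf Q v"
  have Q: "qf Q (s *s u + t *s v) = q0 * s\<^sup>2 + q1 * s * t + q2 * t\<^sup>2" for s t
    unfolding qf_comb q ..
  define U V where "U s t = (q0 - \<alpha>) * s\<^sup>2 + (q1 - \<beta>) * s * t + (q2 - \<gamma>) * t\<^sup>2"
    and "V s t = (q0 + \<alpha>) * s\<^sup>2 + (q1 + \<beta>) * s * t + (q2 + \<gamma>) * t\<^sup>2" for s t
  have sum: "U s t + V s t = 2 * qf Q (s *s u + t *s v)" for s t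
    unfolding Q U_def V_def by (simp add: algebra_simps)
  have prod: "U s t * V s t = lf r1 s t * lf r2 s t * lf r3 s t * lf r4 s t" for s t
  proof -
    have "U s t * V s t = (q0 * s\<^sup>2 + q1 * s * t + q2 * t\<^sup>2)\<^sup>2 - (\<alpha> * s\<^sup>2 + \<beta> * s * t + \<gamma> * t\<^sup>2)\<^sup>2"
      unfolding U_def V_def by (simp add: power2_eq_square algebra_simps)
    also have "\<dots> = (qf Q (s *s u + t *s v))\<^sup>2 - quartic_eval F (s *s u + t *s v)" unfolding Q h ..
    also have "\<dots> = lf r1 s t * lf r2 s t * lf r3 s t * lf r4 s t" unfolding F res r by (simp add: mult_ac)
    finally show ?thesis .
  qed
  obtain s0 t0 where "lf r1 s0 t0 * lf r2 s0 t0 * lf r3 s0 t0 * lf r4 s0 t0 \<noteq> 0"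
    using exists_nonroot[of "{r1, r2, r3, r4}"] rnz by auto
  then have UV0: "U s0 t0 \<noteq> 0" "V s0 t0 \<noteq> 0" unfolding prod[symmetric] by auto
  have "(q0 - \<alpha>, q1 - \<beta>, q2 - \<gamma>) \<noteq> (0, 0, 0)" using UV0(1) unfolding U_def by auto
  from binary_quadratic_factor[OF this] obtain a b where ab: "a \<noteq> 0" "b \<noteq> 0" "\<And>s t. U s t = lf a s t * lf b s t"
    unfolding U_def by blast
  have "(q0 + \<alpha>, q1 + \<beta>, q2 + \<gamma>) \<noteq> (0, 0, 0)" using UV0(2) unfolding V_def by auto
  from binary_quadratic_factor[OF this] obtain c d where cd: "c \<noteq> 0" "d \<noteq> 0" "\<And>s t. V s t = lf c s t * lf d s t"
    unfolding V_def by blast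
  define \<sigma> \<tau> where st: "\<sigma> = snd r1" "\<tau> = - fst r1"
  have r10: "lf r1 \<sigma> \<tau> = 0" by (simp add: st lf_def)
  have st0: "(\<sigma>, \<tau>) \<noteq> (0, 0)" using rnz(1) by (auto simp: st prod_eq_iff)
  have "lf a \<sigma> \<tau> = 0 \<or> lf b \<sigma> \<tau> = 0 \<or> lf c \<sigma> \<tau> = 0 \<or> lf d \<sigma> \<tau> = 0"
    using prod[of \<sigma> \<tau>] r10 unfolding ab(3) cd(3) by simp
  moreover have concl: "\<exists>K m n p. K \<noteq> 0 \<and> (m, n, p) \<in> {(r2, r3, r4), (r3, r2, r4), (r4, r2, r3)} \<and>
      (\<forall>s t. lf a s t * lf b s t = K * (lf r1 s t * lf m s t) \<and> K * (lf c s t * lf d s t) = lf n s t * lf p s t)"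
    if x: "lf a \<sigma> \<tau> = 0" and n: "a \<noteq> 0" "b \<noteq> 0" "c \<noteq> 0" "d \<noteq> 0"
      and e: "\<And>s t. lf a s t * lf b s t * (lf c s t * lf d s t) = U s t * V s t" for a b c d
  proof -
    obtain k where "\<And>s t. lf a s t = k * lf r1 s t" using lf_parallel[OF rnz(1) st0 r10 x] by blast
    from product_pairs[OF n rnz _ this] show ?thesis using e prod by simp
  qed
  ultimately have "\<exists>K m n p. K \<noteq> 0 \<and> (m, n, p) \<in> {(r2, r3, r4), (r3, r2, r4), (r4, r2, r3)} \<and>
      (\<forall>s t. K * (U s t + V s t) = K\<^sup>2 * (lf r1 s t * lf m s t) + lf n s t * lf p s t)"
  proof (elim disjE)
    assume "lf a \<sigma> \<tau> = 0"
    from concl[OF this ab(1,2) cd(1,2)] show ?thesis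
      unfolding ab(3) cd(3) by (simp only: distrib_left power2_eq_square mult.assoc) metis
  next
    assume "lf b \<sigma> \<tau> = 0"
    from concl[OF this ab(2,1) cd(1,2)] show ?thesis
      unfolding ab(3) cd(3) mult.commute[of "lf a _ _"] by (simp only: distrib_left power2_eq_square mult.assoc) metis
  next
    assume "lf c \<sigma> \<tau> = 0"
    from concl[OF this cd(1,2) ab(1,2)] show ?thesis
      unfolding ab(3) cd(3) mult.commute[of "_ * _" "lf a _ _ * _"] add.commute[of "lf a _ _ * _"]
      by (simp only: distrib_left power2_eq_square mult.assoc) metis
  next
    assume "lf d \<sigma> \<tau> = 0"
    from concl[OF this cd(2,1) ab(1,2)] show ?thesis
      unfolding ab(3) cd(3) mult.commute[of "lf c _ _"] mult.commute[of "_ * _" "lf a _ _ * _"] add.commute[of "lf a _ _ * _"]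
      by (simp only: distrib_left power2_eq_square mult.assoc) metis
  qed
  then obtain K m n p where K: "K \<noteq> 0" and mnp: "(m, n, p) \<in> {(r2, r3, r4), (r3, r2, r4), (r4, r2, r3)}"
    and e: "\<And>s t. K * (U s t + V s t) = K\<^sup>2 * (lf r1 s t * lf m s t) + lf n s t * lf p s t" by metis
  have onL: "\<exists>s t. w = s *s u + t *s v" if "dot ?l w = 0" for w
    using kernel_span[OF rep_nonzero u v indep that] .
  have "L \<in> splitting Q l1 m' n' p'" if "m = res m'" "n = res n'" "p = res p'" for m' n' p'
    unfolding in_splitting_iff
  proof (intro exI[of _ K] conjI allI impI K)
    fix w assume "dot ?l w = 0"
    then obtain s t where w: "w = s *s u + t *s v" using onL by blast
    show "K\<^sup>2 * (dot l1 w * dot m' w) - 2 * K * qf Q w + dot n' w * dot p' w = 0"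
      using e[of s t] unfolding sum w res that r by (simp add: algebra_simps)
  qed
  then show ?thesis using mnp unfolding r by auto
qed

text \<open>Four bitangents whose product differs from the quartic by a square account for all others:
  every further bitangent splits their eight points of tangency along one of the three pairings,
  and each pairing contributes two lines for each of four values of the parameter.\<close>

lemma card_bitangents_of_tetrad:
  assumes F: "\<And>w. quartic_eval F w = (qf Q w)\<^sup>2 - (dot l1 w * dot l2 w) * (dot l3 w * dot l4 w)"
  shows "card {L. bitangent F L} = 28"
proof -
  have F13: "quartic_eval F w = (qf Q w)\<^sup>2 - (dot l1 w * dot l3 w) * (dot l2 w * dot l4 w)" for w
    unfolding F by (simp add: mult_ac)
  have F14: "quartic_eval F w = (qf Q w)\<^sup>2 - (dot l1 w * dot l4 w) * (dot l2 w * dot l3 w)" for w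
    unfolding F by (simp add: mult_ac)
  have dec: "crossp a b \<noteq> 0 \<and> bitangent F (abs_proj_plane a)"
    if "\<And>w. dot l1 w * dot l2 w * (dot l3 w * dot l4 w) = dot c w * dot d w * (dot a w * dot b w)" for a b c d
  proof -
    have "quartic_eval F w = (qf Q w)\<^sup>2 - qf (symm c d) w * (dot a w * dot b w)" for w
      unfolding F that qf_symm ..
    then show ?thesis using factors_independent bitangent_of_decomposition by blast
  qed
  have ind: "crossp l1 l2 \<noteq> 0" "crossp l1 l3 \<noteq> 0" "crossp l1 l4 \<noteq> 0" "crossp l2 l3 \<noteq> 0" "crossp l2 l4 \<noteq> 0"
    "crossp l3 l4 \<noteq> 0"
    using dec[of l3 l4 l1 l2] dec[of l2 l4 l1 l3] dec[of l2 l3 l1 l4] dec[of l1 l4 l2 l3] dec[of l1 l3 l2 l4]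
      dec[of l1 l2 l3 l4] by (simp_all add: mult_ac)
  have nz: "l1 \<noteq> 0" "l2 \<noteq> 0" "l3 \<noteq> 0" "l4 \<noteq> 0" using ind by auto
  let ?T = "{abs_proj_plane l1, abs_proj_plane l2, abs_proj_plane l3, abs_proj_plane l4}"
  have ne: "abs_proj_plane a \<noteq> abs_proj_plane b" if "crossp a b \<noteq> 0" "a \<noteq> 0" "b \<noteq> 0" for a b :: "complex ^ 3"
    using that crossp_eq_0_iff[OF that(2)] by (simp add: abs_eq_iff)
  have T: "card ?T = 4" using ne ind nz by simp
  have Tbit: "bitangent F L" if "L \<in> ?T" for L
    using that dec[of l3 l4 l1 l2] dec[of l3 l4 l2 l1] dec[of l1 l2 l3 l4] dec[of l1 l2 l4 l3]
    by (auto simp: mult_ac)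
  let ?G1 = "splitting Q l1 l2 l3 l4" and ?G2 = "splitting Q l1 l3 l2 l4" and ?G3 = "splitting Q l1 l4 l2 l3"
  note c1 = splitting_card[OF F] and c2 = splitting_card[OF F13] and c3 = splitting_card[OF F14]
  have all: "{L. bitangent F L} = ?T \<union> (?G1 \<union> ?G2 \<union> ?G3)"
    using bitangent_in_splitting[OF F nz] Tbit c1(2) c2(2) c3(2) by blast
  have swap: "splitting Q a b c d = splitting Q a b d c" for a b c d
  proof -
    have "symm c d = symm d c" by (simp add: symm_def fun_eq_iff mult.commute add.commute)
    then show ?thesis by (simp add: splitting_def)
  qed
  have d12: "?G1 \<inter> ?G2 = {}" using splitting_disjoint[OF F] .
  have "quartic_eval F w = (qf Q w)\<^sup>2 - (dot l1 w * dot l2 w) * (dot l4 w * dot l3 w)" for w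
    unfolding F by (simp add: mult_ac)
  from splitting_disjoint[OF this] have d13: "?G1 \<inter> ?G3 = {}" unfolding swap[of l1 l2 l4 l3] .
  have "quartic_eval F w = (qf Q w)\<^sup>2 - (dot l1 w * dot l3 w) * (dot l4 w * dot l2 w)" for w
    unfolding F by (simp add: mult_ac)
  from splitting_disjoint[OF this] have d23: "?G2 \<inter> ?G3 = {}"
    unfolding swap[of l1 l3 l4 l2] swap[of l1 l4 l3 l2] .
  have onT: "\<exists>m\<in>{l1, l2, l3, l4}. \<forall>w. dot (rep_proj_plane L) w = 0 \<longrightarrow> dot m w = 0" if L: "L \<in> ?T" for L
  proof -
    obtain m where m: "m \<in> {l1, l2, l3, l4}" "L = abs_proj_plane m" using L by auto
    then have "m \<noteq> 0" using nz by auto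
    then obtain c where "c \<noteq> 0" "rep_proj_plane L = c *s m" using rep_abs m(2) by blast
    then show ?thesis using m(1) by (intro bexI[of _ m]) (auto simp: dot_linear)
  qed
  have dT: "?T \<inter> (?G1 \<union> ?G2 \<union> ?G3) = {}"
  proof (rule ccontr)
    assume "\<not> ?thesis"
    then obtain L where L: "L \<in> ?T" "L \<in> ?G1 \<or> L \<in> ?G2 \<or> L \<in> ?G3" by blast
    obtain m where m: "m \<in> {l1, l2, l3, l4}" "\<And>w. dot (rep_proj_plane L) w = 0 \<Longrightarrow> dot m w = 0"
      using onT[OF L(1)] by blast
    have "m \<in> {l1, l3, l2, l4}" "m \<in> {l1, l4, l2, l3}" using m(1) by auto
    then show False
      using L(2) splitting_no_factor[OF F _ m(1), of L] splitting_no_factor[OF F13, of L m]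
        splitting_no_factor[OF F14, of L m] m(2) by blast
  qed
  have fin: "finite ?G1" "finite ?G2" "finite ?G3"
    using c1(1) c2(1) c3(1) by (auto intro: card_ge_0_finite)
  have "card (?G1 \<union> ?G2 \<union> ?G3) = 24"
  proof -
    have "card (?G1 \<union> ?G2) = 16" using card_Un_disjoint[OF fin(1,2) d12] c1(1) c2(1) by simp
    moreover have "(?G1 \<union> ?G2) \<inter> ?G3 = {}" using d13 d23 by blast
    ultimately show ?thesis using card_Un_disjoint[of "?G1 \<union> ?G2" ?G3] fin c3(1) by simp
  qed
  moreover have "finite ?T" "finite (?G1 \<union> ?G2 \<union> ?G3)" using fin by simp_all
  ultimately show ?thesis unfolding all using card_Un_disjoint[OF _ _ dT] T by presburger
qed

end

lemma binary_quartic_coeffs_eq: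
  fixes c0 :: "'a::{idom,ring_char_0}"
  assumes "\<And>s t. c0 * t^4 + c1 * s * t^3 + c2 * s^2 * t^2 + c3 * s^3 * t + c4 * s^4 =
    d0 * t^4 + d1 * s * t^3 + d2 * s^2 * t^2 + d3 * s^3 * t + d4 * s^4"
  shows "c0 = d0" "c1 = d1" "c2 = d2" "c3 = d3" "c4 = d4"
proof -
  have "poly [:c0, c1, c2, c3, c4:] s = poly [:d0, d1, d2, d3, d4:] s" for s
    using assms[of 1 s] by (simp add: eval_nat_numeral algebra_simps)
  then have "[:c0, c1, c2, c3, c4:] = [:d0, d1, d2, d3, d4:]"
    by (simp only: poly_eq_poly_eq_iff[symmetric] fun_eq_iff) simp
  then show "c0 = d0" "c1 = d1" "c2 = d2" "c3 = d3" "c4 = d4" by simp_all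
qed

context smooth_plane_quartic
begin

text \<open>The square roots of the quartic on the two lines agree at their intersection after a choice of
  sign, so one conic \<open>Q\<close> restricts to both; then \<open>f - Q\<^sup>2\<close> vanishes on both lines.\<close>

lemma decomposition_of_two_bitangents:
  assumes bit: "bitangent F L1" "bitangent F L2" and ne: "L1 \<noteq> L2"
  shows "\<exists>Q B l1 l2. \<forall>w. quartic_eval F w = (qf Q w)\<^sup>2 - (dot l1 w * dot l2 w) * qf B w"
proof -
  define l1 l2 where "l1 = rep_proj_plane L1" and "l2 = rep_proj_plane L2"
  have nz: "l1 \<noteq> 0" "l2 \<noteq> 0" by (simp_all add: l1_def l2_def)
  have "abs_proj_plane l1 \<noteq> abs_proj_plane l2" using ne by (simp add: l1_def l2_def)
  then have "crossp l1 l2 \<noteq> 0" using nz crossp_eq_0_iff[OF nz(1)] by (simp add: abs_eq_iff)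
  then obtain l0 where l0: "dot (crossp l1 l2) l0 = 1" using exists_dot_neq_0 by blast
  define e1 e2 e3 where "e1 = crossp l2 l0" and "e2 = crossp l0 l1" and "e3 = crossp l1 l2"
  have c: "crossp e2 e3 = l1" "crossp e3 e1 = l2" "crossp e1 e2 = l0" "dot l0 e3 = 1"
  proof -
    have d: "dot (crossp l0 l1) l2 = 1" "dot (crossp l2 l0) l1 = 1" "dot (crossp l1 l2) l0 = 1"
      using l0 by (simp_all add: dot_3 algebra_simps)
    show "crossp e2 e3 = l1" "crossp e3 e1 = l2" "crossp e1 e2 = l0"
      unfolding e1_def e2_def e3_def crossp_crossp using d by (simp_all add: dot_commute[of "crossp _ _"])
    show "dot l0 e3 = 1" unfolding e3_def using l0 by (simp add: dot_commute)
  qed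
  have w: "w = dot l1 w *s e1 + dot l2 w *s e2 + dot l0 w *s e3" for w
    using frame_expand[of e1 e2 e3 w] c by simp
  interpret A: line_basis L1 e2 e3
    by unfold_locales (use c nz dot_crossp[of e2 e3] in \<open>simp_all flip: l1_def\<close>)
  interpret B: line_basis L2 e1 e3
  proof
    have "crossp e1 e3 = - l2" unfolding c(2)[symmetric] by (simp add: vec3_eq_iff)
    then show "crossp e1 e3 \<noteq> 0" using nz by simp
  qed (use dot_crossp[of e3 e1] c in \<open>simp_all flip: l2_def\<close>)
  obtain \<alpha>1 \<beta>1 \<gamma>1 where h1: "\<And>s t. quartic_eval F (s *s e2 + t *s e3) = (\<alpha>1 * s\<^sup>2 + \<beta>1 * s * t + \<gamma>1 * t\<^sup>2)\<^sup>2"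
    using bit(1) unfolding A.bitangent_iff by blast
  obtain \<alpha>' \<beta>' \<gamma>' where h': "\<And>s t. quartic_eval F (s *s e1 + t *s e3) = (\<alpha>' * s\<^sup>2 + \<beta>' * s * t + \<gamma>' * t\<^sup>2)\<^sup>2"
    using bit(2) unfolding B.bitangent_iff by blast
  \<comment> \<open>Both squares have the same value at the intersection point, so the sign of one root can be
    chosen such that the roots agree there.\<close>
  have "\<gamma>1\<^sup>2 = \<gamma>'\<^sup>2" using h1[of 0 1] h'[of 0 1] by simp
  then consider "\<gamma>' = \<gamma>1" | "\<gamma>' = - \<gamma>1" by (auto simp: power2_eq_iff)
  then obtain \<alpha>2 \<beta>2 where h2: "\<And>s t. quartic_eval F (s *s e1 + t *s e3) = (\<alpha>2 * s\<^sup>2 + \<beta>2 * s * t + \<gamma>1 * t\<^sup>2)\<^sup>2"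
  proof cases
    case 1 then show thesis using that h' by blast
  next
    case 2
    have "(\<alpha>' * s\<^sup>2 + \<beta>' * s * t + \<gamma>' * t\<^sup>2)\<^sup>2 = ((- \<alpha>') * s\<^sup>2 + (- \<beta>') * s * t + \<gamma>1 * t\<^sup>2)\<^sup>2" for s t
      unfolding 2 by (simp add: power2_eq_square algebra_simps)
    then show thesis using that[of "- \<alpha>'" "- \<beta>'"] h' by simp
  qed
  have "subring (UNIV :: complex set)" by (simp add: subring_def)
  then obtain g where g: "\<And>x y z. quartic_eval F (x *s e1 + y *s e2 + z *s e3) = tern g x y z"
    using quartic_linear_subst[of UNIV F e1 e2 e3] by auto
  have g1: "g (0,0,4) = \<gamma>1\<^sup>2" "g (0,1,3) = 2 * \<beta>1 * \<gamma>1" "g (0,2,2) = \<beta>1\<^sup>2 + 2 * \<alpha>1 * \<gamma>1"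
    "g (0,3,1) = 2 * \<alpha>1 * \<beta>1" "g (0,4,0) = \<alpha>1\<^sup>2"
  proof -
    have "g (0,0,4) * t^4 + g (0,1,3) * s * t^3 + g (0,2,2) * s^2 * t^2 + g (0,3,1) * s^3 * t + g (0,4,0) * s^4 =
        \<gamma>1\<^sup>2 * t^4 + (2 * \<beta>1 * \<gamma>1) * s * t^3 + (\<beta>1\<^sup>2 + 2 * \<alpha>1 * \<gamma>1) * s^2 * t^2 + (2 * \<alpha>1 * \<beta>1) * s^3 * t + \<alpha>1\<^sup>2 * s^4" for s t
      using g[of 0 s t] h1[of s t] by (simp add: tern_expand eval_nat_numeral algebra_simps)
    from binary_quartic_coeffs_eq[OF this] show "g (0,0,4) = \<gamma>1\<^sup>2" "g (0,1,3) = 2 * \<beta>1 * \<gamma>1" "g (0,2,2) = \<beta>1\<^sup>2 + 2 * \<alpha>1 * \<gamma>1"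
      "g (0,3,1) = 2 * \<alpha>1 * \<beta>1" "g (0,4,0) = \<alpha>1\<^sup>2" .
  qed
  have g2: "g (1,0,3) = 2 * \<beta>2 * \<gamma>1" "g (2,0,2) = \<beta>2\<^sup>2 + 2 * \<alpha>2 * \<gamma>1"
    "g (3,0,1) = 2 * \<alpha>2 * \<beta>2" "g (4,0,0) = \<alpha>2\<^sup>2"
  proof -
    have "g (0,0,4) * t^4 + g (1,0,3) * s * t^3 + g (2,0,2) * s^2 * t^2 + g (3,0,1) * s^3 * t + g (4,0,0) * s^4 =
        \<gamma>1\<^sup>2 * t^4 + (2 * \<beta>2 * \<gamma>1) * s * t^3 + (\<beta>2\<^sup>2 + 2 * \<alpha>2 * \<gamma>1) * s^2 * t^2 + (2 * \<alpha>2 * \<beta>2) * s^3 * t + \<alpha>2\<^sup>2 * s^4" for s t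
      using g[of s 0 t] h2[of s t] by (simp add: tern_expand eval_nat_numeral algebra_simps)
    from binary_quartic_coeffs_eq[OF this] show "g (1,0,3) = 2 * \<beta>2 * \<gamma>1" "g (2,0,2) = \<beta>2\<^sup>2 + 2 * \<alpha>2 * \<gamma>1"
      "g (3,0,1) = 2 * \<alpha>2 * \<beta>2" "g (4,0,0) = \<alpha>2\<^sup>2" by simp_all
  qed
  have comb6: "\<exists>M. \<forall>w. qf M w =
      a * (dot l1 w)\<^sup>2 + b * (dot l2 w)\<^sup>2 + c * (dot l0 w)\<^sup>2 + d * (dot l2 w * dot l0 w) + e * (dot l1 w * dot l0 w)
      + k * (dot l1 w * dot l2 w)" for a b c d e k
  proof (intro exI allI)
    show "qf (\<lambda>i. 1 * (\<lambda>i. a * symm l1 l1 i + b * symm l2 l2 i) i + 1 * (\<lambda>i. 1 * (\<lambda>i. c * symm l0 l0 i + d * symm l2 l0 i) i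
      + 1 * (\<lambda>i. e * symm l1 l0 i + k * symm l1 l2 i) i) i) w =
      a * (dot l1 w)\<^sup>2 + b * (dot l2 w)\<^sup>2 + c * (dot l0 w)\<^sup>2 + d * (dot l2 w * dot l0 w) + e * (dot l1 w * dot l0 w)
      + k * (dot l1 w * dot l2 w)" for w
      unfolding qf_lincomb qf_symm by (simp add: power2_eq_square)
  qed
  obtain Q where Q: "\<And>w. qf Q w = \<alpha>2 * (dot l1 w)\<^sup>2 + \<alpha>1 * (dot l2 w)\<^sup>2 + \<gamma>1 * (dot l0 w)\<^sup>2
      + \<beta>1 * (dot l2 w * dot l0 w) + \<beta>2 * (dot l1 w * dot l0 w) + 0 * (dot l1 w * dot l2 w)"
    using comb6[of \<alpha>2 \<alpha>1 \<gamma>1 \<beta>1 \<beta>2 0] by blast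
  obtain B where B: "\<And>w. qf B w = - g (3,1,0) * (dot l1 w)\<^sup>2 + (- g (1,3,0)) * (dot l2 w)\<^sup>2
      + (2 * \<beta>1 * \<beta>2 - g (1,1,2)) * (dot l0 w)\<^sup>2
      + (2 * \<alpha>1 * \<beta>2 - g (1,2,1)) * (dot l2 w * dot l0 w) + (2 * \<alpha>2 * \<beta>1 - g (2,1,1)) * (dot l1 w * dot l0 w)
      + (2 * \<alpha>1 * \<alpha>2 - g (2,2,0)) * (dot l1 w * dot l2 w)"
    using comb6[of "- g (3,1,0)" "- g (1,3,0)" "2 * \<beta>1 * \<beta>2 - g (1,1,2)" "2 * \<alpha>1 * \<beta>2 - g (1,2,1)"
      "2 * \<alpha>2 * \<beta>1 - g (2,1,1)" "2 * \<alpha>1 * \<alpha>2 - g (2,2,0)"] by blast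
  have "quartic_eval F w = (qf Q w)\<^sup>2 - (dot l1 w * dot l2 w) * qf B w" for w
  proof -
    have "quartic_eval F w = tern g (dot l1 w) (dot l2 w) (dot l0 w)"
      using g w[of w] by metis
    also have "\<dots> = (qf Q w)\<^sup>2 - (dot l1 w * dot l2 w) * qf B w"
      unfolding tern_expand g1 g2 Q B by (simp add: eval_nat_numeral algebra_simps)
    finally show ?thesis .
  qed
  then show ?thesis by blast
qed

text \<open>A root of the discriminant polynomial turns a decomposition with two linear forms into one with
  four.\<close>

theorem card_bitangents:
  assumes bit: "bitangent F L1" "bitangent F L2" and ne: "L1 \<noteq> L2"
  shows "card {L. bitangent F L} = 28"
proof -
  obtain Q B l1 l2 where F: "\<And>w. quartic_eval F w = (qf Q w)\<^sup>2 - qf (symm l1 l2) w * qf B w"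
    using decomposition_of_two_bitangents[OF assms] unfolding qf_symm by blast
  have "{c. poly (disc_poly (symm l1 l2) Q B) c = 0} \<noteq> {}" using pencil_roots[OF F] by force
  then obtain c where c: "poly (disc_poly (symm l1 l2) Q B) c = 0" by blast
  obtain l3 l4 where m: "\<And>w. qf (pencil (symm l1 l2) Q B c) w = dot l3 w * dot l4 w"
    using pencil_singular_member(1)[OF F c] by blast
  show ?thesis
    using card_bitangents_of_tetrad[OF pencil_decomposition[OF F, of _ c, unfolded m qf_symm]] .
qed

end

section \<open>Winding numbers and signed zero counts on a cylinder\<close>

text \<open>The degree of a closed path around 0 on \<open>[0, 2 \<pi>]\<close>, through a continuous logarithm.  That the path
  has a logarithm, and so is continuous and avoids 0, is part of the predicate.\<close>

definition has_deg :: "(real \<Rightarrow> complex) \<Rightarrow> int \<Rightarrow> bool" where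
  "has_deg \<gamma> n \<longleftrightarrow> (\<exists>q. continuous_on {0..2 * pi} q \<and> (\<forall>t\<in>{0..2 * pi}. \<gamma> t = exp (q t)) \<and>
     q (2 * pi) - q 0 = of_int n * (2 * pi * \<i>))"

lemma has_degI:
  assumes "continuous_on {0..2 * pi} q" "\<And>t. t \<in> {0..2 * pi} \<Longrightarrow> \<gamma> t = exp (q t)"
    "q (2 * pi) - q 0 = of_int n * (2 * pi * \<i>)"
  shows "has_deg \<gamma> n"
  unfolding has_deg_def using assms by blast

lemma has_deg_0_const: "c \<noteq> 0 \<Longrightarrow> has_deg (\<lambda>_. c) 0"
  by (rule has_degI[of "\<lambda>_. Ln c"]) auto

lemma has_deg_exp: "has_deg (\<lambda>t. exp (c + of_int n * (\<i> * of_real t))) n"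
  by (rule has_degI[of "\<lambda>t. c + of_int n * (\<i> * of_real t)"]) (auto intro!: continuous_intros)

lemma has_deg_mult: "has_deg \<gamma> n \<Longrightarrow> has_deg \<delta> m \<Longrightarrow> has_deg (\<lambda>t. \<gamma> t * \<delta> t) (n + m)"
proof -
  assume "has_deg \<gamma> n" "has_deg \<delta> m"
  then obtain q r where
    q: "continuous_on {0..2 * pi} q" "\<And>t. t \<in> {0..2 * pi} \<Longrightarrow> \<gamma> t = exp (q t)"
       "q (2 * pi) - q 0 = of_int n * (2 * pi * \<i>)" and
    r: "continuous_on {0..2 * pi} r" "\<And>t. t \<in> {0..2 * pi} \<Longrightarrow> \<delta> t = exp (r t)"
       "r (2 * pi) - r 0 = of_int m * (2 * pi * \<i>)"
    unfolding has_deg_def by blast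
  have "(q (2 * pi) + r (2 * pi)) - (q 0 + r 0) = of_int (n + m) * (2 * pi * \<i>)"
    using q(3) r(3) by (simp add: algebra_simps)
  then show ?thesis
    using q r by (intro has_degI[of "\<lambda>t. q t + r t"]) (auto intro: continuous_on_add simp: exp_add)
qed

lemma has_deg_inverse: "has_deg \<gamma> n \<Longrightarrow> has_deg (\<lambda>t. inverse (\<gamma> t)) (- n)"
proof -
  assume "has_deg \<gamma> n"
  then obtain q where
    q: "continuous_on {0..2 * pi} q" "\<And>t. t \<in> {0..2 * pi} \<Longrightarrow> \<gamma> t = exp (q t)"
       "q (2 * pi) - q 0 = of_int n * (2 * pi * \<i>)"
    unfolding has_deg_def by blast
  have "- q (2 * pi) - - q 0 = of_int (- n) * (2 * pi * \<i>)"
    using q(3) by (simp add: algebra_simps)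
  then show ?thesis
    using q by (intro has_degI[of "\<lambda>t. - q t"]) (auto intro: continuous_on_minus simp: exp_minus)
qed

lemma has_deg_cnj: "has_deg \<gamma> n \<Longrightarrow> has_deg (\<lambda>t. cnj (\<gamma> t)) (- n)"
proof -
  assume "has_deg \<gamma> n"
  then obtain q where
    q: "continuous_on {0..2 * pi} q" "\<And>t. t \<in> {0..2 * pi} \<Longrightarrow> \<gamma> t = exp (q t)"
       "q (2 * pi) - q 0 = of_int n * (2 * pi * \<i>)"
    unfolding has_deg_def by blast
  have "cnj (q (2 * pi)) - cnj (q 0) = of_int (- n) * (2 * pi * \<i>)"
    using arg_cong[OF q(3), of cnj] by simp
  then show ?thesis
    using q by (intro has_degI[of "\<lambda>t. cnj (q t)"]) (auto intro!: continuous_intros simp: exp_cnj)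
qed

lemma has_deg_cong: "has_deg \<gamma> n \<Longrightarrow> (\<And>t. t \<in> {0..2 * pi} \<Longrightarrow> \<gamma> t = \<delta> t) \<Longrightarrow> has_deg \<delta> n"
  unfolding has_deg_def by metis

lemma has_deg_nonzero: "has_deg \<gamma> n \<Longrightarrow> t \<in> {0..2 * pi} \<Longrightarrow> \<gamma> t \<noteq> 0"
  unfolding has_deg_def by auto

lemma has_deg_continuous: "has_deg \<gamma> n \<Longrightarrow> continuous_on {0..2 * pi} \<gamma>"
proof -
  assume "has_deg \<gamma> n"
  then obtain q where
    q: "continuous_on {0..2 * pi} q" "\<And>t. t \<in> {0..2 * pi} \<Longrightarrow> \<gamma> t = exp (q t)"
    unfolding has_deg_def by blast
  show ?thesis
    by (rule continuous_on_eq[OF continuous_on_exp[OF q(1)]]) (simp add: q(2))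
qed

lemma has_deg_closed: "has_deg \<gamma> n \<Longrightarrow> \<gamma> (2 * pi) = \<gamma> 0"
proof -
  assume "has_deg \<gamma> n"
  then obtain q where
    q: "\<And>t. t \<in> {0..2 * pi} \<Longrightarrow> \<gamma> t = exp (q t)" "q (2 * pi) - q 0 = of_int n * (2 * pi * \<i>)"
    unfolding has_deg_def by blast
  have "exp (q (2 * pi)) = exp (q 0)"
    unfolding exp_eq using q(2) by (intro exI[of _ n]) (simp add: algebra_simps)
  then show ?thesis using q(1) by simp
qed

text \<open>Two logarithms of the same path differ by a continuous function with values in a discrete set.\<close>

lemma has_deg_unique:
  assumes "has_deg \<gamma> n" "has_deg \<gamma> m"
  shows "n = m"
proof -
  have "has_deg (\<lambda>t. \<gamma> t * inverse (\<gamma> t)) (n + - m)"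
    by (intro has_deg_mult has_deg_inverse assms)
  then have "has_deg (\<lambda>t. 1) (n + - m)"
    by (rule has_deg_cong) (use has_deg_nonzero[OF assms(1)] in auto)
  then obtain q where
    q: "continuous_on {0..2 * pi} q" "\<And>t. t \<in> {0..2 * pi} \<Longrightarrow> 1 = exp (q t)"
       "q (2 * pi) - q 0 = of_int (n + - m) * (2 * pi * \<i>)"
    unfolding has_deg_def by blast
  have "q constant_on {0..2 * pi}"
  proof (rule continuous_discrete_range_constant[OF _ q(1)])
    fix x assume x: "x \<in> {0..2 * pi}"
    have "1 \<le> norm (q y - q x)" if y: "y \<in> {0..2 * pi}" "q y \<noteq> q x" for y
    proof -
      have "exp (q y) = exp (q x)" using q(2)[OF x] q(2)[OF y(1)] by simp
      then obtain k :: int where k: "q y = q x + (of_int (2 * k) * pi) * \<i>"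
        unfolding exp_eq by auto
      then have "k \<noteq> 0" using y(2) by auto
      then have "1 \<le> \<bar>real_of_int k\<bar>" by linarith
      moreover have "norm (q y - q x) = \<bar>real_of_int k\<bar> * (2 * pi)"
        using k by (simp add: norm_mult)
      ultimately show ?thesis
        using mult_mono[of 1 "\<bar>real_of_int k\<bar>" 1 "2 * pi"] pi_gt3 by simp
    qed
    then show "\<exists>e>0. \<forall>y. y \<in> {0..2 * pi} \<and> q y \<noteq> q x \<longrightarrow> e \<le> norm (q y - q x)"
      by (intro exI[of _ 1]) auto
  qed auto
  then have "q (2 * pi) = q 0" unfolding constant_on_def by force
  then show ?thesis using q(3) by simp
qed

text \<open>The principal logarithm is continuous along the path.\<close>

lemma has_deg_Re_pos:
  assumes "continuous_on {0..2 * pi} \<gamma>" "\<gamma> (2 * pi) = \<gamma> 0" "\<And>t. t \<in> {0..2 * pi} \<Longrightarrow> Re (\<gamma> t) > 0"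
  shows "has_deg \<gamma> 0"
proof (rule has_degI[of "\<lambda>t. Ln (\<gamma> t)"])
  show "continuous_on {0..2 * pi} (\<lambda>t. Ln (\<gamma> t))"
    using assms by (intro continuous_on_Ln') (auto simp: complex_nonpos_Reals_iff dest: leD)
  show "\<gamma> t = exp (Ln (\<gamma> t))" if "t \<in> {0..2 * pi}" for t
    using assms(3)[OF that] by (subst exp_Ln) auto
qed (use assms in auto)

text \<open>The product of one path with the conjugate of the other stays in the right half plane, where
  it has degree 0.\<close>

lemma has_deg_perturb:
  assumes \<delta>: "has_deg \<delta> n" and \<gamma>: "continuous_on {0..2 * pi} \<gamma>" "\<gamma> (2 * pi) = \<gamma> 0"
    and pos: "\<And>t. t \<in> {0..2 * pi} \<Longrightarrow> Re (\<gamma> t * cnj (\<delta> t)) > 0"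
  shows "has_deg \<gamma> n"
proof -
  have "has_deg (\<lambda>t. \<gamma> t * cnj (\<delta> t)) 0"
    using has_deg_continuous[OF \<delta>] has_deg_closed[OF \<delta>] assms
    by (intro has_deg_Re_pos) (auto intro!: continuous_intros)
  from has_deg_mult[OF this has_deg_inverse[OF has_deg_cnj[OF \<delta>]]]
  have "has_deg (\<lambda>t. \<gamma> t * cnj (\<delta> t) * inverse (cnj (\<delta> t))) n" by simp
  then show ?thesis
    by (rule has_deg_cong) (use has_deg_nonzero[OF \<delta>] in auto)
qed

lemma has_deg_prod:
  "finite K \<Longrightarrow> (\<And>k. k \<in> K \<Longrightarrow> has_deg (\<gamma> k) (n k)) \<Longrightarrow> has_deg (\<lambda>t. \<Prod>k\<in>K. \<gamma> k t) (\<Sum>k\<in>K. n k)"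
  by (induction K rule: finite_induct) (auto intro: has_deg_mult has_deg_0_const)

text \<open>A nonvanishing periodic function on a strip has a logarithm, whose increment over a period
  does not depend on the position of the segment.\<close>

lemma has_deg_strip:
  fixes g :: "complex \<Rightarrow> complex"
  assumes cont: "continuous_on {z. a \<le> Re z \<and> Re z \<le> b \<and> 0 \<le> Im z \<and> Im z \<le> 2 * pi} g"
    and nz: "\<And>z. a \<le> Re z \<Longrightarrow> Re z \<le> b \<Longrightarrow> 0 \<le> Im z \<Longrightarrow> Im z \<le> 2 * pi \<Longrightarrow> g z \<noteq> 0"
    and per: "\<And>x. a \<le> x \<Longrightarrow> x \<le> b \<Longrightarrow> g (Complex x (2 * pi)) = g (Complex x 0)"
    and "a \<le> b"
  shows "\<exists>n. has_deg (\<lambda>t. g (Complex a t)) n \<and> has_deg (\<lambda>t. g (Complex b t)) n"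
proof -
  let ?S = "{z. a \<le> Re z \<and> Re z \<le> b \<and> 0 \<le> Im z \<and> Im z \<le> 2 * pi}"
  have "?S = cbox (Complex a 0) (Complex b (2 * pi))"
    by (auto simp: in_cbox_complex_iff)
  then have "contractible ?S" using convex_box(1) convex_imp_contractible by metis
  with cont obtain G where G: "continuous_on ?S G" "\<And>z. z \<in> ?S \<Longrightarrow> g z = exp (G z)"
    by (rule continuous_logarithm_on_contractible) (use nz in auto)
  have comp: "continuous_on A (\<lambda>t. G (Complex (u t) (v t)))"
    if "continuous_on A u" "continuous_on A v" "\<And>t. t \<in> A \<Longrightarrow> a \<le> u t \<and> u t \<le> b \<and> 0 \<le> v t \<and> v t \<le> 2 * pi"
    for A :: "real set" and u v
  proof (rule continuous_on_compose2[OF G(1)])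
    show "continuous_on A (\<lambda>t. Complex (u t) (v t))"
      using that(1,2) by (rule continuous_on_Complex)
  qed (use that(3) in auto)
  define d where "d x = G (Complex x (2 * pi)) - G (Complex x 0)" for x
  have dn: "\<exists>k::int. d x = of_int k * (2 * pi * \<i>)" if "x \<in> {a..b}" for x
  proof -
    have "exp (G (Complex x (2 * pi))) = exp (G (Complex x 0))"
      using per[of x] G(2)[of "Complex x (2 * pi)"] G(2)[of "Complex x 0"] that by simp
    then show ?thesis unfolding exp_eq d_def by (auto simp: algebra_simps)
  qed
  have "d constant_on {a..b}"
  proof (rule continuous_discrete_range_constant)
    show "continuous_on {a..b} d"
      unfolding d_def by (intro continuous_on_diff comp) (auto intro: continuous_intros)
    fix x assume x: "x \<in> {a..b}"
    have "1 \<le> norm (d y - d x)" if y: "y \<in> {a..b}" "d y \<noteq> d x" for y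
    proof -
      obtain j k :: int where jk: "d x = of_int j * (2 * pi * \<i>)" "d y = of_int k * (2 * pi * \<i>)"
        using dn x y by meson
      then have "k - j \<noteq> 0" using y(2) by auto
      then have "1 \<le> \<bar>real_of_int (k - j)\<bar>" by linarith
      moreover have "d y - d x = of_int (k - j) * (2 * pi * \<i>)"
        using jk by (simp add: algebra_simps)
      then have "norm (d y - d x) = \<bar>real_of_int (k - j)\<bar> * (2 * pi)"
        by (simp add: norm_mult del: of_int_diff)
      ultimately show ?thesis
        using mult_mono[of 1 "\<bar>real_of_int (k - j)\<bar>" 1 "2 * pi"] pi_gt3 by simp
    qed
    then show "\<exists>e>0. \<forall>y. y \<in> {a..b} \<and> d y \<noteq> d x \<longrightarrow> e \<le> norm (d y - d x)"
      by (intro exI[of _ 1]) auto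
  qed auto
  then have "d a = d b" using \<open>a \<le> b\<close> unfolding constant_on_def by force
  moreover obtain n :: int where n: "d a = of_int n * (2 * pi * \<i>)" using dn[of a] \<open>a \<le> b\<close> by auto
  ultimately have dd: "d x = of_int n * (2 * pi * \<i>)" if "x = a \<or> x = b" for x using that by auto
  have "has_deg (\<lambda>t. g (Complex x t)) n" if x: "x = a \<or> x = b" for x
  proof (rule has_degI[of "\<lambda>t. G (Complex x t)"])
    show "continuous_on {0..2 * pi} (\<lambda>t. G (Complex x t))"
      using x \<open>a \<le> b\<close> by (intro comp) (auto intro: continuous_intros)
  qed (use x \<open>a \<le> b\<close> G(2) dd[unfolded d_def] in auto)
  then show ?thesis by blast
qed

text \<open>The determinant of a real linear map of the complex plane.\<close>

definition jac :: "(complex \<Rightarrow> complex) \<Rightarrow> real" where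
  "jac A = Re (A 1) * Im (A \<i>) - Im (A 1) * Re (A \<i>)"

lemma real_linear_complex:
  fixes A :: "complex \<Rightarrow> complex"
  assumes "linear A"
  shows "A z = of_real (Re z) * A 1 + of_real (Im z) * A \<i>"
proof -
  have "z = Re z *\<^sub>R 1 + Im z *\<^sub>R \<i>" by (simp add: complex_eq_iff)
  then have "A z = A (Re z *\<^sub>R 1 + Im z *\<^sub>R \<i>)" by simp
  also have "\<dots> = Re z *\<^sub>R A 1 + Im z *\<^sub>R A \<i>"
    by (simp only: linear_add[OF assms] linear_scale[OF assms])
  finally show ?thesis by (simp add: scaleR_conv_of_real)
qed

text \<open>In the form \<open>A z = \<alpha> z + \<beta> cnj z\<close> the determinant is \<open>\<bar>\<alpha>\<bar>\<^sup>2 - \<bar>\<beta>\<bar>\<^sup>2\<close>, so its sign decides which of the two terms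
  dominates.\<close>

lemma has_deg_linear_image:
  assumes A: "linear A" and J: "jac A \<noteq> 0" and \<omega>: "has_deg \<omega> n"
  shows "has_deg (\<lambda>t. A (\<omega> t)) (if jac A > 0 then n else - n)"
proof -
  define \<alpha> \<beta> where "\<alpha> = (A 1 - \<i> * A \<i>) / 2" and "\<beta> = (A 1 + \<i> * A \<i>) / 2"
  have A_eq: "A z = \<alpha> * z + \<beta> * cnj z" for z
    unfolding real_linear_complex[OF A, of z] \<alpha>_def \<beta>_def
    by (simp add: complex_eq_iff field_simps)
  have J_eq: "jac A = (cmod \<alpha>)\<^sup>2 - (cmod \<beta>)\<^sup>2"
    unfolding jac_def \<alpha>_def \<beta>_def cmod_power2 by (simp add: power2_eq_square field_simps)
  have clo: "\<omega> (2 * pi) = \<omega> 0" by (rule has_deg_closed[OF \<omega>])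
  have cont: "continuous_on {0..2 * pi} (\<lambda>t. A (\<omega> t))"
    unfolding A_eq using has_deg_continuous[OF \<omega>] by (intro continuous_intros)
  have key: "Re ((u + v) * cnj u) > 0" if "cmod v < cmod u" for u v
  proof -
    have "Re ((u + v) * cnj u) = (cmod u)\<^sup>2 + Re (v * cnj u)"
      unfolding cmod_power2 by (simp add: power2_eq_square algebra_simps)
    moreover have "\<bar>Re (v * cnj u)\<bar> \<le> cmod v * cmod u"
      using abs_Re_le_cmod[of "v * cnj u"] by (simp add: norm_mult)
    moreover have "cmod v * cmod u < (cmod u)\<^sup>2"
      using mult_strict_right_mono[OF that order.strict_trans1[OF norm_ge_zero that]]
      by (simp add: power2_eq_square)
    ultimately show ?thesis by linarith
  qed
  show ?thesis
  proof (cases "jac A > 0")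
    case True
    then have lt: "cmod \<beta> < cmod \<alpha>" unfolding J_eq by (simp add: power2_less_imp_less)
    have "\<alpha> \<noteq> 0" using lt by auto
    have "has_deg (\<lambda>t. \<alpha> * \<omega> t) n"
      using has_deg_mult[OF has_deg_0_const[OF \<open>\<alpha> \<noteq> 0\<close>] \<omega>] by simp
    then have "has_deg (\<lambda>t. A (\<omega> t)) n"
    proof (rule has_deg_perturb[OF _ cont])
      fix t assume "t \<in> {0..2 * pi}"
      then have "cmod (\<beta> * cnj (\<omega> t)) < cmod (\<alpha> * \<omega> t)"
        using lt has_deg_nonzero[OF \<omega>] by (simp add: norm_mult)
      then show "0 < Re (A (\<omega> t) * cnj (\<alpha> * \<omega> t))" unfolding A_eq by (rule key)
    qed (simp add: clo)
    then show ?thesis using True by simp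
  next
    case False
    then have "(cmod \<alpha>)\<^sup>2 < (cmod \<beta>)\<^sup>2" using False J unfolding J_eq by linarith
    then have lt: "cmod \<alpha> < cmod \<beta>" by (simp add: power2_less_imp_less)
    have "\<beta> \<noteq> 0" using lt by auto
    have "has_deg (\<lambda>t. \<beta> * cnj (\<omega> t)) (- n)"
      using has_deg_mult[OF has_deg_0_const[OF \<open>\<beta> \<noteq> 0\<close>] has_deg_cnj[OF \<omega>]] by simp
    then have "has_deg (\<lambda>t. A (\<omega> t)) (- n)"
    proof (rule has_deg_perturb[OF _ cont])
      fix t assume "t \<in> {0..2 * pi}"
      then have "cmod (\<alpha> * \<omega> t) < cmod (\<beta> * cnj (\<omega> t))"
        using lt has_deg_nonzero[OF \<omega>] by (simp add: norm_mult)
      then show "0 < Re (A (\<omega> t) * cnj (\<beta> * cnj (\<omega> t)))"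
        unfolding A_eq add.commute[of "\<alpha> * _"] by (rule key)
    qed (simp add: clo)
    then show ?thesis using False by simp
  qed
qed

text \<open>One of the terms \<open>exp (z - k)\<close> and \<open>- 1\<close> dominates on the whole circle.\<close>

lemma has_deg_exp_minus_1:
  "Re k < b \<Longrightarrow> has_deg (\<lambda>t. exp (Complex b t - k) - 1) 1"
  "b < Re k \<Longrightarrow> has_deg (\<lambda>t. exp (Complex b t - k) - 1) 0"
proof -
  have eq: "Complex b t - k = (of_real b - k) + of_int 1 * (\<i> * of_real t)" for t
    by (simp add: complex_eq_iff)
  have cont: "continuous_on {0..2 * pi} (\<lambda>t. exp (Complex b t - k) - 1)"
    unfolding eq by (intro continuous_intros)
  have clo: "exp (Complex b (2 * pi) - k) - 1 = exp (Complex b 0 - k) - 1"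
  proof -
    have "Complex b (2 * pi) - k = (Complex b 0 - k) + 2 * of_real pi * \<i>"
      by (simp add: complex_eq_iff)
    then show ?thesis by (simp only: exp_add exp_two_pi_i) simp
  qed
  have cm: "cmod (exp (Complex b t - k)) = exp (b - Re k)" for t by simp
  {
    assume "Re k < b"
    have "has_deg (\<lambda>t. exp (Complex b t - k)) 1"
      using has_deg_exp[of "of_real b - k" 1] unfolding eq .
    then show "has_deg (\<lambda>t. exp (Complex b t - k) - 1) 1"
    proof (rule has_deg_perturb[OF _ cont clo])
      fix t
      let ?e = "exp (Complex b t - k)"
      have "Re ((?e - 1) * cnj ?e) = (cmod ?e)\<^sup>2 - Re ?e"
        unfolding cmod_power2 by (simp add: power2_eq_square algebra_simps)
      moreover have "cmod ?e > 1" unfolding cm using \<open>Re k < b\<close> by simp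
      then have "cmod ?e < (cmod ?e)\<^sup>2" by (simp add: power2_eq_square)
      moreover have "Re ?e \<le> cmod ?e" by (rule complex_Re_le_cmod)
      ultimately show "0 < Re ((?e - 1) * cnj ?e)" by linarith
    qed
  }
  {
    assume "b < Re k"
    have "has_deg (\<lambda>t. - 1) 0" by (rule has_deg_0_const) simp
    then show "has_deg (\<lambda>t. exp (Complex b t - k) - 1) 0"
    proof (rule has_deg_perturb[OF _ cont clo])
      fix t
      let ?e = "exp (Complex b t - k)"
      have "cmod ?e < 1" unfolding cm using \<open>b < Re k\<close> by simp
      moreover have "Re ?e \<le> cmod ?e" by (rule complex_Re_le_cmod)
      ultimately have "Re ?e < 1" by linarith
      then show "0 < Re ((?e - 1) * cnj (- 1))" by simp
    qed
  }
qed

lemma jac_inj: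
  assumes "linear A" "jac A \<noteq> 0"
  shows "inj A"
  unfolding linear_injective_0[OF assms(1)]
proof (intro allI impI)
  fix z assume "A z = 0"
  then have z: "of_real (Re z) * A 1 + of_real (Im z) * A \<i> = 0"
    using real_linear_complex[OF assms(1), of z] by simp
  have 1: "Re z * Re (A 1) + Im z * Re (A \<i>) = 0" using arg_cong[OF z, of Re] by simp
  have 2: "Re z * Im (A 1) + Im z * Im (A \<i>) = 0" using arg_cong[OF z, of Im] by simp
  have "Re z * jac A = (Re z * Re (A 1) + Im z * Re (A \<i>)) * Im (A \<i>) -
      (Re z * Im (A 1) + Im z * Im (A \<i>)) * Re (A \<i>)"
    unfolding jac_def by (simp add: algebra_simps)
  moreover have "Im z * jac A = (Re z * Im (A 1) + Im z * Im (A \<i>)) * Re (A 1) -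
      (Re z * Re (A 1) + Im z * Re (A \<i>)) * Im (A 1)"
    unfolding jac_def by (simp add: algebra_simps)
  ultimately have "Re z * jac A = 0" "Im z * jac A = 0" unfolding 1 2 by simp_all
  then show "z = 0" using assms(2) by (simp add: complex_eq_iff)
qed

lemma nondegenerate_zero_growth:
  fixes h :: "complex \<Rightarrow> complex"
  assumes h: "(h has_derivative A) (at a)" "h a = 0" and J: "jac A \<noteq> 0"
  shows "\<exists>c>0. eventually (\<lambda>z. c * cmod (z - a) \<le> cmod (h z)) (at a)"
proof -
  have lin: "linear A" using h(1) by (rule has_derivative_linear)
  then obtain c where c: "c > 0" "\<And>v. c * norm v \<le> norm (A v)"
    using linear_inj_bounded_below_pos[OF lin jac_inj[OF lin J]] by (metis mult.commute)
  have "((\<lambda>z. cmod (h z - h a - A (z - a)) / cmod (z - a)) \<longlongrightarrow> 0) (at a)"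
    using h(1) unfolding has_derivative_iff_norm by blast
  then have "eventually (\<lambda>z. cmod (h z - h a - A (z - a)) / cmod (z - a) < c / 2) (at a)"
    using c(1) by (intro order_tendstoD(2)) auto
  then have "eventually (\<lambda>z. c / 2 * cmod (z - a) \<le> cmod (h z)) (at a)"
    using eventually_neq_at_within[of a]
  proof (rule eventually_elim2)
    fix z assume z: "cmod (h z - h a - A (z - a)) / cmod (z - a) < c / 2" "z \<noteq> a"
    then have "cmod (h z - A (z - a)) \<le> c / 2 * cmod (z - a)"
      using h(2) by (simp add: divide_less_eq)
    moreover have "cmod (A (z - a)) \<le> cmod (h z) + cmod (h z - A (z - a))"
      by (metis norm_minus_commute norm_triangle_sub add.commute)
    ultimately show "c / 2 * cmod (z - a) \<le> cmod (h z)" using c(2)[of "z - a"] by linarith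
  qed
  then show ?thesis using c(1) by (intro exI[of _ "c / 2"]) auto
qed

text \<open>Two functions with the same nondegenerate linear part differ by a term of smaller order than
  either of them.\<close>

lemma nondegenerate_zero_ratio:
  fixes h k :: "complex \<Rightarrow> complex"
  assumes h: "(h has_derivative A) (at a)" "h a = 0"
    and k: "(k has_derivative A) (at a)" "k a = 0" and J: "jac A \<noteq> 0"
  shows "((\<lambda>z. h z / k z) \<longlongrightarrow> 1) (at a)"
proof -
  obtain c where c: "c > 0" "eventually (\<lambda>z. c * cmod (z - a) \<le> cmod (k z)) (at a)"
    using nondegenerate_zero_growth[OF k J] by blast
  have "((\<lambda>z. h z - k z) has_derivative (\<lambda>v. A v - A v)) (at a)"
    by (intro has_derivative_diff h k)
  then have "((\<lambda>z. cmod (h z - k z) / cmod (z - a)) \<longlongrightarrow> 0) (at a)"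
    unfolding has_derivative_iff_norm using h(2) k(2) by simp
  then have lim: "((\<lambda>z. cmod (h z - k z) / cmod (z - a) / c) \<longlongrightarrow> 0) (at a)"
    by (rule tendsto_divide_zero)
  have ne: "eventually (\<lambda>z. z \<noteq> a) (at a)" by (rule eventually_neq_at_within)
  have "((\<lambda>z. h z / k z - 1) \<longlongrightarrow> 0) (at a)"
  proof (rule Lim_null_comparison[OF _ lim])
    show "eventually (\<lambda>z. cmod (h z / k z - 1) \<le> cmod (h z - k z) / cmod (z - a) / c) (at a)"
      using c(2) ne
    proof (rule eventually_elim2)
      fix z assume z: "c * cmod (z - a) \<le> cmod (k z)" "z \<noteq> a"
      then have pos: "0 < c * cmod (z - a)" using c(1) by simp
      then have "k z \<noteq> 0" using z by auto
      then have "h z / k z - 1 = (h z - k z) / k z" by (simp add: diff_divide_distrib)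
      then have "cmod (h z / k z - 1) = cmod (h z - k z) / cmod (k z)" by (simp add: norm_divide)
      also have "\<dots> \<le> cmod (h z - k z) / (c * cmod (z - a))"
        by (rule frac_le[OF norm_ge_zero order.refl pos z(1)])
      finally show "cmod (h z / k z - 1) \<le> cmod (h z - k z) / cmod (z - a) / c"
        by (simp add: mult.commute)
    qed
  qed
  then show ?thesis by (rule LIM_zero_cancel)
qed


lemma eventually_exp_neq: "eventually (\<lambda>z. exp (z - k) \<noteq> 1) (at (a::complex))"
proof -
  have "((\<lambda>z. exp (z - k)) has_derivative (\<lambda>v. exp (a - k) * v)) (at a)"
    by (auto intro!: derivative_eq_intros)
  then have d: "((\<lambda>z. exp (z - k) - exp (a - k)) has_derivative (\<lambda>v. exp (a - k) * v)) (at a)"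
    by (auto intro!: derivative_eq_intros)
  have "jac (\<lambda>v. exp (a - k) * v) = (cmod (exp (a - k)))\<^sup>2"
    unfolding jac_def cmod_power2 by (simp add: power2_eq_square)
  then have "jac (\<lambda>v. exp (a - k) * v) \<noteq> 0" by simp
  from nondegenerate_zero_growth[OF d _ this] obtain c where c: "c > 0"
    "eventually (\<lambda>z. c * cmod (z - a) \<le> cmod (exp (z - k) - exp (a - k))) (at a)" by auto
  show ?thesis
  proof (cases "exp (a - k) = 1")
    case True
    show ?thesis
      using c(2) eventually_neq_at_within[of a]
      by eventually_elim (use c(1) True in \<open>auto simp: mult_le_0_iff\<close>)
  next
    case False
    have "isCont (\<lambda>z. exp (z - k)) a" by (intro continuous_intros)
    then show ?thesis
      using False by (auto simp: isCont_def intro: tendsto_imp_eventually_ne)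
  qed
qed

text \<open>Dividing \<open>h\<close> by the functions \<open>A k (exp (z - k) - 1)\<close>, which have the same zeros with the same
  linear terms, leaves a function that extends continuously to a nonvanishing one.  Its degree is
  the same on both sides of the strip, and the degrees of the divisors are known.\<close>

theorem signed_zero_count:
  fixes h :: "complex \<Rightarrow> complex" and A :: "complex \<Rightarrow> complex \<Rightarrow> complex"
  assumes cont: "continuous_on UNIV h"
    and per: "\<And>z. h (z + 2 * of_real pi * \<i>) = h z"
    and K: "finite K" "K = {z. h z = 0 \<and> 0 \<le> Im z \<and> Im z < 2 * pi}"
    and B: "B > 0" "\<And>k. k \<in> K \<Longrightarrow> \<bar>Re k\<bar> < B"
    and deriv: "\<And>k. k \<in> K \<Longrightarrow> (h has_derivative A k) (at k)"
    and J: "\<And>k. k \<in> K \<Longrightarrow> jac (A k) \<noteq> 0"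
  shows "\<exists>m n. has_deg (\<lambda>t. h (Complex B t)) m \<and> has_deg (\<lambda>t. h (Complex (- B) t)) n \<and>
     m - n = (\<Sum>k\<in>K. if jac (A k) > 0 then 1 else - 1)"
proof -
  define T where "T k z = A k (exp (z - k) - 1)" for k z
  have lin: "linear (A k)" if "k \<in> K" for k using deriv[OF that] by (rule has_derivative_linear)
  have T_0: "T k z = 0 \<longleftrightarrow> exp (z - k) = 1" if "k \<in> K" for k z
    using jac_inj[OF lin J] linear_injective_0[OF lin] linear_0[OF lin] that
    unfolding T_def by (metis eq_iff_diff_eq_0)
  have exp_per: "exp (z + 2 * of_real pi * \<i> - k) = exp (z - k)" for z k :: complex
  proof -
    have "z + 2 * of_real pi * \<i> - k = (z - k) + 2 * of_real pi * \<i>" by simp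
    then show ?thesis by (simp only: exp_add exp_two_pi_i) simp
  qed
  have T_per: "T k (z + 2 * of_real pi * \<i>) = T k z" for k z
    unfolding T_def exp_per ..
  have T_cont: "isCont (T k) z" if "k \<in> K" for k z
  proof -
    have "isCont (A k) w" for w
      using lin[OF that] by (simp add: linear_continuous_at linear_linear)
    then show ?thesis unfolding T_def
      by (intro isCont_o2[where g = "A k" and f = "\<lambda>z. exp (z - k) - 1"] continuous_intros) auto
  qed
  have T_deriv: "(T k has_derivative A k) (at k)" if "k \<in> K" for k
  proof -
    have 1: "((\<lambda>z. exp (z - k) - 1) has_derivative (\<lambda>v. v)) (at k)"
      by (auto intro!: derivative_eq_intros)
    have 2: "(A k has_derivative A k) (at (exp (k - k) - 1))"
      using lin[OF that] by (simp add: linear_imp_has_derivative)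
    show ?thesis unfolding T_def using has_derivative_compose[OF 1 2] .
  qed
  \<comment> \<open>Two zeros in the fundamental domain differ modulo the period.\<close>
  have uniq: "k = k'" if "k \<in> K" "k' \<in> K" "exp (z - k) = 1" "exp (z - k') = 1" for k k' z
  proof -
    have "exp (z - k) = exp (z - k')" using that by simp
    then obtain n :: int where n: "z - k = z - k' + (of_int (2 * n) * pi) * \<i>"
      unfolding exp_eq by blast
    then have "k' = k + (of_int (2 * n) * pi) * \<i>" by (simp add: algebra_simps)
    then have Im: "Im k' = Im k + of_int n * (2 * pi)" and Re: "Re k' = Re k" by simp_all
    have "\<bar>Im k' - Im k\<bar> < 1 * (2 * pi)" using that(1,2) K(2) by auto
    then have "\<bar>real_of_int n\<bar> * (2 * pi) < 1 * (2 * pi)" using Im by (simp add: abs_mult)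
    then have "\<bar>real_of_int n\<bar> < 1" using pi_gt_zero by (subst (asm) mult_less_cancel_right_pos) auto
    then have "n = 0" by linarith
    then show ?thesis using Im Re by (simp add: complex_eq_iff)
  qed
  define P where "P z = (\<Prod>k\<in>K. T k z)" for z
  have P_0: "P z = 0 \<longleftrightarrow> (\<exists>k\<in>K. exp (z - k) = 1)" for z
    unfolding P_def using K(1) T_0 by auto
  define g where "g z = (if P z = 0 then 1 / (\<Prod>j\<in>{j\<in>K. exp (z - j) \<noteq> 1}. T j z) else h z / P z)" for z
  have P_ev: "eventually (\<lambda>z. P z \<noteq> 0) (at a)" for a
  proof -
    have "eventually (\<lambda>z. \<forall>k\<in>K. exp (z - k) \<noteq> 1) (at a)"
      using K(1) eventually_exp_neq by (intro eventually_ball_finite) auto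
    then show ?thesis by eventually_elim (simp add: P_0)
  qed
  have h_isCont: "isCont h z" for z using cont by (simp add: continuous_on_eq_continuous_at)
  have P_isCont: "isCont P z" for z unfolding P_def using T_cont by (intro continuous_intros) auto
  have g_per: "g (z + 2 * of_real pi * \<i>) = g z" for z
    unfolding g_def P_def T_per exp_per per ..
  have lim_K: "((\<lambda>z. h z / P z) \<longlongrightarrow> g k) (at k)" if k: "k \<in> K" for k
  proof -
    have others: "{j\<in>K. exp (k - j) \<noteq> 1} = K - {k}" using uniq[of k _ k] k by auto
    have gk: "g k = 1 * (1 / (\<Prod>j\<in>K - {k}. T j k))"
      using k P_0[of k] unfolding g_def others by auto
    have nz: "(\<Prod>j\<in>K - {k}. T j k) \<noteq> 0" using K(1) others T_0 by auto
    have "((\<lambda>z. h z / T k z) \<longlongrightarrow> 1) (at k)"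
      using k K(2) by (intro nondegenerate_zero_ratio[OF deriv _ T_deriv _ J]) (auto simp: T_0)
    moreover have "isCont (\<lambda>z. \<Prod>j\<in>K - {k}. T j z) k"
      using T_cont by (intro continuous_intros) auto
    then have "((\<lambda>z. 1 / (\<Prod>j\<in>K - {k}. T j z)) \<longlongrightarrow> 1 / (\<Prod>j\<in>K - {k}. T j k)) (at k)"
      unfolding isCont_def using nz by (intro tendsto_divide tendsto_const)
    ultimately have "((\<lambda>z. h z / T k z * (1 / (\<Prod>j\<in>K - {k}. T j z))) \<longlongrightarrow> g k) (at k)"
      unfolding gk by (rule tendsto_mult)
    moreover have "h z / T k z * (1 / (\<Prod>j\<in>K - {k}. T j z)) = h z / P z" for z
      unfolding P_def using prod.remove[OF K(1) k, of "\<lambda>k. T k z"] by simp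
    ultimately show ?thesis by (simp only:)
  qed
  have lim_0: "((\<lambda>z. h z / P z) \<longlongrightarrow> g a) (at a)" if a: "P a = 0" "0 \<le> Im a" "Im a \<le> 2 * pi" for a
  proof -
    obtain k where k: "k \<in> K" "exp (a - k) = 1" using a(1) P_0 by blast
    then obtain n :: int where "a - k = 0 + (of_int (2 * n) * pi) * \<i>"
      using exp_eq[of "a - k" 0] by auto
    then have n: "a = k + of_int n * (2 * of_real pi * \<i>)" by (simp add: algebra_simps)
    then have Im: "Im a = Im k + of_int n * (2 * pi)" by simp
    have Imk: "0 \<le> Im k" "Im k < 2 * pi" using k K(2) by auto
    then have "(-1) * (2 * pi) < of_int n * (2 * pi)" "of_int n * (2 * pi) < 2 * (2 * pi)"
 using a(2,3) Im Imk pi_gt_zero by linarith+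
    then have "n = 0 \<or> n = 1" using pi_gt_zero
      by (simp only: mult_less_cancel_right_pos) linarith
    then consider "a = k" | "a = k + 2 * of_real pi * \<i>" using n by auto
    then show ?thesis
    proof cases
      case 1 then show ?thesis using lim_K k by simp
    next
      case 2
      let ?p = "2 * of_real pi * \<i>"
      have "((\<lambda>z. h (z - ?p) / P (z - ?p)) \<longlongrightarrow> g k) (at (k + ?p))"
        using LIM_offset[OF lim_K[OF k(1)], of "- ?p"] by simp
      moreover have "h (z - ?p) = h z" "P (z - ?p) = P z" for z
        using per[of "z - ?p"] T_per[of _ "z - ?p"] unfolding P_def by simp_all
      ultimately show ?thesis using 2 g_per[of k] by simp
    qed
  qed
  let ?S = "{z. - B \<le> Re z \<and> Re z \<le> B \<and> 0 \<le> Im z \<and> Im z \<le> 2 * pi}"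
  have g_isCont: "isCont g a" if "a \<in> ?S" for a
  proof -
    have "((\<lambda>z. h z / P z) \<longlongrightarrow> g a) (at a)"
    proof (cases "P a = 0")
      case True then show ?thesis using lim_0 that by auto
    next
      case False
      then have "isCont (\<lambda>z. h z / P z) a" using h_isCont P_isCont unfolding isCont_def by (intro tendsto_divide)
      then show ?thesis using False by (simp add: isCont_def g_def)
    qed
    moreover have "eventually (\<lambda>z. h z / P z = g z) (at a)"
      using P_ev[of a] by eventually_elim (simp add: g_def)
    ultimately show ?thesis unfolding isCont_def using tendsto_cong by force
  qed
  have g_nz: "g z \<noteq> 0" if "z \<in> ?S" for z
  proof (cases "P z = 0")
    case True
    then show ?thesis using K(1) T_0 by (auto simp: g_def)
  next
    case False
    have "h z \<noteq> 0"
    proof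
      assume z: "h z = 0"
      have "\<exists>k\<in>K. exp (z - k) = 1"
      proof (cases "Im z < 2 * pi")
        case True then show ?thesis using z that K(2) by (intro bexI[of _ z]) auto
      next
        case False
        then have "Im z = 2 * pi" using that by auto
        moreover have "h (z - 2 * of_real pi * \<i>) = 0"
          using z per[of "z - 2 * of_real pi * \<i>"] by simp
        ultimately have "z - 2 * of_real pi * \<i> \<in> K" using K(2) by auto
        then show ?thesis by (intro bexI[of _ "z - 2 * of_real pi * \<i>"]) auto
      qed
      then show False using False P_0 by blast
    qed
    then show ?thesis using False by (simp add: g_def)
  qed
  have shift: "Complex x (2 * pi) = Complex x 0 + 2 * of_real pi * \<i>" for x
    by (simp add: complex_eq_iff)
  obtain n where n: "has_deg (\<lambda>t. g (Complex (- B) t)) n" "has_deg (\<lambda>t. g (Complex B t)) n"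
    using has_deg_strip[of "- B" B g] g_isCont g_nz B(1) unfolding shift
    by (auto simp: g_per intro!: continuous_at_imp_continuous_on)
  have deg: "has_deg (\<lambda>t. h (Complex x t)) (n + (\<Sum>k\<in>K. s k))"
    if x: "has_deg (\<lambda>t. g (Complex x t)) n" "\<And>k. k \<in> K \<Longrightarrow> Re k \<noteq> x"
      and s: "\<And>k. k \<in> K \<Longrightarrow> has_deg (\<lambda>t. T k (Complex x t)) (s k)" for x s
  proof (rule has_deg_cong)
    show "has_deg (\<lambda>t. g (Complex x t) * P (Complex x t)) (n + (\<Sum>k\<in>K. s k))"
      unfolding P_def by (intro has_deg_mult has_deg_prod x s K(1))
    fix t
    have "exp (Complex x t - k) \<noteq> 1" if "k \<in> K" for k
    proof
      assume "exp (Complex x t - k) = 1"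
      then have "cmod (exp (Complex x t - k)) = 1" by simp
      then show False using x(2)[OF that] by simp
    qed
    then have "P (Complex x t) \<noteq> 0" using P_0 by blast
    then show "g (Complex x t) * P (Complex x t) = h (Complex x t)" by (simp add: g_def)
  qed
  have "has_deg (\<lambda>t. h (Complex B t)) (n + (\<Sum>k\<in>K. if jac (A k) > 0 then 1 else - 1))"
  proof (rule deg[OF n(2)])
    show "Re k \<noteq> B" if "k \<in> K" for k using B(2)[OF that] by auto
    show "has_deg (\<lambda>t. T k (Complex B t)) (if jac (A k) > 0 then 1 else - 1)" if "k \<in> K" for k
      unfolding T_def using B(2)[OF that]
      by (intro has_deg_linear_image lin J that has_deg_exp_minus_1(1)) auto
  qed
  moreover have "has_deg (\<lambda>t. h (Complex (- B) t)) (n + (\<Sum>k\<in>K. 0))"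
  proof (rule deg[OF n(1)])
    show "Re k \<noteq> - B" if "k \<in> K" for k using B(2)[OF that] by auto
    show "has_deg (\<lambda>t. T k (Complex (- B) t)) 0" if "k \<in> K" for k
    proof -
      have "- B < Re k" using B(2)[OF that] by auto
      from has_deg_linear_image[OF lin[OF that] J[OF that] has_deg_exp_minus_1(2)[OF this]]
      show ?thesis unfolding T_def by (simp cong: if_cong)
    qed
  qed
  ultimately show ?thesis by force
qed

section \<open>Real lines and the square condition\<close>

subsection \<open>Real binary quartics that are squares\<close>

text \<open>Interpolation at five points makes the coefficients linear functions of the polynomial
  function, so that continuity and derivatives in parameters follow from those of the values.\<close>

definition cf0 :: "(real \<Rightarrow> real) \<Rightarrow> real" where "cf0 P = P 0"
definition cf1 :: "(real \<Rightarrow> real) \<Rightarrow> real" where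
  "cf1 P = (8 * (P 1 - P (-1)) - (P 2 - P (-2))) / 12"
definition cf2 :: "(real \<Rightarrow> real) \<Rightarrow> real" where
  "cf2 P = (16 * (P 1 + P (-1)) - (P 2 + P (-2)) - 30 * P 0) / 24"
definition cf3 :: "(real \<Rightarrow> real) \<Rightarrow> real" where
  "cf3 P = ((P 2 - P (-2)) - 2 * (P 1 - P (-1))) / 12"
definition cf4 :: "(real \<Rightarrow> real) \<Rightarrow> real" where
  "cf4 P = ((P 2 + P (-2)) - 4 * (P 1 + P (-1)) + 6 * P 0) / 24"

lemmas cf_defs = cf0_def cf1_def cf2_def cf3_def cf4_def

lemma cf_poly:
  assumes "\<And>s. P s = a4 * s^4 + a3 * s^3 + a2 * s^2 + a1 * s + a0"
  shows "cf0 P = a0" "cf1 P = a1" "cf2 P = a2" "cf3 P = a3" "cf4 P = a4"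
  unfolding cf_defs assms by (simp_all add: field_simps)

text \<open>Comparison of a polynomial with coefficients \<open>a4, \<dots>, a0\<close> and \<open>a4 (s\<^sup>2 + p s + q)\<^sup>2\<close> determines \<open>p\<close> and \<open>q\<close> from
  \<open>a3\<close> and \<open>a2\<close>.  The two remaining coefficients then give \<open>H1 = 0\<close> from \<open>a1\<close> and \<open>H0 = 0\<close> from \<open>a0\<close>,
  after the denominators are cleared.\<close>

definition H0 :: "(real \<Rightarrow> real) \<Rightarrow> real" where
  "H0 P = 64 * cf4 P ^ 3 * cf0 P - (4 * cf4 P * cf2 P - cf3 P ^ 2) ^ 2"
definition H1 :: "(real \<Rightarrow> real) \<Rightarrow> real" where
  "H1 P = cf3 P ^ 3 - 4 * cf4 P * cf3 P * cf2 P + 8 * cf4 P ^ 2 * cf1 P"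

lemma square_imp_H_zero:
  assumes P: "\<And>s. P s = a4 * s^4 + a3 * s^3 + a2 * s^2 + a1 * s + a0"
    and sq: "\<And>s. of_real a4 * s^4 + of_real a3 * s^3 + of_real a2 * s^2 + of_real a1 * s + of_real a0 =
       (\<alpha> * s\<^sup>2 + \<beta> * s + \<gamma> :: complex)\<^sup>2"
  shows "H0 P = 0" "H1 P = 0"
proof -
  have "poly [:of_real a0, of_real a1, of_real a2, of_real a3, of_real a4:] s =
      poly [:\<gamma>\<^sup>2, 2 * \<beta> * \<gamma>, \<beta>\<^sup>2 + 2 * \<alpha> * \<gamma>, 2 * \<alpha> * \<beta>, \<alpha>\<^sup>2:] s" for s
    using sq[of s] by (simp add: eval_nat_numeral algebra_simps)
  then have "[:of_real a0, of_real a1, of_real a2, of_real a3, of_real a4:] =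
      [:\<gamma>\<^sup>2, 2 * \<beta> * \<gamma>, \<beta>\<^sup>2 + 2 * \<alpha> * \<gamma>, 2 * \<alpha> * \<beta>, \<alpha>\<^sup>2:]"
    by (simp only: poly_eq_poly_eq_iff[symmetric] fun_eq_iff) simp
  then have c: "complex_of_real a0 = \<gamma>\<^sup>2" "complex_of_real a1 = 2 * \<beta> * \<gamma>"
    "complex_of_real a2 = \<beta>\<^sup>2 + 2 * \<alpha> * \<gamma>" "complex_of_real a3 = 2 * \<alpha> * \<beta>" "complex_of_real a4 = \<alpha>\<^sup>2"
    by simp_all
  have "complex_of_real (H0 P) = 0"
    unfolding H0_def cf_poly[OF P] of_real_diff of_real_mult of_real_power of_real_numeral c
    by (simp add: eval_nat_numeral algebra_simps)
  then show "H0 P = 0" by simp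
  have "complex_of_real (H1 P) = 0"
    unfolding H1_def cf_poly[OF P] of_real_diff of_real_add of_real_mult of_real_power of_real_numeral c
    by (simp add: eval_nat_numeral algebra_simps)
  then show "H1 P = 0" by simp
qed

lemma H_zero_imp_square:
  assumes P: "\<And>s. P s = a4 * s^4 + a3 * s^3 + a2 * s^2 + a1 * s + a0"
    and pos: "a4 > 0" and H: "H0 P = 0" "H1 P = 0"
  shows "\<exists>\<alpha> \<sigma> \<pi>. \<alpha> > 0 \<and> a4 = \<alpha>\<^sup>2 \<and> a3 = - 2 * \<alpha>\<^sup>2 * \<sigma> \<and> a2 = \<alpha>\<^sup>2 * (\<sigma>\<^sup>2 + 2 * \<pi>) \<and>
    a1 = - 2 * \<alpha>\<^sup>2 * \<sigma> * \<pi> \<and> a0 = \<alpha>\<^sup>2 * \<pi>\<^sup>2"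
proof -
  define \<alpha> \<sigma> \<pi> where "\<alpha> = sqrt a4" and "\<sigma> = - a3 / (2 * a4)" and "\<pi> = (4 * a4 * a2 - a3\<^sup>2) / (8 * a4\<^sup>2)"
  have \<alpha>: "\<alpha> > 0" "\<alpha>\<^sup>2 = a4" using pos by (simp_all add: \<alpha>_def)
  have h0: "64 * a4 ^ 3 * a0 = (4 * a4 * a2 - a3\<^sup>2)\<^sup>2" using H(1) unfolding H0_def cf_poly[OF P] by simp
  have h1: "8 * a4\<^sup>2 * a1 = a3 * (4 * a4 * a2 - a3\<^sup>2)" using H(2) unfolding H1_def cf_poly[OF P]
    by (simp add: eval_nat_numeral algebra_simps)
  have "a3 = - 2 * a4 * \<sigma>" using pos by (simp add: \<sigma>_def)
  moreover have "a2 = a4 * (\<sigma>\<^sup>2 + 2 * \<pi>)"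
    using pos by (simp add: \<sigma>_def \<pi>_def power2_eq_square field_simps)
  moreover have "a1 = - 2 * a4 * \<sigma> * \<pi>"
  proof -
    have "- 2 * a4 * \<sigma> * \<pi> = a3 * (4 * a4 * a2 - a3\<^sup>2) / (8 * a4\<^sup>2)" using pos by (simp add: \<sigma>_def \<pi>_def)
    then show ?thesis using pos unfolding h1[symmetric] by simp
  qed
  moreover have "a0 = a4 * \<pi>\<^sup>2"
  proof -
    have "a4 * \<pi>\<^sup>2 = (4 * a4 * a2 - a3\<^sup>2)\<^sup>2 / (64 * a4 ^ 3)"
      using pos by (simp add: \<pi>_def power_divide power_mult_distrib eval_nat_numeral)
    then show ?thesis using pos unfolding h0[symmetric] by simp
  qed
  ultimately show ?thesis using \<alpha> by (intro exI[of _ \<alpha>] exI[of _ \<sigma>] exI[of _ \<pi>]) simp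
qed

text \<open>At a square \<open>\<alpha>\<^sup>2 (s\<^sup>2 - \<sigma> s + \<pi>)\<^sup>2\<close> the differentials of \<open>H0\<close> and \<open>H1\<close> are, up to positive
  factors, the coefficients of the remainder modulo \<open>s\<^sup>2 - \<sigma> s + \<pi>\<close>.\<close>

lemma H_has_derivative:
  fixes f :: "'a::real_normed_vector \<Rightarrow> real \<Rightarrow> real" and f' :: "'a \<Rightarrow> real \<Rightarrow> real"
  assumes d: "\<And>s. ((\<lambda>x. f x s) has_derivative (\<lambda>v. f' v s)) (at p)"
    and a: "cf4 (f p) = \<alpha>\<^sup>2" "cf3 (f p) = - 2 * \<alpha>\<^sup>2 * \<sigma>" "cf2 (f p) = \<alpha>\<^sup>2 * (\<sigma>\<^sup>2 + 2 * \<pi>)"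
      "cf1 (f p) = - 2 * \<alpha>\<^sup>2 * \<sigma> * \<pi>" "cf0 (f p) = \<alpha>\<^sup>2 * \<pi>\<^sup>2"
  shows "((\<lambda>x. H0 (f x)) has_derivative (\<lambda>v. 64 * \<alpha>^6 * (cf0 (f' v) - \<pi> * cf2 (f' v) - \<pi> * \<sigma> * cf3 (f' v)
       + (\<pi>\<^sup>2 - \<pi> * \<sigma>\<^sup>2) * cf4 (f' v)))) (at p)"
    and "((\<lambda>x. H1 (f x)) has_derivative (\<lambda>v. 8 * \<alpha>^4 * (cf1 (f' v) + \<sigma> * cf2 (f' v) + (\<sigma>\<^sup>2 - \<pi>) * cf3 (f' v)
       + (\<sigma>^3 - 2 * \<sigma> * \<pi>) * cf4 (f' v)))) (at p)"
proof -
  have c: "((\<lambda>x. cf0 (f x)) has_derivative (\<lambda>v. cf0 (f' v))) (at p)"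
    "((\<lambda>x. cf1 (f x)) has_derivative (\<lambda>v. cf1 (f' v))) (at p)"
    "((\<lambda>x. cf2 (f x)) has_derivative (\<lambda>v. cf2 (f' v))) (at p)"
    "((\<lambda>x. cf3 (f x)) has_derivative (\<lambda>v. cf3 (f' v))) (at p)"
    "((\<lambda>x. cf4 (f x)) has_derivative (\<lambda>v. cf4 (f' v))) (at p)"
    unfolding cf_defs by ((rule derivative_eq_intros d refl)+; simp)+
  show "((\<lambda>x. H0 (f x)) has_derivative (\<lambda>v. 64 * \<alpha>^6 * (cf0 (f' v) - \<pi> * cf2 (f' v) - \<pi> * \<sigma> * cf3 (f' v)
       + (\<pi>\<^sup>2 - \<pi> * \<sigma>\<^sup>2) * cf4 (f' v)))) (at p)"
    unfolding H0_def by ((rule derivative_eq_intros c refl)+; simp add: a fun_eq_iff)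
      (simp add: eval_nat_numeral algebra_simps)
  show "((\<lambda>x. H1 (f x)) has_derivative (\<lambda>v. 8 * \<alpha>^4 * (cf1 (f' v) + \<sigma> * cf2 (f' v) + (\<sigma>\<^sup>2 - \<pi>) * cf3 (f' v)
       + (\<sigma>^3 - 2 * \<sigma> * \<pi>) * cf4 (f' v)))) (at p)"
    unfolding H1_def by ((rule derivative_eq_intros c refl)+; simp add: a fun_eq_iff)
      (simp add: eval_nat_numeral algebra_simps)
qed

subsection \<open>The family of affine lines\<close>

text \<open>The value at parameter \<open>s\<close> on the line with direction \<open>\<theta>\<close> and signed distance \<open>b\<close> from the
  origin; \<open>\<tau>\<close> is the third homogeneous coordinate.\<close>

definition line_value :: "real quartic \<Rightarrow> real \<Rightarrow> real \<Rightarrow> real \<Rightarrow> real \<Rightarrow> real" where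
  "line_value g b \<tau> \<theta> s = tern g (s * cos \<theta> - b * sin \<theta>) (s * sin \<theta> + b * cos \<theta>) \<tau>"

text \<open>The two conditions as one complex function of \<open>\<zeta> = b + i \<theta>\<close>, in order to use winding numbers.\<close>

definition hfun :: "real quartic \<Rightarrow> complex \<Rightarrow> complex" where
  "hfun g \<zeta> = of_real (H0 (line_value g (Re \<zeta>) 1 (Im \<zeta>))) + \<i> * of_real (H1 (line_value g (Re \<zeta>) 1 (Im \<zeta>)))"

lemma hfun_eq_0_iff: "hfun g \<zeta> = 0 \<longleftrightarrow>
    H0 (line_value g (Re \<zeta>) 1 (Im \<zeta>)) = 0 \<and> H1 (line_value g (Re \<zeta>) 1 (Im \<zeta>)) = 0"
  by (simp add: hfun_def complex_eq_iff)

lemma hfun_periodic: "hfun g (\<zeta> + 2 * of_real pi * \<i>) = hfun g \<zeta>"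
  by (simp add: hfun_def line_value_def[abs_def])

lemma hfun_continuous: "continuous_on UNIV (hfun g)"
  unfolding hfun_def H0_def H1_def cf_defs line_value_def tern_expand
  by (intro continuous_intros) auto

text \<open>The form in coordinates in which the line \<open>(b, \<theta>)\<close> is \<open>y = 0\<close> and \<open>x\<close> is the parameter on it.\<close>

definition adapted :: "real quartic \<Rightarrow> real \<Rightarrow> real \<Rightarrow> real quartic \<Rightarrow> bool" where
  "adapted g b \<theta> g' \<longleftrightarrow> (\<forall>x y z. tern g' x y z =
     tern g (x * cos \<theta> - y * sin \<theta> - z * (b * sin \<theta>)) (x * sin \<theta> + y * cos \<theta> + z * (b * cos \<theta>)) z)"

lemma adapted_line_value:
  assumes "adapted g b \<theta> g'"
  shows "line_value g b 1 \<theta> s = g' (4,0,0) * s^4 + g' (3,0,1) * s^3 + g' (2,0,2) * s^2 + g' (1,0,3) * s + g' (0,0,4)"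
  using assms[unfolded adapted_def, rule_format, of s 0 1]
  unfolding tern_expand[of g'] by (simp add: line_value_def)

text \<open>Moving \<open>b\<close> changes the restriction to the line by the normal cubic \<open>C (s)\<close>, and moving \<open>\<theta>\<close> by \<open>s C (s)\<close>
  and a multiple of the derivative along the line, which is divisible by \<open>s\<^sup>2 - \<sigma> s + \<pi>\<close>.  With
  \<open>c1 s + c0\<close> the remainder of \<open>C\<close>, the Jacobian is therefore a multiple of the determinant of
  multiplication by \<open>c1 s + c0\<close> modulo that polynomial.\<close>

lemma hfun_derivative:
  assumes ad: "adapted g b \<theta> g'"
    and a: "g' (4,0,0) = \<alpha>\<^sup>2" "g' (3,0,1) = - 2 * \<alpha>\<^sup>2 * \<sigma>" "g' (2,0,2) = \<alpha>\<^sup>2 * (\<sigma>\<^sup>2 + 2 * \<pi>)"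
      "g' (1,0,3) = - 2 * \<alpha>\<^sup>2 * \<sigma> * \<pi>" "g' (0,0,4) = \<alpha>\<^sup>2 * \<pi>\<^sup>2"
  defines "c1 \<equiv> g' (3,1,0) * (\<sigma>\<^sup>2 - \<pi>) + g' (2,1,1) * \<sigma> + g' (1,1,2)"
    and "c0 \<equiv> - g' (3,1,0) * \<sigma> * \<pi> - g' (2,1,1) * \<pi> + g' (0,1,3)"
  shows "\<exists>A. (hfun g has_derivative A) (at (Complex b \<theta>)) \<and>
     jac A = 512 * \<alpha>^10 * (c0\<^sup>2 + c0 * c1 * \<sigma> + c1\<^sup>2 * \<pi>)"
proof -
  let ?\<zeta> = "Complex b \<theta>"
  define P' where "P' s = 4 * g' (4,0,0) * s^3 + 3 * g' (3,0,1) * s^2 + 2 * g' (2,0,2) * s + g' (1,0,3)" for s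
  define C where "C s = g' (3,1,0) * s^3 + g' (2,1,1) * s^2 + g' (1,1,2) * s + g' (0,1,3)" for s
  define f where "f \<zeta> = line_value g (Re \<zeta>) 1 (Im \<zeta>)" for \<zeta>
  define f' where "f' v s = C s * (s * Im v + Re v) - b * P' s * Im v" for v :: complex and s
  have f: "f \<zeta> s = tern g' (s * cos (Im \<zeta> - \<theta>) - Re \<zeta> * sin (Im \<zeta> - \<theta>))
      (s * sin (Im \<zeta> - \<theta>) + Re \<zeta> * cos (Im \<zeta> - \<theta>) - b) 1" for \<zeta> s
  proof -
    have cs: "cos (Im \<zeta>) = cos (Im \<zeta> - \<theta>) * cos \<theta> - sin (Im \<zeta> - \<theta>) * sin \<theta>"
      "sin (Im \<zeta>) = sin (Im \<zeta> - \<theta>) * cos \<theta> + cos (Im \<zeta> - \<theta>) * sin \<theta>"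
      using cos_add[of "Im \<zeta> - \<theta>" \<theta>] sin_add[of "Im \<zeta> - \<theta>" \<theta>] by simp_all
    show ?thesis
      unfolding f_def line_value_def ad[unfolded adapted_def, rule_format] cs by (simp add: algebra_simps)
  qed
  have d: "((\<lambda>\<zeta>. f \<zeta> s) has_derivative (\<lambda>v. f' v s)) (at ?\<zeta>)" for s
  proof -
    let ?X = "\<lambda>\<zeta>. s * cos (Im \<zeta> - \<theta>) - Re \<zeta> * sin (Im \<zeta> - \<theta>)"
      and ?Y = "\<lambda>\<zeta>. s * sin (Im \<zeta> - \<theta>) + Re \<zeta> * cos (Im \<zeta> - \<theta>) - b"
    have X: "(?X has_derivative (\<lambda>v. - b * Im v)) (at ?\<zeta>)"
      by (rule derivative_eq_intros refl)+ simp
    have Y: "(?Y has_derivative (\<lambda>v. s * Im v + Re v)) (at ?\<zeta>)"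
      by (rule derivative_eq_intros refl)+ simp
    have XY: "?X ?\<zeta> = s" "?Y ?\<zeta> = 0" by simp_all
    have "((\<lambda>\<zeta>. tern g' (X \<zeta>) (Y \<zeta>) 1) has_derivative (\<lambda>v. P' s * X' v + C s * Y' v)) (at ?\<zeta>)"
      if X: "(X has_derivative X') (at ?\<zeta>)" and Y: "(Y has_derivative Y') (at ?\<zeta>)"
        and 0: "X ?\<zeta> = s" "Y ?\<zeta> = 0" for X Y X' Y'
      unfolding tern_expand
      by ((rule derivative_eq_intros X Y refl)+; simp add: 0 P'_def C_def fun_eq_iff)
        (simp add: eval_nat_numeral algebra_simps)
    from this[OF X Y XY] show ?thesis unfolding f f'_def by (simp add: algebra_simps)
  qed
  have fp: "f ?\<zeta> s = g' (4,0,0) * s^4 + g' (3,0,1) * s^3 + g' (2,0,2) * s^2 + g' (1,0,3) * s + g' (0,0,4)" for s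
    unfolding f_def using adapted_line_value[OF ad, of s] by simp
  note cfs = cf_poly[OF fp, unfolded a]
  note dH = H_has_derivative[where f = f and f' = f', OF d cfs(5,4,3,2,1)]
  define A where "A v = of_real (64 * \<alpha>^6 * (cf0 (f' v) - \<pi> * cf2 (f' v) - \<pi> * \<sigma> * cf3 (f' v)
       + (\<pi>\<^sup>2 - \<pi> * \<sigma>\<^sup>2) * cf4 (f' v))) + \<i> * of_real (8 * \<alpha>^4 * (cf1 (f' v) + \<sigma> * cf2 (f' v)
       + (\<sigma>\<^sup>2 - \<pi>) * cf3 (f' v) + (\<sigma>^3 - 2 * \<sigma> * \<pi>) * cf4 (f' v)))" for v
  have "((\<lambda>\<zeta>. of_real (H0 (f \<zeta>)) + \<i> * of_real (H1 (f \<zeta>))) has_derivative A) (at ?\<zeta>)"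
    unfolding A_def by (rule derivative_eq_intros dH refl)+ simp
  then have "(hfun g has_derivative A) (at ?\<zeta>)" unfolding hfun_def[abs_def] f_def .
  moreover have "jac A = 512 * \<alpha>^10 * (c0\<^sup>2 + c0 * c1 * \<sigma> + c1\<^sup>2 * \<pi>)"
  proof -
    have 1: "f' 1 s = 0 * s^4 + g' (3,1,0) * s^3 + g' (2,1,1) * s^2 + g' (1,1,2) * s + g' (0,1,3)" for s
      by (simp add: f'_def C_def)
    have 2: "f' \<i> s = g' (3,1,0) * s^4 + (g' (2,1,1) - b * (4 * g' (4,0,0))) * s^3 + (g' (1,1,2) - b * (3 * g' (3,0,1))) * s^2
        + (g' (0,1,3) - b * (2 * g' (2,0,2))) * s + (- b * g' (1,0,3))" for s
      by (simp add: f'_def C_def P'_def eval_nat_numeral algebra_simps)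
    have "Re (A 1) = 64 * \<alpha>^6 * c0" "Im (A 1) = 8 * \<alpha>^4 * c1"
      unfolding A_def cf_poly[OF 1] c0_def c1_def by (simp_all add: algebra_simps)
    moreover have "Re (A \<i>) = 64 * \<alpha>^6 * (- \<pi> * c1)" "Im (A \<i>) = 8 * \<alpha>^4 * (c0 + \<sigma> * c1)"
      unfolding A_def cf_poly[OF 2] c0_def c1_def a by (simp_all add: eval_nat_numeral algebra_simps)
    ultimately have "jac A = 64 * \<alpha>^6 * c0 * (8 * \<alpha>^4 * (c0 + \<sigma> * c1)) - 8 * \<alpha>^4 * c1 * (64 * \<alpha>^6 * (- \<pi> * c1))"
      unfolding jac_def by simp
    then show ?thesis by (simp add: eval_nat_numeral algebra_simps)
  qed
  ultimately show ?thesis by blast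
qed

text \<open>The product over the roots is the norm of the remainder \<open>c1 s + c0\<close>, the same expression as in
  the Jacobian.\<close>

lemma normal_cubic_product:
  fixes s1 s2 :: complex and g :: "real quartic" and \<sigma> \<pi> :: real
  assumes "s1 + s2 = of_real \<sigma>" "s1 * s2 = of_real \<pi>"
  defines "c1 \<equiv> g (3,1,0) * (\<sigma>\<^sup>2 - \<pi>) + g (2,1,1) * \<sigma> + g (1,1,2)"
    and "c0 \<equiv> - g (3,1,0) * \<sigma> * \<pi> - g (2,1,1) * \<pi> + g (0,1,3)"
  shows "normal_cubic (cquartic g) s1 1 * normal_cubic (cquartic g) s2 1 = of_real (c0\<^sup>2 + c0 * c1 * \<sigma> + c1\<^sup>2 * \<pi>)"
proof -
  have red: "normal_cubic (cquartic g) s 1 = of_real c1 * s + of_real c0" if s: "s\<^sup>2 = of_real \<sigma> * s - of_real \<pi>" for s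
  proof -
    have "s ^ 3 = s * s\<^sup>2" by (simp add: eval_nat_numeral)
    also have "\<dots> = s * (of_real \<sigma> * s - of_real \<pi>)" by (simp only: s)
    also have "\<dots> = of_real \<sigma> * s\<^sup>2 - of_real \<pi> * s" by (simp add: power2_eq_square algebra_simps)
    also have "\<dots> = (of_real \<sigma> ^ 2 - of_real \<pi>) * s - of_real \<sigma> * of_real \<pi>" unfolding s
      by (simp add: power2_eq_square algebra_simps)
    finally have s3: "s ^ 3 = (of_real \<sigma> ^ 2 - of_real \<pi>) * s - of_real \<sigma> * of_real \<pi>" .
    show ?thesis unfolding normal_cubic_def s3 s cquartic_def c1_def c0_def by (simp add: algebra_simps)
  qed
  have "s1\<^sup>2 = of_real \<sigma> * s1 - of_real \<pi>" "s2\<^sup>2 = of_real \<sigma> * s2 - of_real \<pi>"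
    unfolding assms(1,2)[symmetric] by (simp_all add: power2_eq_square algebra_simps)
  then have "normal_cubic (cquartic g) s1 1 * normal_cubic (cquartic g) s2 1 =
      (of_real c1 * s1 + of_real c0) * (of_real c1 * s2 + of_real c0)" using red by simp
  also have "\<dots> = of_real c1 ^ 2 * (s1 * s2) + of_real c1 * of_real c0 * (s1 + s2) + of_real c0 ^ 2"
    by (simp add: power2_eq_square algebra_simps)
  finally show ?thesis unfolding assms(1,2) by (simp add: algebra_simps)
qed

subsection \<open>Behaviour near the line at infinity\<close>

lemma line_value_poly:
  "\<exists>a4 a3 a2 a1 a0. \<forall>s. line_value g b \<tau> \<theta> s = a4 * s^4 + a3 * s^3 + a2 * s^2 + a1 * s + a0"
proof -
  let ?e = "vector [cos \<theta>, sin \<theta>, 0] :: real ^ 3" and ?v = "vector [- b * sin \<theta>, b * cos \<theta>, \<tau>] :: real ^ 3"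
  have "subring (UNIV :: real set)" by (simp add: subring_def)
  then obtain g' where g': "\<And>x y z. quartic_eval g (x *s ?e + y *s ?v + z *s 0) = tern g' x y z"
    using quartic_linear_subst[of UNIV g ?e ?v 0] by auto
  have "s *s ?e + 1 *s ?v + 0 *s 0 = vector [s * cos \<theta> - b * sin \<theta>, s * sin \<theta> + b * cos \<theta>, \<tau>]" for s
    by (simp add: vec3_eq_iff)
  then have "line_value g b \<tau> \<theta> s = tern g' s 1 0" for s
    using g'[of s 1 0] by (simp add: line_value_def tern_def)
  then have "line_value g b \<tau> \<theta> s = g' (4,0,0) * s^4 + g' (3,1,0) * s^3 + g' (2,2,0) * s^2 + g' (1,3,0) * s + g' (0,4,0)" for s
    by (simp add: tern_expand)
  then show ?thesis by blast
qed

lemma tern_homogeneous: "tern g (c * x) (c * y) (c * z) = c ^ 4 * (tern g x y z :: real)"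
  unfolding tern_expand by (simp add: eval_nat_numeral algebra_simps)

text \<open>Scaling all homogeneous coordinates by \<open>1 / b\<close> scales the parameter on the line, too, and \<open>H0\<close> and
  \<open>H1\<close> are isobaric, of weights 4 and 3.\<close>

lemma H_scaling:
  assumes "b \<noteq> 0"
  shows "H0 (line_value g b 1 \<theta>) = b ^ 4 * H0 (line_value g 1 (1 / b) \<theta>)"
    "H1 (line_value g b 1 \<theta>) = b ^ 3 * H1 (line_value g 1 (1 / b) \<theta>)"
proof -
  obtain a4 a3 a2 a1 a0 where a: "\<And>s. line_value g 1 (1 / b) \<theta> s = a4 * s^4 + a3 * s^3 + a2 * s^2 + a1 * s + a0"
    using line_value_poly by blast
  have "line_value g b 1 \<theta> s = a4 * s^4 + (b * a3) * s^3 + (b^2 * a2) * s^2 + (b^3 * a1) * s + b^4 * a0" for s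
  proof -
    define u where "u = s / b"
    have s: "s = b * u" using assms by (simp add: u_def)
    have "line_value g b 1 \<theta> s = tern g (b * ((s / b) * cos \<theta> - 1 * sin \<theta>)) (b * ((s / b) * sin \<theta> + 1 * cos \<theta>)) (b * (1 / b))"
      using assms by (simp add: line_value_def algebra_simps)
    also have "\<dots> = b ^ 4 * line_value g 1 (1 / b) \<theta> (s / b)"
      unfolding tern_homogeneous line_value_def ..
    finally have "line_value g b 1 \<theta> s = b ^ 4 * line_value g 1 (1 / b) \<theta> u" unfolding u_def .
    then show ?thesis unfolding a s by (simp add: eval_nat_numeral algebra_simps)
  qed
  from cf_poly[OF this] cf_poly[OF a]
  show "H0 (line_value g b 1 \<theta>) = b ^ 4 * H0 (line_value g 1 (1 / b) \<theta>)"
    "H1 (line_value g b 1 \<theta>) = b ^ 3 * H1 (line_value g 1 (1 / b) \<theta>)"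
    unfolding H0_def H1_def by (simp_all add: eval_nat_numeral algebra_simps)
qed

text \<open>The function extends to \<open>\<tau> = 1 / b = 0\<close> after division by \<open>r\<close>, and for small \<open>\<tau>\<close> the degree of \<open>K\<close> is the one at
  \<open>\<tau> = 0\<close>.  Going back to \<open>b = 1 / \<tau>\<close> multiplies the real part by \<open>b\<^sup>4\<close> and the imaginary part by \<open>b\<^sup>3\<close>;
  for negative \<open>b\<close> this conjugates the direction, which reverses the sign of the degree.\<close>

lemma degree_at_infinity:
  fixes K :: "real \<Rightarrow> real \<Rightarrow> complex" and r :: "real \<Rightarrow> real"
  assumes K: "\<And>\<tau> \<theta>. of_real (H0 (line_value g 1 \<tau> \<theta>)) + \<i> * of_real (H1 (line_value g 1 \<tau> \<theta>)) = of_real (r \<tau>) * K \<tau> \<theta>"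
    and r: "\<And>\<tau>. \<tau> \<noteq> 0 \<Longrightarrow> r \<tau> \<noteq> 0"
    and cont: "continuous_on UNIV (\<lambda>p. K (fst p) (snd p))" and per: "\<And>\<tau>. K \<tau> (2 * pi) = K \<tau> 0"
    and m: "has_deg m N" and pos: "\<And>\<theta>. \<theta> \<in> {0..2 * pi} \<Longrightarrow> Re (K 0 \<theta> * cnj (m \<theta>)) > 0"
  shows "\<exists>B>0. (\<forall>b \<theta>. B \<le> \<bar>b\<bar> \<longrightarrow> \<theta> \<in> {0..2 * pi} \<longrightarrow> hfun g (Complex b \<theta>) \<noteq> 0) \<and>
    has_deg (\<lambda>t. hfun g (Complex B t)) N \<and> has_deg (\<lambda>t. hfun g (Complex (- B) t)) (- N)"
proof -
  define \<phi> where "\<phi> p = Re (K (fst p) (snd p) * cnj (m (snd p)))" for p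
  let ?X = "{-1..1} \<times> {0..2 * pi} :: (real \<times> real) set"
  \<comment> \<open>By compactness of the circle, positivity at \<open>\<tau> = 0\<close> extends to a neighbourhood.\<close>
  have "continuous_on ?X \<phi>"
  proof -
    have "continuous_on ?X (\<lambda>p. m (snd p))"
      by (rule continuous_on_compose2[OF has_deg_continuous[OF m]]) (auto intro: continuous_intros)
    then show ?thesis unfolding \<phi>_def
      by (intro continuous_intros continuous_on_subset[OF cont]) auto
  qed
  then have "closed {p \<in> ?X. \<phi> p \<le> 0}"
    by (intro continuous_on_closed_Collect_le continuous_on_const) (auto intro: closed_Times)
  moreover have "bounded {p \<in> ?X. \<phi> p \<le> 0}"
    by (rule bounded_subset[of ?X]) (auto intro: bounded_Times)
  ultimately have comp: "compact {p \<in> ?X. \<phi> p \<le> 0}" by (simp add: compact_eq_bounded_closed)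
  obtain \<delta> where \<delta>: "0 < \<delta>" "\<delta> \<le> 1" "\<And>\<tau> \<theta>. \<bar>\<tau>\<bar> \<le> \<delta> \<Longrightarrow> \<theta> \<in> {0..2 * pi} \<Longrightarrow> \<phi> (\<tau>, \<theta>) > 0"
  proof (cases "{p \<in> ?X. \<phi> p \<le> 0} = {}")
    case True
    have "\<phi> (\<tau>, \<theta>) > 0" if "\<bar>\<tau>\<bar> \<le> 1" "\<theta> \<in> {0..2 * pi}" for \<tau> \<theta>
    proof (rule ccontr)
      assume "\<not> \<phi> (\<tau>, \<theta>) > 0"
      then have "(\<tau>, \<theta>) \<in> {p \<in> ?X. \<phi> p \<le> 0}" using that by (auto simp: abs_le_iff)
      then show False using True by blast
    qed
    then show thesis using that[of 1] by simp
  next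
    case False
    have "continuous_on {p \<in> ?X. \<phi> p \<le> 0} (\<lambda>p. \<bar>fst p\<bar>)" by (intro continuous_intros)
    from continuous_attains_inf[OF comp False this] obtain p where p0: "p \<in> {p \<in> ?X. \<phi> p \<le> 0}"
      "\<forall>q\<in>{p \<in> ?X. \<phi> p \<le> 0}. \<bar>fst p\<bar> \<le> \<bar>fst q\<bar>" by blast
    have p: "p \<in> ?X" "\<phi> p \<le> 0" "\<And>q. q \<in> ?X \<Longrightarrow> \<phi> q \<le> 0 \<Longrightarrow> \<bar>fst p\<bar> \<le> \<bar>fst q\<bar>"
      using p0 by blast+
    have "fst p \<noteq> 0"
    proof
      assume "fst p = 0"
      then have "\<phi> p > 0" unfolding \<phi>_def using pos[of "snd p"] p(1) by auto
      then show False using p(2) by simp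
    qed
    have "\<phi> (\<tau>, \<theta>) > 0" if "\<bar>\<tau>\<bar> \<le> \<bar>fst p\<bar> / 2" "\<theta> \<in> {0..2 * pi}" for \<tau> \<theta>
    proof (rule ccontr)
      assume "\<not> \<phi> (\<tau>, \<theta>) > 0"
      moreover have "\<bar>fst p\<bar> \<le> 1" using p(1) by auto
      moreover from this that(1) have "- 1 \<le> \<tau>" "\<tau> \<le> 1" by linarith+
      ultimately have "\<bar>fst p\<bar> \<le> \<bar>\<tau>\<bar>" using p(3)[of "(\<tau>, \<theta>)"] that by auto
      then show False using that(1) \<open>fst p \<noteq> 0\<close> by simp
    qed
    moreover have "\<bar>fst p\<bar> \<le> 1" using p(1) by auto
    ultimately show thesis using that[of "\<bar>fst p\<bar> / 2"] \<open>fst p \<noteq> 0\<close> by simp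
  qed
  define B where "B = 1 / \<delta>"
  have B: "B > 0" using \<delta>(1) by (simp add: B_def)
  have h: "hfun g (Complex b \<theta>) = of_real (b ^ 4 * r (1 / b) * Re (K (1 / b) \<theta>)) +
      \<i> * of_real (b ^ 3 * r (1 / b) * Im (K (1 / b) \<theta>))" if "b \<noteq> 0" for b \<theta>
  proof -
    have "H0 (line_value g 1 (1 / b) \<theta>) = r (1 / b) * Re (K (1 / b) \<theta>)"
      "H1 (line_value g 1 (1 / b) \<theta>) = r (1 / b) * Im (K (1 / b) \<theta>)"
      using K[of "1 / b" \<theta>] by (simp_all add: complex_eq_iff)
    then show ?thesis unfolding hfun_def using H_scaling[OF that, of g \<theta>] by (simp add: mult.assoc)
  qed
  have nz: "K (1 / b) \<theta> \<noteq> 0" if "B \<le> \<bar>b\<bar>" "\<theta> \<in> {0..2 * pi}" for b \<theta>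
  proof -
    have "\<bar>b\<bar> > 0" using B that(1) by linarith
    then have "\<bar>1 / b\<bar> \<le> \<delta>" using that(1) \<delta>(1) by (simp add: B_def field_simps)
    then have "\<phi> (1 / b, \<theta>) > 0" using \<delta>(3) that(2) by blast
    then show ?thesis unfolding \<phi>_def by auto
  qed
  have "hfun g (Complex b \<theta>) \<noteq> 0" if "B \<le> \<bar>b\<bar>" "\<theta> \<in> {0..2 * pi}" for b \<theta>
  proof -
    have "b \<noteq> 0" using that B by auto
    moreover have "r (1 / b) \<noteq> 0" using r \<open>b \<noteq> 0\<close> by simp
    ultimately show ?thesis unfolding h[OF \<open>b \<noteq> 0\<close>] using nz[OF that] by (simp add: complex_eq_iff)
  qed
  moreover have Kdeg: "has_deg (\<lambda>t. of_real (r \<tau>) * K \<tau> t) N" if "\<tau> = \<delta> \<or> \<tau> = - \<delta>" for \<tau>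
  proof -
    have "continuous_on {0..2 * pi} (\<lambda>t. (\<lambda>p. K (fst p) (snd p)) (\<tau>, t))"
      by (rule continuous_on_compose2[OF cont]) (auto intro!: continuous_intros)
    then have "continuous_on {0..2 * pi} (K \<tau>)" by simp
    then have "has_deg (K \<tau>) N"
      using per \<delta>(1) \<delta>(3)[of \<tau>] that unfolding \<phi>_def by (intro has_deg_perturb[OF m]) auto
    moreover have "complex_of_real (r \<tau>) \<noteq> 0" using r[of \<tau>] that \<delta>(1) by auto
    ultimately show ?thesis using has_deg_mult[OF has_deg_0_const, of "of_real (r \<tau>)" "K \<tau>" N] by simp
  qed
  have hcont: "continuous_on {0..2 * pi} (\<lambda>t. hfun g (Complex b t))" for b
    by (rule continuous_on_compose2[OF hfun_continuous]) (auto intro!: continuous_on_Complex continuous_intros)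
  have hper: "hfun g (Complex b (2 * pi)) = hfun g (Complex b 0)" for b
  proof -
    have "Complex b (2 * pi) = Complex b 0 + 2 * of_real pi * \<i>" by (simp add: complex_eq_iff)
    then show ?thesis by (simp only: hfun_periodic)
  qed
  have "has_deg (\<lambda>t. hfun g (Complex B t)) N"
  proof (rule has_deg_perturb[OF Kdeg[of \<delta>] hcont hper], simp)
    fix t assume t: "t \<in> {0..2 * pi}"
    have "1 / B = \<delta>" by (simp add: B_def)
    then have "Re (hfun g (Complex B t) * cnj (of_real (r \<delta>) * K \<delta> t)) =
        B ^ 3 * (r \<delta>)\<^sup>2 * (B * (Re (K \<delta> t))\<^sup>2 + (Im (K \<delta> t))\<^sup>2)"
      using h[of B t] B by (simp add: eval_nat_numeral algebra_simps)
    moreover have "B * (Re (K \<delta> t))\<^sup>2 + (Im (K \<delta> t))\<^sup>2 > 0"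
    proof -
      have "Re (K \<delta> t) \<noteq> 0 \<or> Im (K \<delta> t) \<noteq> 0" using nz[of B t] t B \<open>1 / B = \<delta>\<close> by (auto simp: complex_eq_iff)
      then show ?thesis using B by (auto intro: add_pos_nonneg add_nonneg_pos)
    qed
    moreover have "B ^ 3 * (r \<delta>)\<^sup>2 > 0" using B r[of \<delta>] \<delta>(1) by simp
    ultimately show "0 < Re (hfun g (Complex B t) * cnj (of_real (r \<delta>) * K \<delta> t))" by simp
  qed
  moreover have "has_deg (\<lambda>t. hfun g (Complex (- B) t)) (- N)"
  proof (rule has_deg_perturb[OF has_deg_cnj[OF Kdeg[of "- \<delta>"]] hcont hper], simp)
    fix t assume t: "t \<in> {0..2 * pi}"
    have e: "1 / (- B) = - \<delta>" by (simp add: B_def)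
    have "Re (hfun g (Complex (- B) t) * cnj (cnj (of_real (r (- \<delta>)) * K (- \<delta>) t))) =
        B ^ 3 * (r (- \<delta>))\<^sup>2 * (B * (Re (K (- \<delta>) t))\<^sup>2 + (Im (K (- \<delta>) t))\<^sup>2)"
    proof -
      have "Re (hfun g (Complex (- B) t)) = B ^ 4 * r (- \<delta>) * Re (K (- \<delta>) t)"
        "Im (hfun g (Complex (- B) t)) = - (B ^ 3 * r (- \<delta>) * Im (K (- \<delta>) t))"
        using h[of "- B" t, unfolded e] B by simp_all
      then show ?thesis by (simp add: eval_nat_numeral algebra_simps)
    qed
    moreover have "B * (Re (K (- \<delta>) t))\<^sup>2 + (Im (K (- \<delta>) t))\<^sup>2 > 0"
    proof -
      have "Re (K (- \<delta>) t) \<noteq> 0 \<or> Im (K (- \<delta>) t) \<noteq> 0"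
        using nz[of "- B" t, unfolded e] t B by (auto simp: complex_eq_iff)
      then show ?thesis using B by (auto intro: add_pos_nonneg add_nonneg_pos)
    qed
    moreover have "B ^ 3 * (r (- \<delta>))\<^sup>2 > 0" using B r[of "- \<delta>"] \<delta>(1) by simp
    ultimately show "0 < Re (hfun g (Complex (- B) t) * cnj (cnj (of_real (r (- \<delta>)) * K (- \<delta>) t)))"
      by simp
  qed
  ultimately show ?thesis using B by blast
qed

lemma norm_rotate: "(u * c - s)\<^sup>2 + (u * s + c)\<^sup>2 = (u\<^sup>2 + 1) * (s\<^sup>2 + c\<^sup>2)" for u c s :: real
  by (simp add: power2_eq_square algebra_simps)

text \<open>The real part of \<open>(u + i)\<^sup>4 exp (4 i \<theta>)\<close>.\<close>

lemma cos_sin_quadruple: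
  fixes u \<theta> :: real
  shows "(u * cos \<theta> - sin \<theta>)^4 - 6 * (u * cos \<theta> - sin \<theta>)^2 * (u * sin \<theta> + cos \<theta>)^2 + (u * sin \<theta> + cos \<theta>)^4 =
   cos (4 * \<theta>) * (u^4 - 6 * u^2 + 1) - sin (4 * \<theta>) * (4 * u^3 - 4 * u)"
proof -
  have re: "Re (Complex x y ^ 4) = x^4 - 6 * x^2 * y^2 + y^4" "Im (Complex x y ^ 4) = 4 * x^3 * y - 4 * x * y^3" for x y
    by (simp_all add: eval_nat_numeral algebra_simps)
  have "Complex (u * cos \<theta> - sin \<theta>) (u * sin \<theta> + cos \<theta>) = cis \<theta> * Complex u 1"
    by (simp add: complex_eq_iff algebra_simps)
  then have "Complex (u * cos \<theta> - sin \<theta>) (u * sin \<theta> + cos \<theta>) ^ 4 = cis (4 * \<theta>) * Complex u 1 ^ 4"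
    using Complex.DeMoivre[of \<theta> 4] by (simp add: power_mult_distrib)
  from arg_cong[OF this, of Re] show ?thesis by (simp only: re times_complex.sel cis.sel) (simp add: mult.commute)
qed

text \<open>On the line at infinity \<open>H0\<close> and \<open>H1\<close> are, up to the factor \<open>64 \<epsilon> (1 - \<epsilon>\<^sup>2)\<close>, equal to
  \<open>4 (2 c + \<epsilon> + \<epsilon> c\<^sup>2)\<close> and \<open>s\<close> with \<open>c = cos (4 \<theta>)\<close> and \<open>s = sin (4 \<theta>)\<close>.  This path stays within a right angle
  of \<open>\<plusminus> (c, 4 s)\<close>, an ellipse that winds four times around 0.\<close>

theorem degree_at_infinity_generic:
  assumes G: "\<And>x y. tern g x y 0 = (x\<^sup>2 + y\<^sup>2)\<^sup>2 + \<epsilon> * (x^4 - 6 * x^2 * y^2 + y^4)" and \<epsilon>: "\<bar>\<epsilon>\<bar> < 1" "\<epsilon> \<noteq> 0"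
  shows "\<exists>B>0. (\<forall>b \<theta>. B \<le> \<bar>b\<bar> \<longrightarrow> \<theta> \<in> {0..2 * pi} \<longrightarrow> hfun g (Complex b \<theta>) \<noteq> 0) \<and>
    has_deg (\<lambda>t. hfun g (Complex B t)) 4 \<and> has_deg (\<lambda>t. hfun g (Complex (- B) t)) (- 4)"
proof (rule degree_at_infinity[where r = "\<lambda>_. 1" and m = "\<lambda>t. of_real (sgn \<epsilon>) * Complex (cos (4 * t)) (4 * sin (4 * t))"
      and K = "\<lambda>\<tau> \<theta>. of_real (H0 (line_value g 1 \<tau> \<theta>)) + \<i> * of_real (H1 (line_value g 1 \<tau> \<theta>))"])
  show "continuous_on UNIV (\<lambda>p. complex_of_real (H0 (line_value g 1 (fst p) (snd p))) + \<i> * of_real (H1 (line_value g 1 (fst p) (snd p))))"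
    unfolding H0_def H1_def cf_defs line_value_def tern_expand by (intro continuous_intros) auto
  show "complex_of_real (H0 (line_value g 1 \<tau> (2 * pi))) + \<i> * of_real (H1 (line_value g 1 \<tau> (2 * pi))) =
     of_real (H0 (line_value g 1 \<tau> 0)) + \<i> * of_real (H1 (line_value g 1 \<tau> 0))" for \<tau>
    by (simp add: line_value_def[abs_def])
  have c4: "has_deg (\<lambda>t. Complex (cos (4 * t)) (4 * sin (4 * t))) 4"
  proof (rule has_deg_perturb)
    show "has_deg (\<lambda>t. exp (0 + of_int 4 * (\<i> * of_real t))) 4" by (rule has_deg_exp)
    show "continuous_on {0..2 * pi} (\<lambda>t. Complex (cos (4 * t)) (4 * sin (4 * t)))"
      by (intro continuous_on_Complex continuous_intros)
    have "cos (4 * (2 * pi)) = 1" "sin (4 * (2 * pi)) = 0"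
      using cos_int_2pin[of 4] sin_int_2pin[of 4] by (simp_all add: mult.commute)
    then show "Complex (cos (4 * (2 * pi))) (4 * sin (4 * (2 * pi))) = Complex (cos (4 * 0)) (4 * sin (4 * 0))" by simp
    fix t :: real
    have "exp (0 + of_int 4 * (\<i> * of_real t)) = cis (4 * t)" by (simp add: cis_conv_exp mult_ac)
    then have "Re (Complex (cos (4 * t)) (4 * sin (4 * t)) * cnj (exp (0 + of_int 4 * (\<i> * of_real t)))) =
        (cos (4 * t))\<^sup>2 + 4 * (sin (4 * t))\<^sup>2"
      by (simp add: power2_eq_square)
    also have "\<dots> = 1 + 3 * (sin (4 * t))\<^sup>2" using sin_cos_squared_add[of "4 * t"] by linarith
    also have "\<dots> > 0" by (simp add: add_pos_nonneg)
    finally show "0 < Re (Complex (cos (4 * t)) (4 * sin (4 * t)) * cnj (exp (0 + of_int 4 * (\<i> * of_real t))))" .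
  qed
  have "has_deg (\<lambda>t. complex_of_real (sgn \<epsilon>) * Complex (cos (4 * t)) (4 * sin (4 * t))) (0 + 4)"
    using \<epsilon>(2) by (intro has_deg_mult has_deg_0_const c4) (simp add: sgn_if)
  then show "has_deg (\<lambda>t. of_real (sgn \<epsilon>) * Complex (cos (4 * t)) (4 * sin (4 * t))) 4" by simp
  fix \<theta> :: real
  define c s where "c = cos (4 * \<theta>)" and "s = sin (4 * \<theta>)"
  have cs: "s\<^sup>2 = 1 - c\<^sup>2" unfolding c_def s_def by (simp add: sin_squared_eq)
  have L: "line_value g 1 0 \<theta> u = (1 + \<epsilon> * c) * u^4 + (- 4 * \<epsilon> * s) * u^3 + (2 - 6 * \<epsilon> * c) * u^2
      + (4 * \<epsilon> * s) * u + (1 + \<epsilon> * c)" for u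
  proof -
    have "(u * cos \<theta> - sin \<theta>)\<^sup>2 + (u * sin \<theta> + cos \<theta>)\<^sup>2 = (u\<^sup>2 + 1) * ((sin \<theta>)\<^sup>2 + (cos \<theta>)\<^sup>2)"
      by (rule norm_rotate)
    then have "(u * cos \<theta> - sin \<theta>)\<^sup>2 + (u * sin \<theta> + cos \<theta>)\<^sup>2 = u\<^sup>2 + 1" by simp
    then have "line_value g 1 0 \<theta> u = (u\<^sup>2 + 1)\<^sup>2 + \<epsilon> * (c * (u^4 - 6 * u^2 + 1) - s * (4 * u^3 - 4 * u))"
      unfolding line_value_def G c_def s_def cos_sin_quadruple[symmetric] by simp
    then show ?thesis by (simp add: eval_nat_numeral algebra_simps)
  qed
  have "H1 (line_value g 1 0 \<theta>) = 64 * \<epsilon> * s * ((1 + \<epsilon> * c) * (1 - \<epsilon> * c) - \<epsilon>\<^sup>2 * s\<^sup>2)"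
    unfolding H1_def cf_poly[OF L] by (simp add: eval_nat_numeral algebra_simps)
  then have h1: "H1 (line_value g 1 0 \<theta>) = 64 * \<epsilon> * (1 - \<epsilon>\<^sup>2) * s"
    unfolding cs by (simp add: power2_eq_square algebra_simps)
  have "H0 (line_value g 1 0 \<theta>) = (32 * \<epsilon> * c * (1 + \<epsilon> * c) + 16 * \<epsilon>\<^sup>2 * s\<^sup>2) * (16 * (1 + \<epsilon> * c) * (1 - \<epsilon> * c) - 16 * \<epsilon>\<^sup>2 * s\<^sup>2)"
    unfolding H0_def cf_poly[OF L] by (simp add: eval_nat_numeral algebra_simps)
  then have h0: "H0 (line_value g 1 0 \<theta>) = 256 * \<epsilon> * (1 - \<epsilon>\<^sup>2) * (2 * c + \<epsilon> + \<epsilon> * c\<^sup>2)"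
    unfolding cs by (simp add: power2_eq_square algebra_simps)
  have "Re ((of_real (H0 (line_value g 1 0 \<theta>)) + \<i> * of_real (H1 (line_value g 1 0 \<theta>))) *
      cnj (of_real (sgn \<epsilon>) * Complex c (4 * s))) = sgn \<epsilon> * (H0 (line_value g 1 0 \<theta>) * c + 4 * H1 (line_value g 1 0 \<theta>) * s)"
    by (simp add: algebra_simps)
  also have "\<dots> = 256 * (\<epsilon> * sgn \<epsilon>) * (1 - \<epsilon>\<^sup>2) * (2 * c\<^sup>2 + \<epsilon> * c + \<epsilon> * c\<^sup>2 * c + s\<^sup>2)"
    unfolding h0 h1 by (simp add: power2_eq_square algebra_simps)
  also have "\<dots> = 256 * \<bar>\<epsilon>\<bar> * (1 - \<epsilon>\<^sup>2) * ((1 + c\<^sup>2) * (1 + \<epsilon> * c))"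
    unfolding cs abs_sgn[symmetric] by (simp add: power2_eq_square algebra_simps)
  also have "\<dots> > 0"
  proof -
    have "\<bar>\<epsilon> * c\<bar> \<le> \<bar>\<epsilon>\<bar> * 1" unfolding abs_mult c_def by (intro mult_left_mono) auto
    then have "1 + \<epsilon> * c > 0" using \<epsilon>(1) by linarith
    moreover have "\<epsilon>\<^sup>2 < 1" using \<epsilon>(1) by (simp add: abs_square_less_1)
    moreover have "1 + c\<^sup>2 > 0" by (simp add: add_pos_nonneg)
    ultimately show ?thesis using \<epsilon>(2) by simp
  qed
  finally show "0 < Re ((of_real (H0 (line_value g 1 0 \<theta>)) + \<i> * of_real (H1 (line_value g 1 0 \<theta>))) *
      cnj (of_real (sgn \<epsilon>) * Complex (cos (4 * \<theta>)) (4 * sin (4 * \<theta>))))" unfolding c_def s_def .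
qed auto

text \<open>The restriction to the line at infinity is a square, so \<open>h\<close> vanishes there to first order in \<open>\<tau>\<close>.
  The leading coefficient has real and imaginary part \<open>64 Re v\<close> and \<open>8 Im v\<close> for \<open>v = W exp (3 i \<theta>)\<close>,
  where \<open>W\<close> comes from the normal cubic of the line at infinity at its points of tangency.\<close>

theorem degree_at_infinity_bitangent:
  assumes G: "\<And>x y. tern g x y 0 = (x\<^sup>2 + y\<^sup>2)\<^sup>2"
    and V: "Complex (g (0,3,1) - g (2,1,1)) (g (1,2,1) - g (3,0,1)) \<noteq> 0"
  shows "\<exists>B>0. (\<forall>b \<theta>. B \<le> \<bar>b\<bar> \<longrightarrow> \<theta> \<in> {0..2 * pi} \<longrightarrow> hfun g (Complex b \<theta>) \<noteq> 0) \<and>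
    has_deg (\<lambda>t. hfun g (Complex B t)) 3 \<and> has_deg (\<lambda>t. hfun g (Complex (- B) t)) (- 3)"
proof -
  define W where "W = Complex (g (0,3,1) - g (2,1,1)) (g (1,2,1) - g (3,0,1))"
  define M where "M \<tau> \<theta> u = (let x = u * cos \<theta> - sin \<theta>; y = u * sin \<theta> + cos \<theta> in
     g (3,0,1) * x^3 + g (2,1,1) * x^2 * y + g (1,2,1) * x * y^2 + g (0,3,1) * y^3
     + \<tau> * (g (2,0,2) * x^2 + g (1,1,2) * x * y + g (0,2,2) * y^2 + \<tau> * (g (1,0,3) * x + g (0,1,3) * y + \<tau> * g (0,0,4))))" for \<tau> \<theta> u
  define m0 m1 m2 m3 m4 where "m0 \<tau> \<theta> = cf0 (M \<tau> \<theta>)" and "m1 \<tau> \<theta> = cf1 (M \<tau> \<theta>)" and "m2 \<tau> \<theta> = cf2 (M \<tau> \<theta>)"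
    and "m3 \<tau> \<theta> = cf3 (M \<tau> \<theta>)" and "m4 \<tau> \<theta> = cf4 (M \<tau> \<theta>)" for \<tau> \<theta>
  define K1 where "K1 \<tau> \<theta> = \<tau>\<^sup>2 * m3 \<tau> \<theta> ^ 3 - 4 * (1 + \<tau> * m4 \<tau> \<theta>) * m3 \<tau> \<theta> * (2 + \<tau> * m2 \<tau> \<theta>)
     + 8 * (1 + \<tau> * m4 \<tau> \<theta>)\<^sup>2 * m1 \<tau> \<theta>" for \<tau> \<theta>
  define X where "X \<tau> \<theta> = 8 * m4 \<tau> \<theta> + 4 * m2 \<tau> \<theta> + 4 * \<tau> * m4 \<tau> \<theta> * m2 \<tau> \<theta> - \<tau> * m3 \<tau> \<theta> ^ 2" for \<tau> \<theta>
  define K0 where "K0 \<tau> \<theta> = 64 * (m0 \<tau> \<theta> * (1 + \<tau> * m4 \<tau> \<theta>) ^ 3 + 3 * m4 \<tau> \<theta> + 3 * \<tau> * m4 \<tau> \<theta> ^ 2 + \<tau>\<^sup>2 * m4 \<tau> \<theta> ^ 3)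
     - 16 * X \<tau> \<theta> - \<tau> * X \<tau> \<theta> ^ 2" for \<tau> \<theta>
  have L: "line_value g 1 \<tau> \<theta> u = (1 * u^4 + 0 * u^3 + 2 * u^2 + 0 * u + 1) + \<tau> * M \<tau> \<theta> u" for \<tau> \<theta> u
  proof -
    have "(u * cos \<theta> - sin \<theta>)\<^sup>2 + (u * sin \<theta> + cos \<theta>)\<^sup>2 = (u\<^sup>2 + 1) * ((sin \<theta>)\<^sup>2 + (cos \<theta>)\<^sup>2)"
      by (rule norm_rotate)
    then have sq: "(u * cos \<theta> - sin \<theta>)\<^sup>2 + (u * sin \<theta> + cos \<theta>)\<^sup>2 = u\<^sup>2 + 1" by simp
    have "tern g x y \<tau> = tern g x y 0 + \<tau> * (g (3,0,1) * x^3 + g (2,1,1) * x^2 * y + g (1,2,1) * x * y^2 + g (0,3,1) * y^3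
     + \<tau> * (g (2,0,2) * x^2 + g (1,1,2) * x * y + g (0,2,2) * y^2 + \<tau> * (g (1,0,3) * x + g (0,1,3) * y + \<tau> * g (0,0,4))))" for x y
      unfolding tern_expand by (simp add: eval_nat_numeral algebra_simps)
    then have "line_value g 1 \<tau> \<theta> u = (u\<^sup>2 + 1)\<^sup>2 + \<tau> * M \<tau> \<theta> u"
      unfolding line_value_def M_def Let_def G by (simp add: sq)
    then show ?thesis by (simp add: eval_nat_numeral algebra_simps)
  qed
  have add: "cf0 (\<lambda>u. P u + \<tau> * R u) = cf0 P + \<tau> * cf0 R" "cf1 (\<lambda>u. P u + \<tau> * R u) = cf1 P + \<tau> * cf1 R"
    "cf2 (\<lambda>u. P u + \<tau> * R u) = cf2 P + \<tau> * cf2 R" "cf3 (\<lambda>u. P u + \<tau> * R u) = cf3 P + \<tau> * cf3 R"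
    "cf4 (\<lambda>u. P u + \<tau> * R u) = cf4 P + \<tau> * cf4 R" for P R :: "real \<Rightarrow> real" and \<tau>
    unfolding cf_defs by (simp_all add: field_simps)
  have base: "cf0 (\<lambda>u :: real. 1 * u^4 + 0 * u^3 + 2 * u^2 + 0 * u + 1) = 1" "cf1 (\<lambda>u :: real. 1 * u^4 + 0 * u^3 + 2 * u^2 + 0 * u + 1) = 0"
    "cf2 (\<lambda>u :: real. 1 * u^4 + 0 * u^3 + 2 * u^2 + 0 * u + 1) = 2" "cf3 (\<lambda>u :: real. 1 * u^4 + 0 * u^3 + 2 * u^2 + 0 * u + 1) = 0"
    "cf4 (\<lambda>u :: real. 1 * u^4 + 0 * u^3 + 2 * u^2 + 0 * u + 1) = 1"
    by (rule cf_poly, rule refl)+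
  have cf: "cf0 (line_value g 1 \<tau> \<theta>) = 1 + \<tau> * m0 \<tau> \<theta>" "cf1 (line_value g 1 \<tau> \<theta>) = \<tau> * m1 \<tau> \<theta>"
    "cf2 (line_value g 1 \<tau> \<theta>) = 2 + \<tau> * m2 \<tau> \<theta>" "cf3 (line_value g 1 \<tau> \<theta>) = \<tau> * m3 \<tau> \<theta>"
    "cf4 (line_value g 1 \<tau> \<theta>) = 1 + \<tau> * m4 \<tau> \<theta>" for \<tau> \<theta>
  proof -
    have "line_value g 1 \<tau> \<theta> = (\<lambda>u. (1 * u^4 + 0 * u^3 + 2 * u^2 + 0 * u + 1) + \<tau> * M \<tau> \<theta> u)"
      by (rule ext) (rule L)
    then show "cf0 (line_value g 1 \<tau> \<theta>) = 1 + \<tau> * m0 \<tau> \<theta>" "cf1 (line_value g 1 \<tau> \<theta>) = \<tau> * m1 \<tau> \<theta>"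
    "cf2 (line_value g 1 \<tau> \<theta>) = 2 + \<tau> * m2 \<tau> \<theta>" "cf3 (line_value g 1 \<tau> \<theta>) = \<tau> * m3 \<tau> \<theta>"
    "cf4 (line_value g 1 \<tau> \<theta>) = 1 + \<tau> * m4 \<tau> \<theta>"
      by (simp_all only: add base m0_def m1_def m2_def m3_def m4_def add_0)
  qed
  have Wdeg: "has_deg (\<lambda>t. W * exp (0 + of_int 3 * (\<i> * of_real t))) 3"
    using has_deg_mult[OF has_deg_0_const has_deg_exp[of 0 3], of W] V by (simp add: W_def)
  show ?thesis
  proof (rule degree_at_infinity[where r = "\<lambda>\<tau>. \<tau>" and K = "\<lambda>\<tau> \<theta>. of_real (K0 \<tau> \<theta>) + \<i> * of_real (K1 \<tau> \<theta>)", OF _ _ _ _ Wdeg])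
    fix \<tau> \<theta>
    have "H1 (line_value g 1 \<tau> \<theta>) = \<tau> * K1 \<tau> \<theta>"
      unfolding H1_def cf K1_def by (simp add: eval_nat_numeral algebra_simps)
    moreover have "H0 (line_value g 1 \<tau> \<theta>) = \<tau> * K0 \<tau> \<theta>"
    proof -
      have "4 * (1 + \<tau> * m4 \<tau> \<theta>) * (2 + \<tau> * m2 \<tau> \<theta>) - (\<tau> * m3 \<tau> \<theta>)\<^sup>2 = 8 + \<tau> * X \<tau> \<theta>"
        unfolding X_def by (simp add: power2_eq_square algebra_simps)
      then show ?thesis unfolding H0_def cf K0_def by (simp add: eval_nat_numeral algebra_simps)
    qed
    ultimately show "complex_of_real (H0 (line_value g 1 \<tau> \<theta>)) + \<i> * of_real (H1 (line_value g 1 \<tau> \<theta>)) =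
        of_real \<tau> * (of_real (K0 \<tau> \<theta>) + \<i> * of_real (K1 \<tau> \<theta>))" by (simp add: algebra_simps)
  next
    show "continuous_on UNIV (\<lambda>p. complex_of_real (K0 (fst p) (snd p)) + \<i> * of_real (K1 (fst p) (snd p)))"
    proof -
      have M: "continuous_on UNIV (\<lambda>p. M (fst p) (snd p) u)" for u
        unfolding M_def Let_def by (intro continuous_intros)
      have m: "continuous_on UNIV (\<lambda>p. m0 (fst p) (snd p))" "continuous_on UNIV (\<lambda>p. m1 (fst p) (snd p))"
        "continuous_on UNIV (\<lambda>p. m2 (fst p) (snd p))" "continuous_on UNIV (\<lambda>p. m3 (fst p) (snd p))"
        "continuous_on UNIV (\<lambda>p. m4 (fst p) (snd p))"
        unfolding m0_def m1_def m2_def m3_def m4_def cf_defs by (intro continuous_intros M; simp)+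
      have X: "continuous_on UNIV (\<lambda>p. X (fst p) (snd p))" unfolding X_def by (intro continuous_intros m)
      show ?thesis unfolding K0_def K1_def by (intro continuous_intros m X)
    qed
    have "M \<tau> (2 * pi) = M \<tau> 0" for \<tau> by (simp add: M_def fun_eq_iff)
    then show "complex_of_real (K0 \<tau> (2 * pi)) + \<i> * of_real (K1 \<tau> (2 * pi)) = of_real (K0 \<tau> 0) + \<i> * of_real (K1 \<tau> 0)" for \<tau>
      unfolding K0_def K1_def X_def m0_def m1_def m2_def m3_def m4_def by simp
  next
    fix \<theta> :: real
    define c s where "c = cos \<theta>" and "s = sin \<theta>"
    have M0: "M 0 \<theta> u = 0 * u^4 + (g (3,0,1) * c^3 + g (2,1,1) * (c^2 * s) + g (1,2,1) * (c * s^2) + g (0,3,1) * s^3) * u^3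
      + (g (3,0,1) * (- 3 * c^2 * s) + g (2,1,1) * (c^3 - 2 * c * s^2) + g (1,2,1) * (2 * s * c^2 - s^3) + g (0,3,1) * (3 * s^2 * c)) * u^2
      + (g (3,0,1) * (3 * c * s^2) + g (2,1,1) * (s^3 - 2 * c^2 * s) + g (1,2,1) * (c^3 - 2 * s^2 * c) + g (0,3,1) * (3 * s * c^2)) * u
      + (g (3,0,1) * (- (s^3)) + g (2,1,1) * (c * s^2) + g (1,2,1) * (- (s * c^2)) + g (0,3,1) * c^3)" for u
      unfolding M_def Let_def c_def[symmetric] s_def[symmetric] by (simp add: eval_nat_numeral algebra_simps)
    define v where "v = W * exp (0 + of_int 3 * (\<i> * of_real \<theta>))"
    have "exp (0 + of_int 3 * (\<i> * complex_of_real \<theta>)) = exp (\<i> * of_real \<theta>) ^ 3"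
      by (simp flip: exp_of_nat_mult)
    also have "\<dots> = Complex c s ^ 3" by (simp add: cis_conv_exp[symmetric] c_def s_def cis.code)
    finally have v: "v = W * Complex c s ^ 3" unfolding v_def by simp
    have "K0 0 \<theta> = 64 * Re v" "K1 0 \<theta> = 8 * Im v"
      unfolding K0_def K1_def X_def m0_def m1_def m2_def m3_def m4_def cf_poly[OF M0] v W_def
      by (simp_all add: eval_nat_numeral algebra_simps)
    then have "Re ((of_real (K0 0 \<theta>) + \<i> * of_real (K1 0 \<theta>)) * cnj v) = 64 * (Re v)\<^sup>2 + 8 * (Im v)\<^sup>2"
      by (simp add: power2_eq_square)
    moreover have "v \<noteq> 0" using V unfolding v_def W_def by simp
    then have "Re v \<noteq> 0 \<or> Im v \<noteq> 0" by (simp add: complex_eq_iff)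
    then have "64 * (Re v)\<^sup>2 + 8 * (Im v)\<^sup>2 > 0" by (auto intro: add_pos_nonneg add_nonneg_pos)
    ultimately show "0 < Re ((of_real (K0 0 \<theta>) + \<i> * of_real (K1 0 \<theta>)) * cnj (W * exp (0 + of_int 3 * (\<i> * of_real \<theta>))))"
      unfolding v_def[symmetric] by simp
  qed auto
qed

section \<open>Positive definite binary quartics\<close>

text \<open>The second term is \<open>\<epsilon> Re ((x + i y)\<^sup>4)\<close>, so that rotations act on the two terms in a simple way.\<close>

definition nf :: "real \<Rightarrow> real \<Rightarrow> real \<Rightarrow> real" where
  "nf \<epsilon> x y = (x\<^sup>2 + y\<^sup>2)\<^sup>2 + \<epsilon> * (x^4 - 6 * x^2 * y^2 + y^4)"

text \<open>The scaling of the variables equalizes the coefficients of \<open>x\<^sup>4\<close> and \<open>y\<^sup>4\<close>.  The product is then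
  a multiple of \<open>x\<^sup>4 + p x\<^sup>2 y\<^sup>2 + y\<^sup>4\<close> with \<open>p > 0\<close>, and \<open>\<epsilon>\<close> is the solution of \<open>(1 + \<epsilon>) p = 2 - 6 \<epsilon>\<close>.\<close>

lemma normal_form_diagonal:
  assumes "\<mu>1 > 0" "\<mu>2 > 0"
  shows "\<exists>k1 k2 \<epsilon>. k1 \<noteq> 0 \<and> k2 \<noteq> 0 \<and> \<bar>\<epsilon>\<bar> < 1 \<and>
    (\<forall>x y. ((k1 * x)\<^sup>2 + (k2 * y)\<^sup>2) * (\<mu>1 * (k1 * x)\<^sup>2 + \<mu>2 * (k2 * y)\<^sup>2) = nf \<epsilon> x y)"
proof -
  define r1 r2 where "r1 = sqrt \<mu>1" and "r2 = sqrt \<mu>2"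
  have r: "r1 > 0" "r2 > 0" "r1\<^sup>2 = \<mu>1" "r2\<^sup>2 = \<mu>2" using assms by (simp_all add: r1_def r2_def)
  define p where "p = (r1\<^sup>2 + r2\<^sup>2) / (r1 * r2)"
  have p: "p > 0" unfolding p_def using r(1,2) by (intro divide_pos_pos add_pos_pos mult_pos_pos) auto
  define \<epsilon> where "\<epsilon> = (2 - p) / (6 + p)"
  have e: "1 + \<epsilon> = 8 / (6 + p)" "2 - 6 * \<epsilon> = 8 * p / (6 + p)" "1 - \<epsilon> = (4 + 2 * p) / (6 + p)"
    using p by (simp_all add: \<epsilon>_def field_simps)
  then have pos: "1 + \<epsilon> > 0" "1 - \<epsilon> > 0" using p by simp_all
  define q where "q = sqrt (1 + \<epsilon>)"
  have q: "q > 0" "q\<^sup>2 = 1 + \<epsilon>" using pos by (simp_all add: q_def)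
  define k1 k2 where "k1 = sqrt (q / r1)" and "k2 = sqrt (q / r2)"
  have k: "k1\<^sup>2 = q / r1" "k2\<^sup>2 = q / r2" "k1 \<noteq> 0" "k2 \<noteq> 0"
    using q r by (simp_all add: k1_def k2_def)
  have "((k1 * x)\<^sup>2 + (k2 * y)\<^sup>2) * (\<mu>1 * (k1 * x)\<^sup>2 + \<mu>2 * (k2 * y)\<^sup>2) = nf \<epsilon> x y" for x y
  proof -
    have "((k1 * x)\<^sup>2 + (k2 * y)\<^sup>2) * (\<mu>1 * (k1 * x)\<^sup>2 + \<mu>2 * (k2 * y)\<^sup>2) =
        q\<^sup>2 * (x^4 + y^4) + q\<^sup>2 * ((r1\<^sup>2 + r2\<^sup>2) / (r1 * r2)) * (x\<^sup>2 * y\<^sup>2)"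
      unfolding power_mult_distrib k r(3,4)[symmetric] using r(1,2)
      by (simp add: field_simps) (simp add: power2_eq_square power4_eq_xxxx algebra_simps)
    also have "\<dots> = (1 + \<epsilon>) * (x^4 + y^4) + (1 + \<epsilon>) * p * (x\<^sup>2 * y\<^sup>2)" unfolding q(2) p_def ..
    also have "(1 + \<epsilon>) * p = 2 - 6 * \<epsilon>" unfolding e by simp
    finally show ?thesis unfolding nf_def by (simp add: power2_eq_square power4_eq_xxxx algebra_simps)
  qed
  then show ?thesis using k pos by (intro exI[of _ k1] exI[of _ k2] exI[of _ \<epsilon>]) auto
qed

text \<open>A rotation diagonalizes the second factor and preserves the first one.\<close>

lemma normal_form_quadratic:
  assumes pos: "\<And>x y. (x, y) \<noteq> (0, 0) \<Longrightarrow> A * x\<^sup>2 + 2 * B * x * y + C * y\<^sup>2 > (0 :: real)"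
  shows "\<exists>k11 k12 k21 k22 \<epsilon>. k11 * k22 - k12 * k21 \<noteq> 0 \<and> \<bar>\<epsilon>\<bar> < 1 \<and>
    (\<forall>x y. ((k11 * x + k12 * y)\<^sup>2 + (k21 * x + k22 * y)\<^sup>2) *
      (A * (k11 * x + k12 * y)\<^sup>2 + 2 * B * (k11 * x + k12 * y) * (k21 * x + k22 * y) + C * (k21 * x + k22 * y)\<^sup>2) = nf \<epsilon> x y)"
proof -
  \<comment> \<open>Rotation by half of this angle removes the mixed term.\<close>
  obtain R \<psi> where R: "A - C = R * cos \<psi>" "2 * B = R * sin \<psi>" using polar_Ex by metis
  define c s where "c = cos (\<psi> / 2)" and "s = sin (\<psi> / 2)"
  have cs: "s\<^sup>2 + c\<^sup>2 = 1" unfolding c_def s_def by (rule sin_cos_squared_add)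
  have dbl: "cos \<psi> = c\<^sup>2 - s\<^sup>2" "sin \<psi> = 2 * s * c"
    using cos_double[of "\<psi> / 2"] sin_double[of "\<psi> / 2"] by (simp_all add: c_def s_def)
  have cross: "B * (c\<^sup>2 - s\<^sup>2) = (A - C) * (s * c)"
  proof -
    have "B = R * (s * c)" "A - C = R * (c\<^sup>2 - s\<^sup>2)" using R unfolding dbl by simp_all
    then show ?thesis by (simp only: mult_ac)
  qed
  define \<mu>1 \<mu>2 where "\<mu>1 = A * c\<^sup>2 + 2 * B * c * s + C * s\<^sup>2" and "\<mu>2 = A * (- s)\<^sup>2 + 2 * B * (- s) * c + C * c\<^sup>2"
  have "(c, s) \<noteq> (0, 0)" using cs by auto
  then have "\<mu>1 > 0" unfolding \<mu>1_def by (rule pos)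
  have "(- s, c) \<noteq> (0, 0)" using cs by auto
  then have "\<mu>2 > 0" unfolding \<mu>2_def by (rule pos)
  obtain k1 k2 \<epsilon> where k: "k1 \<noteq> 0" "k2 \<noteq> 0" "\<bar>\<epsilon>\<bar> < 1"
    "\<And>x y. ((k1 * x)\<^sup>2 + (k2 * y)\<^sup>2) * (\<mu>1 * (k1 * x)\<^sup>2 + \<mu>2 * (k2 * y)\<^sup>2) = nf \<epsilon> x y"
    using normal_form_diagonal[OF \<open>\<mu>1 > 0\<close> \<open>\<mu>2 > 0\<close>] by blast
  have rot1: "(c * X - s * Y)\<^sup>2 + (s * X + c * Y)\<^sup>2 = X\<^sup>2 + Y\<^sup>2" for X Y
  proof -
    have "(c * X - s * Y)\<^sup>2 + (s * X + c * Y)\<^sup>2 = (s\<^sup>2 + c\<^sup>2) * (X\<^sup>2 + Y\<^sup>2)"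
      by (simp add: power2_eq_square algebra_simps)
    then show ?thesis unfolding cs by simp
  qed
  have rot2: "A * (c * X - s * Y)\<^sup>2 + 2 * B * (c * X - s * Y) * (s * X + c * Y) + C * (s * X + c * Y)\<^sup>2 =
      \<mu>1 * X\<^sup>2 + \<mu>2 * Y\<^sup>2" for X Y
  proof -
    have "A * (c * X - s * Y)\<^sup>2 + 2 * B * (c * X - s * Y) * (s * X + c * Y) + C * (s * X + c * Y)\<^sup>2 =
      \<mu>1 * X\<^sup>2 + \<mu>2 * Y\<^sup>2 + 2 * (B * (c\<^sup>2 - s\<^sup>2) - (A - C) * (s * c)) * (X * Y)"
      unfolding \<mu>1_def \<mu>2_def by (simp add: power2_eq_square algebra_simps)
    then show ?thesis unfolding cross by simp
  qed
  have "(c * k1) * (c * k2) - (- s * k2) * (s * k1) = (s\<^sup>2 + c\<^sup>2) * (k1 * k2)"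
    by (simp add: power2_eq_square algebra_simps)
  then have "(c * k1) * (c * k2) - (- s * k2) * (s * k1) \<noteq> 0" unfolding cs using k by simp
  moreover have "(((c * k1) * x + (- s * k2) * y)\<^sup>2 + ((s * k1) * x + (c * k2) * y)\<^sup>2) *
      (A * ((c * k1) * x + (- s * k2) * y)\<^sup>2 + 2 * B * ((c * k1) * x + (- s * k2) * y) * ((s * k1) * x + (c * k2) * y)
       + C * ((s * k1) * x + (c * k2) * y)\<^sup>2) = nf \<epsilon> x y" for x y
  proof -
    have e: "(c * k1) * x + (- s * k2) * y = c * (k1 * x) - s * (k2 * y)"
      "(s * k1) * x + (c * k2) * y = s * (k1 * x) + c * (k2 * y)" by simp_all
    show ?thesis unfolding e rot1 rot2 k(4) ..
  qed
  ultimately show ?thesis using k(3) by blast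
qed

text \<open>The quartic is the product of two definite quadratic forms, one of them from a pair of conjugate
  roots.  A linear change of variables turns this one into \<open>x\<^sup>2 + y\<^sup>2\<close>.\<close>

lemma positive_quartic_normal_form:
  fixes p0 p1 p2 p3 p4 :: real
  defines "G \<equiv> \<lambda>x y. p4 * x^4 + p3 * x^3 * y + p2 * x^2 * y^2 + p1 * x * y^3 + p0 * y^4"
  assumes pos: "\<And>x y. (x, y) \<noteq> (0, 0) \<Longrightarrow> G x y > 0"
  shows "\<exists>k11 k12 k21 k22 \<epsilon>. k11 * k22 - k12 * k21 \<noteq> 0 \<and> \<bar>\<epsilon>\<bar> < 1 \<and>
    (\<forall>x y. G (k11 * x + k12 * y) (k21 * x + k22 * y) = nf \<epsilon> x y)"
proof -
  have p4: "p4 > 0" using pos[of 1 0] by (simp add: G_def)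
  define P where "P = [:of_real p0, of_real p1, of_real p2, of_real p3, complex_of_real p4:]"
  have "\<not> constant (poly P)" using p4 by (simp add: constant_degree P_def)
  then obtain z where z: "poly P z = 0" using Fundamental_Theorem_Algebra.fundamental_theorem_of_algebra by blast
  have Im: "Im z \<noteq> 0"
  proof
    assume "Im z = 0"
    then have "z = of_real (Re z)" by (simp add: complex_eq_iff)
    then have "poly P z = of_real (G (Re z) 1)"
      by (subst \<open>z = of_real (Re z)\<close>) (simp add: P_def G_def eval_nat_numeral algebra_simps)
    then show False using z pos[of "Re z" 1] by simp
  qed
  \<comment> \<open>The monic quadratic factor with the roots \<open>z\<close> and \<open>cnj z\<close>, and the coefficients of the quotient.\<close>
  define a m where "a = 2 * Re z" and "m = (Re z)\<^sup>2 + (Im z)\<^sup>2"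
  define b' where "b' = p3 + a * p4"
  define c' where "c' = p2 + a * b' - m * p4"
  have quad: "z\<^sup>2 - of_real a * z + of_real m = 0"
    by (simp add: a_def m_def complex_eq_iff power2_eq_square algebra_simps)
  have "poly P z = (z\<^sup>2 - of_real a * z + of_real m) * (of_real p4 * z\<^sup>2 + of_real b' * z + of_real c')
      + of_real (p1 - (m * b' - a * c')) * z + of_real (p0 - m * c')"
    by (simp add: P_def b'_def c'_def power2_eq_square algebra_simps)
  then have rem: "of_real (p1 - (m * b' - a * c')) * z + of_real (p0 - m * c') = 0"
    unfolding quad z by simp
  have "Im (of_real r * z + of_real q) = r * Im z" for r q by simp
  then have "(p1 - (m * b' - a * c')) * Im z = 0" using arg_cong[OF rem, of Im] by (metis zero_complex.sel(2))
  then have p1: "p1 = m * b' - a * c'" using Im by simp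
  have "complex_of_real (p0 - m * c') = 0" using rem unfolding p1 by (simp only: diff_self of_real_0 mult_zero_left add_0)
  then have "p0 - m * c' = 0" by (simp only: of_real_eq_0_iff)
  then have p0: "p0 = m * c'" by (rule eq_iff_diff_eq_0[THEN iffD2])
  have G: "G x y = (x\<^sup>2 - a * x * y + m * y\<^sup>2) * (p4 * x\<^sup>2 + b' * x * y + c' * y\<^sup>2)" for x y
    unfolding G_def p1 p0 by (simp add: b'_def c'_def eval_nat_numeral algebra_simps)
  define d where "d = \<bar>Im z\<bar>"
  have d: "d > 0" "d\<^sup>2 = (Im z)\<^sup>2" using Im by (simp_all add: d_def)
  define A B C where "A = p4" and "B = (p4 * a + b') / (2 * d)" and "C = (p4 * a\<^sup>2 / 4 + b' * a / 2 + c') / d\<^sup>2"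
  have q1: "(X + a / (2 * d) * Y)\<^sup>2 - a * (X + a / (2 * d) * Y) * (Y / d) + m * (Y / d)\<^sup>2 = X\<^sup>2 + Y\<^sup>2" for X Y
  proof -
    have m: "m = a\<^sup>2 / 4 + d\<^sup>2" unfolding m_def a_def d(2) by (simp add: power2_eq_square)
    show ?thesis unfolding m using d(1) by (simp add: power2_eq_square field_simps)
  qed
  have q2: "p4 * (X + a / (2 * d) * Y)\<^sup>2 + b' * (X + a / (2 * d) * Y) * (Y / d) + c' * (Y / d)\<^sup>2 =
      A * X\<^sup>2 + 2 * B * X * Y + C * Y\<^sup>2" for X Y
    unfolding A_def B_def C_def using d(1) by (simp add: power2_eq_square field_simps)
  have GXY: "G (X + a / (2 * d) * Y) (Y / d) = (X\<^sup>2 + Y\<^sup>2) * (A * X\<^sup>2 + 2 * B * X * Y + C * Y\<^sup>2)" for X Y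
    unfolding G q1 q2 ..
  have "A * X\<^sup>2 + 2 * B * X * Y + C * Y\<^sup>2 > 0" if "(X, Y) \<noteq> (0, 0)" for X Y
  proof -
    have "(X + a / (2 * d) * Y, Y / d) \<noteq> (0, 0)" using that d(1) by auto
    then have "(X\<^sup>2 + Y\<^sup>2) * (A * X\<^sup>2 + 2 * B * X * Y + C * Y\<^sup>2) > 0" unfolding GXY[symmetric] by (rule pos)
    moreover have "X\<^sup>2 + Y\<^sup>2 > 0" using that by (auto simp: sum_power2_gt_zero_iff)
    ultimately show ?thesis by (simp add: zero_less_mult_iff)
  qed
  from normal_form_quadratic[OF this] obtain k11 k12 k21 k22 \<epsilon> where k: "k11 * k22 - k12 * k21 \<noteq> 0" "\<bar>\<epsilon>\<bar> < 1"
    "\<And>x y. ((k11 * x + k12 * y)\<^sup>2 + (k21 * x + k22 * y)\<^sup>2) *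
      (A * (k11 * x + k12 * y)\<^sup>2 + 2 * B * (k11 * x + k12 * y) * (k21 * x + k22 * y) + C * (k21 * x + k22 * y)\<^sup>2) = nf \<epsilon> x y"
    by blast
  have "G ((k11 + a / (2 * d) * k21) * x + (k12 + a / (2 * d) * k22) * y) (k21 / d * x + k22 / d * y) = nf \<epsilon> x y" for x y
  proof -
    have e: "(k11 + a / (2 * d) * k21) * x + (k12 + a / (2 * d) * k22) * y = (k11 * x + k12 * y) + a / (2 * d) * (k21 * x + k22 * y)"
      "k21 / d * x + k22 / d * y = (k21 * x + k22 * y) / d"
      by (simp_all add: algebra_simps add_divide_distrib)
    show ?thesis unfolding e GXY k(3) ..
  qed
  moreover have "(k11 + a / (2 * d) * k21) * (k22 / d) - (k12 + a / (2 * d) * k22) * (k21 / d) \<noteq> 0"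
  proof -
    have "(k11 + a / (2 * d) * k21) * (k22 / d) - (k12 + a / (2 * d) * k22) * (k21 / d) = (k11 * k22 - k12 * k21) / d"
      by (simp add: algebra_simps diff_divide_distrib)
    then show ?thesis using k(1) d(1) by simp
  qed
  ultimately show ?thesis using k(2) by blast
qed

section \<open>The signed count of real bitangents\<close>

text \<open>The zeros are isolated and lie in a compact rectangle.\<close>

lemma finite_nondegenerate_zeros:
  fixes h :: "complex \<Rightarrow> complex"
  assumes cont: "continuous_on UNIV h"
    and bound: "\<And>z. h z = 0 \<Longrightarrow> 0 \<le> Im z \<Longrightarrow> Im z < 2 * pi \<Longrightarrow> \<bar>Re z\<bar> < B"
    and deriv: "\<And>z. h z = 0 \<Longrightarrow> \<exists>A. (h has_derivative A) (at z) \<and> jac A \<noteq> 0"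
  shows "finite {z. h z = 0 \<and> 0 \<le> Im z \<and> Im z < 2 * pi}" (is "finite ?K")
proof (rule ccontr)
  assume inf: "infinite ?K"
  have "?K \<subseteq> cbox (Complex (- B) 0) (Complex B (2 * pi))"
    using bound by (fastforce simp: in_cbox_complex_iff abs_less_iff)
  moreover have "compact (cbox (Complex (- B) 0) (Complex B (2 * pi)))" by (rule compact_cbox)
  ultimately obtain x where x: "x islimpt ?K"
    using inf unfolding compact_eq_Bolzano_Weierstrass by blast
  have "closed {z. h z = 0}"
    using continuous_closed_vimage[of "{0}" h] cont
    by (simp add: vimage_def continuous_on_eq_continuous_at)
  moreover have "x islimpt {z. h z = 0}" using x by (rule islimpt_subset) auto
  ultimately have "h x = 0" using closed_limpt by blast
  then obtain A where A: "(h has_derivative A) (at x)" "jac A \<noteq> 0" using deriv by blast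
  obtain c where c: "c > 0" "eventually (\<lambda>z. c * cmod (z - x) \<le> cmod (h z)) (at x)"
    using nondegenerate_zero_growth[OF A(1) \<open>h x = 0\<close> A(2)] by blast
  have "eventually (\<lambda>z. z \<notin> ?K) (at x)"
    using c(2) eventually_neq_at_within[of x]
    by eventually_elim (use c(1) in \<open>auto simp: mult_le_0_iff\<close>)
  then show False using x unfolding islimpt_iff_eventually by blast
qed

text \<open>Coordinates in which \<open>e1\<close> and \<open>e2\<close> span the line at infinity and \<open>e0\<close> is the origin of the affine
  plane.  The sign \<open>\<sigma>\<close> makes the quartic positive on the line at infinity.\<close>

locale real_frame =
  fixes f gf :: "real quartic" and Linf :: "real proj_plane" and e1 e2 e0 :: "real ^ 3" and \<sigma> \<epsilon> :: real
  assumes smooth: "smooth_quartic (cquartic f)"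
    and linf: "dot (rep_proj_plane Linf) e1 = 0" "dot (rep_proj_plane Linf) e2 = 0" "dot (rep_proj_plane Linf) e0 = 1"
    and indep: "crossp e1 e2 \<noteq> 0"
    and gf: "\<And>x y z. quartic_eval (cquartic f) (x *s map_coords of_real e1 + y *s map_coords of_real e2
       + z *s map_coords of_real e0) = tern (cquartic gf) x y z"
    and \<sigma>: "\<sigma> = 1 \<or> \<sigma> = - 1"
    and nf: "\<And>x y. \<sigma> * tern gf x y 0 = nf \<epsilon> x y" and \<epsilon>: "\<bar>\<epsilon>\<bar> < 1"
begin

definition g :: "real quartic" where "g e = \<sigma> * gf e"

lemma tern_scale: "tern (\<lambda>e. c * h e) x y z = c * (tern h x y z :: 'a::comm_ring_1)"
  unfolding tern_expand by (simp add: algebra_simps)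

lemma tern_g: "tern g x y z = \<sigma> * tern gf x y z"
  unfolding g_def[abs_def] tern_scale ..

definition \<kappa> :: real where "\<kappa> = dot (crossp e1 e2) e0"

lemma crossp_e: "crossp e1 e2 = \<kappa> *s rep_proj_plane Linf"
proof -
  obtain c where c: "crossp e1 e2 = c *s rep_proj_plane Linf"
    using crossp_parallel[OF rep_nonzero linf(1,2)] by blast
  then have "c = \<kappa>" using linf(3) by (simp add: \<kappa>_def dot_linear)
  then show ?thesis using c by simp
qed

lemma \<kappa>_nz: "\<kappa> \<noteq> 0" using indep crossp_e by auto

lemma frame_ext:
  assumes "dot a e1 = dot b e1" "dot a e2 = dot b e2" "dot a e0 = dot b e0"
  shows "a = b"
proof -
  have det: "dot (crossp e1 e2) e0 \<noteq> 0" using \<kappa>_nz by (simp add: \<kappa>_def)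
  have w: "dot a w = dot b w" for w
    by (subst (1 2) frame_expand[OF det, of w]) (simp add: dot_linear assms)
  have "a $ 1 = b $ 1" using w[of "vector [1, 0, 0]"] by (simp add: dot_3)
  moreover have "a $ 2 = b $ 2" using w[of "vector [0, 1, 0]"] by (simp add: dot_3)
  moreover have "a $ 3 = b $ 3" using w[of "vector [0, 0, 1]"] by (simp add: dot_3)
  ultimately show ?thesis by (simp add: vec3_eq_iff)
qed

definition eu :: "real \<Rightarrow> real ^ 3" where "eu \<theta> = cos \<theta> *s e1 + sin \<theta> *s e2"
definition en :: "real \<Rightarrow> real ^ 3" where "en \<theta> = - sin \<theta> *s e1 + cos \<theta> *s e2"
definition ev :: "complex \<Rightarrow> real ^ 3" where "ev \<zeta> = e0 + Re \<zeta> *s en (Im \<zeta>)"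
definition form :: "complex \<Rightarrow> real ^ 3" where "form \<zeta> = crossp (eu (Im \<zeta>)) (ev \<zeta>)"
definition line :: "complex \<Rightarrow> real proj_plane" where "line \<zeta> = abs_proj_plane (form \<zeta>)"

lemma form_coords:
  "dot (form \<zeta>) e1 = \<kappa> * sin (Im \<zeta>)" "dot (form \<zeta>) e2 = - \<kappa> * cos (Im \<zeta>)" "dot (form \<zeta>) e0 = \<kappa> * Re \<zeta>"
proof -
  have 1: "dot (crossp (c *s e1 + s *s e2) (e0 + b *s (- s *s e1 + c *s e2))) e1 = \<kappa> * s"
    "dot (crossp (c *s e1 + s *s e2) (e0 + b *s (- s *s e1 + c *s e2))) e2 = - \<kappa> * c"
    "dot (crossp (c *s e1 + s *s e2) (e0 + b *s (- s *s e1 + c *s e2))) e0 = \<kappa> * b * (s\<^sup>2 + c\<^sup>2)" for c s b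
    unfolding \<kappa>_def dot_3 by (simp_all add: power2_eq_square algebra_simps)
  show "dot (form \<zeta>) e1 = \<kappa> * sin (Im \<zeta>)" "dot (form \<zeta>) e2 = - \<kappa> * cos (Im \<zeta>)" "dot (form \<zeta>) e0 = \<kappa> * Re \<zeta>"
    unfolding form_def eu_def ev_def en_def 1 by simp_all
qed

lemma form_nz: "form \<zeta> \<noteq> 0"
proof
  assume "form \<zeta> = 0"
  then have "sin (Im \<zeta>) = 0" "cos (Im \<zeta>) = 0" using form_coords[of \<zeta>] \<kappa>_nz by auto
  then show False using sin_cos_squared_add[of "Im \<zeta>"] by simp
qed

lemma form_orth: "dot (form \<zeta>) (eu (Im \<zeta>)) = 0" "dot (form \<zeta>) (ev \<zeta>) = 0" "dot (form \<zeta>) (en (Im \<zeta>)) = - \<kappa>"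
proof -
  show "dot (form \<zeta>) (eu (Im \<zeta>)) = 0" "dot (form \<zeta>) (ev \<zeta>) = 0" by (simp_all add: form_def)
  have "dot (form \<zeta>) (en (Im \<zeta>)) = - \<kappa> * ((sin (Im \<zeta>))\<^sup>2 + (cos (Im \<zeta>))\<^sup>2)"
    unfolding en_def dot_linear form_coords by (simp only: power2_eq_square algebra_simps)
  then show "dot (form \<zeta>) (en (Im \<zeta>)) = - \<kappa>" by simp
qed

lemma linf_frame: "dot (rep_proj_plane Linf) (eu \<theta>) = 0" "dot (rep_proj_plane Linf) (ev \<zeta>) = 1"
  unfolding eu_def ev_def en_def dot_linear linf by simp_all

lemma real_tern: "quartic_eval f (x *s e1 + y *s e2 + z *s e0) = tern gf x y z"
proof -
  have "complex_of_real (quartic_eval f (x *s e1 + y *s e2 + z *s e0)) = of_real (tern gf x y z)"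
    unfolding cquartic_eval[symmetric] tern_of_real[symmetric] map_of_real_linear gf ..
  then show ?thesis by simp
qed

lemma adapted_frame:
  "\<exists>g'. adapted gf (Re \<zeta>) (Im \<zeta>) g' \<and> (\<forall>x y z. quartic_eval (cquartic f) (x *s map_coords of_real (eu (Im \<zeta>))
     + y *s map_coords of_real (en (Im \<zeta>)) + z *s map_coords of_real (ev \<zeta>)) = tern (cquartic g') x y z)"
proof -
  obtain g' where g': "\<forall>x y z. quartic_eval (cquartic f) (x *s map_coords of_real (eu (Im \<zeta>))
     + y *s map_coords of_real (en (Im \<zeta>)) + z *s map_coords of_real (ev \<zeta>)) = tern (cquartic g') x y z"
    "\<And>x y z. quartic_eval f (x *s eu (Im \<zeta>) + y *s en (Im \<zeta>) + z *s ev \<zeta>) = tern g' x y z"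
    using quartic_real_subst[of f "eu (Im \<zeta>)" "en (Im \<zeta>)" "ev \<zeta>"] by blast
  have "x *s eu (Im \<zeta>) + y *s en (Im \<zeta>) + z *s ev \<zeta> = (x * cos (Im \<zeta>) - y * sin (Im \<zeta>) - z * (Re \<zeta> * sin (Im \<zeta>))) *s e1
      + (x * sin (Im \<zeta>) + y * cos (Im \<zeta>) + z * (Re \<zeta> * cos (Im \<zeta>))) *s e2 + z *s e0" for x y z
    unfolding eu_def en_def ev_def by (simp add: vec3_eq_iff algebra_simps)
  then have "adapted gf (Re \<zeta>) (Im \<zeta>) g'" unfolding adapted_def g'(2)[symmetric] real_tern[symmetric] by simp
  then show ?thesis using g'(1) by blast
qed

lemma nf_pos: "x\<^sup>2 + y\<^sup>2 = 1 \<Longrightarrow> nf \<epsilon> x y > 0"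
proof -
  assume 1: "x\<^sup>2 + y\<^sup>2 = 1"
  have "x^4 - 6 * x^2 * y^2 + y^4 = (x\<^sup>2 + y\<^sup>2)\<^sup>2 - 2 * (2 * x * y)\<^sup>2"
    by (simp add: power2_eq_square power4_eq_xxxx algebra_simps)
  moreover have "(2 * x * y)\<^sup>2 \<le> (x\<^sup>2 + y\<^sup>2)\<^sup>2"
  proof -
    have "(x\<^sup>2 + y\<^sup>2)\<^sup>2 - (2 * x * y)\<^sup>2 = (x\<^sup>2 - y\<^sup>2)\<^sup>2" by (simp add: power2_eq_square algebra_simps)
    then show ?thesis by (metis diff_ge_0_iff_ge zero_le_power2)
  qed
  ultimately have "\<bar>x^4 - 6 * x^2 * y^2 + y^4\<bar> \<le> 1"
    using zero_le_power2[of "2 * x * y"] unfolding 1 power_one abs_le_iff by linarith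
  then have "\<bar>\<epsilon> * (x^4 - 6 * x^2 * y^2 + y^4)\<bar> \<le> \<bar>\<epsilon>\<bar> * 1" unfolding abs_mult by (intro mult_left_mono) auto
  then show ?thesis unfolding nf_def 1 using \<epsilon> by simp
qed

lemma adapted_g: "adapted gf b \<theta> g' \<Longrightarrow> adapted g b \<theta> (\<lambda>e. \<sigma> * g' e)"
  unfolding adapted_def tern_scale tern_g by simp

lemma adapted_lead: "adapted g b \<theta> g' \<Longrightarrow> g' (4,0,0) > 0"
proof -
  assume "adapted g b \<theta> g'"
  then have "tern g' 1 0 0 = tern g (cos \<theta>) (sin \<theta>) 0" unfolding adapted_def by simp
  then have "g' (4,0,0) = nf \<epsilon> (cos \<theta>) (sin \<theta>)" unfolding tern_g nf by (simp add: tern_expand)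
  then show ?thesis using nf_pos[of "cos \<theta>" "sin \<theta>"] by simp
qed

lemma csqrt_\<sigma>: "(csqrt (of_real \<sigma>))\<^sup>2 = of_real \<sigma>" "csqrt (of_real \<sigma>) \<noteq> 0" "complex_of_real \<sigma> * of_real \<sigma> = 1" "\<sigma> * \<sigma> = 1"
  using \<sigma> by (auto simp flip: of_real_mult)

text \<open>The restriction to the line is \<open>\<sigma>\<close> times a real square, hence a complex square, and \<open>\<sigma>\<close> drops out
  of the product of the two normal derivatives.\<close>

lemma zero_imp_bitangent:
  assumes 0: "hfun g \<zeta> = 0"
  shows "bitangent (cquartic f) (base_change of_real (line \<zeta>))"
    "\<exists>A. (hfun g has_derivative A) (at \<zeta>) \<and> jac A \<noteq> 0 \<and>
       Qtype of_real f Linf (line \<zeta>) = (if jac A > 0 then \<langle>1\<rangle> else \<langle>- 1\<rangle>)"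
proof -
  let ?b = "Re \<zeta>" and ?\<theta> = "Im \<zeta>"
  obtain g' where ad: "adapted gf ?b ?\<theta> g'" and F: "\<And>x y z. quartic_eval (cquartic f) (x *s map_coords of_real (eu ?\<theta>)
     + y *s map_coords of_real (en ?\<theta>) + z *s map_coords of_real (ev \<zeta>)) = tern (cquartic g') x y z"
    using adapted_frame by blast
  define g'' where "g'' = (\<lambda>e. \<sigma> * g' e)"
  have ad'': "adapted g ?b ?\<theta> g''" unfolding g''_def using adapted_g[OF ad] .
  note lv = adapted_line_value[OF ad'']
  obtain \<alpha> \<rho> \<pi> where \<alpha>: "\<alpha> > 0" and a: "g'' (4,0,0) = \<alpha>\<^sup>2" "g'' (3,0,1) = - 2 * \<alpha>\<^sup>2 * \<rho>" "g'' (2,0,2) = \<alpha>\<^sup>2 * (\<rho>\<^sup>2 + 2 * \<pi>)"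
    "g'' (1,0,3) = - 2 * \<alpha>\<^sup>2 * \<rho> * \<pi>" "g'' (0,0,4) = \<alpha>\<^sup>2 * \<pi>\<^sup>2"
    using H_zero_imp_square[OF lv adapted_lead[OF ad'']] 0 unfolding hfun_eq_0_iff by blast
  define \<delta> where "\<delta> = csqrt (of_real (\<rho>\<^sup>2 - 4 * \<pi>))"
  define s1 s2 where "s1 = (of_real \<rho> + \<delta>) / 2" and "s2 = (of_real \<rho> - \<delta>) / 2"
  have s: "s1 + s2 = of_real \<rho>" "s1 * s2 = of_real \<pi>"
  proof -
    show "s1 + s2 = of_real \<rho>" by (simp add: s1_def s2_def add_divide_distrib diff_divide_distrib)
    have "s1 * s2 = (of_real \<rho> ^ 2 - \<delta>\<^sup>2) / 4" by (simp add: s1_def s2_def power2_eq_square field_simps)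
    also have "\<delta>\<^sup>2 = of_real (\<rho>\<^sup>2 - 4 * \<pi>)" by (simp add: \<delta>_def)
    finally show "s1 * s2 = of_real \<pi>" by simp
  qed
  define \<alpha>' where "\<alpha>' = csqrt (of_real \<sigma>) * of_real \<alpha>"
  have \<alpha>': "\<alpha>' \<noteq> 0" "\<alpha>'\<^sup>2 = of_real \<sigma> * of_real \<alpha> ^ 2" using \<alpha> csqrt_\<sigma> by (simp_all add: \<alpha>'_def power_mult_distrib)
  have g'_eq: "g' e = \<sigma> * g'' e" for e using csqrt_\<sigma>(4) by (simp add: g''_def mult.assoc[symmetric])
  have sq: "tern (cquartic g') s 0 t = (\<alpha>' * (s - s1 * t) * (s - s2 * t))\<^sup>2" for s t
  proof -
    have "(\<alpha>' * (s - s1 * t) * (s - s2 * t))\<^sup>2 = \<alpha>'\<^sup>2 * ((s\<^sup>2 - (s1 + s2) * s * t + s1 * s2 * t\<^sup>2))\<^sup>2"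
      by (simp add: power2_eq_square algebra_simps)
    also have "\<dots> = of_real \<sigma> * (of_real \<alpha> ^ 2 * (s\<^sup>2 - of_real \<rho> * s * t + of_real \<pi> * t\<^sup>2)\<^sup>2)"
      unfolding s \<alpha>'(2) by simp
    also have "of_real \<alpha> ^ 2 * (s\<^sup>2 - of_real \<rho> * s * t + of_real \<pi> * t\<^sup>2)\<^sup>2 = tern (cquartic g'') s 0 t"
      unfolding tern_expand cquartic_def a by (simp add: eval_nat_numeral algebra_simps)
    also have "of_real \<sigma> * tern (cquartic g'') s 0 t = tern (cquartic g') s 0 t"
      unfolding tern_scale[symmetric] cquartic_def g'_eq by simp
    finally show ?thesis by simp
  qed
  obtain c where c: "c \<noteq> 0" "rep_proj_plane (line \<zeta>) = c *s form \<zeta>" using rep_abs[OF form_nz] unfolding line_def by blast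
  have orth: "dot (rep_proj_plane (line \<zeta>)) (eu ?\<theta>) = 0" "dot (rep_proj_plane (line \<zeta>)) (ev \<zeta>) = 0"
    "dot (rep_proj_plane (line \<zeta>)) (en ?\<theta>) \<noteq> 0"
    unfolding c using c(1) \<kappa>_nz by (simp_all add: dot_linear form_orth)
  have uv: "crossp (eu ?\<theta>) (ev \<zeta>) \<noteq> 0" using form_nz unfolding form_def .
  have sR: "s1 + s2 \<in> \<real>" "s1 * s2 \<in> \<real>" unfolding s by simp_all
  have linfv: "dot (rep_proj_plane Linf) (ev \<zeta>) \<noteq> 0" using linf_frame(2) by simp
  note Q = Qtype_real[OF smooth orth uv linf_frame(1) linfv F sq \<alpha>'(1) sR]
  show "bitangent (cquartic f) (base_change of_real (line \<zeta>))" using Q(1) .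
  define c1 where "c1 = g'' (3,1,0) * (\<rho>\<^sup>2 - \<pi>) + g'' (2,1,1) * \<rho> + g'' (1,1,2)"
  define c0 where "c0 = - g'' (3,1,0) * \<rho> * \<pi> - g'' (2,1,1) * \<pi> + g'' (0,1,3)"
  define N where "N = c0\<^sup>2 + c0 * c1 * \<rho> + c1\<^sup>2 * \<pi>"
  have "normal_cubic (cquartic g'') s 1 = of_real \<sigma> * normal_cubic (cquartic g') s 1" for s
    unfolding normal_cubic_def cquartic_def g''_def by (simp add: algebra_simps)
  then have "normal_cubic (cquartic g'') s1 1 * normal_cubic (cquartic g'') s2 1 =
      (of_real \<sigma> * of_real \<sigma>) * (normal_cubic (cquartic g') s1 1 * normal_cubic (cquartic g') s2 1)" by simp
  then have R: "normal_cubic (cquartic g') s1 1 * normal_cubic (cquartic g') s2 1 = of_real N"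
    unfolding csqrt_\<sigma>(3) normal_cubic_product[OF s] N_def c1_def c0_def by simp
  have \<zeta>: "Complex ?b ?\<theta> = \<zeta>" by simp
  obtain A where A: "(hfun g has_derivative A) (at \<zeta>)" "jac A = 512 * \<alpha>^10 * N"
    using hfun_derivative[OF ad'' a] unfolding \<zeta> N_def c1_def c0_def by blast
  have "N \<noteq> 0" "Qtype of_real f Linf (line \<zeta>) = (if N > 0 then \<langle>1\<rangle> else \<langle>- 1\<rangle>)"
    using Q(3,4) unfolding R by simp_all
  moreover have "jac A \<noteq> 0 \<longleftrightarrow> N \<noteq> 0" "jac A > 0 \<longleftrightarrow> N > 0"
    unfolding A(2) using \<alpha> by (simp_all add: zero_less_mult_iff)
  ultimately show "\<exists>A. (hfun g has_derivative A) (at \<zeta>) \<and> jac A \<noteq> 0 \<and>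
       Qtype of_real f Linf (line \<zeta>) = (if jac A > 0 then \<langle>1\<rangle> else \<langle>- 1\<rangle>)"
    using A(1) by auto
qed

lemma bitangent_imp_zero:
  assumes bit: "bitangent (cquartic f) (base_change of_real (line \<zeta>))"
  shows "hfun g \<zeta> = 0"
proof -
  let ?b = "Re \<zeta>" and ?\<theta> = "Im \<zeta>" and ?c = "map_coords complex_of_real"
  obtain g' where ad: "adapted gf ?b ?\<theta> g'" and F: "\<And>x y z. quartic_eval (cquartic f) (x *s ?c (eu ?\<theta>)
     + y *s ?c (en ?\<theta>) + z *s ?c (ev \<zeta>)) = tern (cquartic g') x y z"
    using adapted_frame by blast
  note lv = adapted_line_value[OF adapted_g[OF ad]]
  have L: "base_change complex_of_real (line \<zeta>) = abs_proj_plane (?c (form \<zeta>))"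
    unfolding line_def using form_nz by (rule base_change_of_real_abs)
  have "?c (form \<zeta>) \<noteq> 0" using form_nz by simp
  then obtain c where c: "c \<noteq> 0" "rep_proj_plane (base_change complex_of_real (line \<zeta>)) = c *s ?c (form \<zeta>)"
    using rep_abs unfolding L by blast
  interpret line_basis "base_change complex_of_real (line \<zeta>)" "?c (eu ?\<theta>)" "?c (ev \<zeta>)"
  proof
    show "crossp (?c (eu ?\<theta>)) (?c (ev \<zeta>)) \<noteq> 0" unfolding map_of_real_crossp form_def[symmetric] using form_nz by simp
  qed (simp_all add: c dot_linear map_of_real_dot form_orth)
  obtain \<alpha> \<beta> \<gamma> where sq: "\<And>s t. quartic_eval (cquartic f) (s *s ?c (eu ?\<theta>) + t *s ?c (ev \<zeta>)) = (\<alpha> * s\<^sup>2 + \<beta> * s * t + \<gamma> * t\<^sup>2)\<^sup>2"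
    using bit unfolding bitangent_iff by blast
  let ?r = "csqrt (of_real \<sigma>)"
  have "of_real (\<sigma> * g' (4,0,0)) * s^4 + of_real (\<sigma> * g' (3,0,1)) * s^3 + of_real (\<sigma> * g' (2,0,2)) * s^2
      + of_real (\<sigma> * g' (1,0,3)) * s + of_real (\<sigma> * g' (0,0,4)) = ((?r * \<alpha>) * s\<^sup>2 + (?r * \<beta>) * s + (?r * \<gamma>))\<^sup>2" for s
  proof -
    have "((?r * \<alpha>) * s\<^sup>2 + (?r * \<beta>) * s + (?r * \<gamma>))\<^sup>2 = ?r\<^sup>2 * (\<alpha> * s\<^sup>2 + \<beta> * s * 1 + \<gamma> * 1\<^sup>2)\<^sup>2"
      by (simp add: power2_eq_square algebra_simps)
    also have "\<dots> = of_real \<sigma> * tern (cquartic g') s 0 1"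
      unfolding sq[symmetric] csqrt_\<sigma>(1) using F[of s 0 1] by simp
    finally show ?thesis by (simp add: tern_expand cquartic_def algebra_simps)
  qed
  from square_imp_H_zero[OF lv this] show ?thesis unfolding hfun_eq_0_iff by simp
qed

subsection \<open>Each line has two parameters\<close>

lemma line_neq_infinity: "line \<zeta> \<noteq> Linf"
proof
  assume "line \<zeta> = Linf"
  then obtain c where "c \<noteq> 0" "rep_proj_plane Linf = c *s form \<zeta>" using rep_abs[OF form_nz] unfolding line_def by metis
  then have "c * (\<kappa> * sin (Im \<zeta>)) = 0" "c * (- \<kappa> * cos (Im \<zeta>)) = 0"
    using linf(1,2) form_coords[of \<zeta>] by (simp_all add: dot_linear)
  then have "sin (Im \<zeta>) = 0" "cos (Im \<zeta>) = 0" using \<open>c \<noteq> 0\<close> \<kappa>_nz by auto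
  then show False using sin_cos_squared_add[of "Im \<zeta>"] by simp
qed

text \<open>The two parameters differ by the orientation of the line.\<close>

lemma card_parameters:
  assumes "L \<noteq> Linf"
  shows "card {\<zeta>. line \<zeta> = L \<and> 0 \<le> Im \<zeta> \<and> Im \<zeta> < 2 * pi} = 2"
proof -
  let ?l = "rep_proj_plane L"
  define A B C where "A = dot ?l e1" and "B = dot ?l e2" and "C = dot ?l e0"
  have "(A, B) \<noteq> (0, 0)"
  proof
    assume "(A, B) = (0, 0)"
    then have "?l = C *s rep_proj_plane Linf"
      by (intro frame_ext) (simp_all add: dot_linear linf A_def B_def C_def)
    then have "abs_proj_plane (rep_proj_plane Linf) = abs_proj_plane ?l" by (subst abs_eq_iff) auto
    then show False using assms by simp
  qed
  then have pos: "A\<^sup>2 + B\<^sup>2 > 0" by (auto simp: sum_power2_gt_zero_iff)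
  define \<rho> where "\<rho> = sqrt (A\<^sup>2 + B\<^sup>2)"
  have \<rho>: "\<rho> > 0" "\<rho>\<^sup>2 = A\<^sup>2 + B\<^sup>2" using pos by (simp_all add: \<rho>_def)
  have iff: "line \<zeta> = L \<longleftrightarrow> (\<exists>t\<in>{1, - 1}. sin (Im \<zeta>) = t * A / \<rho> \<and> cos (Im \<zeta>) = - t * B / \<rho> \<and> Re \<zeta> = t * C / \<rho>)" for \<zeta>
  proof
    assume "line \<zeta> = L"
    then obtain c where c: "?l = c *s form \<zeta>" using rep_abs[OF form_nz] unfolding line_def by metis
    define d where "d = c * \<kappa>"
    have ABC: "A = d * sin (Im \<zeta>)" "B = - d * cos (Im \<zeta>)" "C = d * Re \<zeta>"
      unfolding A_def B_def C_def c by (simp_all add: dot_linear form_coords d_def)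
    have "\<rho>\<^sup>2 = d\<^sup>2 * ((sin (Im \<zeta>))\<^sup>2 + (cos (Im \<zeta>))\<^sup>2)"
      unfolding \<rho>(2) ABC by (simp add: power_mult_distrib distrib_left del: sin_cos_squared_add)
    then have "d\<^sup>2 = \<rho>\<^sup>2" by simp
    then have "d = \<rho> \<or> d = - \<rho>" by (simp add: power2_eq_iff)
    then show "\<exists>t\<in>{1, - 1}. sin (Im \<zeta>) = t * A / \<rho> \<and> cos (Im \<zeta>) = - t * B / \<rho> \<and> Re \<zeta> = t * C / \<rho>"
      using \<rho>(1) unfolding ABC by auto
  next
    assume "\<exists>t\<in>{1, - 1}. sin (Im \<zeta>) = t * A / \<rho> \<and> cos (Im \<zeta>) = - t * B / \<rho> \<and> Re \<zeta> = t * C / \<rho>"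
    then obtain t :: real where t1: "t \<in> {1, - 1}"
      and t': "sin (Im \<zeta>) = t * A / \<rho>" "cos (Im \<zeta>) = - t * B / \<rho>" "Re \<zeta> = t * C / \<rho>"
      by blast
    have "t * t = 1" using t1 by auto
    note t = this t'
    have tt: "t * (t * x) = x" for x using t(1) by (simp add: mult.assoc[symmetric])
    have "?l = (t * \<rho> / \<kappa>) *s form \<zeta>"
    proof (rule frame_ext)
      show "dot ?l e1 = dot ((t * \<rho> / \<kappa>) *s form \<zeta>) e1"
        unfolding dot_smult_left form_coords t A_def[symmetric] using \<rho>(1) \<kappa>_nz by (simp add: tt)
      show "dot ?l e2 = dot ((t * \<rho> / \<kappa>) *s form \<zeta>) e2"
        unfolding dot_smult_left form_coords t B_def[symmetric] using \<rho>(1) \<kappa>_nz by (simp add: tt)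
      show "dot ?l e0 = dot ((t * \<rho> / \<kappa>) *s form \<zeta>) e0"
        unfolding dot_smult_left form_coords t C_def[symmetric] using \<rho>(1) \<kappa>_nz by (simp add: tt)
    qed
    then have "line \<zeta> = abs_proj_plane ?l" unfolding line_def by (subst abs_eq_iff[OF form_nz]) auto
    then show "line \<zeta> = L" by simp
  qed
  have ex: "\<exists>\<zeta>. 0 \<le> Im \<zeta> \<and> Im \<zeta> < 2 * pi \<and> sin (Im \<zeta>) = t * A / \<rho> \<and> cos (Im \<zeta>) = - t * B / \<rho> \<and> Re \<zeta> = t * C / \<rho>"
    if "t \<in> {1, - 1}" for t
  proof -
    have "(- t * B / \<rho>)\<^sup>2 + (t * A / \<rho>)\<^sup>2 = t\<^sup>2 * (A\<^sup>2 + B\<^sup>2) / \<rho>\<^sup>2"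
      by (simp add: power_divide power_mult_distrib add_divide_distrib distrib_left)
    also have "\<dots> = 1" using that \<rho> pos by auto
    finally obtain \<theta> where "0 \<le> \<theta>" "\<theta> < 2 * pi" "- t * B / \<rho> = cos \<theta>" "t * A / \<rho> = sin \<theta>"
      using sincos_total_2pi[of "- t * B / \<rho>" "t * A / \<rho>"] by blast
    then show ?thesis by (intro exI[of _ "Complex (t * C / \<rho>) \<theta>"]) simp
  qed
  then obtain z where z: "\<And>t. t \<in> {1, - 1} \<Longrightarrow> 0 \<le> Im (z t) \<and> Im (z t) < 2 * pi \<and> sin (Im (z t)) = t * A / \<rho> \<and>
      cos (Im (z t)) = - t * B / \<rho> \<and> Re (z t) = t * C / \<rho>" by metis
  have uniq: "\<zeta> = z t" if t: "t \<in> {1, - 1}" and "0 \<le> Im \<zeta>" "Im \<zeta> < 2 * pi" "sin (Im \<zeta>) = t * A / \<rho>" "cos (Im \<zeta>) = - t * B / \<rho>" "Re \<zeta> = t * C / \<rho>"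
    for \<zeta> t
  proof -
    have "sin (Im \<zeta>) = sin (Im (z t)) \<and> cos (Im \<zeta>) = cos (Im (z t))" using that(4,5) z[OF t] by simp
    then obtain n :: int where n: "Im \<zeta> = Im (z t) + 2 * pi * n" unfolding sin_cos_eq_iff by blast
    have "\<bar>Im \<zeta> - Im (z t)\<bar> < 1 * (2 * pi)" using that(2,3) z[OF t] by auto
    then have "\<bar>real_of_int n\<bar> * (2 * pi) < 1 * (2 * pi)" using n by (simp add: abs_mult mult.commute)
    then have "\<bar>real_of_int n\<bar> < 1" using pi_gt_zero by (subst (asm) mult_less_cancel_right_pos) auto
    then have "n = 0" by linarith
    then show ?thesis using n that(6) z[OF t] by (simp add: complex_eq_iff)
  qed
  have set: "{\<zeta>. line \<zeta> = L \<and> 0 \<le> Im \<zeta> \<and> Im \<zeta> < 2 * pi} = {z 1, z (- 1)}"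
    unfolding iff using z[of 1] z[of "- 1"] uniq by blast
  have "z 1 \<noteq> z (- 1)"
  proof
    assume "z 1 = z (- 1)"
    then have "A / \<rho> = - A / \<rho>" "B / \<rho> = - B / \<rho>" using z[of 1] z[of "- 1"] by auto
    then have "A = 0" "B = 0" using \<rho>(1) by auto
    then show False using pos by simp
  qed
  then show ?thesis unfolding set by simp
qed

definition type_sign :: "real proj_plane \<Rightarrow> int" where
  "type_sign L = (if Qtype of_real f Linf L = \<langle>1\<rangle> then 1 else - 1)"

abbreviation finite_bitangents :: "real proj_plane set" where
  "finite_bitangents \<equiv> {L. bitangent (cquartic f) (base_change of_real L) \<and> L \<noteq> Linf}"

lemma type_of_finite_bitangent:
  assumes "L \<in> finite_bitangents"
  shows "Qtype of_real f Linf L = \<langle>1\<rangle> \<or> Qtype of_real f Linf L = \<langle>- 1\<rangle>"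
proof -
  have "{\<zeta>. line \<zeta> = L \<and> 0 \<le> Im \<zeta> \<and> Im \<zeta> < 2 * pi} \<noteq> {}" using card_parameters[of L] assms by force
  then obtain \<zeta> where "line \<zeta> = L" by blast
  then show ?thesis using zero_imp_bitangent(2)[OF bitangent_imp_zero, of \<zeta>] assms by auto
qed

text \<open>The zeros on the cylinder count each line twice, and the two degrees are opposite.\<close>

lemma signed_count_of_degree:
  assumes "B > 0" and nz: "\<And>b \<theta>. B \<le> \<bar>b\<bar> \<Longrightarrow> \<theta> \<in> {0..2 * pi} \<Longrightarrow> hfun g (Complex b \<theta>) \<noteq> 0"
    and deg: "has_deg (\<lambda>t. hfun g (Complex B t)) N" "has_deg (\<lambda>t. hfun g (Complex (- B) t)) (- N)"
  shows "finite finite_bitangents" "(\<Sum>L\<in>finite_bitangents. type_sign L) = N"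
proof -
  let ?R = finite_bitangents
  define K where "K = {\<zeta>. hfun g \<zeta> = 0 \<and> 0 \<le> Im \<zeta> \<and> Im \<zeta> < 2 * pi}"
  have bound: "\<bar>Re \<zeta>\<bar> < B" if "hfun g \<zeta> = 0" "0 \<le> Im \<zeta>" "Im \<zeta> < 2 * pi" for \<zeta>
    using nz[of "Re \<zeta>" "Im \<zeta>"] that by force
  have fin: "finite K" unfolding K_def
    using zero_imp_bitangent(2) by (intro finite_nondegenerate_zeros[OF hfun_continuous bound]) blast+
  have "\<forall>\<zeta>\<in>K. \<exists>A. (hfun g has_derivative A) (at \<zeta>) \<and> jac A \<noteq> 0 \<and>
       Qtype of_real f Linf (line \<zeta>) = (if jac A > 0 then \<langle>1\<rangle> else \<langle>- 1\<rangle>)"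
    unfolding K_def using zero_imp_bitangent(2) by blast
  then obtain A where A: "\<And>\<zeta>. \<zeta> \<in> K \<Longrightarrow> (hfun g has_derivative A \<zeta>) (at \<zeta>)" "\<And>\<zeta>. \<zeta> \<in> K \<Longrightarrow> jac (A \<zeta>) \<noteq> 0"
    "\<And>\<zeta>. \<zeta> \<in> K \<Longrightarrow> Qtype of_real f Linf (line \<zeta>) = (if jac (A \<zeta>) > 0 then \<langle>1\<rangle> else \<langle>- 1\<rangle>)" by metis
  have KB: "\<bar>Re k\<bar> < B" if "k \<in> K" for k using bound that unfolding K_def by blast
  obtain m n where mn: "has_deg (\<lambda>t. hfun g (Complex B t)) m" "has_deg (\<lambda>t. hfun g (Complex (- B) t)) n"
    "m - n = (\<Sum>k\<in>K. if jac (A k) > 0 then 1 else - 1)"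
    using signed_zero_count[where h = "hfun g", OF hfun_continuous hfun_periodic fin K_def \<open>B > 0\<close> KB A(1,2)] by blast
  have "m = N" "n = - N" using has_deg_unique mn deg by blast+
  then have "2 * N = (\<Sum>k\<in>K. if jac (A k) > 0 then 1 else - 1)" using mn(3) by simp
  also have "\<dots> = (\<Sum>k\<in>K. type_sign (line k))"
    using A(3) rank_one_real_neq by (intro sum.cong refl) (auto simp: type_sign_def)
  also have "\<dots> = (\<Sum>L\<in>line ` K. \<Sum>k\<in>{k \<in> K. line k = L}. type_sign (line k))"
    by (rule sum.image_gen[OF fin])
  also have img: "line ` K = ?R"
  proof (intro equalityI subsetI)
    fix L assume "L \<in> line ` K"
    then show "L \<in> ?R" using zero_imp_bitangent(1) line_neq_infinity by (auto simp: K_def)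
  next
    fix L assume L: "L \<in> ?R"
    then have "{\<zeta>. line \<zeta> = L \<and> 0 \<le> Im \<zeta> \<and> Im \<zeta> < 2 * pi} \<noteq> {}" using card_parameters[of L] by force
    then obtain \<zeta> where "line \<zeta> = L" "0 \<le> Im \<zeta>" "Im \<zeta> < 2 * pi" by blast
    then show "L \<in> line ` K" using bitangent_imp_zero[of \<zeta>] L by (auto simp: K_def)
  qed
  also have "(\<Sum>L\<in>?R. \<Sum>k\<in>{k \<in> K. line k = L}. type_sign (line k)) = (\<Sum>L\<in>?R. 2 * type_sign L)"
  proof (intro sum.cong refl)
    fix L assume L: "L \<in> ?R"
    have "{k \<in> K. line k = L} = {\<zeta>. line \<zeta> = L \<and> 0 \<le> Im \<zeta> \<and> Im \<zeta> < 2 * pi}"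
      using bitangent_imp_zero L by (auto simp: K_def)
    then have "card {k \<in> K. line k = L} = 2" using card_parameters[of L] L by simp
    then show "(\<Sum>k\<in>{k \<in> K. line k = L}. type_sign (line k)) = 2 * type_sign L" by simp
  qed
  finally show "(\<Sum>L\<in>?R. type_sign L) = N" by (simp add: sum_distrib_left[symmetric])
  show "finite ?R" using fin img by (metis finite_imageI)
qed

end

context real_frame
begin

lemma infinity_basis: "line_basis (base_change complex_of_real Linf) (map_coords of_real e1) (map_coords of_real e2)"
proof -
  have "map_coords complex_of_real (rep_proj_plane Linf) \<noteq> 0" by simp
  then obtain c where c: "c \<noteq> 0"
    "rep_proj_plane (base_change complex_of_real Linf) = c *s map_coords of_real (rep_proj_plane Linf)"
    unfolding base_change_def using rep_abs by blast
  show ?thesis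
    by unfold_locales (use indep in \<open>auto simp: c dot_linear map_of_real_dot linf map_of_real_crossp\<close>)
qed

lemma coeffs_at_infinity:
  "gf (0,4,0) = \<sigma> * (1 + \<epsilon>)" "gf (1,3,0) = 0" "gf (2,2,0) = \<sigma> * (2 - 6 * \<epsilon>)" "gf (3,1,0) = 0" "gf (4,0,0) = \<sigma> * (1 + \<epsilon>)"
proof -
  have "gf (0,4,0) * y^4 + gf (1,3,0) * x * y^3 + gf (2,2,0) * x^2 * y^2 + gf (3,1,0) * x^3 * y + gf (4,0,0) * x^4 =
    (\<sigma> * (1 + \<epsilon>)) * y^4 + 0 * x * y^3 + (\<sigma> * (2 - 6 * \<epsilon>)) * x^2 * y^2 + 0 * x^3 * y + (\<sigma> * (1 + \<epsilon>)) * x^4" for x y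
  proof -
    have "tern gf x y 0 = \<sigma> * (\<sigma> * tern gf x y 0)" using csqrt_\<sigma>(4) by (simp add: mult.assoc[symmetric])
    also have "\<dots> = \<sigma> * ((x\<^sup>2 + y\<^sup>2)\<^sup>2 + \<epsilon> * (x^4 - 6 * x^2 * y^2 + y^4))" unfolding nf nf_def ..
    finally show ?thesis unfolding tern_expand by (simp add: power2_eq_square power3_eq_cube power4_eq_xxxx algebra_simps)
  qed
  from binary_quartic_coeffs_eq[OF this]
  show "gf (0,4,0) = \<sigma> * (1 + \<epsilon>)" "gf (1,3,0) = 0" "gf (2,2,0) = \<sigma> * (2 - 6 * \<epsilon>)" "gf (3,1,0) = 0" "gf (4,0,0) = \<sigma> * (1 + \<epsilon>)" .
qed

lemma value_at_infinity:
  "quartic_eval (cquartic f) (s *s map_coords of_real e1 + t *s map_coords of_real e2) = tern (cquartic gf) s t 0"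
  using gf[of s t 0] by simp

text \<open>The coefficients \<open>1 + \<epsilon>, 0, 2 - 6 \<epsilon>, 0, 1 + \<epsilon>\<close> are those of a square with nonzero end coefficients
  only for \<open>\<epsilon> = 0\<close> and \<open>\<epsilon> = 1\<close>, and the latter is excluded.\<close>

lemma infinity_bitangent_imp:
  assumes "bitangent (cquartic f) (base_change of_real Linf)"
  shows "\<epsilon> = 0"
proof -
  obtain \<alpha> \<beta> \<gamma> where sq: "\<And>s t. tern (cquartic gf) s t 0 = (\<alpha> * s\<^sup>2 + \<beta> * s * t + \<gamma> * t\<^sup>2)\<^sup>2"
    using assms unfolding line_basis.bitangent_iff[OF infinity_basis] value_at_infinity by blast
  have "of_real (\<sigma> * (1 + \<epsilon>)) * t^4 + 0 * s * t^3 + of_real (\<sigma> * (2 - 6 * \<epsilon>)) * s^2 * t^2 + 0 * s^3 * t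
      + of_real (\<sigma> * (1 + \<epsilon>)) * s^4 =
    \<gamma>\<^sup>2 * t^4 + (2 * \<beta> * \<gamma>) * s * t^3 + (\<beta>\<^sup>2 + 2 * \<alpha> * \<gamma>) * s^2 * t^2 + (2 * \<alpha> * \<beta>) * s^3 * t + \<alpha>\<^sup>2 * s^4" for s t
    using sq[of s t] unfolding tern_expand cquartic_def coeffs_at_infinity
    by (simp add: power2_eq_square power3_eq_cube power4_eq_xxxx algebra_simps)
  note c = binary_quartic_coeffs_eq[OF this]
  have "1 + \<epsilon> \<noteq> 0" using \<epsilon> by auto
  then have "\<alpha>\<^sup>2 \<noteq> 0" using c(5) csqrt_\<sigma>(4) by (metis mult_eq_0_iff of_real_eq_0_iff zero_neq_one)
  then have "\<beta> = 0" using c(4) by auto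
  then have "(of_real (\<sigma> * (2 - 6 * \<epsilon>)))\<^sup>2 = 4 * (of_real (\<sigma> * (1 + \<epsilon>)) * (of_real (\<sigma> * (1 + \<epsilon>)) :: complex))"
    unfolding c(3) c(1) c(5)[unfolded c(1)] using c(1,5) by (simp add: power2_eq_square algebra_simps)
  then have "complex_of_real ((\<sigma> * (2 - 6 * \<epsilon>))\<^sup>2) = of_real (4 * (\<sigma> * (1 + \<epsilon>))\<^sup>2)" by (simp add: power2_eq_square)
  then have "(\<sigma> * (2 - 6 * \<epsilon>))\<^sup>2 = 4 * (\<sigma> * (1 + \<epsilon>))\<^sup>2" unfolding of_real_eq_iff .
  then have "(\<sigma> * \<sigma>) * (2 - 6 * \<epsilon>)\<^sup>2 = (\<sigma> * \<sigma>) * (4 * (1 + \<epsilon>)\<^sup>2)"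
    by (simp add: power_mult_distrib power2_eq_square[of \<sigma>] mult_ac)
  then have "(2 - 6 * \<epsilon>)\<^sup>2 = 4 * (1 + \<epsilon>)\<^sup>2" unfolding csqrt_\<sigma>(4) by simp
  then have "\<epsilon> * (\<epsilon> - 1) = 0" by (simp add: power2_eq_square algebra_simps)
  then show ?thesis using \<epsilon> by auto
qed

lemma infinity_square:
  assumes "\<epsilon> = 0"
  shows "tern (cquartic gf) s t 0 = (csqrt (of_real \<sigma>) * (s\<^sup>2 + t\<^sup>2))\<^sup>2"
  unfolding power_mult_distrib csqrt_\<sigma>(1) tern_expand cquartic_def coeffs_at_infinity assms
  by (simp add: power2_eq_square power3_eq_cube power4_eq_xxxx algebra_simps)

lemma infinity_bitangentI:
  assumes "\<epsilon> = 0"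
  shows "bitangent (cquartic f) (base_change of_real Linf)"
  unfolding line_basis.bitangent_iff[OF infinity_basis] value_at_infinity infinity_square[OF assms]
  by (intro exI[of _ "csqrt (of_real \<sigma>)"] exI[of _ 0]) (use csqrt_\<sigma>(2) in \<open>auto simp: algebra_simps\<close>)

text \<open>For \<open>\<epsilon> = 0\<close> the points of tangency of the line at infinity are \<open>(1, \<plusminus> i)\<close>, and the complex number is,
  up to conjugation and a factor of absolute value 1, the value of the normal cubic at one of them.\<close>

lemma infinity_normal_cubic:
  assumes "\<epsilon> = 0"
  shows "Complex (g (0,3,1) - g (2,1,1)) (g (1,2,1) - g (3,0,1)) \<noteq> 0"
proof
  assume 0: "Complex (g (0,3,1) - g (2,1,1)) (g (1,2,1) - g (3,0,1)) = 0"
  define gs where "gs = (\<lambda>(i, j, k). cquartic gf (i, k, j))"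
  let ?c = "map_coords complex_of_real" and ?r = "csqrt (of_real \<sigma>)"
  interpret line_frame "cquartic f" gs "?c (rep_proj_plane Linf)" "?c e1" "?c e0" "?c e2" "(?r, ?r * \<i>)" "(1, - \<i>)"
  proof
    show "quartic_eval (cquartic f) (x *s ?c e1 + y *s ?c e0 + z *s ?c e2) = tern gs x y z" for x y z
    proof -
      have "x *s ?c e1 + y *s ?c e0 + z *s ?c e2 = x *s ?c e1 + z *s ?c e2 + y *s ?c e0" by simp
      also have "quartic_eval (cquartic f) \<dots> = tern (cquartic gf) x z y" by (rule gf)
      also have "\<dots> = tern gs x y z" unfolding tern_expand gs_def by simp
      finally show ?thesis .
    qed
    show "quartic_eval (cquartic f) (s *s ?c e1 + t *s ?c e2) = (lf (?r, ?r * \<i>) s t * lf (1, - \<i>) s t)\<^sup>2" for s t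
      unfolding value_at_infinity infinity_square[OF assms] lf_def
      by (simp add: power2_eq_square algebra_simps)
  qed (use csqrt_\<sigma>(2) indep smooth in \<open>auto simp: map_of_real_dot linf map_of_real_crossp prod_eq_iff\<close>)
  have "normal_cubic gs 1 \<i> \<noteq> 0"
    by (rule normal_cubic_nz) (simp_all add: lf_def mult.assoc)
  moreover have "normal_cubic gs 1 \<i> = of_real (gf (3,0,1) - gf (1,2,1)) + \<i> * of_real (gf (2,1,1) - gf (0,3,1))"
    unfolding normal_cubic_def gs_def cquartic_def by (simp add: power2_eq_square power3_eq_cube algebra_simps)
  moreover have "gf (3,0,1) = gf (1,2,1)" "gf (2,1,1) = gf (0,3,1)"
    using 0 \<sigma> by (auto simp: g_def complex_eq_iff)
  ultimately show False by simp
qed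

text \<open>If the line at infinity is not a bitangent, all real bitangents are affine; otherwise it
  contributes the type \<open>\<langle>1\<rangle>\<close> in addition to a signed count of 3.\<close>

theorem signed_count:
  defines "R \<equiv> {L. bitangent (cquartic f) (base_change of_real L)}"
  shows "finite R \<and> (\<forall>L\<in>R. Qtype of_real f Linf L = \<langle>1\<rangle> \<or> Qtype of_real f Linf L = \<langle>- 1\<rangle>) \<and>
    (\<Sum>L\<in>R. if Qtype of_real f Linf L = \<langle>1\<rangle> then 1 else - 1 :: int) = 4"
proof (cases "\<epsilon> = 0")
  case False
  then have R: "R = finite_bitangents" using infinity_bitangent_imp by (auto simp: R_def)
  have "\<exists>B>0. (\<forall>b \<theta>. B \<le> \<bar>b\<bar> \<longrightarrow> \<theta> \<in> {0..2 * pi} \<longrightarrow> hfun g (Complex b \<theta>) \<noteq> 0) \<and>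
    has_deg (\<lambda>t. hfun g (Complex B t)) 4 \<and> has_deg (\<lambda>t. hfun g (Complex (- B) t)) (- 4)"
    by (rule degree_at_infinity_generic[where \<epsilon> = \<epsilon>]) (use False \<epsilon> in \<open>simp_all add: tern_g nf nf_def\<close>)
  then have "finite finite_bitangents" "(\<Sum>L\<in>finite_bitangents. type_sign L) = 4"
    using signed_count_of_degree by blast+
  then show ?thesis using type_of_finite_bitangent unfolding R type_sign_def by blast
next
  case True
  have R: "R = insert Linf finite_bitangents" using infinity_bitangentI[OF True] by (auto simp: R_def)
  have Q: "Qtype of_real f Linf Linf = \<langle>1\<rangle>" using Qtype_at_infinity infinity_bitangentI[OF True] by blast
  have "\<exists>B>0. (\<forall>b \<theta>. B \<le> \<bar>b\<bar> \<longrightarrow> \<theta> \<in> {0..2 * pi} \<longrightarrow> hfun g (Complex b \<theta>) \<noteq> 0) \<and>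
    has_deg (\<lambda>t. hfun g (Complex B t)) 3 \<and> has_deg (\<lambda>t. hfun g (Complex (- B) t)) (- 3)"
    by (rule degree_at_infinity_bitangent[OF _ infinity_normal_cubic[OF True]]) (simp add: tern_g nf nf_def True)
  then have fin: "finite finite_bitangents" and sum: "(\<Sum>L\<in>finite_bitangents. type_sign L) = 3"
    using signed_count_of_degree by blast+
  have "(\<Sum>L\<in>R. type_sign L) = type_sign Linf + (\<Sum>L\<in>finite_bitangents. type_sign L)"
    unfolding R using fin by (intro sum.insert) auto
  then have "(\<Sum>L\<in>R. type_sign L) = 4" unfolding sum by (simp add: type_sign_def Q)
  then show ?thesis using type_of_finite_bitangent fin Q unfolding R type_sign_def by blast
qed

end

text \<open>The punctured plane is connected.\<close>

lemma constant_sign_on_punctured_plane: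
  fixes G :: "real \<Rightarrow> real \<Rightarrow> real"
  assumes cont: "continuous_on UNIV (\<lambda>z. G (Re z) (Im z))" and nz: "\<And>x y. (x, y) \<noteq> (0, 0) \<Longrightarrow> G x y \<noteq> 0"
  shows "\<exists>\<sigma>. (\<sigma> = 1 \<or> \<sigma> = - 1) \<and> (\<forall>x y. (x, y) \<noteq> (0, 0) \<longrightarrow> \<sigma> * G x y > 0)"
proof -
  let ?G = "\<lambda>z. G (Re z) (Im z)"
  have "connected (- {0 :: complex})" by (rule connected_punctured_universe) simp
  then have "connected (?G ` (- {0}))"
    by (intro connected_continuous_image continuous_on_subset[OF cont]) auto
  then have ivl: "c \<in> ?G ` (- {0})" if "z \<noteq> 0" "w \<noteq> 0" "?G z \<le> c" "c \<le> ?G w" for z w c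
    using that unfolding connected_iff_interval by blast
  have **: "\<not> (G x y < 0 \<and> G x' y' > 0)" if "(x, y) \<noteq> (0, 0)" "(x', y') \<noteq> (0, 0)" for x y x' y'
  proof
    assume "G x y < 0 \<and> G x' y' > 0"
    then have "0 \<in> ?G ` (- {0})"
      using ivl[of "Complex x y" "Complex x' y'" 0] that by (simp add: complex_eq_iff)
    then obtain z where "0 = ?G z" "z \<in> - {0}" by (rule imageE)
    then show False using nz[of "Re z" "Im z"] by (simp add: complex_eq_iff)
  qed
  show ?thesis
  proof (cases "G 1 0 > 0")
    case True
    then have "G x y > 0" if "(x, y) \<noteq> (0, 0)" for x y using **[OF that, of 1 0] nz[OF that] by force
    then show ?thesis by (intro exI[of _ 1]) simp
  next
    case False
    then have "G 1 0 < 0" using nz[of 1 0] by simp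
    then have "G x y < 0" if "(x, y) \<noteq> (0, 0)" for x y using **[of 1 0, OF _ that] nz[OF that] by force
    then show ?thesis by (intro exI[of _ "- 1"]) simp
  qed
qed

lemma exists_real_frame:
  assumes smooth: "smooth_quartic (cquartic f)"
    and no_real_points: "\<not> (\<exists>p. incident p Linf \<and> on_quartic f p)"
  shows "\<exists>gf e1 e2 e0 \<sigma> \<epsilon>. real_frame f gf Linf e1 e2 e0 \<sigma> \<epsilon>"
proof -
  let ?l = "rep_proj_plane Linf"
  obtain u v where uv: "crossp u v = ?l" using exists_kernel_basis[OF rep_nonzero] by blast
  obtain e0 where e0: "dot ?l e0 = 1" using exists_dot_neq_0[OF rep_nonzero] by blast
  have l: "dot ?l u = 0" "dot ?l v = 0" using dot_crossp[of u v] by (simp_all add: uv)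
  obtain G where G: "\<And>x y z. quartic_eval f (x *s u + y *s v + z *s e0) = tern G x y z"
    using quartic_real_subst[of f u v e0] by blast
  have G0: "quartic_eval f (x *s u + y *s v) = tern G x y 0" for x y using G[of x y 0] by simp
  have nz: "tern G x y 0 \<noteq> 0" if "(x, y) \<noteq> (0, 0)" for x y
  proof
    assume 0: "tern G x y 0 = 0"
    have w: "x *s u + y *s v \<noteq> 0"
    proof
      assume 0: "x *s u + y *s v = 0"
      have "y *s crossp u v = crossp u (x *s u + y *s v)" "x *s crossp u v = crossp (x *s u + y *s v) v"
        by (simp_all add: vec3_eq_iff algebra_simps)
      moreover have "crossp u 0 = 0" "crossp 0 v = 0" by (simp_all add: vec3_eq_iff)
      ultimately have "y *s ?l = 0" "x *s ?l = 0" unfolding 0 uv by simp_all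
      then show False using that rep_nonzero[of Linf] by auto
    qed
    obtain c where c: "rep_proj_plane (abs_proj_plane (x *s u + y *s v)) = c *s (x *s u + y *s v)"
      using rep_abs[OF w] by blast
    have "c *s (x *s u + y *s v) = (c * x) *s u + (c * y) *s v" by (simp add: vec3_eq_iff algebra_simps)
    then have "quartic_eval f (rep_proj_plane (abs_proj_plane (x *s u + y *s v))) = tern G (c * x) (c * y) 0"
      unfolding c by (simp only: G0)
    also have "\<dots> = c^4 * tern G x y 0" unfolding tern_expand by (simp add: eval_nat_numeral algebra_simps)
    finally have "on_quartic f (abs_proj_plane (x *s u + y *s v))" unfolding on_quartic_def 0 by simp
    moreover have "incident (abs_proj_plane (x *s u + y *s v)) Linf" unfolding incident_abs[OF w] by (simp add: dot_linear l)
    ultimately show False using no_real_points by blast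
  qed
  obtain \<sigma> where \<sigma>: "\<sigma> = 1 \<or> \<sigma> = - 1" "\<And>x y. (x, y) \<noteq> (0, 0) \<Longrightarrow> \<sigma> * tern G x y 0 > 0"
  proof -
    have "continuous_on UNIV (\<lambda>z. tern G (Re z) (Im z) 0)"
      unfolding tern_expand by (intro continuous_intros)
    from constant_sign_on_punctured_plane[of "\<lambda>x y. tern G x y 0", OF this nz] show ?thesis using that by blast
  qed
  have G': "\<sigma> * tern G x y 0 = \<sigma> * G (4,0,0) * x^4 + \<sigma> * G (3,1,0) * x^3 * y + \<sigma> * G (2,2,0) * x^2 * y^2
      + \<sigma> * G (1,3,0) * x * y^3 + \<sigma> * G (0,4,0) * y^4" for x y
    unfolding tern_expand by (simp add: algebra_simps)
  obtain k11 k12 k21 k22 \<epsilon> where k: "k11 * k22 - k12 * k21 \<noteq> 0" and \<epsilon>: "\<bar>\<epsilon>\<bar> < 1"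
    and nf: "\<And>x y. \<sigma> * tern G (k11 * x + k12 * y) (k21 * x + k22 * y) 0 = nf \<epsilon> x y"
    using positive_quartic_normal_form[OF \<sigma>(2)[unfolded G']] unfolding G'[symmetric] by blast
  define e1 e2 where "e1 = k11 *s u + k21 *s v" and "e2 = k12 *s u + k22 *s v"
  obtain gf where gf: "\<And>x y z. quartic_eval (cquartic f) (x *s map_coords of_real e1 + y *s map_coords of_real e2
       + z *s map_coords of_real e0) = tern (cquartic gf) x y z"
    "\<And>x y z. quartic_eval f (x *s e1 + y *s e2 + z *s e0) = tern gf x y z"
    using quartic_real_subst[of f e1 e2 e0] by blast
  have "real_frame f gf Linf e1 e2 e0 \<sigma> \<epsilon>"
  proof
    show "smooth_quartic (cquartic f)" by (rule smooth)
    show "dot ?l e1 = 0" "dot ?l e2 = 0" by (simp_all add: e1_def e2_def dot_linear l)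
    show "crossp e1 e2 \<noteq> 0"
    proof -
      have "crossp e1 e2 = (k11 * k22 - k12 * k21) *s ?l"
        unfolding e1_def e2_def uv[symmetric] by (simp add: vec3_eq_iff algebra_simps)
      then show ?thesis using k rep_nonzero[of Linf] by auto
    qed
    show "\<sigma> * tern gf x y 0 = nf \<epsilon> x y" for x y
    proof -
      have "x *s e1 + y *s e2 + 0 *s e0 = (k11 * x + k12 * y) *s u + (k21 * x + k22 * y) *s v"
        unfolding e1_def e2_def by (simp add: vec3_eq_iff algebra_simps)
      then show ?thesis unfolding gf(2)[symmetric] nf[symmetric] by (simp only: G0)
    qed
  qed (fact e0 \<sigma>(1) \<epsilon> gf(1))+
  then show ?thesis by blast
qed

section \<open>Complex conjugation of lines\<close>

lemma base_change_cnj_abs: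
  assumes "v \<noteq> 0"
  shows "base_change cnj (abs_proj_plane v) = abs_proj_plane (map_coords cnj v)"
proof -
  obtain c where c: "c \<noteq> 0" "rep_proj_plane (abs_proj_plane v) = c *s v" using rep_abs[OF assms] by blast
  have "map_coords cnj (c *s v) = cnj c *s map_coords cnj v" by (simp add: vec3_eq_iff)
  moreover have "map_coords cnj v \<noteq> 0" using assms by (auto simp: vec3_eq_iff)
  ultimately show ?thesis unfolding base_change_def c(2) using c(1) by (simp add: abs_smult)
qed

lemma map_cnj_rep_nonzero: "map_coords cnj (rep_proj_plane L) \<noteq> 0"
  using rep_nonzero[of L] unfolding vec3_eq_iff by simp

lemma base_change_cnj_cnj: "base_change cnj (base_change cnj L) = L"
proof -
  have "base_change cnj (base_change cnj L) = abs_proj_plane (map_coords cnj (map_coords cnj (rep_proj_plane L)))"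
    unfolding base_change_def[of cnj L] using base_change_cnj_abs[OF map_cnj_rep_nonzero] .
  also have "map_coords cnj (map_coords cnj (rep_proj_plane L)) = rep_proj_plane L" by (simp add: vec3_eq_iff)
  finally show ?thesis by simp
qed

text \<open>A line equal to its conjugate has an equation with real coefficients: after one coordinate is
  scaled to 1, the conjugate equation is equal and not just proportional.\<close>

lemma conj_fixed_iff: "base_change cnj L = L \<longleftrightarrow> (\<exists>L0. L = base_change complex_of_real L0)"
proof
  assume "\<exists>L0. L = base_change complex_of_real L0"
  then obtain L0 where L0: "L = abs_proj_plane (map_coords complex_of_real (rep_proj_plane L0))"
    unfolding base_change_def by blast
  have "map_coords complex_of_real (rep_proj_plane L0) \<noteq> 0" by simp
  moreover have "map_coords cnj (map_coords complex_of_real (rep_proj_plane L0)) = map_coords complex_of_real (rep_proj_plane L0)"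
    by (simp add: vec3_eq_iff)
  ultimately show "base_change cnj L = L" unfolding L0 by (simp add: base_change_cnj_abs)
next
  let ?l = "rep_proj_plane L"
  assume "base_change cnj L = L"
  then have "abs_proj_plane ?l = abs_proj_plane (map_coords cnj ?l)" unfolding base_change_def by simp
  then obtain c where c: "map_coords cnj ?l = c *s ?l" using abs_eq_iff[OF rep_nonzero map_cnj_rep_nonzero] by blast
  obtain i where i: "?l $ i \<noteq> 0" using rep_nonzero[of L] by (auto simp: Finite_Cartesian_Product.vec_eq_iff)
  have cj: "cnj (?l $ j) = c * ?l $ j" for j using arg_cong[OF c, of "\<lambda>w. w $ j"] by simp
  have "c \<noteq> 0" using cj[of i] i by auto
  have "cnj (?l $ j / ?l $ i) = ?l $ j / ?l $ i" for j using \<open>c \<noteq> 0\<close> by (simp add: cj)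
  then have real: "complex_of_real (Re (?l $ j / ?l $ i)) = ?l $ j / ?l $ i" for j
    by (metis Reals_cnj_iff of_real_Re)
  define m where "m = (\<chi> j. Re (?l $ j / ?l $ i))"
  have "map_coords complex_of_real m = (1 / ?l $ i) *s ?l"
    by (simp add: m_def real[unfolded complex_of_real_def] real Finite_Cartesian_Product.vec_eq_iff)
  moreover have "(1 / ?l $ i) *s ?l \<noteq> 0" using i by simp
  ultimately have "L = abs_proj_plane (map_coords complex_of_real m)" "m \<noteq> 0"
    using abs_smult[of "1 / ?l $ i" ?l] i by (auto simp del: map_of_real_eq_0 simp flip: map_of_real_eq_0)
  then show "\<exists>L0. L = base_change complex_of_real L0" using base_change_of_real_abs by metis
qed

lemma quartic_eval_cnj: "quartic_eval (cquartic f) (map_coords cnj w) = cnj (quartic_eval (cquartic f) w)"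
  by (simp add: quartic_eval_def cquartic_def case_prod_unfold)

text \<open>Conjugation maps the square on the line to the square with conjugate coefficients, because the
  quartic has real coefficients.\<close>

lemma bitangent_cnj:
  assumes "bitangent (cquartic f) L"
  shows "bitangent (cquartic f) (base_change cnj L)"
proof -
  obtain u v where uv: "crossp u v = rep_proj_plane L" using exists_kernel_basis[OF rep_nonzero] by blast
  have l: "dot (rep_proj_plane L) u = 0" "dot (rep_proj_plane L) v = 0" using dot_crossp[of u v] by (simp_all add: uv)
  have "line_basis L u v" by unfold_locales (use l uv in simp_all)
  then obtain \<alpha> \<beta> \<gamma> where nz: "(\<alpha>, \<beta>, \<gamma>) \<noteq> (0, 0, 0)"
    and sq: "\<And>s t. quartic_eval (cquartic f) (s *s u + t *s v) = (\<alpha> * s\<^sup>2 + \<beta> * s * t + \<gamma> * t\<^sup>2)\<^sup>2"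
    using assms unfolding line_basis.bitangent_iff[OF \<open>line_basis L u v\<close>] by blast
  obtain c where c: "rep_proj_plane (base_change cnj L) = c *s map_coords cnj (rep_proj_plane L)"
    unfolding base_change_def using rep_abs[OF map_cnj_rep_nonzero] by blast
  have dot_cnj: "dot (map_coords cnj a) (map_coords cnj b) = cnj (dot a b)" for a b by (simp add: dot_3)
  interpret line_basis "base_change cnj L" "map_coords cnj u" "map_coords cnj v"
  proof
    have "crossp (map_coords cnj u) (map_coords cnj v) = map_coords cnj (crossp u v)" by (simp add: vec3_eq_iff)
    then show "crossp (map_coords cnj u) (map_coords cnj v) \<noteq> 0" unfolding uv using map_cnj_rep_nonzero by metis
  qed (simp_all add: c dot_linear dot_cnj l)
  have "quartic_eval (cquartic f) (s *s map_coords cnj u + t *s map_coords cnj v) =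
      (cnj \<alpha> * s\<^sup>2 + cnj \<beta> * s * t + cnj \<gamma> * t\<^sup>2)\<^sup>2" for s t
  proof -
    have eq: "s *s map_coords cnj u + t *s map_coords cnj v = map_coords cnj (cnj s *s u + cnj t *s v)"
      by (simp add: vec3_eq_iff)
    show ?thesis unfolding eq quartic_eval_cnj sq by simp
  qed
  moreover have "(cnj \<alpha>, cnj \<beta>, cnj \<gamma>) \<noteq> (0, 0, 0)" using nz by simp
  ultimately show ?thesis unfolding bitangent_iff by blast
qed

section \<open>The sum over closed points\<close>

theorem theorem1:
  fixes Linf :: "real proj_plane" and f :: "real quartic"
  assumes smooth: "smooth_quartic (cquartic f)"
    and no_real_points: "\<not> (\<exists>p. incident p Linf \<and> on_quartic f p)"
  shows "int (card {L :: real proj_plane. bitangent (cquartic f) (base_change of_real L) \<and>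
              Qtype of_real f Linf L = \<langle>1\<rangle>})
          - int (card {L :: real proj_plane. bitangent (cquartic f) (base_change of_real L) \<and>
              Qtype of_real f Linf L = \<langle>- 1\<rangle>}) = 4
        \<and> (\<Sum>X \<in> {X \<in> closed_points. \<exists>L \<in> X. bitangent (cquartic f) L}. Tr_Qtype f Linf X)
          = 16 * \<langle>1\<rangle> + 12 * \<langle>- 1\<rangle>"
proof -
  let ?b = "bitangent (cquartic f)" and ?r = "base_change complex_of_real" and ?c = "base_change cnj"
  let ?q = "Qtype of_real f Linf"
  define R where "R = {L. ?b (?r L)}"
  define P where "P = {L. ?b (?r L) \<and> ?q L = \<langle>1\<rangle>}"
  define N where "N = {L. ?b (?r L) \<and> ?q L = \<langle>- 1\<rangle>}"
  obtain gf e1 e2 e0 \<sigma> \<epsilon> where "real_frame f gf Linf e1 e2 e0 \<sigma> \<epsilon>"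
    using exists_real_frame[OF smooth no_real_points] by blast
  note sc = real_frame.signed_count[OF this, folded R_def]
  have finR: "finite R" and types: "\<And>L. L \<in> R \<Longrightarrow> ?q L = \<langle>1\<rangle> \<or> ?q L = \<langle>- 1\<rangle>"
    and sum4: "(\<Sum>L\<in>R. if ?q L = \<langle>1\<rangle> then 1 else - 1 :: int) = 4" using sc by blast+
  have R: "R = P \<union> N" "P \<inter> N = {}" using types rank_one_real_neq by (auto simp: R_def P_def N_def)
  have fin: "finite P" "finite N" using finR R(1) by auto
  have "(\<Sum>L\<in>R. if ?q L = \<langle>1\<rangle> then 1 else - 1 :: int) =
      (\<Sum>L\<in>P. if ?q L = \<langle>1\<rangle> then 1 else - 1) + (\<Sum>L\<in>N. if ?q L = \<langle>1\<rangle> then 1 else - 1)"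
    unfolding R(1) by (rule sum.union_disjoint[OF fin R(2)])
  also have "(\<Sum>L\<in>P. if ?q L = \<langle>1\<rangle> then 1 else - 1 :: int) = (\<Sum>L\<in>P. 1)"
    by (rule sum.cong) (auto simp: P_def)
  also have "(\<Sum>L\<in>N. if ?q L = \<langle>1\<rangle> then 1 else - 1 :: int) = (\<Sum>L\<in>N. - 1)"
    by (rule sum.cong) (use rank_one_real_neq in \<open>auto simp: N_def\<close>)
  finally have diff: "int (card P) - int (card N) = 4" unfolding sum4 by simp

  define B where "B = {L. ?b L}"
  define C where "C = {L. ?b L \<and> ?c L \<noteq> L}"
  have inj: "inj_on ?r S" for S by (rule inj_onI) (simp add: base_change_of_real_inj)
  have B: "B = ?r ` R \<union> C" "?r ` R \<inter> C = {}"
    using conj_fixed_iff by (auto simp: B_def C_def R_def)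
  \<comment> \<open>The difference 4 provides the two bitangents that the count of all bitangents needs.\<close>
  have cardB: "card B = 28"
  proof -
    have "card P > 1" using diff by simp
    then obtain L1 L2 where "L1 \<in> P" "L2 \<in> P" "L1 \<noteq> L2"
      by (metis One_nat_def card_le_Suc0_iff_eq fin(1) not_less)
    then have "?b (?r L1)" "?b (?r L2)" "?r L1 \<noteq> ?r L2" by (simp_all add: P_def base_change_of_real_inj)
    then show ?thesis unfolding B_def 
      by (rule smooth_plane_quartic.card_bitangents[OF smooth_plane_quartic.intro[OF smooth]])
  qed
  then have finC: "finite C" using B(1) card.infinite[of B] by fastforce
  have cc: "?c (?c L) = L" for L by (rule base_change_cnj_cnj)
  have C_conj: "?c L \<in> C" if "L \<in> C" for L
    using that bitangent_cnj[of f L] cc[of L] by (auto simp: C_def)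
  define S where "S = (\<lambda>L. {L, ?c L}) ` C"
  have "\<Union> S = C" using C_conj by (auto simp: S_def)
  moreover have "2 * card S = card (\<Union> S)"
  proof (rule card_partition)
    show "finite S" "finite (\<Union> S)" using finC by (simp_all add: S_def)
    show "card X = 2" if "X \<in> S" for X using that by (auto simp: S_def C_def card_2_iff)
    show "X \<inter> Y = {}" if "X \<in> S" "Y \<in> S" "X \<noteq> Y" for X Y
      using that cc by (auto simp: S_def) metis+
  qed
  ultimately have cardS: "card C = 2 * card S" by simp
  have "28 = card R + 2 * card S"
    using cardB card_Un_disjoint[OF _ finC B(2)] finR card_image[OF inj, of R] cardS unfolding B(1) by simp
  moreover have "card R = card P + card N" unfolding R(1) by (rule card_Un_disjoint[OF fin R(2)])
  ultimately have PN: "card P + card S = 16" "card N + card S = 12" using diff by simp_all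

  define X where "X = {X \<in> closed_points. \<exists>L \<in> X. ?b L}"
  have X: "X = (\<lambda>L. {?r L}) ` R \<union> S"
  proof (intro equalityI subsetI)
    fix Y assume "Y \<in> X"
    then obtain L where Y: "Y = {L, ?c L}" "?b L \<or> ?b (?c L)" by (auto simp: X_def closed_points_def)
    then have "?b L" using bitangent_cnj[of f "?c L"] cc[of L] by auto
    then have "L \<in> ?r ` R \<union> C" using B(1) by (auto simp: B_def)
    then show "Y \<in> (\<lambda>L. {?r L}) ` R \<union> S"
    proof
      assume "L \<in> ?r ` R"
      then have "L \<in> ?r ` R" "?c L = L" using conj_fixed_iff by auto
      then show ?thesis using Y(1) by auto
    qed (use Y(1) in \<open>auto simp: S_def\<close>)
  next
    fix Y assume "Y \<in> (\<lambda>L. {?r L}) ` R \<union> S"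
    then show "Y \<in> X"
    proof
      assume "Y \<in> (\<lambda>L. {?r L}) ` R"
      then obtain L where L: "Y = {?r L}" "?b (?r L)" by (auto simp: R_def)
      moreover have "{?r L} = {?r L, ?c (?r L)}" using conj_fixed_iff by auto
      ultimately show ?thesis unfolding X_def closed_points_def by blast
    qed (auto simp: S_def C_def X_def closed_points_def)
  qed
  have disj: "(\<lambda>L. {?r L}) ` R \<inter> S = {}"
  proof -
    have "card Y \<noteq> 1" if "Y \<in> S" for Y using that by (auto simp: S_def C_def)
    then show ?thesis by fastforce
  qed
  have pairs: "Tr_Qtype f Linf Y = \<langle>1\<rangle> + \<langle>- 1\<rangle>" if Y: "Y \<in> S" for Y
  proof -
    have "\<nexists>L. Y = {?r L}" using Y by (auto simp: S_def C_def)
    moreover have "(SOME L. L \<in> Y) \<in> Y" unfolding some_in_eq using Y by (auto simp: S_def)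
    then have "?b (SOME L. L \<in> Y)" using Y \<open>\<Union> S = C\<close> by (auto simp: C_def)
    ultimately show ?thesis
      unfolding Tr_Qtype_def using Qtype_complex[OF smooth] GW_transfer_1 by simp
  qed
  have singles: "Tr_Qtype f Linf {?r L} = ?q L" for L
  proof -
    have "(THE L'. {?r L} = {?r L'}) = L" by (rule the_equality) (simp_all add: base_change_of_real_inj)
    then show ?thesis unfolding Tr_Qtype_def by (simp add: exI[of _ L])
  qed
  have inj1: "inj_on (\<lambda>L. {?r L}) R" by (rule inj_onI) (simp add: base_change_of_real_inj)
  have "sum (Tr_Qtype f Linf) X = sum (Tr_Qtype f Linf) ((\<lambda>L. {?r L}) ` R) + sum (Tr_Qtype f Linf) S"
    unfolding X by (rule sum.union_disjoint) (use finR finC disj in \<open>simp_all add: S_def\<close>)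
  also have "sum (Tr_Qtype f Linf) ((\<lambda>L. {?r L}) ` R) = (\<Sum>L\<in>R. ?q L)"
    by (simp add: sum.reindex[OF inj1] singles)
  also have "\<dots> = (\<Sum>L\<in>P. ?q L) + (\<Sum>L\<in>N. ?q L)" unfolding R(1) by (rule sum.union_disjoint[OF fin R(2)])
  also have "(\<Sum>L\<in>P. ?q L) = of_nat (card P) * \<langle>1\<rangle>" by (simp add: P_def)
  also have "(\<Sum>L\<in>N. ?q L) = of_nat (card N) * \<langle>- 1\<rangle>" by (simp add: N_def)
  also have "sum (Tr_Qtype f Linf) S = of_nat (card S) * (\<langle>1\<rangle> + \<langle>- 1\<rangle>)" by (simp add: pairs)
  also have "of_nat (card P) * \<langle>1\<rangle> + of_nat (card N) * \<langle>- 1\<rangle> + of_nat (card S) * (\<langle>1\<rangle> + \<langle>- 1\<rangle>) =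
      of_nat (card P + card S) * \<langle>1\<rangle> + of_nat (card N + card S) * \<langle>- 1 :: real\<rangle>"
    by (simp add: algebra_simps)
  also have "\<dots> = 16 * \<langle>1\<rangle> + 12 * \<langle>- 1\<rangle>" unfolding PN by simp
  finally show ?thesis using diff unfolding P_def N_def X_def by blast
qed

end
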